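(* Let $k\in\mathbb{N}$ with $k\ge 2$ and assume that for all $K\in\mathcal{T}_h$ the element mapping satisfies $F_K\in Q_1(\hat K)^2$ if $d=2$, respectively $F_K\in P_1(\hat K)^3$ if $d=3$. Let $(V,Q)$ be the pair of spaces corresponding to the boundary conditions (pure Dirichlet, mixed, or pure Neumann), and let $$V_h=\{v\in V: v\circ F_K\in Q_k(\hat K)^d\ \text{for all } K\in\mathcal{T}_h\},\qquad Q_h=\{q\in Q\cap C(\bar\Omega): q\circ F_K\in Q_{k-1}(\hat K)\ \text{for all } K\in\mathcal{T}_h\}.$$ Then there is a constant $c>0$, independent of the mesh size $h$ (depending only on $k$, the shape regularity constants $c_1,\dots,c_4$, and the fixed data $d,\Omega,\Gamma_D,\Gamma_N$), such that $$\sup_{0\ne v_h\in V_h}\frac{b(v_h,q_h)}{\|v_h\|_0}\ \ge\ c\,\|\nabla q_h\|_0\qquad\text{for all } q_h\in Q_h .$$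
   Context: Domain and mesh. $d\in\{2,3\}$; $\Omega\subset\mathbb{R}^d$ is a bounded, connected, open polygonal/polyhedral set with Lipschitz continuous boundary $\partial\Omega=\Gamma_D\cup\Gamma_N$, $\Gamma_D\cap\Gamma_N=\emptyset$. $\mathcal{T}_h$ is a subdivision of $\Omega$ into (closed) convex quadrilaterals ($d=2$) / hexahedrons ($d=3$) $K$ satisfying the standard compatibility conditions: two distinct elements are either disjoint or meet in a common vertex, edge or face, and every face (edge if $d=2$) of an element lying on $\partial\Omega$ is, up to its relative boundary, contained either in $\Gamma_D$ or in $\Gamma_N$; $\Gamma_D$ is closed (the union of the closed faces belonging to it). Let $\hat K=[0,1]^d$. Each $K\in\mathcal{T}_h$ has the form $K=F_K(\hat K)$ with $F_K$ continuously differentiable and bijective from $\hat K$ onto $K$, with Jacobian $J_K$ satisfying $\det J_K(\hat x)>0$ and, with positive constants $c_1,\dots,c_4$ (shape regularity constants), $c_1h_K^d\le|\det J_K(\hat x)|\le c_2h_K^d$ and $c_3h_K^2I_d\le J_K(\hat x)^\top J_K(\hat x)\le c_4h_K^2I_d$ for all $\hat x\in\hat K$, where $h_K$ is the diameter of $K$ and $I_d$ the identity matrix. Set $h=\max\{h_K:K\in\mathcal{T}_h\}$. For each $K\in\mathcal{T}_h$ at least one vertex of $K$ does not lie on $\Gamma_D$. Polynomials. $P_k(D)$: polynomials on $D$ of total degree $\le k$; $Q_k(D)$: polynomials on $D$ of degree $\le k$ in each variable. Spaces. (a) Pure Dirichlet boundary conditions ($\Gamma_N=\emptyset$): $V=H_0^1(\Omega)^d$,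 $Q=L_0^2(\Omega)=\{q\in L^2(\Omega):\int_\Omega q\,dx=0\}$. (b) Mixed boundary conditions ($|\Gamma_D|,|\Gamma_N|>0$): $V=H^1_{0,\Gamma_D}(\Omega)^d=\{v\in H^1(\Omega)^d:v=0\text{ on }\Gamma_D\}$, $Q=L^2(\Omega)$. (c) Pure Neumann boundary conditions ($\Gamma_D=\emptyset$): $V=\{v\in H^1(\Omega)^d:\int_\Omega v\,dx=0\}$, $Q=L^2(\Omega)$. Notation. $b(v,q)=-\int_\Omega q\,\operatorname{div}v\,dx$; $\|\cdot\|_0$ is the norm of $L^2(\Omega)$ (also for vector-valued functions). *)

theory Defs
  imports "HOL-Analysis.Analysis"
begin

section \<open>Polynomials\<close>

text \<open>Multi-indices are functions from the (finite) index type of the coordinates to the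
  naturals; polynomial functions on \<open>D\<close> are determined by their values on \<open>D\<close> only.\<close>

definition monomial :: "('n::finite \<Rightarrow> nat) \<Rightarrow> real ^ 'n \<Rightarrow> real" where
  "monomial \<alpha> x = (\<Prod>i\<in>UNIV. (x $ i) ^ \<alpha> i)"

definition polys_on :: "('n::finite \<Rightarrow> nat) set \<Rightarrow> (real ^ 'n) set \<Rightarrow> (real ^ 'n \<Rightarrow> real) set" where
  "polys_on I D = {f. \<exists>a. \<forall>x\<in>D. f x = (\<Sum>\<alpha>\<in>I. a \<alpha> * monomial \<alpha> x)}"

definition P_poly :: "nat \<Rightarrow> (real ^ 'n::finite) set \<Rightarrow> (real ^ 'n \<Rightarrow> real) set" where
  "P_poly k D = polys_on {\<alpha>. (\<Sum>i\<in>UNIV. \<alpha> i) \<le> k} D"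

definition Q_poly :: "nat \<Rightarrow> (real ^ 'n::finite) set \<Rightarrow> (real ^ 'n \<Rightarrow> real) set" where
  "Q_poly k D = polys_on {\<alpha>. \<forall>i. \<alpha> i \<le> k} D"

text \<open>The space \<open>S\<^sup>d\<close> of vector fields with all components in \<open>S\<close>.\<close>

definition componentwise :: "(real ^ 'n \<Rightarrow> real) set \<Rightarrow> (real ^ 'n \<Rightarrow> real ^ 'n::finite) set" where
  "componentwise S = {v. \<forall>i. (\<lambda>x. v x $ i) \<in> S}"


section \<open>The spaces \<open>L\<^sup>2\<close> and \<open>H\<^sup>1\<close>\<close>

text \<open>Functions stand for their classes modulo equality almost everywhere in \<open>\<Omega>\<close>.\<close>

definition L2 :: "(real ^ 'n::finite) set \<Rightarrow> (real ^ 'n \<Rightarrow> 'b::euclidean_space) set" where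
  "L2 \<Omega> = {f. f \<in> borel_measurable (lebesgue_on \<Omega>) \<and>
              integrable (lebesgue_on \<Omega>) (\<lambda>x. (norm (f x))\<^sup>2)}"

definition L2_norm :: "(real ^ 'n::finite) set \<Rightarrow> (real ^ 'n \<Rightarrow> 'b::euclidean_space) \<Rightarrow> real" where
  "L2_norm \<Omega> f = sqrt (LINT x|lebesgue_on \<Omega>. (norm (f x))\<^sup>2)"

definition partial :: "'n::finite \<Rightarrow> (real ^ 'n \<Rightarrow> real) \<Rightarrow> real ^ 'n \<Rightarrow> real" where
  "partial i f x = frechet_derivative f (at x) (axis i 1)"

primrec C_cont_diff :: "nat \<Rightarrow> (real ^ 'n::finite \<Rightarrow> real) \<Rightarrow> bool" where
  "C_cont_diff 0 f \<longleftrightarrow> continuous_on UNIV f"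
| "C_cont_diff (Suc m) f \<longleftrightarrow> (\<forall>x. f differentiable (at x)) \<and> (\<forall>i. C_cont_diff m (partial i f))"

text \<open>\<open>C\<^sub>c\<^sup>\<infinity>(\<Omega>)\<close>\<close>

definition test_functions :: "(real ^ 'n::finite) set \<Rightarrow> (real ^ 'n \<Rightarrow> real) set" where
  "test_functions \<Omega> = {\<phi>. (\<forall>m. C_cont_diff m \<phi>) \<and>
     (\<exists>C. compact C \<and> C \<subseteq> \<Omega> \<and> (\<forall>x. x \<notin> C \<longrightarrow> \<phi> x = 0))}"

definition is_weak_grad ::
    "(real ^ 'n::finite) set \<Rightarrow> (real ^ 'n \<Rightarrow> real) \<Rightarrow> (real ^ 'n \<Rightarrow> real ^ 'n) \<Rightarrow> bool" where
  "is_weak_grad \<Omega> f g \<longleftrightarrow> (\<forall>\<phi>\<in>test_functions \<Omega>. \<forall>i.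
     (LINT x|lebesgue_on \<Omega>. f x * partial i \<phi> x) = - (LINT x|lebesgue_on \<Omega>. g x $ i * \<phi> x))"

definition H1 :: "(real ^ 'n::finite) set \<Rightarrow> (real ^ 'n \<Rightarrow> real) set" where
  "H1 \<Omega> = {f \<in> L2 \<Omega>. \<exists>g\<in>L2 \<Omega>. is_weak_grad \<Omega> f g}"

text \<open>For \<open>f \<in> H1 \<Omega>\<close> the choice is unique up to equality almost everywhere in \<open>\<Omega>\<close>.\<close>

definition weak_grad ::
    "(real ^ 'n::finite) set \<Rightarrow> (real ^ 'n \<Rightarrow> real) \<Rightarrow> real ^ 'n \<Rightarrow> real ^ 'n" where
  "weak_grad \<Omega> f = (SOME g. g \<in> L2 \<Omega> \<and> is_weak_grad \<Omega> f g)"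

definition H1_norm :: "(real ^ 'n::finite) set \<Rightarrow> (real ^ 'n \<Rightarrow> real) \<Rightarrow> real" where
  "H1_norm \<Omega> f = sqrt ((L2_norm \<Omega> f)\<^sup>2 + (L2_norm \<Omega> (weak_grad \<Omega> f))\<^sup>2)"

definition weak_div ::
    "(real ^ 'n::finite) set \<Rightarrow> (real ^ 'n \<Rightarrow> real ^ 'n) \<Rightarrow> real ^ 'n \<Rightarrow> real" where
  "weak_div \<Omega> v x = (\<Sum>i\<in>UNIV. weak_grad \<Omega> (\<lambda>y. v y $ i) x $ i)"

definition b_form ::
    "(real ^ 'n::finite) set \<Rightarrow> (real ^ 'n \<Rightarrow> real ^ 'n) \<Rightarrow> (real ^ 'n \<Rightarrow> real) \<Rightarrow> real" where
  "b_form \<Omega> v q = - (LINT x|lebesgue_on \<Omega>. q x * weak_div \<Omega> v x)"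


section \<open>Surface measure and traces\<close>

text \<open>The \<open>(d-1)\<close>-dimensional Hausdorff measure, normalised to agree with the usual surface
  measure. It is a metric outer measure, hence (Caratheodory) a measure on the Borel sets, so that
  \<open>measure_of\<close> does not fall back to the zero measure.\<close>

definition hausdorff_outer :: "(real ^ 'n::finite) set \<Rightarrow> ennreal" where
  "hausdorff_outer A = (SUP \<delta>\<in>{0<..}.
     INF C\<in>{C :: nat \<Rightarrow> (real ^ 'n) set. A \<subseteq> (\<Union>j. C j) \<and>
              (\<forall>j. bounded (C j) \<and> diameter (C j) \<le> \<delta>)}.
       (\<Sum>j. ennreal (unit_ball_vol (real (CARD('n) - 1)) * (diameter (C j) / 2) ^ (CARD('n) - 1))))"

definition surface_measure :: "(real ^ 'n::finite) measure" where
  "surface_measure = measure_of UNIV (sets borel) hausdorff_outer"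

abbreviation boundary_measure :: "(real ^ 'n::finite) set \<Rightarrow> (real ^ 'n) measure" where
  "boundary_measure \<Omega> \<equiv> restrict_space surface_measure (frontier \<Omega>)"

text \<open>The trace operator of a Lipschitz domain is the continuous extension to \<open>H\<^sup>1(\<Omega>)\<close>,
  with values in \<open>L\<^sup>2(\<partial>\<Omega>)\<close>, of the restriction to \<open>\<partial>\<Omega>\<close> of functions in
  \<open>H\<^sup>1(\<Omega>)\<close> that are continuous on the closure; this is its graph.\<close>

definition has_trace ::
    "(real ^ 'n::finite) set \<Rightarrow> (real ^ 'n \<Rightarrow> real) \<Rightarrow> (real ^ 'n \<Rightarrow> real) \<Rightarrow> bool" where
  "has_trace \<Omega> f g \<longleftrightarrow> f \<in> H1 \<Omega> \<and> g \<in> borel_measurable (boundary_measure \<Omega>) \<and>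
     (\<exists>\<phi> :: nat \<Rightarrow> real ^ 'n \<Rightarrow> real.
        (\<forall>n. \<phi> n \<in> H1 \<Omega> \<and> continuous_on (closure \<Omega>) (\<phi> n)) \<and>
        (\<lambda>n. H1_norm \<Omega> (\<lambda>x. \<phi> n x - f x)) \<longlonglongrightarrow> 0 \<and>
        (\<lambda>n. \<integral>\<^sup>+ x. ennreal ((\<phi> n x - g x)\<^sup>2) \<partial>boundary_measure \<Omega>) \<longlonglongrightarrow> 0)"

text \<open>\<open>H\<^sup>1(\<Omega>)\<close>-functions with \<open>f = 0\<close> on \<open>\<Gamma>\<close>; for \<open>\<Gamma> = \<partial>\<Omega>\<close> this is
  \<open>H\<^sub>0\<^sup>1(\<Omega>)\<close>.\<close>

definition H1_zero_on :: "(real ^ 'n::finite) set \<Rightarrow> (real ^ 'n) set \<Rightarrow> (real ^ 'n \<Rightarrow> real) set" where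
  "H1_zero_on \<Omega> \<Gamma> = {f \<in> H1 \<Omega>. \<exists>g. has_trace \<Omega> f g \<and>
     (AE x in boundary_measure \<Omega>. x \<in> \<Gamma> \<longrightarrow> g x = 0)}"


section \<open>Domain, boundary conditions and the pair \<open>(V, Q)\<close>\<close>

text \<open>Locally, up to a rotation, \<open>\<Omega>\<close> is the set below the graph of a Lipschitz function of
  the \<open>d - 1\<close> coordinates orthogonal to a unit vector \<open>\<nu>\<close>.\<close>

definition lipschitz_boundary :: "(real ^ 'n::finite) set \<Rightarrow> bool" where
  "lipschitz_boundary \<Omega> \<longleftrightarrow> (\<forall>x\<in>frontier \<Omega>. \<exists>\<nu> r L \<gamma>.
     norm \<nu> = 1 \<and> r > 0 \<and> L-lipschitz_on {z. z \<bullet> \<nu> = 0} \<gamma> \<and>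
     \<Omega> \<inter> ball x r = {y \<in> ball x r. y \<bullet> \<nu> < \<gamma> (y - (y \<bullet> \<nu>) *\<^sub>R \<nu>)})"

definition polyhedral_domain :: "(real ^ 'n::finite) set \<Rightarrow> bool" where
  "polyhedral_domain \<Omega> \<longleftrightarrow> \<Omega> \<noteq> {} \<and> open \<Omega> \<and> connected \<Omega> \<and> bounded \<Omega> \<and>
     (\<exists>\<P>. finite \<P> \<and> (\<forall>P\<in>\<P>. polytope P) \<and> closure \<Omega> = \<Union>\<P>) \<and> lipschitz_boundary \<Omega>"

text \<open>The last conjunct lists the three cases: pure Dirichlet, pure Neumann, mixed.\<close>

definition boundary_partition ::
    "(real ^ 'n::finite) set \<Rightarrow> (real ^ 'n) set \<Rightarrow> (real ^ 'n) set \<Rightarrow> bool" where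
  "boundary_partition \<Omega> \<Gamma>\<^sub>D \<Gamma>\<^sub>N \<longleftrightarrow> \<Gamma>\<^sub>D \<union> \<Gamma>\<^sub>N = frontier \<Omega> \<and> \<Gamma>\<^sub>D \<inter> \<Gamma>\<^sub>N = {} \<and> closed \<Gamma>\<^sub>D \<and>
     (\<Gamma>\<^sub>N = {} \<or> \<Gamma>\<^sub>D = {} \<or> emeasure surface_measure \<Gamma>\<^sub>D > 0 \<and> emeasure surface_measure \<Gamma>\<^sub>N > 0)"

definition V_space ::
    "(real ^ 'n::finite) set \<Rightarrow> (real ^ 'n) set \<Rightarrow> (real ^ 'n) set \<Rightarrow> (real ^ 'n \<Rightarrow> real ^ 'n) set" where
  "V_space \<Omega> \<Gamma>\<^sub>D \<Gamma>\<^sub>N =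
     (if \<Gamma>\<^sub>N = {} then componentwise (H1_zero_on \<Omega> (frontier \<Omega>))
      else if \<Gamma>\<^sub>D = {} then {v \<in> componentwise (H1 \<Omega>). (LINT x|lebesgue_on \<Omega>. v x) = 0}
      else componentwise (H1_zero_on \<Omega> \<Gamma>\<^sub>D))"

definition Q_space :: "(real ^ 'n::finite) set \<Rightarrow> (real ^ 'n) set \<Rightarrow> (real ^ 'n \<Rightarrow> real) set" where
  "Q_space \<Omega> \<Gamma>\<^sub>N =
     (if \<Gamma>\<^sub>N = {} then {q \<in> L2 \<Omega>. (LINT x|lebesgue_on \<Omega>. q x) = 0} else L2 \<Omega>)"


section \<open>Meshes\<close>

definition quadrilateral :: "(real ^ 'n::finite) set \<Rightarrow> bool" where
  "quadrilateral K \<longleftrightarrow> polytope K \<and> aff_dim K = 2 \<and> card {x. x extreme_point_of K} = 4"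

text \<open>The condition on the facets excludes the pentagonal wedge, which also has six facets and
  eight vertices.\<close>

definition hexahedron :: "(real ^ 'n::finite) set \<Rightarrow> bool" where
  "hexahedron K \<longleftrightarrow> polytope K \<and> aff_dim K = 3 \<and> card {f. f facet_of K} = 6 \<and>
     (\<forall>f. f facet_of K \<longrightarrow> quadrilateral f)"

definition mesh_cell :: "(real ^ 'n::finite) set \<Rightarrow> bool" where
  "mesh_cell K \<longleftrightarrow> (if CARD('n) = 2 then quadrilateral K else hexahedron K)"

text \<open>The reference cell \<open>[0,1]\<^sup>d\<close>; \<open>1\<close> is the vector with all entries \<open>1\<close>.\<close>

abbreviation ref_cell :: "(real ^ 'n::finite) set" where
  "ref_cell \<equiv> cbox 0 1"

text \<open>\<open>J\<close> is the Jacobian of \<open>F\<close> on the reference cell; only the values of \<open>F\<close> there matter.\<close>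

definition regular_map ::
    "real \<Rightarrow> real \<Rightarrow> real \<Rightarrow> real \<Rightarrow> (real ^ 'n::finite) set \<Rightarrow> (real ^ 'n \<Rightarrow> real ^ 'n) \<Rightarrow> bool" where
  "regular_map c1 c2 c3 c4 K F \<longleftrightarrow> bij_betw F ref_cell K \<and>
     (\<exists>J :: real ^ 'n \<Rightarrow> real ^ 'n ^ 'n. continuous_on ref_cell J \<and>
       (\<forall>x\<in>ref_cell. (F has_derivative (\<lambda>\<xi>. J x *v \<xi>)) (at x within ref_cell) \<and>
          det (J x) > 0 \<and>
          c1 * diameter K ^ CARD('n) \<le> \<bar>det (J x)\<bar> \<and> \<bar>det (J x)\<bar> \<le> c2 * diameter K ^ CARD('n) \<and>
          (\<forall>\<xi>. c3 * (diameter K)\<^sup>2 * (\<xi> \<bullet> \<xi>) \<le> \<xi> \<bullet> ((transpose (J x) ** J x) *v \<xi>) \<and>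
               \<xi> \<bullet> ((transpose (J x) ** J x) *v \<xi>) \<le> c4 * (diameter K)\<^sup>2 * (\<xi> \<bullet> \<xi>))))"

text \<open>For distinct full-dimensional polytopes, an intersection that is a face of both is empty or
  a common vertex, edge, ..., of dimension at most \<open>d - 1\<close>.\<close>

definition regular_mesh ::
    "(real ^ 'n::finite) set \<Rightarrow> (real ^ 'n) set \<Rightarrow> (real ^ 'n) set \<Rightarrow>
     real \<Rightarrow> real \<Rightarrow> real \<Rightarrow> real \<Rightarrow>
     (real ^ 'n) set set \<Rightarrow> ((real ^ 'n) set \<Rightarrow> real ^ 'n \<Rightarrow> real ^ 'n) \<Rightarrow> bool" where
  "regular_mesh \<Omega> \<Gamma>\<^sub>D \<Gamma>\<^sub>N c1 c2 c3 c4 \<T> F \<longleftrightarrow>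
     finite \<T> \<and> \<Union>\<T> = closure \<Omega> \<and>
     (\<forall>K\<in>\<T>. mesh_cell K \<and> regular_map c1 c2 c3 c4 K (F K)) \<and>
     (\<forall>K\<in>\<T>. \<forall>K'\<in>\<T>. K \<noteq> K' \<longrightarrow> (K \<inter> K') face_of K \<and> (K \<inter> K') face_of K') \<and>
     (\<forall>K\<in>\<T>. \<forall>f. f facet_of K \<and> f \<subseteq> frontier \<Omega> \<longrightarrow>
        rel_interior f \<subseteq> \<Gamma>\<^sub>D \<or> rel_interior f \<subseteq> \<Gamma>\<^sub>N) \<and>
     \<Gamma>\<^sub>D = \<Union>{f. f \<subseteq> \<Gamma>\<^sub>D \<and> (\<exists>K\<in>\<T>. f facet_of K)} \<and>
     (\<forall>K\<in>\<T>. \<exists>x. x extreme_point_of K \<and> x \<notin> \<Gamma>\<^sub>D)"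


section \<open>Finite element spaces\<close>

text \<open>Elements of \<open>V\<close> are classes of functions, so \<open>v \<circ> F\<^sub>K\<close> is a polynomial almost everywhere;
  elements of \<open>Q\<^sub>h\<close> are identified with their continuous representatives.\<close>

definition V_h ::
    "(real ^ 'n::finite) set \<Rightarrow> (real ^ 'n) set \<Rightarrow> (real ^ 'n) set \<Rightarrow>
     (real ^ 'n) set set \<Rightarrow> ((real ^ 'n) set \<Rightarrow> real ^ 'n \<Rightarrow> real ^ 'n) \<Rightarrow> nat \<Rightarrow>
     (real ^ 'n \<Rightarrow> real ^ 'n) set" where
  "V_h \<Omega> \<Gamma>\<^sub>D \<Gamma>\<^sub>N \<T> F k = {v \<in> V_space \<Omega> \<Gamma>\<^sub>D \<Gamma>\<^sub>N. \<forall>K\<in>\<T>.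
     \<exists>p\<in>componentwise (Q_poly k ref_cell). AE x in lebesgue_on ref_cell. v (F K x) = p x}"

definition Q_h ::
    "(real ^ 'n::finite) set \<Rightarrow> (real ^ 'n) set \<Rightarrow>
     (real ^ 'n) set set \<Rightarrow> ((real ^ 'n) set \<Rightarrow> real ^ 'n \<Rightarrow> real ^ 'n) \<Rightarrow> nat \<Rightarrow>
     (real ^ 'n \<Rightarrow> real) set" where
  "Q_h \<Omega> \<Gamma>\<^sub>N \<T> F k = {q \<in> Q_space \<Omega> \<Gamma>\<^sub>N. continuous_on (closure \<Omega>) q \<and>
     (\<forall>K\<in>\<T>. q \<circ> F K \<in> Q_poly (k - 1) ref_cell)}"

end

theory Submission
  imports Defs "HOL-Computational_Algebra.Polynomial"
begin

text \<open>
  The velocity is built on the Lobatto grid with \<open>k + 1\<close> nodes per direction. On every line of the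
  grid, which has a constant direction \<open>\<tau>\<close> because the element map is affine along it, take
  \<open>s (1 - s) \<partial>\<^sub>s q \<tau> / |\<tau>|\<^sup>2\<close> times the Lagrange polynomials of the transversal nodes, and drop the lines
  in \<open>\<Gamma>\<^sub>D\<close>. The Piola transform has low degree on these fields, so Lobatto quadrature in the
  transversal directions evaluates \<open>b(v, q)\<close> exactly, as a sum of weighted energies of \<open>q\<close> along the
  retained lines. That sum also controls \<open>\<parallel>v\<parallel>\<^sub>0\<^sup>2\<close>, and it controls \<open>\<parallel>\<nabla>q\<parallel>\<^sub>0\<^sup>2\<close>: a cell with a vertex off
  \<open>\<Gamma>\<^sub>D\<close> retains all lines that avoid the faces opposite to that vertex, and these determine a polynomial
  of degree \<open>k - 1\<close> in each variable up to a constant. In the Neumann case subtract the mean, which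
  leaves \<open>b(v, q)\<close> unchanged and does not increase the norm.
\<close>

section \<open>Lobatto quadrature\<close>

text \<open>The degrees leave no slack. A Lagrange polynomial of a transversal node has degree k and
  q has degree k - 1; their product has degree 2k - 1, the last one that the rule with k + 1 nodes
  integrates exactly. The endpoints must be nodes, so that the field on a face depends only on the
  lines in that face. The factor s (1 - s) removes the boundary terms in s and lets each summand
  vanish at the ends of its line, and the degree stays at k. Division by |\<tau>|^2 makes a summand
  independent of the parametrisation: reversing a line changes the sign of both the derivative of q
  and \<tau>. The obstacle is the variable Jacobian of a bilinear map. Multiplied by the
  determinant, the inverse Jacobian applied to \<tau> has affine components, and its transversal
  part contributes exactly the product-rule term that turns the determinant into a weight on the
  line. A cell enters b(v, q) and the bounds of both squared norms with the same power h^(d - 2), so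
  h drops out of the constants. If \<nabla>q vanishes, the supremum still has to run over a nonempty
  set; a coordinate function then supplies a nonzero velocity.\<close>

definition ip :: "real poly \<Rightarrow> real" where
  "ip p = integral {0..1} (poly p)"

lemma poly_integrable_on: "poly p integrable_on {a..b::real}"
  by (intro integrable_continuous_real continuous_intros)

lemma ip_add: "ip (p + q) = ip p + ip q"
  unfolding ip_def using Henstock_Kurzweil_Integration.integral_add[OF poly_integrable_on[of p] poly_integrable_on[of q]]
  by (simp add: fun_eq_iff flip: poly_add)

lemma ip_smult: "ip (smult c p) = c * ip p"
proof -
  have "poly (smult c p) = (\<lambda>x. c * poly p x)" by auto
  then show ?thesis by (simp add: ip_def)
qed

lemma ip_0 [simp]: "ip 0 = 0"
  using ip_smult[of 0 0] by simp

lemma ip_sum: "ip (\<Sum>i\<in>A. f i) = (\<Sum>i\<in>A. ip (f i))"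
  by (induction A rule: infinite_finite_induct) (auto simp: ip_add)

lemma ip_pderiv: "ip (pderiv p) = poly p 1 - poly p 0"
proof -
  have "(poly (pderiv p) has_integral poly p 1 - poly p 0) {0..1}"
    by (rule fundamental_theorem_of_calculus)
      (auto simp flip: has_real_derivative_iff_has_vector_derivative intro: DERIV_subset[OF poly_DERIV])
  then show ?thesis
    by (simp add: ip_def integral_unique)
qed

lemma ip_parts:
  assumes "poly (p * q) 0 = 0" "poly (p * q) 1 = 0"
  shows "ip (pderiv p * q) = - ip (p * pderiv q)"
proof -
  have "0 = ip (pderiv (p * q))"
    using assms unfolding ip_pderiv by linarith
  also have "pderiv (p * q) = pderiv p * q + p * pderiv q"
    by (simp add: pderiv_mult algebra_simps)
  finally show ?thesis by (simp add: ip_add)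
qed

lemma ip_pos:
  assumes "p \<noteq> 0" "\<And>x. x \<in> {0..1} \<Longrightarrow> poly p x \<ge> 0"
  shows "ip p > 0"
proof (rule ccontr)
  assume "\<not> ip p > 0"
  moreover have "ip p \<ge> 0"
    unfolding ip_def by (intro Henstock_Kurzweil_Integration.integral_nonneg poly_integrable_on assms(2))
  ultimately have "integral (cbox 0 1) (poly p) = 0" by (simp add: ip_def)
  then have "\<forall>x\<in>cbox 0 1. poly p x = 0"
    using integral_eq_0_iff[of 0 1 "poly p"] assms(2) continuous_on_poly[OF continuous_on_id, of "{0..1}" p]
    by (auto simp: id_def)
  then have "{0..1} \<subseteq> {x. poly p x = 0}" by auto
  moreover have "infinite {0..1::real}" by simp
  ultimately show False
    using poly_roots_finite[OF assms(1)] finite_subset by blast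
qed

text \<open>The strict inclusion between \<open>Min Z\<close> and \<open>Max Z\<close> carries the
  induction: inserting a new maximum adds a Rolle point beyond \<open>Max Z\<close>, hence different
  from all earlier ones.\<close>

lemma rolle_roots:
  fixes Z :: "real set" and p :: "real poly"
  assumes "finite Z" "Z \<noteq> {}" "\<And>z. z \<in> Z \<Longrightarrow> poly p z = 0"
  shows "\<exists>Z'. finite Z' \<and> card Z' = card Z - 1 \<and> Z' \<subseteq> {Min Z<..<Max Z} \<and> (\<forall>z\<in>Z'. poly (pderiv p) z = 0)"
  using assms
proof (induction Z rule: finite_linorder_max_induct)
  case empty
  then show ?case by simp
next
  case (insert b Z)
  show ?case
  proof (cases "Z = {}")
    case True
    then show ?thesis by (intro exI[of _ "{}"]) auto
  next
    case False
    then obtain Z' where Z': "finite Z'" "card Z' = card Z - 1" "Z' \<subseteq> {Min Z<..<Max Z}"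
        "\<forall>z\<in>Z'. poly (pderiv p) z = 0"
      using insert by auto
    have *: "Max Z < b" using insert False by auto
    obtain c where c: "Max Z < c" "c < b" "poly (pderiv p) c = 0"
    proof -
      have "\<exists>z. Max Z < z \<and> z < b \<and> DERIV (poly p) z :> 0"
        using * insert.prems(2)[of b] insert.prems(2)[of "Max Z"] insert.hyps False
        by (intro Rolle) (auto intro: continuous_intros poly_differentiable)
      then obtain z where "Max Z < z" "z < b" "DERIV (poly p) z :> 0" by blast
      then show ?thesis using that DERIV_unique[OF poly_DERIV] by blast
    qed
    have "Max (insert b Z) = b"
      using insert.hyps by (intro Max_eqI) (auto simp: less_imp_le)
    moreover have "Min (insert b Z) = Min Z"
      using insert.hyps(1) False insert.hyps(2)[rule_format, OF Min_in] by (subst Min_insert) auto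
    ultimately have M: "Max (insert b Z) = b" "Min (insert b Z) = Min Z" by auto
    have "Min Z \<le> Max Z" using insert.hyps(1) False by auto
    have "c \<notin> Z'" using Z'(3) c(1) by (meson greaterThanLessThan_iff less_asym subsetD)
    show ?thesis
    proof (intro exI[of _ "insert c Z'"] conjI)
      show "card (insert c Z') = card (insert b Z) - 1"
        using Z'(1,2) \<open>c \<notin> Z'\<close> insert.hyps(1) less_irrefl[of b] insert.hyps(2) False
        by (metis One_nat_def Suc_diff_1 Z'(2) card_gt_0_iff card_insert_disjoint diff_Suc_1)
      show "insert c Z' \<subseteq> {Min (insert b Z)<..<Max (insert b Z)}"
        unfolding M using Z'(3) c * \<open>Min Z \<le> Max Z\<close> by fastforce
    qed (use Z' c in auto)
  qed
qed

text \<open>Rodrigues' formula on the unit interval: \<open>m = k\<close> gives a multiple of the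
  shifted Legendre polynomial, and \<open>m = k - 1\<close> an antiderivative of it, whose k + 1
  roots are the Gauss-Lobatto nodes.\<close>

definition lob_poly :: "nat \<Rightarrow> nat \<Rightarrow> real poly" where
  "lob_poly k m = (pderiv ^^ m) ([:0, 1, - 1:] ^ k)"

lemma lob_poly_0: "lob_poly k 0 = [:0, 1, - 1:] ^ k"
  by (simp add: lob_poly_def)

lemma lob_poly_Suc: "lob_poly k (Suc m) = pderiv (lob_poly k m)"
  by (simp add: lob_poly_def)

lemma degree_lob_poly: "degree (lob_poly k m) = 2 * k - m"
  by (induction m) (simp_all add: lob_poly_0 lob_poly_Suc degree_power_eq degree_pderiv)

lemma lob_poly_nz: "m \<le> 2 * k \<Longrightarrow> lob_poly k m \<noteq> 0"
  by (induction m) (auto simp: lob_poly_0 lob_poly_Suc pderiv_eq_0_iff degree_lob_poly)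

text \<open>s (1 - s) is invariant under s -> 1 - s and every derivative contributes a sign. The
  resulting symmetry of the nodes is needed because two cells may run through a common face in
  opposite directions.\<close>

lemma lob_poly_reflect: "pcompose (lob_poly k m) [:1, - 1:] = smult ((- 1) ^ m) (lob_poly k m)"
proof (induction m)
  case 0
  have "pcompose [:0, 1, - 1::real:] [:1, - 1:] = [:0, 1, - 1:]"
    by (simp add: pcompose_pCons)
  then show ?case
    unfolding lob_poly_0 by (induction k) (simp_all add: pcompose_1 pcompose_mult del: mult_pCons_left)
next
  case (Suc m)
  have "pderiv (pcompose (lob_poly k m) [:1, - 1:]) = - (pcompose (pderiv (lob_poly k m)) [:1, - 1:])"
    by (simp add: pderiv_pcompose pderiv_pCons)
  then show ?case
    by (simp add: Suc lob_poly_Suc pderiv_smult)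
qed

text \<open>Each derivative lowers the multiplicity of the roots 0 and 1 by at most one. Hence all
  derivatives below the k-th still vanish at both ends.\<close>

lemma lob_poly_dvd: 
  assumes "m \<le> k"
  shows "[:0, 1, - 1:] ^ (k - m) dvd lob_poly k m"
  using assms
proof (induction m)
  case (Suc m)
  let ?s = "[:0, 1, - 1:] :: real poly"
  obtain r where r: "lob_poly k m = ?s ^ (k - m) * r"
    using Suc by (auto simp: dvd_def)
  have km: "k - m = Suc (k - Suc m)" using Suc by simp
  show ?case
    unfolding lob_poly_Suc r km pderiv_mult pderiv_power_Suc
    by (intro dvd_add dvd_mult2[OF dvd_smult] dvd_mult2[of _ "?s ^ _"])
      (auto simp del: mult_pCons_left mult_pCons_right simp: power_Suc2 intro: dvd_smult)
qed (simp add: lob_poly_0)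

lemma lob_poly_ends:
  assumes "m < k" "x \<in> {0, 1}"
  shows "poly (lob_poly k m) x = 0"
proof -
  have "[:0, 1, - 1:] dvd [:0, 1, - 1::real:] ^ (k - m)"
    using assms by simp
  then have "[:0, 1, - 1:] dvd lob_poly k m"
    using lob_poly_dvd[of m k] assms dvd_trans by fastforce
  then show ?thesis using assms by (auto simp: dvd_def)
qed

text \<open>Integration by parts moves the m derivatives onto r one at a time. The boundary terms
  vanish because m does not exceed k, and m derivatives annihilate r.\<close>

lemma lob_poly_orth:
  assumes "m \<le> k" "degree r < m"
  shows "ip (lob_poly k m * r) = 0"
  using assms
proof (induction m arbitrary: r)
  case (Suc m)
  have "ip (lob_poly k (Suc m) * r) = - ip (lob_poly k m * pderiv r)"
    unfolding lob_poly_Suc using Suc.prems by (intro ip_parts) (auto simp: lob_poly_ends)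
  also have "ip (lob_poly k m * pderiv r) = 0"
  proof (cases "degree r = 0")
    case True
    then show ?thesis by (simp add: pderiv_eq_0_iff[THEN iffD2])
  next
    case False
    then show ?thesis using Suc by (intro Suc.IH) (auto simp: degree_pderiv)
  qed
  finally show ?case by simp
qed simp

text \<open>As long as \<open>m < k\<close>, the endpoints are roots in addition to the m interior
  ones, so Rolle turns m + 2 roots into m + 1 interior roots of the next derivative.\<close>

lemma lob_poly_roots:
  assumes "m < k"
  shows "\<exists>Z. finite Z \<and> card Z = m \<and> Z \<subseteq> {0<..<1} \<and> (\<forall>z\<in>Z. poly (lob_poly k m) z = 0)"
  using assms
proof (induction m)
  case (Suc m)
  then obtain Z where Z: "finite Z" "card Z = m" "Z \<subseteq> {0<..<1}" "\<forall>z\<in>Z. poly (lob_poly k m) z = 0"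
    by auto
  let ?Z = "insert 0 (insert 1 Z)"
  have c: "card ?Z = Suc (Suc m)"
    using Z by (auto simp: card_insert_if subset_iff)
  have "Min ?Z = 0" "Max ?Z = 1"
    using Z by (intro Min_eqI Max_eqI; force simp: less_imp_le subset_iff)+
  moreover have "poly (lob_poly k m) z = 0" if "z \<in> ?Z" for z
    using that Z(4) Suc.prems lob_poly_ends[of m k z] by auto
  ultimately obtain Z' where "finite Z'" "card Z' = card ?Z - 1" "Z' \<subseteq> {0<..<1}"
      "\<forall>z\<in>Z'. poly (pderiv (lob_poly k m)) z = 0"
    using rolle_roots[of ?Z "lob_poly k m"] Z(1) by auto
  then show ?case
    unfolding lob_poly_Suc using c by auto
qed auto

section \<open>Lagrange interpolation and the Gauss-Lobatto rule\<close>

definition lagr :: "real set \<Rightarrow> real \<Rightarrow> real poly" where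
  "lagr N y = (\<Prod>u\<in>N - {y}. smult (1 / (y - u)) [:- u, 1:])"

lemma poly_lagr: "poly (lagr N y) x = (\<Prod>u\<in>N - {y}. (x - u) / (y - u))"
  unfolding lagr_def poly_prod by (intro prod.cong) (auto simp: divide_simps)

lemma lagr_delta:
  assumes "finite N" "x \<in> N"
  shows "poly (lagr N y) x = (if x = y then 1 else 0)"
  using assms by (auto simp: poly_lagr intro!: prod.neutral)

lemma degree_lagr:
  assumes "finite N" "y \<in> N"
  shows "degree (lagr N y) \<le> card N - 1"
proof -
  have "degree (lagr N y) \<le> (\<Sum>u\<in>N - {y}. degree (smult (1 / (y - u)) [:- u, 1:]))"
    unfolding lagr_def by (rule degree_prod_sum_le[unfolded o_def]) (use assms in auto)
  also have "\<dots> \<le> (\<Sum>u\<in>N - {y}. 1)"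
    by (intro sum_mono order.trans[OF degree_smult_le]) auto
  also have "\<dots> = card N - 1" using assms by simp
  finally show ?thesis .
qed

lemma lagr_interpolation:
  assumes "finite N" "degree p < card N"
  shows "p = (\<Sum>u\<in>N. smult (poly p u) (lagr N u))"
proof (rule ccontr)
  let ?q = "(\<Sum>u\<in>N. smult (poly p u) (lagr N u))"
  assume "p \<noteq> ?q"
  then have nz: "p - ?q \<noteq> 0" by simp
  have "N \<noteq> {}" using assms by auto
  have "degree ?q \<le> card N - 1"
    using assms by (intro degree_sum_le order.trans[OF degree_smult_le degree_lagr]) auto
  then have "degree (p - ?q) \<le> card N - 1"
    using assms by (intro degree_diff_le) auto
  moreover have "N \<subseteq> {x. poly (p - ?q) x = 0}"
  proof
    fix x assume x: "x \<in> N"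
    have "poly ?q x = (\<Sum>u\<in>N. if u = x then poly p u else 0)"
      unfolding poly_sum poly_smult by (intro sum.cong refl) (simp add: lagr_delta[OF assms(1) x])
    then show "x \<in> {x. poly (p - ?q) x = 0}"
      using x assms(1) by simp
  qed
  then have "card N \<le> degree (p - ?q)"
    by (intro order.trans[OF card_mono[OF poly_roots_finite[OF nz]] card_poly_roots_bound[OF nz]])
  moreover have "card N > 0" using \<open>N \<noteq> {}\<close> assms by (simp add: card_gt_0_iff)
  ultimately show False by linarith
qed

text \<open>Reflection changes the sign of every numerator and every denominator together. It
  matches the basis polynomials of two cells that parametrise a common face in opposite
  directions.\<close>

lemma lagr_reflect:
  assumes N: "\<And>u. u \<in> N \<Longrightarrow> 1 - u \<in> N"
  shows "poly (lagr N (1 - y)) (1 - x) = poly (lagr N y) x"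
proof -
  have "poly (lagr N (1 - y)) (1 - x) = (\<Prod>u\<in>N - {y}. (1 - x - (1 - u)) / (1 - y - (1 - u)))"
    unfolding poly_lagr
    by (rule prod.reindex_bij_witness[of _ "\<lambda>u. 1 - u" "\<lambda>u. 1 - u"]) (use N in auto)
  also have "\<dots> = poly (lagr N y) x"
    unfolding poly_lagr
  proof (intro prod.cong refl)
    fix u
    have "1 - x - (1 - u) = - (x - u)" "1 - y - (1 - u) = - (y - u)" by auto
    then show "(1 - x - (1 - u)) / (1 - y - (1 - u)) = (x - u) / (y - u)"
      by (simp only: minus_divide_divide)
  qed
  finally show ?thesis .
qed

text \<open>The nodes are the roots of \<open>lob_poly k (k - 1)\<close> and the weights are
  integrals of Lagrange polynomials. Exactness beyond interpolation comes from orthogonality;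
  positivity comes from testing the rule on a nonnegative polynomial that vanishes at all nodes but
  one.\<close>

lemma lobatto_rule:
  assumes "k \<ge> 1"
  obtains N w where "finite N" "card N = Suc k" "N \<subseteq> {0..1}" "0 \<in> N" "1 \<in> N"
    "\<And>u. u \<in> N \<Longrightarrow> 1 - u \<in> N" "\<And>u. u \<in> N \<Longrightarrow> w u > 0"
    "\<And>p. degree p \<le> 2 * k - 1 \<Longrightarrow> ip p = (\<Sum>u\<in>N. w u * poly p u)"
proof -
  let ?W = "lob_poly k (k - 1)"
  obtain Z where Z: "finite Z" "card Z = k - 1" "Z \<subseteq> {0<..<1}" "\<forall>z\<in>Z. poly ?W z = 0"
    using lob_poly_roots[of "k - 1" k] assms by auto
  define N where "N = insert 0 (insert 1 Z)"
  define w where "w u = ip (lagr N u)" for u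
  have fin: "finite N" using Z by (simp add: N_def)
  have card: "card N = Suc k"
    unfolding N_def using Z assms by (auto simp: card_insert_if subset_iff)
  have sub: "N \<subseteq> {0..1}" using Z by (auto simp: N_def less_imp_le)
  have root: "poly ?W u = 0" if "u \<in> N" for u
    using that Z lob_poly_ends[of "k - 1" k] assms by (auto simp: N_def)
  have nz: "?W \<noteq> 0" by (rule lob_poly_nz) simp
  have deg: "degree ?W = Suc k" using assms by (simp add: degree_lob_poly)
  \<comment> \<open>The k + 1 roots already found exhaust a polynomial of degree k + 1, so the
    symmetry of the polynomial passes to \<open>N\<close>.\<close>
  have N_roots: "N = {x. poly ?W x = 0}"
    using root card card_poly_roots_bound[OF nz] poly_roots_finite[OF nz] deg
    by (intro card_seteq) auto
  have refl: "1 - u \<in> N" if "u \<in> N" for u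
  proof -
    have "poly (pcompose ?W [:1, - 1:]) u = 0"
      unfolding lob_poly_reflect using that root by simp
    then show ?thesis by (simp add: N_roots poly_pcompose)
  qed
  have exact: "ip p = (\<Sum>u\<in>N. w u * poly p u)" if "degree p \<le> 2 * k - 1" for p
  proof -
    \<comment> \<open>The quotient has degree below k - 1, so \<open>lob_poly_orth\<close> disposes
      of its product with \<open>?W\<close>; the remainder has degree at most k and is interpolated
      exactly.\<close>
    define s r where "s = p div ?W" and "r = p mod ?W"
    have p: "p = ?W * s + r" by (simp add: s_def r_def)
    have rdeg: "degree r < card N"
      using degree_mod_less[OF nz, of p] deg card by (auto simp: r_def)
    have pr: "poly p u = poly r u" if "u \<in> N" for u
      using root[OF that] by (simp add: p)
    have "ip (?W * s) = 0"
    proof (cases "s = 0")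
      case False
      have "degree (?W * s) = Suc k + degree s"
        using nz False deg by (simp add: degree_mult_eq)
      moreover have "degree (?W * s) \<le> max (degree p) (degree r)"
        using degree_diff_le_max[of p r] p by (metis add_diff_cancel_right')
      ultimately have "degree s < k - 1" using that rdeg card by auto
      then show ?thesis by (intro lob_poly_orth) auto
    qed simp
    then have "ip p = ip r" by (subst p) (simp add: ip_add)
    also have "ip r = ip (\<Sum>u\<in>N. smult (poly r u) (lagr N u))"
      using lagr_interpolation[OF fin rdeg] by simp
    also have "\<dots> = (\<Sum>u\<in>N. w u * poly p u)"
      by (simp add: ip_sum ip_smult w_def pr mult.commute)
    finally show ?thesis .
  qed
  have pos: "w u > 0" if "u \<in> N" for u
  proof -
    \<comment> \<open>The square removes the interior nodes other than u and \<open>?e\<close> the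
      endpoints other than u. The degree is 2 + 2 (k - 2) for an interior u and 1 + 2 (k - 1) for an
      endpoint, within the exactness 2k - 1 in both cases.\<close>
    let ?M = "\<Prod>v\<in>Z - {u}. [:- v, 1:]"
    let ?e = "(if u = 1 then 1 else [:1, -1:]) * (if u = 0 then 1 else [:0, 1:]) :: real poly"
    let ?f = "?e * ?M ^ 2"
    have Mz: "?M \<noteq> 0" using Z by (simp add: prod_zero_iff)
    have fz: "?f \<noteq> 0" using Mz by auto
    have degM: "degree ?M = card (Z - {u})"
      by (subst degree_prod_eq_sum_degree) auto
    have u: "u = 0 \<or> u = 1 \<or> (u \<in> Z \<and> u \<noteq> 0 \<and> u \<noteq> 1)" using that Z(3) by (auto simp: N_def)
    have "degree ?f \<le> 2 * k - 1"
    proof -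
      have cz: "card (Z - {u}) = (if u \<in> Z then k - 2 else k - 1)" using Z by auto
      have "u \<in> Z \<Longrightarrow> k \<ge> 2" using Z assms by (cases "k = 1") auto
      moreover have "u \<in> Z \<Longrightarrow> u \<noteq> 0 \<and> u \<noteq> 1" using Z(3) by auto
      ultimately show ?thesis
        using u Mz assms unfolding degM[symmetric] 
        by (auto simp: degree_mult_eq degree_power_eq degM cz)
    qed
    then have eq: "ip ?f = (\<Sum>v\<in>N. w v * poly ?f v)" by (rule exact)
    have "poly ?f v = 0" if "v \<in> N - {u}" for v
      using that Z(1) by (auto simp: N_def poly_prod)
    then have eq2: "(\<Sum>v\<in>N. w v * poly ?f v) = w u * poly ?f u"
      using \<open>u \<in> N\<close> fin by (subst sum.remove[of _ u]) (simp_all add: sum.neutral del: poly_mult)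
    have "ip ?f > 0"
    proof (rule ip_pos[OF fz])
      fix x :: real assume "x \<in> {0..1}"
      then have "poly ?e x \<ge> 0" by (simp add: mult_nonneg_nonneg)
      then show "poly ?f x \<ge> 0"
        using mult_nonneg_nonneg[OF _ zero_le_power2[of "poly ?M x"]] by (simp only: poly_mult poly_power)
    qed
    moreover have "poly ?f u \<ge> 0"
    proof -
      have "poly ?e u \<ge> 0" using that sub by (auto simp: mult_nonneg_nonneg)
      then show ?thesis
        using mult_nonneg_nonneg[OF _ zero_le_power2[of "poly ?M u"]] by (simp only: poly_mult poly_power)
    qed
    ultimately show ?thesis unfolding eq eq2 by (metis mult_nonpos_nonneg not_le)
  qed
  show ?thesis
  proof (rule that[of N w])
    show "0 \<in> N" "1 \<in> N" by (simp_all add: N_def)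
  qed (fact fin card sub refl exact pos)+
qed

section \<open>Weak gradients of piecewise smooth functions\<close>

text \<open>A whole sequence of successive derivatives is part of the notion, so that it passes to
  the derivative by a mere shift of the index.\<close>

definition smooth :: "(real \<Rightarrow> real) \<Rightarrow> bool" where
  "smooth u \<longleftrightarrow> (\<exists>D :: nat \<Rightarrow> real \<Rightarrow> real. D 0 = u \<and> (\<forall>m t. (D m has_real_derivative D (Suc m) t) (at t)))"

lemma smooth_deriv:
  assumes "smooth u"
  shows "\<exists>u'. smooth u' \<and> (\<forall>t. (u has_real_derivative u' t) (at t))"
proof -
  obtain D :: "nat \<Rightarrow> real \<Rightarrow> real" where D: "D 0 = u" "\<And>m t. (D m has_real_derivative D (Suc m) t) (at t)"
    using assms by (auto simp: smooth_def)
  show ?thesis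
  proof (intro exI[of _ "D 1"] conjI allI)
    show "smooth (D 1)"
      unfolding smooth_def by (rule exI[of _ "\<lambda>m. D (Suc m)"]) (use D(2) in auto)
    show "(u has_real_derivative D 1 t) (at t)" for t
      using D(2)[of 0 t] by (simp add: D(1))
  qed
qed

text \<open>A partial derivative of a tensor product is again a tensor product, with one factor
  differentiated; therefore the induction generalises over the factors \<open>u\<close>.\<close>

lemma C_cont_diff_prod:
  fixes u :: "'n::finite \<Rightarrow> real \<Rightarrow> real"
  assumes "\<And>i. smooth (u i)"
  shows "C_cont_diff m (\<lambda>x :: real ^ 'n. \<Prod>i\<in>UNIV. u i (x $ i))"
  using assms
proof (induction m arbitrary: u)
  case 0
  have "isCont (u i) t" for i t
  proof -
    obtain w where w: "smooth w" "\<And>t. (u i has_real_derivative w t) (at t)"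
      using smooth_deriv[OF 0[of i]] by blast
    show ?thesis using w(2) by (rule DERIV_isCont)
  qed
  then have "continuous_on UNIV (u i)" for i
    by (auto intro: continuous_at_imp_continuous_on)
  then have "continuous_on UNIV (\<lambda>x :: real ^ 'n. u i (x $ i))" for i
    by (rule continuous_on_compose2) (auto intro: continuous_intros)
  then show ?case by (simp add: continuous_on_prod)
next
  case (Suc m)
  define u' where "u' i = (SOME w. smooth w \<and> (\<forall>t. (u i has_real_derivative w t) (at t)))" for i
  have u': "smooth (u' i)" "(u i has_real_derivative u' i t) (at t)" for i t
  proof -
    have "\<exists>w. smooth w \<and> (\<forall>t. (u i has_real_derivative w t) (at t))"
      by (rule smooth_deriv) (rule Suc.prems)
    from someI_ex[OF this] show "smooth (u' i)" "(u i has_real_derivative u' i t) (at t)"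
      by (auto simp: u'_def)
  qed
  let ?f = "\<lambda>x :: real ^ 'n. \<Prod>i\<in>UNIV. u i (x $ i)"
  have der: "(?f has_derivative (\<lambda>h. \<Sum>i\<in>UNIV. (u' i (x $ i) * (h $ i)) * (\<Prod>j\<in>UNIV - {i}. u j (x $ j)))) (at x)" for x
  proof (rule has_derivative_prod)
    fix i :: 'n
    have "((\<lambda>x :: real ^ 'n. x $ i) has_derivative (\<lambda>h. h $ i)) (at x)"
      by (intro bounded_linear_imp_has_derivative bounded_linear_vec_nth)
    from has_derivative_compose[OF this, of "u i" "\<lambda>t. u' i (x $ i) * t"]
    show "((\<lambda>x. u i (x $ i)) has_derivative (\<lambda>h. u' i (x $ i) * (h $ i))) (at x)"
      using u'(2)[of i "x $ i"] by (simp add: has_field_derivative_def)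
  qed
  have "partial i ?f = (\<lambda>x. \<Prod>j\<in>UNIV. (u(i := u' i)) j (x $ j))" for i
  proof
    fix x
    have "partial i ?f x = (\<Sum>j\<in>UNIV. (u' j (x $ j) * (axis i 1 $ j)) * (\<Prod>l\<in>UNIV - {j}. u l (x $ l)))"
      unfolding partial_def by (subst frechet_derivative_at[OF der, symmetric]) simp
    also have "\<dots> = (\<Sum>j\<in>UNIV. if j = i then u' i (x $ i) * (\<Prod>l\<in>UNIV - {i}. u l (x $ l)) else 0)"
      by (intro sum.cong) (auto simp: axis_def)
    also have "\<dots> = u' i (x $ i) * (\<Prod>l\<in>UNIV - {i}. u l (x $ l))"
      by simp
    also have "(\<Prod>l\<in>UNIV - {i}. u l (x $ l)) = (\<Prod>l\<in>UNIV - {i}. (u(i := u' i)) l (x $ l))"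
      by (intro prod.cong) auto
    also have "u' i (x $ i) * \<dots> = (\<Prod>j\<in>UNIV. (u(i := u' i)) j (x $ j))"
      by (subst (2) prod.remove[of _ i]) auto
    finally show "partial i ?f x = \<dots>" .
  qed
  moreover have "C_cont_diff m (\<lambda>x. \<Prod>j\<in>UNIV. (u(i := u' i)) j (x $ j))" for i
    using u' Suc.prems by (intro Suc.IH) auto
  moreover have "?f differentiable (at x)" for x
    using der by (auto simp: differentiable_def)
  ultimately show ?case by simp
qed

text \<open>The classical bump exp(-1/s) is the case \<open>P = 1\<close>, \<open>r = 0\<close>. The
  parameters make the family closed under differentiation, which yields smoothness at once.\<close>

definition bump :: "real poly \<Rightarrow> real poly \<Rightarrow> nat \<Rightarrow> real \<Rightarrow> real" where
  "bump s P r t = (if poly s t > 0 then poly P t * exp (- (1 / poly s t)) / poly s t ^ r else 0)"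

text \<open>A single term of the exponential series, the one of index r + 2, already beats the power
  in the denominator with two orders to spare; these two orders give a vanishing derivative at the
  edge of the support.\<close>

lemma exp_neg_inverse_le:
  fixes s :: real
  assumes "s > 0"
  shows "exp (- (1 / s)) / s ^ r \<le> fact (r + 2) * s ^ 2"
proof -
  have "(1 / s) ^ (r + 2) / fact (r + 2) \<le> exp (1 / s)"
  proof -
    have "(\<Sum>n\<in>{r + 2}. (1 / s) ^ n /\<^sub>R fact n) \<le> (\<Sum>n. (1 / s) ^ n /\<^sub>R fact n)"
      by (intro sum_le_suminf summable_exp_generic) (use assms in auto)
    then show ?thesis by (simp add: exp_def field_simps)
  qed
  then have "(1 / s) ^ (r + 2) \<le> fact (r + 2) * exp (1 / s)"
    by (simp only: pos_divide_le_eq fact_gt_zero mult.commute)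
  then have "(1 / s) ^ (r + 2) * (s ^ 2 * exp (- (1 / s))) \<le> fact (r + 2) * exp (1 / s) * (s ^ 2 * exp (- (1 / s)))"
    by (rule mult_right_mono) simp
  moreover have "(1 / s) ^ (r + 2) * (s ^ 2 * exp (- (1 / s))) = exp (- (1 / s)) / s ^ r"
    using assms by (simp add: power_add power_one_over power2_eq_square)
  moreover have "K * exp (1 / s) * (s ^ 2 * exp (- (1 / s))) = K * s ^ 2" for K
    by (simp add: exp_minus)
  ultimately show ?thesis by simp
qed

text \<open>Where s is positive this is the quotient rule, brought to the common denominator s^(r +
  2). Elsewhere the new bump is 0 and the difference quotient has to be shown to tend to 0.\<close>

lemma bump_has_derivative:
  "(bump s P r has_real_derivative
     bump s (pderiv P * s ^ 2 - smult (of_nat r) (P * pderiv s * s) + P * pderiv s) (r + 2) t) (at t)"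
proof (cases "poly s t > 0")
  case True
  have "open {x. 0 < poly s x}" by (intro open_Collect_less continuous_intros)
  then have ev: "eventually (\<lambda>x. poly s x > 0) (nhds t)"
    using True by (auto dest: eventually_nhds_in_open)
  have *: "((\<lambda>x. poly P x * exp (- (1 / poly s x)) / poly s x ^ r) has_real_derivative
      poly (pderiv P * s ^ 2 - smult (of_nat r) (P * pderiv s * s) + P * pderiv s) t * exp (- (1 / poly s t)) / poly s t ^ (r + 2)) (at t)"
  proof (cases r)
    case 0
    show ?thesis unfolding 0
      by (rule derivative_eq_intros poly_DERIV refl | use True in force)+
       (use True in \<open>simp add: field_simps power2_eq_square\<close>)
  next
    case (Suc r')
    show ?thesis unfolding Suc
      by (rule derivative_eq_intros poly_DERIV refl | use True in force)+
       (use True in \<open>simp add: field_simps power2_eq_square\<close>)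
  qed
  have "eventually (\<lambda>x. bump s P r x = poly P x * exp (- (1 / poly s x)) / poly s x ^ r) (nhds t)"
    using ev by eventually_elim (simp add: bump_def)
  from iffD2[OF DERIV_cong_ev[OF refl this refl] *] show ?thesis
    unfolding bump_def[of s "pderiv P * s ^ 2 - smult (of_nat r) (P * pderiv s * s) + P * pderiv s"]
    by (simp only: True if_True)
next
  case False
  \<comment> \<open>Since s is not positive at t, factoring out x - t bounds s by M |x - t| near t
    wherever it is positive. With the quadratic bound for the exponential the bump is of order |x -
    t|^2.\<close>
  have "[:- t, 1:] dvd s - [:poly s t:]"
    by (simp add: poly_eq_0_iff_dvd[symmetric])
  then obtain q where q: "s - [:poly s t:] = [:- t, 1:] * q" by (auto simp: dvd_def)
  have sle: "poly s x = poly s t + (x - t) * poly q x" for x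
    using arg_cong[OF q, of "\<lambda>p. poly p x"] by (simp add: algebra_simps)
  have "bounded (poly q ` cball t 1)" "bounded (poly P ` cball t 1)"
    by (intro compact_imp_bounded compact_continuous_image continuous_intros compact_cball)+
  then obtain M B where "\<forall>y\<in>poly q ` cball t 1. norm y \<le> M" "\<forall>y\<in>poly P ` cball t 1. norm y \<le> B"
    unfolding bounded_iff by blast
  then have M: "\<bar>poly q x\<bar> \<le> M" and B: "\<bar>poly P x\<bar> \<le> B" if "x \<in> cball t 1" for x
    using that by auto
  have "M \<ge> 0" "B \<ge> 0" using M[of t] B[of t] by auto
  have bound: "\<bar>bump s P r x\<bar> \<le> B * fact (r + 2) * M ^ 2 * \<bar>x - t\<bar> ^ 2" if x: "x \<in> cball t 1" for x
  proof (cases "poly s x > 0")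
    case True
    have "poly s x \<le> \<bar>x - t\<bar> * \<bar>poly q x\<bar>"
      using sle[of x] False abs_ge_self[of "(x - t) * poly q x"] by (simp add: abs_mult)
    also have "\<dots> \<le> \<bar>x - t\<bar> * M"
      using M[OF x] by (intro mult_left_mono) auto
    finally have s2: "poly s x ^ 2 \<le> (\<bar>x - t\<bar> * M) ^ 2"
      using True by (intro power_mono) auto
    have "\<bar>bump s P r x\<bar> = \<bar>poly P x\<bar> * (exp (- (1 / poly s x)) / poly s x ^ r)"
      using True by (simp add: bump_def abs_mult)
    also have "\<dots> \<le> B * (fact (r + 2) * poly s x ^ 2)"
      using True by (intro mult_mono B x exp_neg_inverse_le) (auto simp: \<open>B \<ge> 0\<close>)
    also have "\<dots> \<le> B * (fact (r + 2) * (\<bar>x - t\<bar> * M) ^ 2)"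
      using s2 \<open>B \<ge> 0\<close> by (intro mult_left_mono) auto
    finally show ?thesis by (simp add: power_mult_distrib mult_ac)
  next
    case False
    then show ?thesis using \<open>B \<ge> 0\<close> by (simp add: bump_def)
  qed
  have b0: "bump s P r t = 0" using False by (simp add: bump_def)
  have "((\<lambda>x. (bump s P r x - bump s P r t) / (x - t)) \<longlongrightarrow> 0) (at t)"
  proof (rule Lim_null_comparison)
    show "\<forall>\<^sub>F x in at t. norm ((bump s P r x - bump s P r t) / (x - t)) \<le> B * fact (r + 2) * M ^ 2 * \<bar>x - t\<bar>"
      unfolding eventually_at
    proof (intro exI[of _ 1] conjI ballI impI)
      fix x assume x: "x \<noteq> t \<and> dist x t < 1"
      then have "\<bar>bump s P r x\<bar> \<le> B * fact (r + 2) * M ^ 2 * \<bar>x - t\<bar> * \<bar>x - t\<bar>"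
        using bound[of x] by (simp add: dist_commute power2_eq_square mult_ac)
      then show "norm ((bump s P r x - bump s P r t) / (x - t)) \<le> B * fact (r + 2) * M ^ 2 * \<bar>x - t\<bar>"
        using x by (simp add: b0 divide_le_eq)
    qed simp
    show "((\<lambda>x. B * fact (r + 2) * M ^ 2 * \<bar>x - t\<bar>) \<longlongrightarrow> 0) (at t)"
      by (rule tendsto_eq_intros refl | simp)+
  qed
  then have "(bump s P r has_real_derivative 0) (at t)"
    by (simp add: has_field_derivative_iff)
  then show ?thesis using False by (simp add: bump_def)
qed

lemma smooth_bump: "smooth (bump s P r)"
proof -
  define Q where "Q = rec_nat P (\<lambda>m R. pderiv R * s ^ 2 - smult (of_nat (r + 2 * m)) (R * pderiv s * s) + R * pderiv s)"
  have "(bump s (Q m) (r + 2 * m) has_real_derivative bump s (Q (Suc m)) (r + 2 * Suc m) t) (at t)" for m t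
    using bump_has_derivative[of s "Q m" "r + 2 * m" t] by (simp add: Q_def)
  then show ?thesis
    unfolding smooth_def by (intro exI[of _ "\<lambda>m. bump s (Q m) (r + 2 * m)"]) (simp add: Q_def)
qed

text \<open>Indicators of boxes thus become bounded pointwise limits of admissible test functions,
  ready for dominated convergence.\<close>

lemma box_test_functions:
  fixes a b :: "real ^ 'n::finite"
  assumes "cbox a b \<subseteq> \<Omega>"
  obtains \<phi> :: "nat \<Rightarrow> real ^ 'n \<Rightarrow> real" where "\<And>m. \<phi> m \<in> test_functions \<Omega>"
    "\<And>m x. 0 \<le> \<phi> m x \<and> \<phi> m x \<le> 1" "\<And>x. (\<lambda>m. \<phi> m x) \<longlonglongrightarrow> indicator (box a b) x"
    "\<And>m. continuous_on UNIV (\<phi> m)"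
proof (cases "\<forall>i. a $ i < b $ i")
  case False
  then obtain i where "b $ i \<le> a $ i" by (auto simp: not_less)
  then have "box a b = {}"
    unfolding set_eq_iff mem_box_cart by (metis empty_iff not_less order_less_trans)
  show ?thesis
  proof (rule that[of "\<lambda>_ _. 0"])
    have "C_cont_diff m (\<lambda>x :: real ^ 'n. 0)" for m
      using C_cont_diff_prod[of "\<lambda>_ :: 'n. bump 0 0 0" m] smooth_bump by (simp add: bump_def zero_power)
    then show "(\<lambda>_. 0) \<in> test_functions \<Omega>"
      by (auto simp: test_functions_def intro!: exI[of _ "{}"])
  qed (use \<open>box a b = {}\<close> in auto)
next
  case True
  \<comment> \<open>Positive exactly on the open interval. The factor \<open>Suc m\<close> drives
    exp(-1/s) to 1 there without moving the support.\<close>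
  define s where "s m i = smult (real (Suc m)) ([:- (a $ i), 1:] * [:b $ i, - 1:])" for m i
  define \<phi> where "\<phi> m x = (\<Prod>i\<in>UNIV. bump (s m i) 1 0 (x $ i))" for m and x :: "real ^ 'n"
  have s: "poly (s m i) t = real (Suc m) * ((t - a $ i) * (b $ i - t))" for m i t
    by (simp add: s_def algebra_simps)
  have spos: "poly (s m i) t > 0 \<longleftrightarrow> a $ i < t \<and> t < b $ i" for m i t
    unfolding s using True[rule_format, of i] by (auto simp: zero_less_mult_iff)
  have C: "C_cont_diff l (\<phi> m)" for l m
    unfolding \<phi>_def[abs_def] by (intro C_cont_diff_prod smooth_bump)
  show ?thesis
  proof (rule that[of \<phi>])
    show "\<phi> m \<in> test_functions \<Omega>" for m
      unfolding test_functions_def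
    proof (intro CollectI conjI allI C exI[of _ "cbox a b"] impI)
      fix x assume "x \<notin> cbox a b"
      then have "x \<notin> box a b" using box_subset_cbox by blast
      then obtain i where "\<not> (a $ i < x $ i \<and> x $ i < b $ i)"
        by (auto simp: mem_box_cart)
      then have "bump (s m i) 1 0 (x $ i) = 0" by (simp add: bump_def spos)
      then show "\<phi> m x = 0" by (auto simp: \<phi>_def)
    qed (use assms in auto)
    have b01: "0 \<le> bump (s m i) 1 0 t \<and> bump (s m i) 1 0 t \<le> 1" for m i t
      by (auto simp: bump_def)
    show "0 \<le> \<phi> m x \<and> \<phi> m x \<le> 1" for m x
      unfolding \<phi>_def using b01 by (auto intro!: prod_nonneg prod_le_1)
    show "continuous_on UNIV (\<phi> m)" for m
      using C[of 0 m] by simp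
    show "(\<lambda>m. \<phi> m x) \<longlonglongrightarrow> indicator (box a b) x" for x
    proof (cases "x \<in> box a b")
      case True
      have "(\<lambda>m. bump (s m i) 1 0 (x $ i)) \<longlonglongrightarrow> 1" for i
      proof -
        let ?c = "(x $ i - a $ i) * (b $ i - x $ i)"
        have c: "?c > 0" "a $ i < x $ i" "x $ i < b $ i" using True by (auto simp: mem_box_cart)
        have "(\<lambda>m. exp (- (1 / ?c * (1 / real (Suc m))))) \<longlonglongrightarrow> exp (- (1 / ?c * 0))"
          by (intro tendsto_intros LIMSEQ_Suc[OF lim_1_over_n])
        moreover have "bump (s m i) 1 0 (x $ i) = exp (- (1 / ?c * (1 / real (Suc m))))" for m
          using c spos[of m i "x $ i"] by (simp add: bump_def s field_simps)
        ultimately show ?thesis by simp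
      qed
      then have "(\<lambda>m. \<phi> m x) \<longlonglongrightarrow> (\<Prod>i\<in>(UNIV :: 'n set). 1)"
        unfolding \<phi>_def by (intro tendsto_prod)
      then show ?thesis using True by simp
    next
      case False
      then have "x \<notin> box a b" using box_subset_cbox by blast
      then obtain i where "\<not> (a $ i < x $ i \<and> x $ i < b $ i)"
        by (auto simp: mem_box_cart)
      then have "bump (s m i) 1 0 (x $ i) = 0" for m by (simp add: bump_def spos)
      then have "\<phi> m x = 0" for m by (auto simp: \<phi>_def)
      then show ?thesis using False by simp
    qed
  qed
qed

text \<open>The positive and the negative part of f are densities of two finite measures that agree
  on boxes, an intersection-stable generator of the Borel sets. Hence the two parts coincide, which
  is possible only where f = 0.\<close>

lemma AE_zero_of_box_integrals_borel:
  fixes f :: "'a::euclidean_space \<Rightarrow> real"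
  assumes f: "integrable lborel f" and 0: "\<And>a b. (LINT x|lborel. indicator (box a b) x * f x) = 0"
  shows "AE x in lborel. f x = 0"
proof -
  let ?p = "density lborel (\<lambda>x. ennreal (f x))" and ?m = "density lborel (\<lambda>x. ennreal (- f x))"
  have [measurable]: "f \<in> borel_measurable borel" using f by auto
  have fin: "emeasure ?p UNIV < \<infinity>"
    using f unfolding real_integrable_def by (simp add: emeasure_density less_top)
  have eq: "emeasure ?p (box a b) = emeasure ?m (box a b)" for a b
  proof -
    let ?f = "\<lambda>x. indicator (box a b) x * f x"
    have i: "integrable lborel ?f"
      using integrable_mult_indicator[OF _ f, of "box a b"] by simp
    have conv: "(\<integral>\<^sup>+x. ennreal (f x) * indicator (box a b) x \<partial>lborel) = (\<integral>\<^sup>+x. ennreal (?f x) \<partial>lborel)"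
         "(\<integral>\<^sup>+x. ennreal (- f x) * indicator (box a b) x \<partial>lborel) = (\<integral>\<^sup>+x. ennreal (- ?f x) \<partial>lborel)"
      by (auto intro!: nn_integral_cong simp: indicator_def)
    have "enn2real (\<integral>\<^sup>+x. ennreal (?f x) \<partial>lborel) = enn2real (\<integral>\<^sup>+x. ennreal (- ?f x) \<partial>lborel)"
      using 0[of a b] by (simp add: real_lebesgue_integral_def[OF i])
    moreover have "(\<integral>\<^sup>+x. ennreal (?f x) \<partial>lborel) \<noteq> \<infinity>" "(\<integral>\<^sup>+x. ennreal (- ?f x) \<partial>lborel) \<noteq> \<infinity>"
      using i by (simp_all only: real_integrable_def simp_thms)
    ultimately have "(\<integral>\<^sup>+x. ennreal (?f x) \<partial>lborel) = (\<integral>\<^sup>+x. ennreal (- ?f x) \<partial>lborel)"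
      using ennreal_enn2real[of "\<integral>\<^sup>+x. ennreal (?f x) \<partial>lborel"]
        ennreal_enn2real[of "\<integral>\<^sup>+x. ennreal (- ?f x) \<partial>lborel"]
      unfolding less_top infinity_ennreal_def by metis
    then show ?thesis
      by (simp add: emeasure_density conv)
  qed
  have "?p = ?m"
  proof (rule measure_eqI_generator_eq[where E = "range (\<lambda>(a, b). box a b :: 'a set)" and \<Omega> = UNIV
        and A = "\<lambda>n. box (- (real n *\<^sub>R One)) (real n *\<^sub>R One)"])
    show "Int_stable (range (\<lambda>(a, b). box a b :: 'a set))"
      by (auto simp: Int_stable_def Int_interval box_Int_box)
    show "sets ?p = sigma_sets UNIV (range (\<lambda>(a, b). box a b :: 'a set))"
         "sets ?m = sigma_sets UNIV (range (\<lambda>(a, b). box a b :: 'a set))"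
      by (simp_all add: borel_eq_box)
    show "(\<Union>n. box (- (real n *\<^sub>R One)) (real n *\<^sub>R One)) = (UNIV :: 'a set)"
      by (rule UN_box_eq_UNIV)
    show "emeasure ?p (box (- (real n *\<^sub>R One)) (real n *\<^sub>R One)) \<noteq> \<infinity>" for n
      using order.strict_trans1[OF emeasure_mono fin] by (simp add: less_top)
  qed (auto simp: eq)
  then have "AE x in lborel. ennreal (f x) = ennreal (- f x)"
    by (subst (asm) sigma_finite_measure.density_unique_iff[OF lborel.sigma_finite_measure_axioms]) auto
  then show ?thesis
    by eventually_elim (metis ennreal_eq_0_iff ennreal_neg linorder_linear neg_le_0_iff_le order_antisym)
qed

text \<open>A Borel representative carries the preceding statement over to the completed
  measure.\<close>

lemma AE_zero_of_box_integrals: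
  fixes f :: "'a::euclidean_space \<Rightarrow> real"
  assumes f: "integrable lebesgue f" and 0: "\<And>a b. (LINT x|lebesgue. indicator (box a b) x * f x) = 0"
  shows "AE x in lebesgue. f x = 0"
proof -
  obtain g where g: "g \<in> borel_measurable lborel" "AE x in lborel. f x = g x"
    using completion_ex_borel_measurable_real[of f lborel] f by auto
  have fg: "AE x in lebesgue. f x = g x" using g(2) by (simp add: AE_completion_iff)
  have [measurable]: "f \<in> borel_measurable lebesgue" "g \<in> borel_measurable lebesgue"
    using f g(1) by (auto intro: measurable_completion)
  have "integrable lebesgue g"
    using f fg by (subst integrable_cong_AE[of _ _ f]) auto
  then have "integrable lborel g" using g(1) by (simp add: integrable_completion)
  moreover have "(LINT x|lborel. indicator (box a b) x * g x) = 0" for a b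
  proof -
    have [measurable]: "box a b \<in> sets lebesgue" by simp
    have "(LINT x|lborel. indicator (box a b) x * g x) = (LINT x|lebesgue. indicator (box a b) x * g x)"
      using g(1) by (intro integral_completion[symmetric]) auto
    also have "\<dots> = (LINT x|lebesgue. indicator (box a b) x * f x)"
      using fg by (intro integral_cong_AE) auto
    finally show ?thesis using 0 by simp
  qed
  ultimately have "AE x in lborel. g x = 0" by (rule AE_zero_of_box_integrals_borel)
  then have "AE x in lebesgue. g x = 0" by (simp add: AE_completion_iff)
  then show ?thesis using fg by eventually_elim simp
qed

text \<open>Approximating indicators by test functions shows that f integrates to 0 over boxes
  inside a closed box contained in \<Omega>, so f vanishes almost everywhere on that closed box.
  Countably many such boxes cover \<Omega>.\<close>

lemma fundamental_lemma_variations: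
  fixes \<Omega> :: "(real ^ 'n::finite) set"
  assumes "open \<Omega>" and f: "integrable (lebesgue_on \<Omega>) f"
    and 0: "\<And>\<phi>. \<phi> \<in> test_functions \<Omega> \<Longrightarrow> continuous_on UNIV \<phi> \<Longrightarrow> (LINT x|lebesgue_on \<Omega>. f x * \<phi> x) = 0"
  shows "AE x in lebesgue_on \<Omega>. f x = 0"
proof -
  have [simp]: "\<Omega> \<in> sets lebesgue" using sets_completionI_sub[of \<Omega> lborel] assms(1) by simp
  have fi: "integrable lebesgue (\<lambda>x. indicator \<Omega> x * f x)"
    using f by (simp add: integrable_restrict_space)
  have box0: "AE x in lebesgue. x \<in> cbox a b \<longrightarrow> f x = 0" if ab: "cbox a b \<subseteq> \<Omega>" for a b
  proof -
    let ?F = "\<lambda>x. indicator (box a b) x * (indicator \<Omega> x * f x)"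
    have "integrable lebesgue ?F"
      using integrable_mult_indicator[OF _ fi, of "box a b"] by simp
    moreover have "(LINT x|lebesgue. indicator (box c d) x * ?F x) = 0" for c d
    proof -
      \<comment> \<open>Two boxes intersect in a box again; its closed counterpart stays in
        \<open>cbox a b\<close> and hence in \<Omega>, so the approximating test functions are
        admissible.\<close>
      define e where "e = (\<chi> i. max (a $ i) (c $ i))"
      define g where "g = (\<chi> i. min (b $ i) (d $ i))"
      have box_eq: "box c d \<inter> box a b = box e g"
        by (auto simp: set_eq_iff mem_box_cart e_def g_def)
      have "cbox e g \<subseteq> cbox a b"
        by (auto simp: mem_box_cart e_def g_def)
      then have "cbox e g \<subseteq> \<Omega>" using ab by blast
      from box_test_functions[OF this] obtain \<phi> :: "nat \<Rightarrow> real ^ 'n \<Rightarrow> real" where \<phi>: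
        "\<And>m. \<phi> m \<in> test_functions \<Omega>" "\<And>m x. 0 \<le> \<phi> m x \<and> \<phi> m x \<le> 1"
        "\<And>x. (\<lambda>m. \<phi> m x) \<longlonglongrightarrow> indicator (box e g) x" "\<And>m. continuous_on UNIV (\<phi> m)" by blast
      have [measurable]: "\<phi> m \<in> borel_measurable lebesgue" for m
        by (intro measurable_completion) (use \<phi>(4) in \<open>auto intro: borel_measurable_continuous_onI\<close>)
      have [measurable]: "(\<lambda>x. indicator \<Omega> x * f x) \<in> borel_measurable lebesgue" "box e g \<in> sets lebesgue"
        using fi by auto
      have "(\<lambda>m. LINT x|lebesgue. \<phi> m x * (indicator \<Omega> x * f x)) \<longlonglongrightarrow> (LINT x|lebesgue. indicator (box e g) x * (indicator \<Omega> x * f x))"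
      proof (rule integral_dominated_convergence[where w = "\<lambda>x. \<bar>indicator \<Omega> x * f x\<bar>"])
        show "AE x in lebesgue. (\<lambda>m. \<phi> m x * (indicator \<Omega> x * f x)) \<longlonglongrightarrow> indicator (box e g) x * (indicator \<Omega> x * f x)"
          by (intro AE_I2 tendsto_intros \<phi>)
        show "AE x in lebesgue. norm (\<phi> m x * (indicator \<Omega> x * f x)) \<le> \<bar>indicator \<Omega> x * f x\<bar>" for m
          using \<phi>(2)[of m] by (intro AE_I2) (simp add: abs_mult mult_left_le_one_le)
      qed (use fi in auto)
      moreover have "(LINT x|lebesgue. \<phi> m x * (indicator \<Omega> x * f x)) = 0" for m
        using 0[OF \<phi>(1,4), of m] by (simp add: integral_restrict_space mult_ac)
      ultimately have "(LINT x|lebesgue. indicator (box e g) x * (indicator \<Omega> x * f x)) = 0"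
        by (simp add: LIMSEQ_const_iff)
      then show ?thesis
        by (simp add: box_eq[symmetric] indicator_inter_arith mult_ac)
    qed
    ultimately have "AE x in lebesgue. ?F x = 0" by (rule AE_zero_of_box_integrals)
    moreover have "AE x in lebesgue. x \<notin> cbox a b - box a b"
      by (rule AE_not_in) (simp add: negligible_iff_null_sets[symmetric] negligible_frontier_interval)
    ultimately show ?thesis
    proof eventually_elim
      case (elim x)
      then show ?case using ab by (auto split: split_indicator_asm)
    qed
  qed
  obtain \<D> where \<D>: "countable \<D>" "\<D> \<subseteq> Pow \<Omega>" "\<And>X. X \<in> \<D> \<Longrightarrow> \<exists>a b. X = cbox a b" "\<Union>\<D> = \<Omega>"
    using open_countable_Union_open_cbox[OF assms(1)] by metis
  have "AE x in lebesgue. \<forall>X\<in>\<D>. x \<in> X \<longrightarrow> f x = 0"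
    using \<D>(1)
  proof (rule AE_ball_countable[THEN iffD2], intro ballI)
    fix X assume "X \<in> \<D>"
    then show "AE x in lebesgue. x \<in> X \<longrightarrow> f x = 0" using \<D>(2,3) box0 by blast
  qed
  then have "AE x in lebesgue. x \<in> \<Omega> \<longrightarrow> f x = 0"
    by eventually_elim (use \<D>(4) in blast)
  then show ?thesis by (simp add: AE_restrict_space_iff)
qed

section \<open>Integrability, properties of test functions and uniqueness of the weak
  gradient\<close>

lemma lebesgue_sets_open [simp]: "open S \<Longrightarrow> S \<in> sets lebesgue"
  using sets_completionI_sub[of S lborel] by simp

lemma bounded_open_lmeasurable: "open S \<Longrightarrow> bounded S \<Longrightarrow> S \<in> lmeasurable"
  by (simp add: lmeasurable_open)

lemma integrable_const_lebesgue_on: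
  assumes "open \<Omega>" "bounded \<Omega>"
  shows "integrable (lebesgue_on \<Omega>) (\<lambda>x. c :: 'b::{banach, second_countable_topology})"
proof -
  interpret finite_measure "lebesgue_on \<Omega>"
    by (rule finite_measure_lebesgue_on) (rule bounded_open_lmeasurable[OF assms])
  show ?thesis by simp
qed

lemma L2_integrable_component:
  fixes g :: "real ^ 'n::finite \<Rightarrow> real ^ 'm::finite"
  assumes "open \<Omega>" "bounded \<Omega>" "g \<in> L2 \<Omega>"
  shows "integrable (lebesgue_on \<Omega>) (\<lambda>x. g x $ i)"
proof (rule Bochner_Integration.integrable_bound)
  show "integrable (lebesgue_on \<Omega>) (\<lambda>x. 1 + (norm (g x))\<^sup>2)"
    using assms(3) integrable_const_lebesgue_on[OF assms(1,2), of "1::real"] by (auto simp: L2_def)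
  have "g \<in> borel_measurable (lebesgue_on \<Omega>)" using assms(3) by (simp add: L2_def)
  then have "(\<lambda>x. g x \<bullet> axis i 1) \<in> borel_measurable (lebesgue_on \<Omega>)"
    by (intro borel_measurable_inner) auto
  then show "(\<lambda>x. g x $ i) \<in> borel_measurable (lebesgue_on \<Omega>)"
    by (simp add: inner_axis)
  show "AE x in lebesgue_on \<Omega>. norm (g x $ i) \<le> norm (1 + (norm (g x))\<^sup>2)"
  proof (rule AE_I2)
    fix x
    have "0 \<le> (norm (g x) - 1)\<^sup>2" by (rule zero_le_power2)
    then have "norm (g x) \<le> 1 + (norm (g x))\<^sup>2"
      using norm_ge_zero[of "g x"] unfolding power2_diff one_power2 mult_1_right by linarith
    then show "norm (g x $ i) \<le> norm (1 + (norm (g x))\<^sup>2)"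
      using component_le_norm_cart[of "g x" i] by simp
  qed
qed

lemma test_function_props:
  fixes \<phi> :: "real ^ 'n::finite \<Rightarrow> real"
  assumes "\<phi> \<in> test_functions \<Omega>"
  shows "\<exists>C B. compact C \<and> C \<subseteq> \<Omega> \<and> (\<forall>x. x \<notin> C \<longrightarrow> \<phi> x = 0) \<and> (\<forall>x i. x \<notin> C \<longrightarrow> partial i \<phi> x = 0) \<and>
    continuous_on UNIV \<phi> \<and> (\<forall>i. continuous_on UNIV (partial i \<phi>)) \<and> (\<forall>x. \<phi> differentiable (at x)) \<and>
    (\<forall>x. \<bar>\<phi> x\<bar> \<le> B) \<and> (\<forall>x i. \<bar>partial i \<phi> x\<bar> \<le> B)"
proof -
  obtain C where C: "compact C" "C \<subseteq> \<Omega>" "\<And>x. x \<notin> C \<Longrightarrow> \<phi> x = 0"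
    using assms by (auto simp: test_functions_def)
  have sm: "C_cont_diff m \<phi>" for m using assms by (auto simp: test_functions_def)
  have cont: "continuous_on UNIV \<phi>" using sm[of 0] by simp
  have contp: "continuous_on UNIV (partial i \<phi>)" for i using sm[of 1] by simp
  have diff: "\<phi> differentiable (at x)" for x using sm[of 1] by simp
  have p0: "partial i \<phi> x = 0" if "x \<notin> C" for x i
  proof -
    have "eventually (\<lambda>y. \<phi> y = 0) (nhds x)"
      using that C(1,3) eventually_nhds_in_open[of "- C" x]
      by (auto simp: compact_imp_closed open_Compl elim: eventually_mono)
    then have "(\<phi> has_derivative (\<lambda>h. 0)) (at x)"
      by (intro has_derivative_transform_eventually[OF has_derivative_const[of 0]])
        (auto simp: eventually_at_filter C(3)[OF that] elim: eventually_mono)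
    then show ?thesis
      unfolding partial_def by (subst frechet_derivative_at[symmetric]) auto
  qed
  have bnd: "\<exists>B. \<forall>x. \<bar>h x\<bar> \<le> B" if "continuous_on UNIV h" "\<And>x. x \<notin> C \<Longrightarrow> h x = 0" for h :: "real ^ 'n \<Rightarrow> real"
  proof -
    have "bounded (h ` C)"
      using that(1) C(1) by (intro compact_imp_bounded compact_continuous_image) (auto intro: continuous_on_subset)
    then obtain B where "\<forall>y\<in>h ` C. norm y \<le> B" unfolding bounded_iff by blast
    then have "\<bar>h x\<bar> \<le> max B 0" for x using that(2)[of x] by (cases "x \<in> C") auto
    then show ?thesis by blast
  qed
  obtain B0 where B0: "\<And>x. \<bar>\<phi> x\<bar> \<le> B0" using bnd[OF cont C(3)] by blast
  have "\<forall>i. \<exists>B. \<forall>x. \<bar>partial i \<phi> x\<bar> \<le> B" using bnd[OF contp p0] by blast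
  then obtain B1 where B1: "\<And>i x. \<bar>partial i \<phi> x\<bar> \<le> B1 i" by metis
  have B1': "B1 i \<le> (\<Sum>i\<in>UNIV. \<bar>B1 i\<bar>)" for i
    using member_le_sum[of i UNIV "\<lambda>i. \<bar>B1 i\<bar>"] by auto
  have "0 \<le> \<bar>B0\<bar>" "0 \<le> (\<Sum>i\<in>UNIV. \<bar>B1 i\<bar>)" by (auto intro: sum_nonneg)
  then have "\<bar>\<phi> x\<bar> \<le> \<bar>B0\<bar> + (\<Sum>i\<in>UNIV. \<bar>B1 i\<bar>)" "\<bar>partial i \<phi> x\<bar> \<le> \<bar>B0\<bar> + (\<Sum>i\<in>UNIV. \<bar>B1 i\<bar>)" for x i
    using B0[of x] B1[of i x] B1'[of i] by linarith+
  then show ?thesis using C p0 cont contp diff by blast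
qed

lemma integrable_mult_bounded_continuous:
  fixes f \<phi> :: "real ^ 'n::finite \<Rightarrow> real"
  assumes "open \<Omega>" "integrable (lebesgue_on \<Omega>) f" "continuous_on UNIV \<phi>" "\<And>x. \<bar>\<phi> x\<bar> \<le> B"
  shows "integrable (lebesgue_on \<Omega>) (\<lambda>x. f x * \<phi> x)"
proof (rule Bochner_Integration.integrable_bound)
  show "integrable (lebesgue_on \<Omega>) (\<lambda>x. B * f x)" using assms by simp
  have "\<phi> \<in> borel_measurable (lebesgue_on \<Omega>)"
    using assms(1,3) by (intro continuous_imp_measurable_on_sets_lebesgue) (auto intro: continuous_on_subset)
  then show "(\<lambda>x. f x * \<phi> x) \<in> borel_measurable (lebesgue_on \<Omega>)"
    using assms(2) by auto
  have "\<bar>f x * \<phi> x\<bar> \<le> \<bar>B * f x\<bar>" for x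
    using assms(4)[of x] unfolding abs_mult by (subst mult.commute) (intro mult_right_mono, auto)
  then show "AE x in lebesgue_on \<Omega>. norm (f x * \<phi> x) \<le> norm (B * f x)" by simp
qed

lemma weak_grad_unique:
  fixes f :: "real ^ 'n::finite \<Rightarrow> real"
  assumes \<Omega>: "open \<Omega>" "bounded \<Omega>"
    and "g \<in> L2 \<Omega>" "is_weak_grad \<Omega> f g" "g' \<in> L2 \<Omega>" "is_weak_grad \<Omega> f g'"
  shows "AE x in lebesgue_on \<Omega>. g x = g' x"
proof -
  have "AE x in lebesgue_on \<Omega>. g x $ i - g' x $ i = 0" for i
  proof (rule fundamental_lemma_variations[OF \<Omega>(1)])
    have int: "integrable (lebesgue_on \<Omega>) (\<lambda>x. g x $ i)" "integrable (lebesgue_on \<Omega>) (\<lambda>x. g' x $ i)"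
      using L2_integrable_component[OF \<Omega>] assms by blast+
    then show "integrable (lebesgue_on \<Omega>) (\<lambda>x. g x $ i - g' x $ i)" by simp
    fix \<phi> assume \<phi>: "\<phi> \<in> test_functions \<Omega>"
    obtain C B where "continuous_on UNIV \<phi>" "\<forall>x. \<bar>\<phi> x\<bar> \<le> B"
      using test_function_props[OF \<phi>] by blast
    then have B: "continuous_on UNIV \<phi>" "\<And>x. \<bar>\<phi> x\<bar> \<le> B" by auto
    have "(LINT x|lebesgue_on \<Omega>. g x $ i * \<phi> x) = (LINT x|lebesgue_on \<Omega>. g' x $ i * \<phi> x)"
      using assms(4)[unfolded is_weak_grad_def, rule_format, OF \<phi>, of i]
        assms(6)[unfolded is_weak_grad_def, rule_format, OF \<phi>, of i] by linarith
    then show "(LINT x|lebesgue_on \<Omega>. (g x $ i - g' x $ i) * \<phi> x) = 0"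
      using int[THEN integrable_mult_bounded_continuous[OF \<Omega>(1) _ B]]
      by (simp add: left_diff_distrib)
  qed
  then have "AE x in lebesgue_on \<Omega>. \<forall>i. g x $ i - g' x $ i = 0"
    by (subst AE_all_countable) auto
  then show ?thesis by (auto simp: vec_eq_iff elim: eventually_mono)
qed

lemma weak_grad_works:
  assumes "g \<in> L2 \<Omega>" "is_weak_grad \<Omega> f g"
  shows "weak_grad \<Omega> f \<in> L2 \<Omega>" "is_weak_grad \<Omega> f (weak_grad \<Omega> f)"
proof -
  have "weak_grad \<Omega> f \<in> L2 \<Omega> \<and> is_weak_grad \<Omega> f (weak_grad \<Omega> f)"
    unfolding weak_grad_def by (rule someI[of _ g]) (use assms in simp)
  then show "weak_grad \<Omega> f \<in> L2 \<Omega>" "is_weak_grad \<Omega> f (weak_grad \<Omega> f)" by simp_all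
qed

text \<open>\<open>weak_grad\<close> is an arbitrary choice; this is how an explicit gradient
  replaces it under integrals.\<close>

lemma weak_grad_eq:
  fixes f :: "real ^ 'n::finite \<Rightarrow> real"
  assumes \<Omega>: "open \<Omega>" "bounded \<Omega>" and g: "g \<in> L2 \<Omega>" "is_weak_grad \<Omega> f g"
  shows "AE x in lebesgue_on \<Omega>. weak_grad \<Omega> f x = g x"
  by (rule weak_grad_unique[OF \<Omega> weak_grad_works[OF g] g])

section \<open>Translations, difference quotients and Lipschitz bounds along segments\<close>

lemma integrable_bounded_support:
  fixes k :: "'a::euclidean_space \<Rightarrow> real"
  assumes "k \<in> borel_measurable borel" "\<And>x. \<bar>k x\<bar> \<le> C" "bounded S" "\<And>x. x \<notin> S \<Longrightarrow> k x = 0"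
  shows "integrable lborel k"
proof -
  obtain R where "\<forall>y\<in>S. dist 0 y \<le> R" using assms(3) unfolding bounded_any_center[of S 0] by blast
  then have R: "S \<subseteq> cball 0 R" by auto
  have "integrable lborel (\<lambda>x. C * indicator (cball (0::'a) R) x)"
    by (intro integrable_mult_right integrable_real_indicator) (auto simp: emeasure_bounded_finite[OF bounded_cball, unfolded infinity_ennreal_def])
  then show ?thesis
  proof (rule Bochner_Integration.integrable_bound)
    show "AE x in lborel. norm (k x) \<le> norm (C * indicator (cball (0::'a) R) x)"
    proof (rule AE_I2)
      fix x
      show "norm (k x) \<le> norm (C * indicator (cball (0::'a) R) x)"
      proof (cases "x \<in> S")
        case True
        then have "x \<in> cball 0 R" using R by (rule subsetD[rotated])
        then show ?thesis using assms(2)[of x] by simp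
      qed (simp add: assms(4))
    qed
  qed (use assms(1) in simp)
qed

lemma integral_lborel_shift:
  fixes k :: "'a::euclidean_space \<Rightarrow> real"
  assumes "k \<in> borel_measurable borel"
  shows "(LINT x|lborel. k (c + x)) = (LINT x|lborel. k x)"
proof -
  have "(LINT x|lborel. k x) = (LINT x|distr lborel borel ((+) c). k x)"
    by (simp add: lborel_distr_plus)
  also have "\<dots> = (LINT x|lborel. k (c + x))"
    using assms by (intro integral_distr) auto
  finally show ?thesis ..
qed

lemma has_derivative_quotients:
  fixes f :: "'a::real_normed_vector \<Rightarrow> real"
  assumes "(f has_derivative D) (at x)" "h \<longlonglongrightarrow> 0" "\<And>n. h n \<noteq> 0"
  shows "(\<lambda>n. (f (x + h n *\<^sub>R e) - f x) / h n) \<longlonglongrightarrow> D e"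
proof -
  have lin: "linear D" using assms(1) by (simp add: has_derivative_linear)
  have "((\<lambda>t. x + t *\<^sub>R e) has_derivative (\<lambda>t. t *\<^sub>R e)) (at 0)"
    by (auto intro!: derivative_eq_intros)
  from has_derivative_compose[OF this, of f D] assms(1)
  have "((\<lambda>t. f (x + t *\<^sub>R e)) has_derivative (\<lambda>t. t * D e)) (at 0)"
    by (simp add: linear_scale[OF lin])
  then have "((\<lambda>t. f (x + t *\<^sub>R e)) has_real_derivative D e) (at 0)"
    by (simp add: has_field_derivative_def mult.commute[of _ "D e"])
  then have "((\<lambda>t. (f (x + t *\<^sub>R e) - f x) / t) \<longlongrightarrow> D e) (at 0)"
    by (simp add: has_field_derivative_iff)
  moreover have "filterlim h (at 0) sequentially"
    using assms(2,3) by (intro filterlim_atI) auto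
  ultimately show ?thesis by (rule filterlim_compose)
qed

text \<open>Along a segment the closed pieces pull back to finitely many closed sets covering the
  unit interval, and on an interval a Lipschitz constant common to such sets holds globally.
  Convexity of the union plays no part.\<close>

lemma segment_lipschitz:
  fixes f :: "'a::euclidean_space \<Rightarrow> real"
  assumes T: "finite T" "\<And>K. K \<in> T \<Longrightarrow> closed K" "\<And>K. K \<in> T \<Longrightarrow> L-lipschitz_on K f" "L \<ge> 0"
    and seg: "closed_segment x y \<subseteq> \<Union>T"
  shows "\<bar>f y - f x\<bar> \<le> L * norm (y - x)"
proof -
  let ?c = "\<lambda>t. x + t *\<^sub>R (y - x)"
  have "(L * norm (y - x))-lipschitz_on {0..1} (\<lambda>t. f (?c t))"
  proof (rule lipschitz_on_closed_Union[where I = T and U = "\<lambda>K. ?c -` K"])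
    fix K assume K: "K \<in> T"
    show "(L * norm (y - x))-lipschitz_on (?c -` K) (\<lambda>t. f (?c t))"
    proof (rule lipschitz_onI)
      fix s t assume st: "s \<in> ?c -` K" "t \<in> ?c -` K"
      have "dist (f (?c s)) (f (?c t)) \<le> L * dist (?c s) (?c t)"
        by (rule lipschitz_onD[OF T(3)[OF K]]) (use st in auto)
      also have "dist (?c s) (?c t) = norm (y - x) * dist s t"
        by (simp add: dist_norm mult.commute flip: scaleR_left_diff_distrib)
      finally show "dist (f (?c s)) (f (?c t)) \<le> L * norm (y - x) * dist s t" by (simp add: mult_ac)
    qed (use T(4) in auto)
    show "closed (?c -` K)"
      by (intro closed_vimage T(2) K continuous_intros)
  next
    show "{0..1} \<subseteq> (\<Union>K\<in>T. ?c -` K)"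
    proof
      fix t :: real assume "t \<in> {0..1}"
      then have "?c t \<in> closed_segment x y"
        by (auto simp: in_segment algebra_simps intro!: exI[of _ t])
      then show "t \<in> (\<Union>K\<in>T. ?c -` K)" using seg by auto
    qed
  qed (use T in auto)
  from lipschitz_onD[OF this, of 1 0] show ?thesis by (simp add: dist_norm)
qed

text \<open>What finite element functions offer for weak differentiability: a Lipschitz bound on
  finitely many closed pieces and a classical gradient off a null set. The weak gradient is obtained
  from difference quotients, so boundary integrals over the pieces do not occur. Setting
  \<open>g\<close> to zero off \<open>U\<close> makes it a measurable total function.\<close>

locale piecewise_smooth =
  fixes \<Omega> :: "(real ^ 'n::finite) set" and T :: "(real ^ 'n) set set" and U f g L B
  assumes \<Omega>: "open \<Omega>" "bounded \<Omega>"
    and T: "finite T" "\<And>K. K \<in> T \<Longrightarrow> closed K" "\<Omega> \<subseteq> \<Union>T"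
    and lip: "\<And>K. K \<in> T \<Longrightarrow> L-lipschitz_on K f" and L: "L \<ge> 0"
    and U: "open U" "U \<subseteq> \<Omega>" "negligible (\<Omega> - U)"
    and der: "\<And>x. x \<in> U \<Longrightarrow> (f has_derivative (\<lambda>h. g x \<bullet> h)) (at x)"
    and g0: "\<And>x. x \<notin> U \<Longrightarrow> g x = (0 :: real ^ 'n)"
    and B: "\<And>x. x \<in> \<Omega> \<Longrightarrow> \<bar>f x\<bar> \<le> B"
begin

text \<open>The extension by zero, so that translation invariance of Lebesgue measure on the whole
  space applies.\<close>

definition "F x = indicator \<Omega> x * f x"

lemma cont: "continuous_on \<Omega> f"
proof -
  have "continuous_on (\<Union>K\<in>T. K) f"
    using T lip by (intro continuous_on_closed_Union) (auto intro: lipschitz_on_continuous_on)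
  then show ?thesis using T(3) by (auto intro: continuous_on_subset)
qed

lemma F_measurable [measurable]: "F \<in> borel_measurable borel"
  unfolding F_def[abs_def]
  using borel_measurable_continuous_on_indicator[OF _ cont] \<Omega>(1) by simp

lemma F_bound: "\<bar>F x\<bar> \<le> \<bar>B\<bar>"
  using B[of x] by (auto simp: F_def split: split_indicator)

lemma seg: "closed_segment x y \<subseteq> \<Omega> \<Longrightarrow> \<bar>f y - f x\<bar> \<le> L * norm (y - x)"
  using T lip L by (intro segment_lipschitz[of T]) auto

lemma quot:
  assumes "x \<in> U"
  shows "(\<lambda>n. (F (x + (1 / real (Suc n)) *\<^sub>R e) - F x) / (1 / real (Suc n))) \<longlonglongrightarrow> g x \<bullet> e"
proof (rule has_derivative_quotients)
  show "(F has_derivative (\<lambda>h. g x \<bullet> h)) (at x)"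
    by (rule has_derivative_transform_within_open[OF der[OF assms] U(1) assms])
      (use U(2) in \<open>auto simp: F_def\<close>)
qed (use LIMSEQ_Suc[OF lim_1_over_n] in auto)

text \<open>On the open set \<open>U\<close> the components are pointwise limits of difference
  quotients of the measurable \<open>F\<close>.\<close>

lemma g_measurable [measurable]: "g \<in> borel_measurable borel"
proof -
  have "(\<lambda>x. g x $ i) \<in> borel_measurable borel" for i
  proof (rule borel_measurable_LIMSEQ_real)
    show "(\<lambda>n. indicator U x * ((F (x + (1 / real (Suc n)) *\<^sub>R axis i 1) - F x) / (1 / real (Suc n)))) \<longlonglongrightarrow> g x $ i" for x
    proof (cases "x \<in> U")
      case True
      then show ?thesis using quot[OF True, of "axis i 1"] by (simp add: inner_axis)
    next
      case False
      then show ?thesis using g0 by simp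
    qed
    show "(\<lambda>x. indicator U x * ((F (x + (1 / real (Suc n)) *\<^sub>R axis i 1) - F x) / (1 / real (Suc n)))) \<in> borel_measurable borel" for n
    proof -
      have [measurable]: "U \<in> sets borel" using U(1) by simp
      show ?thesis by measurable
    qed
  qed
  then show ?thesis
    by (subst borel_measurable_euclidean_space) (auto simp: Basis_vec_def inner_axis)
qed

text \<open>The Lipschitz constant bounds difference quotients even when they cross several pieces,
  and it survives in the limit.\<close>

lemma g_bound: "\<bar>g x $ i\<bar> \<le> L"
proof (cases "x \<in> U")
  case True
  obtain r where r: "r > 0" "ball x r \<subseteq> \<Omega>" using True U(2) \<Omega>(1) by (meson openE subsetD)
  let ?h = "\<lambda>n. (r / 2) / real (Suc n)"
  have "(\<lambda>n. (f (x + ?h n *\<^sub>R axis i 1) - f x) / ?h n) \<longlonglongrightarrow> g x \<bullet> axis i 1"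
    using r by (intro has_derivative_quotients[OF der[OF True]] LIMSEQ_Suc[OF lim_const_over_n]) auto
  then have "(\<lambda>n. \<bar>(f (x + ?h n *\<^sub>R axis i 1) - f x) / ?h n\<bar>) \<longlonglongrightarrow> \<bar>g x $ i\<bar>"
    by (intro tendsto_rabs) (simp add: inner_axis)
  moreover have "\<bar>(f (x + ?h n *\<^sub>R axis i 1) - f x) / ?h n\<bar> \<le> L" for n
  proof -
    have h: "0 < ?h n" "?h n < r" using r(1) by (auto simp: field_simps add_pos_nonneg)
    have "closed_segment x (x + ?h n *\<^sub>R axis i 1) \<subseteq> ball x r"
      using h by (intro closed_segment_subset) (auto simp: dist_norm norm_axis_1)
    then have "\<bar>f (x + ?h n *\<^sub>R axis i 1) - f x\<bar> \<le> L * norm (?h n *\<^sub>R axis i (1::real) :: real ^ 'n)"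
      using seg[of x "x + ?h n *\<^sub>R axis i 1"] r(2) by auto
    also have "norm (?h n *\<^sub>R axis i (1::real) :: real ^ 'n) = ?h n"
      using r(1) by simp
    finally have *: "\<bar>f (x + ?h n *\<^sub>R axis i 1) - f x\<bar> \<le> L * ?h n" .
    have "\<bar>a / d\<bar> \<le> L" if "0 < d" "\<bar>a\<bar> \<le> L * d" for a d :: real
      using that by (simp add: abs_divide divide_le_eq)
    from this[OF h(1) *] show ?thesis .
  qed
  ultimately show ?thesis by (intro LIMSEQ_le_const2) auto
next
  case False
  then show ?thesis using g0 L by simp
qed

lemma f_L2: "f \<in> L2 \<Omega>"
proof -
  interpret finite_measure "lebesgue_on \<Omega>"
    by (rule finite_measure_lebesgue_on) (rule bounded_open_lmeasurable[OF \<Omega>])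
  have m: "f \<in> borel_measurable (lebesgue_on \<Omega>)"
    using cont \<Omega>(1) by (intro continuous_imp_measurable_on_sets_lebesgue) auto
  have "integrable (lebesgue_on \<Omega>) (\<lambda>x. (norm (f x))\<^sup>2)"
  proof (rule integrable_const_bound[where B = "B\<^sup>2"])
    show "AE x in lebesgue_on \<Omega>. norm ((norm (f x))\<^sup>2) \<le> B\<^sup>2"
      using B by (intro AE_I2) (auto intro!: abs_le_square_iff[THEN iffD1] simp: abs_of_nonneg[OF order.trans[OF abs_ge_zero B]])
  qed (use m in measurable)
  then show ?thesis using m by (simp add: L2_def)
qed

lemma g_L2: "g \<in> L2 \<Omega>"
proof -
  interpret finite_measure "lebesgue_on \<Omega>"
    by (rule finite_measure_lebesgue_on) (rule bounded_open_lmeasurable[OF \<Omega>])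
  have m: "g \<in> borel_measurable (lebesgue_on \<Omega>)"
    by (intro measurable_restrict_space1 measurable_completion) simp
  have "integrable (lebesgue_on \<Omega>) (\<lambda>x. (norm (g x))\<^sup>2)"
  proof (rule integrable_const_bound[where B = "(\<Sum>i\<in>(UNIV :: 'n set). L)\<^sup>2"])
    have "norm (g x) \<le> (\<Sum>i\<in>(UNIV :: 'n set). L)" for x
      by (rule order.trans[OF norm_le_l1_cart sum_mono]) (rule g_bound)
    then show "AE x in lebesgue_on \<Omega>. norm ((norm (g x))\<^sup>2) \<le> (\<Sum>i\<in>(UNIV :: 'n set). L)\<^sup>2"
      by (intro AE_I2) (auto intro!: power_mono)
  qed (use m in measurable)
  then show ?thesis using m by (simp add: L2_def)
qed

lemma AE_U: "AE x in lborel. x \<in> \<Omega> \<longrightarrow> x \<in> U"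
proof -
  have "AE x in lebesgue. x \<notin> \<Omega> - U"
    using U(3) by (intro AE_not_in) (simp add: negligible_iff_null_sets)
  then have "AE x in lebesgue. x \<in> \<Omega> \<longrightarrow> x \<in> U" by eventually_elim auto
  then show ?thesis by (simp add: AE_completion_iff)
qed

text \<open>Discrete integration by parts by translation, followed by dominated convergence on both
  sides: difference quotients of \<phi> on one side, of \<open>F\<close> on the other.\<close>

lemma weak: "is_weak_grad \<Omega> f g"
  unfolding is_weak_grad_def
proof (intro ballI allI)
  fix \<phi> :: "real ^ 'n \<Rightarrow> real" and i assume \<phi>: "\<phi> \<in> test_functions \<Omega>"
  obtain C M where C: "compact C" "C \<subseteq> \<Omega>" and props: "\<forall>x. x \<notin> C \<longrightarrow> \<phi> x = 0"
      "continuous_on UNIV \<phi>" "\<forall>i. continuous_on UNIV (partial i \<phi>)" "\<forall>x. \<phi> differentiable (at x)"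
      "\<forall>x. \<bar>\<phi> x\<bar> \<le> M" "\<forall>x i. \<bar>partial i \<phi> x\<bar> \<le> M"
    using test_function_props[OF \<phi>] by blast
  note \<phi>0 = props(1)[rule_format] and cont\<phi> = props(2) and contp = props(3)[rule_format]
    and diff = props(4)[rule_format] and M = props(5,6)[rule_format]
  have [measurable]: "\<phi> \<in> borel_measurable borel" "partial i \<phi> \<in> borel_measurable borel"
    using cont\<phi> contp by (auto intro: borel_measurable_continuous_onI)
  have [measurable]: "(\<lambda>x. g x $ i) \<in> borel_measurable borel"
    using borel_measurable_inner[OF g_measurable, of "\<lambda>_. axis i 1"] by (simp add: inner_axis)
  let ?e = "axis i 1 :: real ^ 'n"
  have [simp]: "norm ?e = 1" by (simp add: norm_axis_1)
  have "M \<ge> 0" using M(1)[of 0] by linarith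
  obtain \<delta> where \<delta>: "\<delta> > 0" "(\<Union>x\<in>C. ball x \<delta>) \<subseteq> \<Omega>"
    using compact_subset_open_imp_ball_epsilon_subset[OF C(1) \<Omega>(1) C(2)] by blast
  \<comment> \<open>Steps below \<delta> keep every translated segment that starts in the support
    \<open>C\<close> inside \<Omega>.\<close>
  define h where "h n = (\<delta> / 2) / real (Suc n)" for n
  have h: "0 < h n" "h n < \<delta>" for n using \<delta>(1) by (auto simp: h_def field_simps add_pos_nonneg)
  have h0: "h \<longlonglongrightarrow> 0" unfolding h_def[abs_def] by (rule LIMSEQ_Suc[OF lim_const_over_n])
  let ?P = "\<lambda>n x. F x * ((\<phi> (x + h n *\<^sub>R ?e) - \<phi> x) / h n)"
  let ?Q = "\<lambda>n x. (F (x + (- h n) *\<^sub>R ?e) - F x) / h n * \<phi> x"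
  have Fi: "integrable lborel (\<lambda>x. F x * k x)" if "k \<in> borel_measurable borel" "\<And>x. \<bar>k x\<bar> \<le> b" for k b
  proof (rule integrable_bounded_support[of _ "\<bar>B\<bar> * b" \<Omega>])
    show "\<bar>F x * k x\<bar> \<le> \<bar>B\<bar> * b" for x
      unfolding abs_mult by (intro mult_mono F_bound that abs_ge_zero)
    show "(\<lambda>x. F x * k x) \<in> borel_measurable borel" using that(1) by measurable
    show "F x * k x = 0" if "x \<notin> \<Omega>" for x using that by (simp add: F_def)
  qed (rule \<Omega>(2))
  have \<phi>i: "integrable lborel (\<lambda>x. k x * \<phi> x)" if "k \<in> borel_measurable borel" "\<And>x. x \<in> C \<Longrightarrow> \<bar>k x\<bar> \<le> b" for k b
  proof (rule integrable_bounded_support[of _ "\<bar>b\<bar> * M" C])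
    show "\<bar>k x * \<phi> x\<bar> \<le> \<bar>b\<bar> * M" for x
      using that(2)[of x] M(1)[of x] \<phi>0[of x] \<open>M \<ge> 0\<close> unfolding abs_mult
      by (cases "x \<in> C") (auto intro!: mult_mono)
  qed (use that(1) \<phi>0 C(1) in \<open>auto simp: compact_imp_bounded\<close>)
  \<comment> \<open>Translation by \<open>h n\<close> moves the difference from \<phi> to
    \<open>F\<close>; the two undisplaced terms are the same.\<close>
  have PQ: "(LINT x|lborel. ?P n x) = (LINT x|lborel. ?Q n x)" for n
  proof -
    have i1: "integrable lborel (\<lambda>x. F x * \<phi> (x + h n *\<^sub>R ?e))" using M by (intro Fi) auto
    have i2: "integrable lborel (\<lambda>x. F x * \<phi> x)" using M by (intro Fi) auto
    have i3: "integrable lborel (\<lambda>x. F (x + (- h n) *\<^sub>R ?e) * \<phi> x)"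
      using F_bound by (intro \<phi>i) auto
    have "(LINT x|lborel. F x * \<phi> (x + h n *\<^sub>R ?e)) = (LINT x|lborel. F (x + (- h n) *\<^sub>R ?e) * \<phi> x)"
      using integral_lborel_shift[of "\<lambda>x. F (x + (- h n) *\<^sub>R ?e) * \<phi> x" "h n *\<^sub>R ?e"]
      by (simp add: add.commute)
    moreover have "(LINT x|lborel. ?P n x) = ((LINT x|lborel. F x * \<phi> (x + h n *\<^sub>R ?e)) - (LINT x|lborel. F x * \<phi> x)) / h n"
      by (simp add: i1 i2 right_diff_distrib diff_divide_distrib)
    moreover have "(LINT x|lborel. ?Q n x) = ((LINT x|lborel. F (x + (- h n) *\<^sub>R ?e) * \<phi> x) - (LINT x|lborel. F x * \<phi> x)) / h n"
      using i2 i3 by (simp add: left_diff_distrib diff_divide_distrib)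
    ultimately show ?thesis by (simp only:)
  qed
  have P: "(\<lambda>n. LINT x|lborel. ?P n x) \<longlonglongrightarrow> (LINT x|lborel. F x * partial i \<phi> x)"
  proof (rule integral_dominated_convergence[where w = "\<lambda>x. \<bar>F x * M\<bar>"])
    show "integrable lborel (\<lambda>x. \<bar>F x * M\<bar>)" using Fi[of "\<lambda>_. M" "\<bar>M\<bar>"] by auto
    show "AE x in lborel. (\<lambda>n. ?P n x) \<longlonglongrightarrow> F x * partial i \<phi> x"
    proof (intro AE_I2 tendsto_intros)
      fix x
      have "(\<phi> has_derivative frechet_derivative \<phi> (at x)) (at x)"
        by (rule iffD1[OF frechet_derivative_works diff])
      from has_derivative_quotients[OF this h0 less_imp_neq[OF h(1), symmetric]]
      show "(\<lambda>n. (\<phi> (x + h n *\<^sub>R ?e) - \<phi> x) / h n) \<longlonglongrightarrow> partial i \<phi> x"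
        unfolding partial_def .
    qed
    show "AE x in lborel. norm (?P n x) \<le> \<bar>F x * M\<bar>" for n
    proof (intro AE_I2)
      fix x
      have "\<exists>z. z > 0 \<and> z < h n \<and> \<phi> (x + h n *\<^sub>R ?e) - \<phi> (x + 0 *\<^sub>R ?e) = (h n - 0) * partial i \<phi> (x + z *\<^sub>R ?e)"
      proof (rule MVT2[OF h(1)])
        fix t
        have d: "(\<phi> has_derivative frechet_derivative \<phi> (at (x + t *\<^sub>R ?e))) (at (x + t *\<^sub>R ?e))"
          by (rule iffD1[OF frechet_derivative_works diff])
        have "((\<lambda>t. x + t *\<^sub>R ?e) has_derivative (\<lambda>t. t *\<^sub>R ?e)) (at t)"
          by (auto intro!: derivative_eq_intros)
        from has_derivative_compose[OF this d]
        show "((\<lambda>t. \<phi> (x + t *\<^sub>R ?e)) has_real_derivative partial i \<phi> (x + t *\<^sub>R ?e)) (at t)"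
          by (simp add: has_field_derivative_def partial_def mult_commute_abs
              linear_scale[OF has_derivative_linear[OF d]])
      qed
      then obtain z where "\<phi> (x + h n *\<^sub>R ?e) - \<phi> x = h n * partial i \<phi> (x + z *\<^sub>R ?e)" by auto
      then have "(\<phi> (x + h n *\<^sub>R ?e) - \<phi> x) / h n = partial i \<phi> (x + z *\<^sub>R ?e)"
        using h(1)[of n] by simp
      then show "norm (?P n x) \<le> \<bar>F x * M\<bar>"
        using M(2)[where x = "x + z *\<^sub>R ?e" and i = i] \<open>M \<ge> 0\<close> by (simp add: abs_mult mult_left_mono)
    qed
  qed auto
  have Q: "(\<lambda>n. LINT x|lborel. ?Q n x) \<longlonglongrightarrow> (LINT x|lborel. - (g x $ i * \<phi> x))"
  proof (rule integral_dominated_convergence[where w = "\<lambda>x. \<bar>L * \<phi> x\<bar>"])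
    show "integrable lborel (\<lambda>x. \<bar>L * \<phi> x\<bar>)" using \<phi>i[of "\<lambda>_. L" "L"] L by auto
    show "AE x in lborel. (\<lambda>n. ?Q n x) \<longlonglongrightarrow> - (g x $ i * \<phi> x)"
      using AE_U
    proof eventually_elim
      case (elim x)
      show ?case
      proof (cases "x \<in> C")
        case True
        then have "x \<in> U" using elim C by auto
        have "(F has_derivative (\<lambda>h. g x \<bullet> h)) (at x)"
          by (rule has_derivative_transform_within_open[OF der[OF \<open>x \<in> U\<close>] U(1) \<open>x \<in> U\<close>])
            (use U(2) in \<open>auto simp: F_def\<close>)
        then have "(\<lambda>n. (F (x + (- h n) *\<^sub>R ?e) - F x) / (- h n)) \<longlonglongrightarrow> g x \<bullet> ?e"
          using h(1) tendsto_minus[OF h0] by (intro has_derivative_quotients) (auto simp: less_imp_neq[symmetric])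
        then have "(\<lambda>n. - ((F (x + (- h n) *\<^sub>R ?e) - F x) / (- h n)) * \<phi> x) \<longlonglongrightarrow> - (g x \<bullet> ?e) * \<phi> x"
          by (intro tendsto_intros)
        then show ?thesis by (simp add: inner_axis)
      qed (simp add: \<phi>0)
    qed
    \<comment> \<open>Off \<open>C\<close> the factor \<phi> is zero, and for points of
      \<open>C\<close> the whole segment lies in \<Omega>, where the Lipschitz bound holds. The jump
      of \<open>F\<close> across the boundary of \<Omega> is never met.\<close>
    show "AE x in lborel. norm (?Q n x) \<le> \<bar>L * \<phi> x\<bar>" for n
    proof (intro AE_I2)
      fix x
      show "norm (?Q n x) \<le> \<bar>L * \<phi> x\<bar>"
      proof (cases "x \<in> C")
        case True
        let ?y = "x + (- h n) *\<^sub>R ?e"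
        have "closed_segment x ?y \<subseteq> ball x \<delta>"
          using h[of n] by (intro closed_segment_subset) (auto simp: dist_norm)
        then have sub: "closed_segment x ?y \<subseteq> \<Omega>" using \<delta>(2) True by blast
        have "x \<in> \<Omega>" "?y \<in> \<Omega>"
          by (rule subsetD[OF sub ends_in_segment(1)], rule subsetD[OF sub ends_in_segment(2)])
        then have "\<bar>F ?y - F x\<bar> \<le> L * h n"
          using seg[OF sub] h(1)[of n] by (simp add: F_def)
        then have "\<bar>(F ?y - F x) / h n\<bar> \<le> L"
          using h(1)[of n] by (simp add: abs_divide divide_le_eq)
        then show ?thesis unfolding real_norm_def abs_mult
          using L by (intro mult_right_mono) auto
      qed (simp add: \<phi>0)
    qed
  qed auto
  have eq: "(LINT x|lborel. F x * partial i \<phi> x) = (LINT x|lborel. - (g x $ i * \<phi> x))"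
    using P Q unfolding PQ by (rule LIMSEQ_unique)
  have [measurable]: "\<Omega> \<in> sets borel" using \<Omega>(1) by simp
  have e1: "(LINT x|lebesgue_on \<Omega>. f x * partial i \<phi> x) = (LINT x|lborel. F x * partial i \<phi> x)"
  proof -
    have "(LINT x|lebesgue_on \<Omega>. f x * partial i \<phi> x) = (LINT x|lebesgue. F x * partial i \<phi> x)"
      using \<Omega>(1) by (simp add: integral_restrict_space F_def mult_ac)
    also have "\<dots> = (LINT x|lborel. F x * partial i \<phi> x)" by (rule integral_completion) measurable
    finally show ?thesis .
  qed
  have e2: "(LINT x|lebesgue_on \<Omega>. g x $ i * \<phi> x) = (LINT x|lborel. g x $ i * \<phi> x)"
  proof -
    have "(LINT x|lebesgue_on \<Omega>. g x $ i * \<phi> x) = (LINT x|lebesgue. g x $ i * \<phi> x)"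
      using \<Omega>(1) g0[OF contra_subsetD[OF U(2)]]
      by (subst integral_restrict_space) (auto intro!: Bochner_Integration.integral_cong split: split_indicator)
    also have "\<dots> = (LINT x|lborel. g x $ i * \<phi> x)" by (rule integral_completion) measurable
    finally show ?thesis .
  qed
  show "(LINT x|lebesgue_on \<Omega>. f x * partial i \<phi> x) = - (LINT x|lebesgue_on \<Omega>. g x $ i * \<phi> x)"
    unfolding e1 e2 eq by simp
qed

end

section \<open>Polynomials on the cube\<close>

text \<open>An inductive span reduces statements that are linear in the polynomial to monomials. The
  index set is a parameter because, besides degree at most k in each variable, it also serves total
  degree at most one and polynomials in some of the variables.\<close>

inductive Qspan :: "('n::finite \<Rightarrow> nat) set \<Rightarrow> (real ^ 'n \<Rightarrow> real) \<Rightarrow> bool" for S where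
  mono: "\<beta> \<in> S \<Longrightarrow> Qspan S (\<lambda>x. c * monomial \<beta> x)"
| add: "Qspan S f \<Longrightarrow> Qspan S g \<Longrightarrow> Qspan S (\<lambda>x. f x + g x)"

abbreviation Qfun :: "nat \<Rightarrow> (real ^ 'n::finite \<Rightarrow> real) \<Rightarrow> bool" where
  "Qfun k \<equiv> Qspan {\<beta>. \<forall>i. \<beta> i \<le> k}"

lemma Qspan_mult:
  assumes "Qspan S f"
  shows "Qspan S (\<lambda>x. c * f x)"
  using assms
proof induction
  case (mono \<beta> d)
  then show ?case using Qspan.mono[of \<beta> S "c * d"] by (simp add: mult.assoc)
next
  case (add f g)
  then show ?case using Qspan.add by (fastforce simp: distrib_left)
qed

lemma Qspan_subset:
  assumes "Qspan S f" "S \<subseteq> S'"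
  shows "Qspan S' f"
  using assms by (induction) (auto intro: Qspan.intros)

lemma Qspan_0: "S \<noteq> {} \<Longrightarrow> Qspan S (\<lambda>x. 0)"
  using Qspan.mono[of _ S 0] by auto

lemma Qspan_sum:
  assumes "S \<noteq> {}" "\<And>a. a \<in> A \<Longrightarrow> Qspan S (f a)"
  shows "Qspan S (\<lambda>x. \<Sum>a\<in>A. f a x)"
  using assms(2) by (induction A rule: infinite_finite_induct) (auto intro: Qspan_0[OF assms(1)] Qspan.add)

lemma Qfun_sum:
  assumes "\<And>a. a \<in> A \<Longrightarrow> Qfun k (f a)"
  shows "Qfun k (\<lambda>x. \<Sum>a\<in>A. f a x)"
proof (rule Qspan_sum)
qed (use assms in \<open>auto intro: exI[of _ "\<lambda>_. 0"]\<close>)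

lemma finite_bounded_indices: "finite {\<beta> :: 'n::finite \<Rightarrow> nat. \<forall>i. \<beta> i \<le> k}"
proof -
  have "{\<beta> :: 'n \<Rightarrow> nat. \<forall>i. \<beta> i \<le> k} = PiE UNIV (\<lambda>_. {..k})" by auto
  then show ?thesis by (simp add: finite_PiE)
qed

lemma Q_poly_obtain:
  assumes "f \<in> Q_poly k D"
  obtains g where "Qfun k g" "\<And>x. x \<in> D \<Longrightarrow> f x = g x"
proof -
  obtain a where a: "\<forall>x\<in>D. f x = (\<Sum>\<alpha> | \<forall>i. \<alpha> i \<le> k. a \<alpha> * monomial \<alpha> x)"
    using assms by (auto simp: Q_poly_def polys_on_def)
  have "Qfun k (\<lambda>x. \<Sum>\<alpha> | \<forall>i. \<alpha> i \<le> k. a \<alpha> * monomial \<alpha> x)"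
    by (intro Qfun_sum Qspan.mono)
  then show ?thesis using that a by blast
qed

lemma Qfun_Q_poly:
  assumes "Qfun k f"
  shows "f \<in> Q_poly k D"
proof -
  have "\<exists>a. \<forall>x. f x = (\<Sum>\<alpha> | \<forall>i. \<alpha> i \<le> k. a \<alpha> * monomial \<alpha> x)"
    using assms
  proof induction
    case (mono \<beta> c)
    have "c * monomial \<beta> x = (\<Sum>\<alpha> | \<forall>i. \<alpha> i \<le> k. (if \<alpha> = \<beta> then c else 0) * monomial \<alpha> x)" for x :: "real ^ 'a"
    proof -
      have "(\<Sum>\<alpha> | \<forall>i. \<alpha> i \<le> k. (if \<alpha> = \<beta> then c else 0) * monomial \<alpha> x)
          = (\<Sum>\<alpha> | \<forall>i. \<alpha> i \<le> k. if \<alpha> = \<beta> then c * monomial \<beta> x else 0)"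
        by (intro sum.cong) auto
      then show ?thesis using mono by (simp add: sum.delta[OF finite_bounded_indices])
    qed
    then show ?case by (intro exI[of _ "\<lambda>\<alpha>. if \<alpha> = \<beta> then c else 0"] allI)
  next
    case (add f g)
    then obtain a b where "\<forall>x. f x = (\<Sum>\<alpha> | \<forall>i. \<alpha> i \<le> k. a \<alpha> * monomial \<alpha> x)"
      "\<forall>x. g x = (\<Sum>\<alpha> | \<forall>i. \<alpha> i \<le> k. b \<alpha> * monomial \<alpha> x)" by blast
    then have "\<forall>x. f x + g x = (\<Sum>\<alpha> | \<forall>i. \<alpha> i \<le> k. (a \<alpha> + b \<alpha>) * monomial \<alpha> x)"
      by (simp add: distrib_right sum.distrib)
    then show ?case by (rule exI[of _ "\<lambda>\<alpha>. a \<alpha> + b \<alpha>"])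
  qed
  then show ?thesis by (auto simp: Q_poly_def polys_on_def)
qed

text \<open>A new factor depends on a variable that is absent from the product so far, so no
  exponents are added up and the bound k per variable is kept.\<close>

lemma Qspan_prod:
  fixes p :: "'n::finite \<Rightarrow> real poly"
  assumes "finite A" "\<And>i. degree (p i) \<le> k"
  shows "Qspan {\<beta>. (\<forall>i. \<beta> i \<le> k) \<and> (\<forall>i. i \<notin> A \<longrightarrow> \<beta> i = 0)} (\<lambda>x. \<Prod>i\<in>A. poly (p i) (x $ i))"
  using assms(1)
proof induction
  case empty
  show ?case using Qspan.mono[of "\<lambda>_. 0" "{\<beta>. (\<forall>i. \<beta> i \<le> k) \<and> (\<forall>i. \<beta> i = 0)}" 1] by (simp add: monomial_def)
next
  case (insert j A)
  let ?S = "\<lambda>A :: 'n set. {\<beta> :: 'n \<Rightarrow> nat. (\<forall>i. \<beta> i \<le> k) \<and> (\<forall>i. i \<notin> A \<longrightarrow> \<beta> i = 0)}"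
  have *: "Qspan (?S (insert j A)) (\<lambda>x. poly (p j) (x $ j) * f x)" if "Qspan (?S A) f" for f
    using that
  proof induction
    case (mono \<beta> c)
    have m: "(x $ j) ^ a * monomial \<beta> x = monomial (\<beta>(j := a)) x" for a and x :: "real ^ 'n"
    proof -
      have "monomial \<beta> x = (\<Prod>i\<in>UNIV - {j}. (x $ i) ^ \<beta> i)"
        unfolding monomial_def using mono insert(2) by (subst prod.remove[of _ j]) auto
      also have "\<dots> = (\<Prod>i\<in>UNIV - {j}. (x $ i) ^ (\<beta>(j := a)) i)" by (intro prod.cong) auto
      finally show ?thesis unfolding monomial_def[of "\<beta>(j := a)"] by (subst prod.remove[of _ j]) auto
    qed
    have eq: "(\<lambda>x. poly (p j) (x $ j) * (c * monomial \<beta> x))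
        = (\<lambda>x. \<Sum>a\<le>degree (p j). (coeff (p j) a * c) * monomial (\<beta>(j := a)) x)"
      by (auto simp: poly_altdef sum_distrib_left sum_distrib_right m[symmetric] mult_ac)
    show ?case unfolding eq
    proof (rule Qspan_sum)
      show "?S (insert j A) \<noteq> {}" by (auto intro: exI[of _ "\<lambda>_. 0"])
      fix a assume "a \<in> {..degree (p j)}"
      then show "Qspan (?S (insert j A)) (\<lambda>x. coeff (p j) a * c * monomial (\<beta>(j := a)) x)"
        using mono assms(2)[of j] by (intro Qspan.mono) auto
    qed
  next
    case (add f g)
    then show ?case using Qspan.add by (fastforce simp: distrib_left)
  qed
  show ?case using *[OF insert.IH] insert.hyps by simp
qed

lemma Qfun_prod:
  fixes p :: "'n::finite \<Rightarrow> real poly"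
  assumes "\<And>i. degree (p i) \<le> k"
  shows "Qfun k (\<lambda>x. \<Prod>i\<in>UNIV. poly (p i) (x $ i))"
  using Qspan_prod[of UNIV p k] assms by simp

section \<open>Restriction to coordinate lines, derivatives and integrals over the cube\<close>

definition upd :: "real ^ 'n \<Rightarrow> 'n \<Rightarrow> real \<Rightarrow> real ^ 'n" where
  "upd x i s = (\<chi> l. if l = i then s else x $ l)"

lemma upd_nth [simp]: "upd x i s $ l = (if l = i then s else x $ l)"
  by (simp add: upd_def)

lemma upd_triv [simp]: "upd x i (x $ i) = x"
  by (simp add: vec_eq_iff)

lemma upd_upd [simp]: "upd (upd x i s) i t = upd x i t"
  by (simp add: vec_eq_iff)

lemma upd_eq_add: "upd x i s = x + (s - x $ i) *\<^sub>R axis i 1"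
  by (simp add: vec_eq_iff axis_def)

lemma upd_cube: "x \<in> cbox 0 1 \<Longrightarrow> s \<in> {0..1} \<Longrightarrow> upd x i s \<in> cbox 0 (1 :: real ^ 'n)"
  by (auto simp: mem_box_cart)

lemma Qfun_line:
  assumes "Qfun k f"
  shows "\<exists>p. degree p \<le> k \<and> (\<forall>s. f (upd x i s) = poly p s)"
  using assms
proof induction
  case (mono \<beta> c)
  let ?p = "monom (c * (\<Prod>l\<in>UNIV - {i}. (x $ l) ^ \<beta> l)) (\<beta> i)"
  have "c * monomial \<beta> (upd x i s) = poly ?p s" for s
    unfolding monomial_def by (subst prod.remove[of _ i]) (auto simp: poly_monom intro!: prod.cong)
  moreover have "degree ?p \<le> k" using mono by (auto intro: order.trans[OF degree_monom_le])
  ultimately show ?case by blast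
next
  case (add f g)
  then obtain p q where "degree p \<le> k" "degree q \<le> k" "\<forall>s. f (upd x i s) = poly p s" "\<forall>s. g (upd x i s) = poly q s"
    by blast
  then show ?case by (intro exI[of _ "p + q"]) (auto intro: degree_add_le)
qed

lemma Qfun_derivative:
  assumes "Qfun k f"
  shows "\<exists>f'. (\<forall>i. Qfun k (f' i)) \<and> (\<forall>x. (f has_derivative (\<lambda>h. \<Sum>i\<in>UNIV. f' i x * h $ i)) (at x))"
  using assms
proof induction
  case (mono \<beta> c)
  \<comment> \<open>For an exponent 0 the truncated subtraction is harmless, because the coefficient
    is 0.\<close>
  let ?f = "\<lambda>i x. (c * real (\<beta> i)) * monomial (\<beta>(i := \<beta> i - 1)) x"
  have "Qfun k (?f i)" for i
    using mono by (intro Qspan.mono) (auto intro: le_trans[OF diff_le_self])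
  moreover have "((\<lambda>x. c * monomial \<beta> x) has_derivative (\<lambda>h. \<Sum>i\<in>UNIV. ?f i x * h $ i)) (at x)" for x
  proof -
    have "((\<lambda>x :: real ^ 'a. (x $ i) ^ \<beta> i) has_derivative (\<lambda>h. real (\<beta> i) * (x $ i) ^ (\<beta> i - 1) * h $ i)) (at x)" for i
    proof -
      have "((\<lambda>x :: real ^ 'a. x $ i) has_derivative (\<lambda>h. h $ i)) (at x)"
        by (intro bounded_linear_imp_has_derivative bounded_linear_vec_nth)
      from has_derivative_power[OF this, of "\<beta> i"] show ?thesis by (simp add: mult_ac)
    qed
    then have "((\<lambda>x. \<Prod>i\<in>UNIV. (x $ i) ^ \<beta> i) has_derivative
        (\<lambda>h. \<Sum>i\<in>UNIV. (real (\<beta> i) * (x $ i) ^ (\<beta> i - 1) * h $ i) * (\<Prod>j\<in>UNIV - {i}. (x $ j) ^ \<beta> j))) (at x)"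
      by (rule has_derivative_prod)
    then have "((\<lambda>x. c * monomial \<beta> x) has_derivative
        (\<lambda>h. c * (\<Sum>i\<in>UNIV. (real (\<beta> i) * (x $ i) ^ (\<beta> i - 1) * h $ i) * (\<Prod>j\<in>UNIV - {i}. (x $ j) ^ \<beta> j)))) (at x)"
      unfolding monomial_def by (rule has_derivative_mult_right)
    moreover have "monomial (\<beta>(i := \<beta> i - 1)) x = (x $ i) ^ (\<beta> i - 1) * (\<Prod>j\<in>UNIV - {i}. (x $ j) ^ \<beta> j)" for i
      unfolding monomial_def by (subst prod.remove[of _ i]) (auto intro!: prod.cong)
    ultimately show ?thesis by (simp add: sum_distrib_left mult_ac)
  qed
  ultimately show ?case by (intro exI[of _ ?f] conjI allI)
next
  case (add f g)
  then obtain f' g' where f': "\<forall>i. Qfun k (f' i)" "\<forall>i. Qfun k (g' i)" and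
     d: "\<And>x. (f has_derivative (\<lambda>h. \<Sum>i\<in>UNIV. f' i x * h $ i)) (at x)"
        "\<And>x. (g has_derivative (\<lambda>h. \<Sum>i\<in>UNIV. g' i x * h $ i)) (at x)" by blast
  have "((\<lambda>x. f x + g x) has_derivative (\<lambda>h. \<Sum>i\<in>UNIV. (f' i x + g' i x) * h $ i)) (at x)" for x
    using has_derivative_add[OF d] by (simp add: distrib_right sum.distrib)
  then show ?case using f' by (intro exI[of _ "\<lambda>i x. f' i x + g' i x"] conjI allI Qspan.add) auto
qed

lemma Qfun_continuous: "Qfun k f \<Longrightarrow> continuous_on S f"
proof (induction rule: Qspan.induct)
  case (mono \<beta> c)
  then show ?case unfolding monomial_def by (intro continuous_intros)
qed (intro continuous_intros)

text \<open>Fubini for product functions: Lebesgue measure on the vectors is the image of the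
  product measure over the basis.\<close>

lemma cube_integral_prod:
  fixes p :: "'n::finite \<Rightarrow> real poly"
  shows "integral (cbox 0 1) (\<lambda>x :: real ^ 'n. \<Prod>i\<in>UNIV. poly (p i) (x $ i)) = (\<Prod>i\<in>UNIV. ip (p i))"
proof -
  define g where "g i s = indicator {0..1} s *\<^sub>R poly (p i) s" for i s
  let ?F = "\<lambda>x :: real ^ 'n. \<Prod>i\<in>UNIV. poly (p i) (x $ i)"
  have conv: "integral S h = (LINT x|lborel. indicator S x *\<^sub>R h x)" "integrable lborel (\<lambda>x. indicator S x *\<^sub>R h x)"
    if "compact S" "continuous_on S h" for S and h :: "'b::euclidean_space \<Rightarrow> real"
  proof -
    show i: "integrable lborel (\<lambda>x. indicator S x *\<^sub>R h x)" using that by (rule borel_integrable_compact)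
    show "integral S h = (LINT x|lborel. indicator S x *\<^sub>R h x)"
      using set_borel_integral_eq_integral(2)[of S h] i by (simp add: set_integrable_def set_lebesgue_integral_def)
  qed
  have gi: "integrable lborel (g i)" for i
    unfolding g_def[abs_def] by (intro conv continuous_intros) auto
  then have [measurable]: "g i \<in> borel_measurable borel" for i
    using borel_measurable_integrable[OF gi[of i]] by simp
  have ipg: "ip (p i) = integral\<^sup>L lborel (g i)" for i
    unfolding ip_def g_def[abs_def] by (intro conv continuous_intros) auto
  interpret product_sigma_finite "\<lambda>b :: real ^ 'n. lborel :: real measure" by standard
  have "integral (cbox 0 1) ?F = (LINT x|lborel. indicator (cbox 0 1) x *\<^sub>R ?F x)"
    by (intro conv continuous_intros) auto
  also have "\<dots> = (LINT x|lborel. (\<Prod>i\<in>UNIV. g i ((x :: real ^ 'n) $ i)))"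
  proof (intro Bochner_Integration.integral_cong refl)
    fix x :: "real ^ 'n"
    show "indicator (cbox 0 1) x *\<^sub>R ?F x = (\<Prod>i\<in>UNIV. g i (x $ i))"
    proof (cases "x \<in> cbox 0 1")
      case True
      then have "g i (x $ i) = poly (p i) (x $ i)" for i by (simp add: g_def mem_box_cart)
      then show ?thesis using True by simp
    next
      case False
      then obtain i where "x $ i \<notin> {0..1}" by (auto simp: mem_box_cart)
      then have "g i (x $ i) = 0" by (simp add: g_def)
      then have "(\<Prod>i\<in>UNIV. g i (x $ i)) = 0" by (intro prod_zero) auto
      then show ?thesis using False by simp
    qed
  qed
  also have "\<dots> = (LINT f|(\<Pi>\<^sub>M b\<in>(Basis :: (real ^ 'n) set). lborel). (\<Prod>i\<in>UNIV. g i ((\<Sum>b\<in>Basis. f b *\<^sub>R b) $ i)))"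
  proof (subst lborel_eq, rule integral_distr)
    show "(\<lambda>f. \<Sum>b\<in>Basis. f b *\<^sub>R b) \<in> (\<Pi>\<^sub>M b\<in>(Basis :: (real ^ 'n) set). lborel) \<rightarrow>\<^sub>M borel"
      by measurable
    have [measurable]: "(\<lambda>x :: real ^ 'n. x $ i) \<in> borel_measurable borel" for i
      by (intro borel_measurable_continuous_onI continuous_intros)
    show "(\<lambda>x :: real ^ 'n. \<Prod>i\<in>UNIV. g i (x $ i)) \<in> borel_measurable borel"
      by measurable
  qed
  also have "\<dots> = (LINT f|(\<Pi>\<^sub>M b\<in>(Basis :: (real ^ 'n) set). lborel). (\<Prod>b\<in>Basis. g (axis_index b) (f b)))"
  proof (intro Bochner_Integration.integral_cong refl)
    fix f :: "real ^ 'n \<Rightarrow> real"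
    have "(\<Sum>b\<in>Basis. f b *\<^sub>R b) $ i = f (axis i 1)" for i
    proof -
      have "(\<Sum>b\<in>Basis. f b *\<^sub>R b) $ i = (\<Sum>b\<in>Basis. f b *\<^sub>R b) \<bullet> axis i 1" by (simp add: inner_axis)
      also have "\<dots> = f (axis i 1)" by (rule inner_sum_left_Basis) (simp add: axis_in_Basis_iff)
      finally show ?thesis .
    qed
    moreover have "(\<Prod>b\<in>(Basis :: (real ^ 'n) set). g (axis_index b) (f b)) = (\<Prod>i\<in>UNIV. g i (f (axis i 1)))"
      by (rule prod.reindex_bij_witness[of _ "\<lambda>i. axis i 1" axis_index])
        (auto simp: Basis_vec_def axis_index_axis)
    ultimately show "(\<Prod>i\<in>UNIV. g i ((\<Sum>b\<in>Basis. f b *\<^sub>R b) $ i)) = (\<Prod>b\<in>Basis. g (axis_index b) (f b))" by simp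
  qed
  also have "\<dots> = (\<Prod>b\<in>(Basis :: (real ^ 'n) set). integral\<^sup>L lborel (g (axis_index b)))"
    by (rule product_integral_prod) (auto intro: gi)
  also have "\<dots> = (\<Prod>i\<in>UNIV. ip (p i))"
    by (rule prod.reindex_bij_witness[of _ "\<lambda>i. axis i 1" axis_index])
      (auto simp: Basis_vec_def axis_index_axis ipg)
  finally show ?thesis .
qed

text \<open>If the integral against each transversal factor sees only the value at z $ i, the
  integral over the cube collapses to the line through z. The factors \<open>g\<close> and values
  \<open>\<kappa>\<close> stay general: they are a Lagrange polynomial with its weight, or (s - y)
  times its derivative with the negative weight.\<close>

lemma line_quadrature:
  fixes z :: "real ^ 'n::finite"
  assumes q: "Qfun k q" and \<kappa>: "\<And>i p. i \<noteq> j \<Longrightarrow> degree p \<le> k \<Longrightarrow> ip (g i * p) = \<kappa> i * poly p (z $ i)"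
    and p: "\<And>s. q (upd z j s) = poly p s"
  shows "integral (cbox 0 1) (\<lambda>x. (poly f (x $ j) * (\<Prod>i\<in>UNIV - {j}. poly (g i) (x $ i))) * q x)
     = (\<Prod>i\<in>UNIV - {j}. \<kappa> i) * ip (f * p)"
  using q p
proof (induction arbitrary: p)
  case (mono \<beta> c)
  let ?h = "\<lambda>i. (if i = j then smult c f else g i) * monom 1 (\<beta> i)"
  have "(\<lambda>x. (poly f (x $ j) * (\<Prod>i\<in>UNIV - {j}. poly (g i) (x $ i))) * (c * monomial \<beta> x))
      = (\<lambda>x. \<Prod>i\<in>UNIV. poly (?h i) (x $ i))"
  proof
    fix x
    have "(\<Prod>i\<in>UNIV. poly (?h i) (x $ i)) = (\<Prod>i\<in>UNIV. poly (if i = j then smult c f else g i) (x $ i)) * monomial \<beta> x"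
      by (simp add: poly_monom monomial_def prod.distrib)
    also have "(\<Prod>i\<in>UNIV. poly (if i = j then smult c f else g i) (x $ i))
        = c * poly f (x $ j) * (\<Prod>i\<in>UNIV - {j}. poly (g i) (x $ i))"
      by (subst prod.remove[of _ j]) (auto intro!: prod.cong)
    finally show "(poly f (x $ j) * (\<Prod>i\<in>UNIV - {j}. poly (g i) (x $ i))) * (c * monomial \<beta> x) = (\<Prod>i\<in>UNIV. poly (?h i) (x $ i))"
      by simp
  qed
  then have "integral (cbox 0 1) (\<lambda>x. (poly f (x $ j) * (\<Prod>i\<in>UNIV - {j}. poly (g i) (x $ i))) * (c * monomial \<beta> x))
      = (\<Prod>i\<in>UNIV. ip (?h i))"
    by (simp only: cube_integral_prod)
  also have "\<dots> = ip (smult c f * monom 1 (\<beta> j)) * (\<Prod>i\<in>UNIV - {j}. ip (?h i))"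
    by (subst prod.remove[of _ j]) auto
  also have "(\<Prod>i\<in>UNIV - {j}. ip (?h i)) = (\<Prod>i\<in>UNIV - {j}. \<kappa> i * (z $ i) ^ \<beta> i)"
    using mono by (intro prod.cong refl) (auto simp: \<kappa> degree_monom_eq poly_monom)
  also have "\<dots> = (\<Prod>i\<in>UNIV - {j}. \<kappa> i) * (\<Prod>i\<in>UNIV - {j}. (z $ i) ^ \<beta> i)"
    by (rule prod.distrib)
  finally have eq: "integral (cbox 0 1) (\<lambda>x. (poly f (x $ j) * (\<Prod>i\<in>UNIV - {j}. poly (g i) (x $ i))) * (c * monomial \<beta> x))
     = (\<Prod>i\<in>UNIV - {j}. \<kappa> i) * (c * (\<Prod>i\<in>UNIV - {j}. (z $ i) ^ \<beta> i) * ip (f * monom 1 (\<beta> j)))"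
    by (simp add: ip_smult mult_ac)
  have "p = smult (c * (\<Prod>i\<in>UNIV - {j}. (z $ i) ^ \<beta> i)) (monom 1 (\<beta> j))"
  proof (rule poly_ext)
    fix s
    have "poly p s = c * monomial \<beta> (upd z j s)" using mono(2)[of s] by simp
    also have "monomial \<beta> (upd z j s) = s ^ \<beta> j * (\<Prod>i\<in>UNIV - {j}. (z $ i) ^ \<beta> i)"
      unfolding monomial_def by (subst prod.remove[of _ j]) (auto intro!: prod.cong)
    finally show "poly p s = poly (smult (c * (\<Prod>i\<in>UNIV - {j}. (z $ i) ^ \<beta> i)) (monom 1 (\<beta> j))) s"
      by (simp add: poly_monom)
  qed
  then show ?case unfolding eq by (simp add: ip_smult)
next
  case (add q1 q2)
  obtain p1 where p1: "\<And>s. q1 (upd z j s) = poly p1 s" using Qfun_line[OF add(1)] by blast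
  obtain p2 where p2: "\<And>s. q2 (upd z j s) = poly p2 s" using Qfun_line[OF add(2)] by blast
  have p: "p = p1 + p2"
    by (rule poly_ext) (use add.prems p1 p2 in \<open>simp flip: add.prems\<close>)
  let ?G = "\<lambda>x. poly f (x $ j) * (\<Prod>i\<in>UNIV - {j}. poly (g i) (x $ i))"
  have "(\<lambda>x. ?G x * q1 x) integrable_on cbox 0 1" "(\<lambda>x. ?G x * q2 x) integrable_on cbox 0 1"
    by (intro integrable_continuous continuous_intros Qfun_continuous[OF add(1)] Qfun_continuous[OF add(2)])+
  from Henstock_Kurzweil_Integration.integral_add[OF this]
  have "integral (cbox 0 1) (\<lambda>x. ?G x * (q1 x + q2 x)) = integral (cbox 0 1) (\<lambda>x. ?G x * q1 x) + integral (cbox 0 1) (\<lambda>x. ?G x * q2 x)"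
    by (simp add: distrib_left)
  then show ?case using add.IH(1)[OF p1] add.IH(2)[OF p2] by (simp add: p distrib_left ip_add)
qed

text \<open>The constant is one more than a bound for the sum of the absolute Lagrange polynomials.
  The conclusion names one node instead of a maximum, so that it can be applied to one coordinate
  after the other.\<close>

lemma node_bound:
  fixes N :: "real set"
  assumes "finite N"
  shows "\<exists>D\<ge>1. \<forall>p. degree p < card N \<longrightarrow> (\<forall>x\<in>{0..1}. \<exists>u\<in>N. \<bar>poly p x\<bar> \<le> D * \<bar>poly p u\<bar>)"
proof -
  have "\<exists>b. \<forall>x\<in>{0..1}. \<bar>poly (lagr N u) x\<bar> \<le> b" for u
  proof -
    have "bounded (poly (lagr N u) ` {0..1})"
      by (intro compact_imp_bounded compact_continuous_image continuous_intros) auto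
    then show ?thesis by (auto simp: bounded_iff)
  qed
  then obtain b where b: "\<And>u x. x \<in> {0..1} \<Longrightarrow> \<bar>poly (lagr N u) x\<bar> \<le> b u" by metis
  let ?D = "1 + (\<Sum>u\<in>N. \<bar>b u\<bar>)"
  have "\<exists>u\<in>N. \<bar>poly p x\<bar> \<le> ?D * \<bar>poly p u\<bar>" if p: "degree p < card N" and x: "x \<in> {0..1}" for p x
  proof -
    have "N \<noteq> {}" using p by auto
    define M where "M = Max ((\<lambda>u. \<bar>poly p u\<bar>) ` N)"
    have "M \<in> (\<lambda>u. \<bar>poly p u\<bar>) ` N" unfolding M_def using assms \<open>N \<noteq> {}\<close> by (intro Max_in) auto
    then obtain u where u: "u \<in> N" "M = \<bar>poly p u\<bar>" by blast
    have M: "\<bar>poly p v\<bar> \<le> M" if "v \<in> N" for v unfolding M_def using assms that by (intro Max_ge) auto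
    have "poly p x = (\<Sum>v\<in>N. poly p v * poly (lagr N v) x)"
      by (subst lagr_interpolation[OF assms p]) (simp add: poly_sum)
    then have "\<bar>poly p x\<bar> \<le> (\<Sum>v\<in>N. \<bar>poly p v * poly (lagr N v) x\<bar>)" by simp
    also have "\<dots> \<le> (\<Sum>v\<in>N. M * \<bar>b v\<bar>)"
      unfolding abs_mult using u(2) by (intro sum_mono mult_mono M order.trans[OF b[OF x]]) auto
    also have "\<dots> = M * (\<Sum>v\<in>N. \<bar>b v\<bar>)" by (rule sum_distrib_left[symmetric])
    also have "\<dots> \<le> ?D * M" using u(2) by (simp only: distrib_right mult.commute[of M]) simp
    finally show ?thesis using u by auto
  qed
  moreover have "?D \<ge> 1" by (simp add: sum_nonneg)
  ultimately show ?thesis by blast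
qed

text \<open>The coordinates in \<open>I\<close> are replaced by nodes one at a time, each
  replacement at the cost of a factor \<open>D\<close>; the node chosen may depend on the earlier
  choices.\<close>

lemma Qfun_node_bound:
  fixes N :: "'n::finite \<Rightarrow> real set"
  assumes q: "Qfun k q" and D: "D \<ge> 1" "\<And>i p x. degree p \<le> k \<Longrightarrow> x \<in> {0..1} \<Longrightarrow> \<exists>u\<in>N i. \<bar>poly p x\<bar> \<le> D * \<bar>poly p u\<bar>"
    and N: "\<And>i. N i \<subseteq> {0..1}" and x: "x \<in> cbox 0 1" and "finite I"
  shows "\<exists>z. (\<forall>i\<in>I. z $ i \<in> N i) \<and> (\<forall>i. i \<notin> I \<longrightarrow> z $ i = x $ i) \<and> \<bar>q x\<bar> \<le> D ^ card I * \<bar>q z\<bar>"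
  using \<open>finite I\<close>
proof induction
  case empty
  show ?case by (intro exI[of _ x]) auto
next
  case (insert i I)
  then obtain z where z: "\<forall>i\<in>I. z $ i \<in> N i" "\<forall>i. i \<notin> I \<longrightarrow> z $ i = x $ i" "\<bar>q x\<bar> \<le> D ^ card I * \<bar>q z\<bar>"
    by blast
  obtain p where p: "degree p \<le> k" "\<And>s. q (upd z i s) = poly p s" using Qfun_line[OF q] by blast
  have zi: "z $ i \<in> {0..1}" using z(2) insert.hyps x by (simp add: mem_box_cart)
  obtain u where u: "u \<in> N i" "\<bar>poly p (z $ i)\<bar> \<le> D * \<bar>poly p u\<bar>" using D(2)[OF p(1) zi] by blast
  have "\<bar>q z\<bar> \<le> D * \<bar>q (upd z i u)\<bar>" using u(2) p(2)[of "z $ i"] p(2)[of u] by simp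
  then have "D ^ card I * \<bar>q z\<bar> \<le> D ^ card I * (D * \<bar>q (upd z i u)\<bar>)"
    using D(1) by (intro mult_left_mono) auto
  then have "\<bar>q x\<bar> \<le> D ^ card (insert i I) * \<bar>q (upd z i u)\<bar>"
    using z(3) insert.hyps by (simp add: mult_ac)
  moreover have "\<forall>l\<in>insert i I. upd z i u $ l \<in> N l" "\<forall>l. l \<notin> insert i I \<longrightarrow> upd z i u $ l = x $ l"
    using z u(1) by auto
  ultimately show ?case by blast
qed

text \<open>The weight s (1 - s) vanishes at the ends, so the comparison uses the interior nodes of
  the Lobatto rule of order m + 2. There are m + 1 of them, enough for degree m; the weight is
  positive on them; and the exactness 2m + 3 covers the degree 2m + 2 of the integrand.\<close>

lemma weighted_sup_bound:
  "\<exists>C>0. \<forall>p. degree p \<le> m \<longrightarrow> (\<forall>x\<in>{0..1}. (poly p x)\<^sup>2 \<le> C * ip ([:0, 1, - 1:] * p ^ 2))"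
proof -
  obtain N w where N: "finite N" "card N = Suc (m + 2)" "N \<subseteq> {0..1}" "0 \<in> N" "1 \<in> N"
    "\<And>u. u \<in> N \<Longrightarrow> 1 - u \<in> N" "\<And>u. u \<in> N \<Longrightarrow> w u > 0"
    "\<And>p. degree p \<le> 2 * (m + 2) - 1 \<Longrightarrow> ip p = (\<Sum>u\<in>N. w u * poly p u)"
    using lobatto_rule[of "m + 2"] by auto
  let ?M = "N - {0, 1}"
  have M: "finite ?M" "card ?M = Suc m" using N(1,2,4,5) by (auto simp: card_Diff_subset)
  obtain D where D: "D \<ge> 1" "\<And>p x. degree p < card ?M \<Longrightarrow> x \<in> {0..1} \<Longrightarrow> \<exists>u\<in>?M. \<bar>poly p x\<bar> \<le> D * \<bar>poly p u\<bar>"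
    using node_bound[OF M(1)] by blast
  define c where "c u = w u * (u * (1 - u))" for u
  have c: "c u > 0" if "u \<in> ?M" for u
  proof -
    have "u > 0" "u < 1" using that N(3) by (auto simp: order_less_le)
    then show ?thesis using N(7)[of u] that by (simp add: c_def)
  qed
  define C where "C = D\<^sup>2 * (\<Sum>u\<in>?M. 1 / c u)"
  have "?M \<noteq> {}" using M(2) by (metis card.empty nat.distinct(1))
  then have "C > 0" unfolding C_def using D(1) c M(1) by (intro mult_pos_pos sum_pos) auto
  moreover have "(poly p x)\<^sup>2 \<le> C * ip ([:0, 1, - 1:] * p ^ 2)" if p: "degree p \<le> m" and x: "x \<in> {0..1}" for p x
  proof -
    obtain u where u: "u \<in> ?M" "\<bar>poly p x\<bar> \<le> D * \<bar>poly p u\<bar>" using D(2)[of p x] p x M(2) by auto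
    have "degree ([:0, 1, - 1:] * p ^ 2) \<le> 2 + 2 * m"
      using p by (intro order.trans[OF degree_mult_le] add_mono order.trans[OF degree_power_le]) auto
    then have "ip ([:0, 1, - 1:] * p ^ 2) = (\<Sum>v\<in>N. w v * poly ([:0, 1, - 1:] * p ^ 2) v)"
      by (intro N(8)) auto
    also have "\<dots> = (\<Sum>v\<in>N. c v * (poly p v)\<^sup>2)"
      by (intro sum.cong) (auto simp: c_def algebra_simps)
    finally have ip: "ip ([:0, 1, - 1:] * p ^ 2) = \<dots>" .
    have c0: "c v \<ge> 0" if "v \<in> N" for v
      using c[of v] that by (cases "v \<in> ?M") (auto simp: c_def)
    have "c u * (poly p u)\<^sup>2 \<le> ip ([:0, 1, - 1:] * p ^ 2)"
      unfolding ip using u(1) N(1) c0 by (intro member_le_sum) auto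
    then have le: "(poly p u)\<^sup>2 \<le> 1 / c u * ip ([:0, 1, - 1:] * p ^ 2)"
      using c[OF u(1)] by (simp add: field_simps)
    have ip0: "ip ([:0, 1, - 1:] * p ^ 2) \<ge> 0" unfolding ip using c0 by (intro sum_nonneg) auto
    have "1 / c u \<le> (\<Sum>u\<in>?M. 1 / c u)" using u(1) M(1) c by (intro member_le_sum) (auto simp: less_imp_le)
    then have "1 / c u * ip ([:0, 1, - 1:] * p ^ 2) \<le> (\<Sum>u\<in>?M. 1 / c u) * ip ([:0, 1, - 1:] * p ^ 2)"
      using ip0 by (rule mult_right_mono)
    then have "(poly p u)\<^sup>2 \<le> (\<Sum>u\<in>?M. 1 / c u) * ip ([:0, 1, - 1:] * p ^ 2)" using le by linarith
    then have "D\<^sup>2 * (poly p u)\<^sup>2 \<le> D\<^sup>2 * ((\<Sum>u\<in>?M. 1 / c u) * ip ([:0, 1, - 1:] * p ^ 2))"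
      by (rule mult_left_mono) simp
    moreover have "(poly p x)\<^sup>2 \<le> D\<^sup>2 * (poly p u)\<^sup>2"
      using power_mono[OF u(2), of 2] by (simp add: power_mult_distrib)
    ultimately show ?thesis by (simp add: C_def mult_ac)
  qed
  ultimately show ?thesis by blast
qed

section \<open>Change of variables\<close>

text \<open>Conjugation by \<pi> is a bijection between the permutations of the two index types and
  preserves the sign.\<close>

lemma det_reindex:
  fixes A :: "real ^ 'n::finite ^ 'n" and \<pi> :: "'m::finite \<Rightarrow> 'n"
  assumes "bij \<pi>"
  shows "det ((\<chi> a b. A $ \<pi> a $ \<pi> b) :: real ^ 'm ^ 'm) = det A"
proof -
  have inj: "inj \<pi>" and surj: "surj \<pi>" using assms by (auto simp: bij_def)
  have [simp]: "inv \<pi> (\<pi> a) = a" "\<pi> (inv \<pi> i) = i" for a i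
    using inj surj by (auto simp: surj_f_inv_f)
  have perm: "(\<pi> \<circ> p \<circ> inv \<pi>) permutes UNIV" if "p permutes UNIV" for p
    using bij_comp[OF bij_imp_bij_inv[OF assms] bij_comp[OF permutes_bij[OF that] assms]]
    by (intro bij_imp_permutes) (simp_all add: comp_assoc)
  have perm': "(inv \<pi> \<circ> p \<circ> \<pi>) permutes UNIV" if "p permutes UNIV" for p
    using bij_comp[OF assms bij_comp[OF permutes_bij[OF that] bij_imp_bij_inv[OF assms]]]
    by (intro bij_imp_permutes) (simp_all add: comp_assoc)
  have sign: "sign (\<pi> \<circ> p \<circ> inv \<pi>) = sign p" if "p permutes UNIV" for p
  proof -
    have "map_permutation UNIV \<pi> p = \<pi> \<circ> p \<circ> inv \<pi>"
      using surj by (auto simp: map_permutation_def restrict_id_def)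
    then show ?thesis using sign_map_permutation[OF inj that] by simp
  qed
  show ?thesis
    unfolding det_def
  proof (rule sum.reindex_bij_witness[of _ "\<lambda>p. inv \<pi> \<circ> p \<circ> \<pi>" "\<lambda>p. \<pi> \<circ> p \<circ> inv \<pi>"])
    fix p assume p: "p \<in> {p. p permutes (UNIV :: 'm set)}"
    have "(\<Prod>i\<in>UNIV. A $ i $ (\<pi> \<circ> p \<circ> inv \<pi>) i) = (\<Prod>a\<in>UNIV. A $ \<pi> a $ \<pi> (p a))"
      by (rule prod.reindex_bij_witness[of _ \<pi> "inv \<pi>"]) auto
    then show "of_int (sign (\<pi> \<circ> p \<circ> inv \<pi>)) * (\<Prod>i\<in>UNIV. A $ i $ (\<pi> \<circ> p \<circ> inv \<pi>) i)
       = of_int (sign p) * (\<Prod>i\<in>UNIV. ((\<chi> a b. A $ \<pi> a $ \<pi> b) :: real ^ 'm ^ 'm) $ i $ p i)"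
      using sign p by simp
  qed (auto simp: fun_eq_iff perm perm')
qed

text \<open>The general transformation formula is applied over a well-ordered index type.
  \<open>R\<close> relabels the coordinates along \<pi>: it maps boxes to boxes of equal content,
  and relabelling rows and columns together does not change the determinant.\<close>

lemma change_of_variables_reindex:
  fixes F :: "real ^ 'n::finite \<Rightarrow> real ^ 'n" and \<pi> :: "'m::{finite,wellorder} \<Rightarrow> 'n" and G :: "real ^ 'n \<Rightarrow> real"
  assumes \<pi>: "bij \<pi>"
    and der: "\<And>x. x \<in> cbox 0 1 \<Longrightarrow> (F has_derivative (\<lambda>\<xi>. J x *v \<xi>)) (at x within cbox 0 1)"
    and inj: "inj_on F (cbox 0 1)" and K: "F ` cbox 0 1 = K" "bounded K"
    and G: "G integrable_on K" "(\<lambda>x. norm (G x)) integrable_on K"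
  shows "integral K G = integral (cbox 0 1) (\<lambda>x. \<bar>det (J x)\<bar> * G (F x))"
proof -
  have [simp]: "inv \<pi> (\<pi> a) = a" "\<pi> (inv \<pi> i) = i" for a i
    using \<pi> by (auto simp: bij_def surj_f_inv_f)
  define R :: "real ^ 'm::{finite,wellorder} \<Rightarrow> real ^ 'n" where "R y = (\<chi> i. y $ inv \<pi> i)" for y
  define R' :: "real ^ 'n \<Rightarrow> real ^ 'm::{finite,wellorder}" where "R' x = (\<chi> a. x $ \<pi> a)" for x
  have RR' [simp]: "R (R' x) = x" "R' (R y) = y" for x y by (simp_all add: R_def R'_def vec_eq_iff)
  have linR: "linear R" "linear R'" by (auto simp: R_def R'_def linear_iff vec_eq_iff)
  have boxR: "R ` cbox u v = cbox (R u) (R v)" for u v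
  proof -
    have "cbox (R u) (R v) = R ` (R' ` cbox (R u) (R v))" by (simp add: image_image)
    also have "R' ` cbox (R u) (R v) = cbox u v"
    proof (intro set_eqI iffI)
      fix y assume "y \<in> cbox u v"
      then have "R y \<in> cbox (R u) (R v)" by (simp add: mem_box_cart R_def)
      then show "y \<in> R' ` cbox (R u) (R v)" by (metis RR'(2) imageI)
    next
      fix y assume "y \<in> R' ` cbox (R u) (R v)"
      then obtain x where x: "x \<in> cbox (R u) (R v)" "y = R' x" by blast
      have "u $ a \<le> x $ \<pi> a \<and> x $ \<pi> a \<le> v $ a" for a
        using x(1)[unfolded mem_box_cart, rule_format, of "\<pi> a"] by (simp add: R_def)
      then show "y \<in> cbox u v" by (simp add: x(2) mem_box_cart R'_def)
    qed
    finally show ?thesis ..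
  qed
  have boxR': "R' ` cbox u v = cbox (R' u) (R' v)" for u v
  proof -
    have "R' ` cbox u v = R' ` cbox (R (R' u)) (R (R' v))" by simp
    also have "\<dots> = R' ` R ` cbox (R' u) (R' v)" by (simp only: boxR)
    finally show ?thesis by (simp add: image_image)
  qed
  have contentR: "Henstock_Kurzweil_Integration.content (R ` cbox u v) = 1 * Henstock_Kurzweil_Integration.content (cbox u v)" for u v
  proof -
    have "(\<Prod>i\<in>UNIV. R v $ i - R u $ i) = (\<Prod>a\<in>UNIV. v $ a - u $ a)"
      by (rule prod.reindex_bij_witness[of _ \<pi> "inv \<pi>"]) (auto simp: R_def)
    moreover have "cbox (R u) (R v) = {} \<longleftrightarrow> cbox u v = {}" by (simp flip: boxR)
    ultimately show ?thesis by (simp add: boxR content_cbox_if_cart)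
  qed
  have contentR': "Henstock_Kurzweil_Integration.content (R' ` cbox u v) = 1 * Henstock_Kurzweil_Integration.content (cbox u v)" for u v
    using contentR[of "R' u" "R' v"] boxR[of "R' u" "R' v"] by (simp add: boxR')
  have conts: "continuous (at x) R" "continuous (at y) R'" for x y
    using linR by (auto intro: linear_continuous_at simp: linear_conv_bounded_linear)
  have twR: "((\<lambda>y. f (R y)) has_integral I) (R' ` cbox u v)" if "(f has_integral I) (cbox u v)" for f :: "_ \<Rightarrow> real" and I u v
    using has_integral_twiddle[of 1 R' R f I u v] that boxR boxR' contentR conts by fastforce
  have twR': "((\<lambda>x. f (R' x)) has_integral I) (R ` cbox u v)" if "(f has_integral I) (cbox u v)" for f :: "_ \<Rightarrow> real" and I u v
    using has_integral_twiddle[of 1 R R' f I u v] that boxR boxR' contentR' conts by fastforce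
  obtain u v where uv: "K \<subseteq> cbox u v" using bounded_subset_cbox_symmetric[OF K(2)] by blast
  have tr: "((\<lambda>y. g (R y)) has_integral I) (R' ` K)" if "(g has_integral I) K" for g :: "real ^ 'n \<Rightarrow> real" and I
  proof -
    have "((\<lambda>x. if x \<in> K then g x else 0) has_integral I) (cbox u v)"
      using that uv by (simp add: has_integral_restrict)
    from twR[OF this] have "((\<lambda>y. if R y \<in> K then g (R y) else 0) has_integral I) (R' ` cbox u v)" .
    moreover have "R y \<in> K \<longleftrightarrow> y \<in> R' ` K" for y by (metis RR' image_iff)
    moreover have "R' ` K \<subseteq> R' ` cbox u v" using uv by blast
    ultimately show ?thesis by (simp add: has_integral_restrict)
  qed
  have G': "((\<lambda>y. G (R y)) has_integral integral K G) (R' ` K)"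
    using tr G(1) by (simp add: has_integral_integral)
  have "(\<lambda>y. norm (G (R y))) integrable_on R' ` K"
    using tr[of "\<lambda>x. norm (G x)"] G(2) by (meson has_integral_integrable_integral integrable_on_def)
  then have absG: "(\<lambda>y. G (R y)) absolutely_integrable_on R' ` K"
    using G' by (auto simp: absolutely_integrable_on_def integrable_on_def)
  define F' where "F' = R' \<circ> F \<circ> R"
  define J' where "J' y = (\<lambda>\<xi>. R' (J (R y) *v R \<xi>))" for y
  have R01: "R ` cbox 0 1 = cbox 0 1" "R' ` cbox 0 1 = cbox 0 1" 
    unfolding boxR boxR' by (simp_all add: R_def R'_def zero_vec_def one_vec_def)
  have img: "F' ` cbox 0 1 = R' ` K"
  proof -
    have "F' ` cbox 0 1 = R' ` F ` R ` cbox 0 1" by (simp only: F'_def image_comp comp_assoc)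
    then show ?thesis by (simp only: R01 K)
  qed
  have det: "det (matrix (J' y)) = det (J (R y))" for y
  proof -
    have Rax: "R (axis b 1) = axis (\<pi> b) 1" for b
      using \<pi> by (auto simp: R_def axis_def vec_eq_iff)
    then have "matrix (J' y) = (\<chi> a b. J (R y) $ \<pi> a $ \<pi> b)"
      unfolding matrix_def J'_def R'_def Rax by (simp add: matrix_vector_mult_basis column_def)
    then show ?thesis by (simp add: det_reindex[OF \<pi>])
  qed
  \<comment> \<open>The transformation formula has values in a space of vectors, so the real
    integrand is wrapped in dimension one and unwrapped at the end.\<close>
  let ?v = "vec :: real \<Rightarrow> real ^ 1"
  have v: "bounded_linear ?v" by (simp add: linear_vec flip: linear_conv_bounded_linear)
  have der': "(F' has_derivative J' y) (at y within cbox 0 1)" if "y \<in> cbox 0 1" for y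
  proof -
    have Ry: "R y \<in> cbox 0 1" using that R01(1) by blast
    have dR: "(R has_derivative R) (at y within cbox 0 1)"
      using linR by (simp add: linear_conv_bounded_linear bounded_linear_imp_has_derivative)
    have "((F \<circ> R) has_derivative (\<lambda>\<xi>. J (R y) *v \<xi>) \<circ> R) (at y within cbox 0 1)"
      using diff_chain_within[OF dR, of F] der[OF Ry] by (simp add: R01)
    moreover have "(R' has_derivative R') (at ((F \<circ> R) y) within (F \<circ> R) ` cbox 0 1)"
      using linR by (simp add: linear_conv_bounded_linear bounded_linear_imp_has_derivative)
    ultimately have "((R' \<circ> (F \<circ> R)) has_derivative (R' \<circ> ((\<lambda>\<xi>. J (R y) *v \<xi>) \<circ> R))) (at y within cbox 0 1)"
      by (rule diff_chain_within)
    then show ?thesis by (simp add: F'_def J'_def o_def)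
  qed
  have inj': "inj_on F' (cbox 0 1)"
  proof (rule inj_onI)
    fix x y assume xy: "x \<in> cbox 0 1" "y \<in> cbox 0 1" "F' x = F' y"
    then have "R (F' x) = R (F' y)" by simp
    then have "F (R x) = F (R y)" by (simp add: F'_def)
    then have "R x = R y" using inj xy(1,2) R01(1) by (metis imageI inj_onD)
    then show "x = y" by (metis RR'(2))
  qed
  have "(\<lambda>y. \<bar>det (matrix (J' y))\<bar> *\<^sub>R (?v \<circ> (\<lambda>y. G (R y))) (F' y)) absolutely_integrable_on cbox 0 1 \<and>
       integral (cbox 0 1) (\<lambda>y. \<bar>det (matrix (J' y))\<bar> *\<^sub>R (?v \<circ> (\<lambda>y. G (R y))) (F' y)) = ?v (integral K G)"
  proof (subst has_absolute_integral_change_of_variables)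
    show "(?v \<circ> (\<lambda>y. G (R y))) absolutely_integrable_on F' ` cbox 0 1 \<and>
      integral (F' ` cbox 0 1) (?v \<circ> (\<lambda>y. G (R y))) = ?v (integral K G)"
      unfolding img using absolutely_integrable_linear[OF absG v] integral_linear[OF has_integral_integrable[OF G'] v]
      by (simp add: integral_unique[OF G'])
    show "cbox 0 1 \<in> sets (lebesgue :: (real ^ 'm::{finite,wellorder}) measure)" by simp
    show "(F' has_derivative J' y) (at y within cbox 0 1)" if "y \<in> cbox 0 1" for y using der'[OF that] .
    show "inj_on F' (cbox 0 1)" by (rule inj')
  qed
  then have i: "(\<lambda>y. \<bar>det (matrix (J' y))\<bar> *\<^sub>R (?v \<circ> (\<lambda>y. G (R y))) (F' y)) integrable_on cbox 0 1"
    "integral (cbox 0 1) (\<lambda>y. \<bar>det (matrix (J' y))\<bar> *\<^sub>R (?v \<circ> (\<lambda>y. G (R y))) (F' y)) = ?v (integral K G)"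
    by (rule set_lebesgue_integral_eq_integral(1)[OF conjunct1], rule conjunct2)
  then have "((\<lambda>y. \<bar>det (matrix (J' y))\<bar> *\<^sub>R (?v \<circ> (\<lambda>y. G (R y))) (F' y)) has_integral ?v (integral K G)) (cbox 0 1)"
    by (simp only: has_integral_iff simp_thms)
  from has_integral_linear[OF this bounded_linear_vec_nth[of 1]]
  have "((\<lambda>y. \<bar>det (J (R y))\<bar> * G (F (R y))) has_integral integral K G) (cbox 0 1)"
    by (simp add: o_def det F'_def)
  from twR'[OF this] show ?thesis by (simp add: R01 integral_unique)
qed

section \<open>Element maps\<close>

lemma det_two:
  fixes A :: "real ^ 'n::finite ^ 'n"
  assumes U: "(UNIV :: 'n set) = {i, j}" and ij: "i \<noteq> j"
  shows "det A = A $ i $ i * A $ j $ j - A $ i $ j * A $ j $ i"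
proof -
  have f: "finite {j}" "i \<notin> {j}" using ij by auto
  show ?thesis
    unfolding det_def U
    unfolding sum_over_permutations_insert[OF f]
    unfolding permutes_sing
    using ij by (simp add: sign_swap_id sign_id swap_id_eq transpose_def)
qed

text \<open>
  For \<open>z\<close> on a coordinate line in
  direction \<open>j\<close>, the vector \<open>E = det (J x) J(x)\<^sup>-\<^sup>1 t\<close> with \<open>t = J z *v axis j 1\<close> is the Piola
  transform of the constant field \<open>t\<close>; for bilinear maps in the plane and for affine maps it has
  the simple form in \<open>piola\<close>.
\<close>

locale cell =
  fixes K :: "(real ^ 'n::finite) set" and F :: "real ^ 'n \<Rightarrow> real ^ 'n" and J :: "real ^ 'n \<Rightarrow> real ^ 'n ^ 'n"
    and h c1 c3 c4 :: real
  assumes bij: "bij_betw F (cbox 0 1) K"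
    and poly: "polytope K" and h: "h = diameter K" "h > 0"
    and int: "interior K \<noteq> {}"
    and cpos: "c1 > 0" "c3 > 0" "c4 > 0"
    and Q1: "\<And>i. \<exists>g. Qfun 1 g \<and> (\<forall>x\<in>cbox 0 1. F x $ i = g x)"
    and der: "\<And>x. x \<in> cbox 0 1 \<Longrightarrow> (F has_derivative (\<lambda>\<xi>. J x *v \<xi>)) (at x within cbox 0 1)"
    and det_pos: "\<And>x. x \<in> cbox 0 1 \<Longrightarrow> det (J x) > 0"
    and det_ge: "\<And>x. x \<in> cbox 0 1 \<Longrightarrow> c1 * h ^ CARD('n) \<le> det (J x)"
    and J_ge: "\<And>x \<xi>. x \<in> cbox 0 1 \<Longrightarrow> c3 * h\<^sup>2 * (norm \<xi>)\<^sup>2 \<le> (norm (J x *v \<xi>))\<^sup>2"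
    and J_le: "\<And>x \<xi>. x \<in> cbox 0 1 \<Longrightarrow> (norm (J x *v \<xi>))\<^sup>2 \<le> c4 * h\<^sup>2 * (norm \<xi>)\<^sup>2"
    and line: "\<And>x i s. x \<in> cbox 0 1 \<Longrightarrow> s \<in> {0..1} \<Longrightarrow> F (upd x i s) = F x + (s - x $ i) *\<^sub>R (J x *v axis i 1)"
    and facet: "\<And>i e. e \<in> {0, 1} \<Longrightarrow> \<exists>a b. \<forall>x\<in>cbox 0 1. \<exists>d>0. a \<bullet> F x = b + (x $ i - e) * d"
    and piola: "\<And>j z. z \<in> cbox 0 1 \<Longrightarrow> \<exists>\<alpha> \<beta>. \<beta> * (real CARD('n) - 2) = 0 \<and>
        (\<forall>s\<in>{0..1}. \<alpha> + \<beta> * s = det (J (upd z j s))) \<and>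
        (\<forall>x\<in>cbox 0 1. (\<Sum>i\<in>UNIV. (if i = j then \<alpha> + \<beta> * x $ j else - \<beta> * (x $ i - z $ i)) *\<^sub>R (J x *v axis i 1))
            = det (J x) *\<^sub>R (J z *v axis j 1))"
    and affine_on_faces: "\<And>y z. y \<in> cbox 0 1 \<Longrightarrow> z \<in> cbox 0 1 \<Longrightarrow> (\<And>i. y $ i \<in> {0, 1} \<Longrightarrow> z $ i = y $ i) \<Longrightarrow>
        \<exists>i. y $ i \<in> {0, 1} \<Longrightarrow> F z = F y + J y *v (z - y)"

lemma matrix_inv_left:
  fixes A :: "real ^ 'n::finite ^ 'n"
  assumes "invertible A"
  shows "matrix_inv A ** A = mat 1"
  using someI_ex[OF assms[unfolded invertible_def]] by (simp add: matrix_inv_def)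

lemma norm_matrix_sq:
  fixes A :: "real ^ 'n::finite ^ 'n"
  shows "\<xi> \<bullet> ((transpose A ** A) *v \<xi>) = (norm (A *v \<xi>))\<^sup>2"
proof -
  have "\<xi> \<bullet> ((transpose A ** A) *v \<xi>) = \<xi> \<bullet> (transpose A *v (A *v \<xi>))"
    by (simp add: matrix_vector_mul_assoc)
  also have "\<dots> = (\<xi> v* transpose A) \<bullet> (A *v \<xi>)" by (rule dot_lmul_matrix[symmetric])
  finally show ?thesis by (simp add: dot_square_norm)
qed

lemma Qfun_1_line:
  assumes "Qfun 1 g"
  shows "g (upd x i s) = g (upd x i 0) + s * (g (upd x i 1) - g (upd x i 0))"
proof -
  obtain p where p: "degree p \<le> 1" "\<forall>s. g (upd x i s) = poly p s" using Qfun_line[OF assms] by blast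
  have "poly p s = coeff p 0 + s * coeff p 1" for s
  proof -
    have "p = [:coeff p 0, coeff p 1:]"
      using p(1) by (intro poly_eqI) (auto simp: coeff_pCons coeff_eq_0 split: nat.split)
    then show ?thesis by (metis poly_pCons poly_0 mult_zero_right add_0_right mult.commute)
  qed
  then show ?thesis using p(2) by (simp add: algebra_simps)
qed

lemma P_poly_1_affine:
  assumes "f \<in> P_poly 1 (cbox 0 1)"
  shows "\<exists>g l. Qfun 1 g \<and> (\<forall>x\<in>cbox 0 1. f x = g x) \<and> (\<forall>y z. g z = g y + l \<bullet> (z - y))"
proof -
  let ?S = "{\<beta> :: 'a \<Rightarrow> nat. (\<Sum>i\<in>UNIV. \<beta> i) \<le> 1}"
  obtain a where a: "\<forall>x\<in>cbox 0 1. f x = (\<Sum>\<alpha>\<in>?S. a \<alpha> * monomial \<alpha> x)"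
    using assms by (auto simp: P_poly_def polys_on_def)
  have span: "Qspan ?S (\<lambda>x. \<Sum>\<alpha>\<in>?S. a \<alpha> * monomial \<alpha> x)"
  proof (rule Qspan_sum)
    show "?S \<noteq> {}" by (auto intro: exI[of _ "\<lambda>_. 0"])
  qed (intro Qspan.mono)
  have sub: "?S \<subseteq> {\<beta>. \<forall>i. \<beta> i \<le> 1}"
  proof clarify
    fix \<beta> :: "'a \<Rightarrow> nat" and i assume "(\<Sum>i\<in>UNIV. \<beta> i) \<le> 1"
    moreover have "\<beta> i \<le> (\<Sum>i\<in>UNIV. \<beta> i)" by (rule member_le_sum) auto
    ultimately show "\<beta> i \<le> 1" by linarith
  qed
  have "\<exists>l. \<forall>y z. g z = g y + l \<bullet> (z - y)" if "Qspan ?S g" for g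
    using that
  proof induction
    case (mono \<beta> c)
    show ?case
    proof (cases "\<forall>i. \<beta> i = 0")
      case True
      then show ?thesis by (intro exI[of _ 0]) (simp add: monomial_def)
    next
      case False
      then obtain i where i: "\<beta> i > 0" by auto
      have "\<beta> i + (\<Sum>l\<in>UNIV - {i}. \<beta> l) \<le> 1" using mono by (subst (asm) sum.remove[of _ i]) auto
      then have "\<beta> i = 1" "(\<Sum>l\<in>UNIV - {i}. \<beta> l) = 0" using i by linarith+
      then have b: "\<beta> i = 1" "\<And>l. l \<noteq> i \<Longrightarrow> \<beta> l = 0" by (simp_all add: sum_eq_0_iff)
      have m: "monomial \<beta> x = x $ i" for x
        unfolding monomial_def by (subst prod.remove[of _ i]) (auto simp: b)
      show ?thesis
        by (intro exI[of _ "c *\<^sub>R axis i 1"]) (simp add: m inner_axis' algebra_simps)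
    qed
  next
    case (add f g)
    then obtain l1 l2 where l: "\<And>y z. f z = f y + l1 \<bullet> (z - y)" "\<And>y z. g z = g y + l2 \<bullet> (z - y)" by blast
    have "f z + g z = f y + g y + (l1 + l2) \<bullet> (z - y)" for y z
      using l(1)[of z y] l(2)[of z y] by (simp add: inner_add_left)
    then show ?case by blast
  qed
  then obtain l where "\<forall>y z. (\<Sum>\<alpha>\<in>?S. a \<alpha> * monomial \<alpha> z) = (\<Sum>\<alpha>\<in>?S. a \<alpha> * monomial \<alpha> y) + l \<bullet> (z - y)"
    using span by blast
  then show ?thesis using a Qspan_subset[OF span sub] by blast
qed

text \<open>Two shapes of the Jacobian decide everything. In the plane its columns are A + x_i m and
  B + x_j m with one common vector m; in space it is a constant matrix M. Facets, the Piola formula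
  and affinity on faces are read off from these shapes.\<close>

lemma cell_intro:
  fixes F :: "real ^ 'n::finite \<Rightarrow> real ^ 'n"
  assumes card: "CARD('n) = 2 \<or> CARD('n) = 3"
    and pos: "c1 > 0" "c3 > 0" "c4 > 0"
    and "mesh_cell K" and reg: "regular_map c1 c2 c3 c4 K F"
    and poly: "F \<in> componentwise (if CARD('n) = 2 then Q_poly 1 ref_cell else P_poly 1 ref_cell)"
  obtains J where "cell K F J (diameter K) c1 c3 c4" "continuous_on (cbox 0 1) J"
proof -
  have "polytope K" using \<open>mesh_cell K\<close> by (auto simp: mesh_cell_def quadrilateral_def hexahedron_def split: if_splits)
  then have K: "convex K" "compact K" using polytope_imp_convex polytope_imp_compact by blast+
  let ?h = "diameter K"
  have "aff_dim K = int CARD('n)"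
    using \<open>mesh_cell K\<close> card by (auto simp: mesh_cell_def quadrilateral_def hexahedron_def)
  then have "affine hull K = UNIV" "K \<noteq> {}" by (auto simp: aff_dim_eq_full[symmetric] aff_dim_empty)
  then have int: "interior K \<noteq> {}"
    using rel_interior_interior[of K] rel_interior_eq_empty[OF K(1)] by simp
  obtain J where bij: "bij_betw F (cbox 0 1) K" and contJ: "continuous_on (cbox 0 1) J" and
    J: "\<And>x. x \<in> cbox 0 1 \<Longrightarrow> (F has_derivative (\<lambda>\<xi>. J x *v \<xi>)) (at x within cbox 0 1)"
     "\<And>x. x \<in> cbox 0 1 \<Longrightarrow> det (J x) > 0" "\<And>x. x \<in> cbox 0 1 \<Longrightarrow> c1 * ?h ^ CARD('n) \<le> \<bar>det (J x)\<bar>"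
     "\<And>x \<xi>. x \<in> cbox 0 1 \<Longrightarrow> c3 * ?h\<^sup>2 * (\<xi> \<bullet> \<xi>) \<le> \<xi> \<bullet> ((transpose (J x) ** J x) *v \<xi>)"
     "\<And>x \<xi>. x \<in> cbox 0 1 \<Longrightarrow> \<xi> \<bullet> ((transpose (J x) ** J x) *v \<xi>) \<le> c4 * ?h\<^sup>2 * (\<xi> \<bullet> \<xi>)"
    using reg unfolding regular_map_def by blast
  have J4: "c3 * ?h\<^sup>2 * (norm \<xi>)\<^sup>2 \<le> (norm (J x *v \<xi>))\<^sup>2" if "x \<in> cbox 0 1" for x \<xi>
    using J(4)[OF that, of \<xi>] by (simp add: norm_matrix_sq dot_square_norm)
  have J5: "(norm (J x *v \<xi>))\<^sup>2 \<le> c4 * ?h\<^sup>2 * (norm \<xi>)\<^sup>2" if "x \<in> cbox 0 1" for x \<xi>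
    using J(5)[OF that, of \<xi>] by (simp add: norm_matrix_sq dot_square_norm)
  have zero: "0 \<in> cbox 0 (1 :: real ^ 'n)" by (simp add: mem_box_cart)
  have "?h > 0"
  proof (rule ccontr)
    assume "\<not> ?h > 0"
    then have "?h = 0" using diameter_ge_0[OF compact_imp_bounded[OF K(2)]] by simp
    then have "J 0 *v \<xi> = 0" for \<xi> using J5[OF zero, of \<xi>] by simp
    then have "J 0 *v \<xi> = 0 *v \<xi>" for \<xi> by simp
    then have "J 0 = 0" by (simp add: matrix_eq)
    moreover have "det (0 :: real ^ 'n ^ 'n) = 0"
      by (rule det_zero_row(1)[of "undefined"]) (simp add: row_def vec_eq_iff)
    ultimately show False using J(2)[OF zero] by simp
  qed
  have Q1: "\<exists>g. Qfun 1 g \<and> (\<forall>x\<in>cbox 0 1. F x $ i = g x)" for i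
  proof (cases "CARD('n) = 2")
    case True
    then have "(\<lambda>x. F x $ i) \<in> Q_poly 1 (cbox 0 1)" using poly by (simp add: componentwise_def)
    from Q_poly_obtain[OF this] show ?thesis by metis
  next
    case False
    then have "(\<lambda>x. F x $ i) \<in> P_poly 1 (cbox 0 1)" using poly by (simp add: componentwise_def)
    from P_poly_1_affine[OF this] show ?thesis by blast
  qed
  \<comment> \<open>The components have degree at most one in each variable, hence are affine along
    every coordinate line.\<close>
  have aff_line: "F (upd x i s) = F (upd x i 0) + s *\<^sub>R (F (upd x i 1) - F (upd x i 0))"
    if "x \<in> cbox 0 1" "s \<in> {0..1}" for x i s
  proof (subst vec_eq_iff, rule allI)
    fix l
    obtain g where g: "Qfun 1 g" "\<forall>x\<in>cbox 0 1. F x $ l = g x" using Q1[of l] by blast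
    show "F (upd x i s) $ l = (F (upd x i 0) + s *\<^sub>R (F (upd x i 1) - F (upd x i 0))) $ l"
      using Qfun_1_line[OF g(1), of x i s] g(2) upd_cube[OF that(1), of _ i] that(2) by simp
  qed
  \<comment> \<open>The derivative along such a line is the difference of the end values, also at
    points on the boundary of the cube, where uniqueness of the derivative within the closed
    interval is used.\<close>
  have Jcol: "J x *v axis i 1 = F (upd x i 1) - F (upd x i 0)" if x: "x \<in> cbox 0 1" for x i
  proof -
    let ?c = "\<lambda>s. upd x i s"
    have xi: "x $ i \<in> {0..1}" using x by (simp add: mem_box_cart)
    have "(?c has_derivative (\<lambda>s. s *\<^sub>R axis i 1)) (at (x $ i) within {0..1})"
      unfolding upd_eq_add by (auto intro!: derivative_eq_intros)
    moreover have "(F has_derivative (\<lambda>\<xi>. J x *v \<xi>)) (at (?c (x $ i)) within ?c ` {0..1})"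
    proof -
      have "?c ` {0..1} \<subseteq> cbox 0 1" using upd_cube[OF x] by (auto simp del: atLeastAtMost_iff)
      from has_derivative_subset[OF J(1)[OF x] this] show ?thesis by simp
    qed
    ultimately have "((F \<circ> ?c) has_derivative ((\<lambda>\<xi>. J x *v \<xi>) \<circ> (\<lambda>s. s *\<^sub>R axis i 1))) (at (x $ i) within {0..1})"
      by (rule diff_chain_within)
    then have "((\<lambda>s. F (?c s)) has_vector_derivative J x *v axis i 1) (at (x $ i) within cbox 0 1)"
      by (simp add: has_vector_derivative_def o_def matrix_vector_mult_scaleR)
    moreover have "((\<lambda>s. F (?c s)) has_vector_derivative F (?c 1) - F (?c 0)) (at (x $ i) within cbox 0 1)"
    proof (rule has_vector_derivative_transform[of _ _ "\<lambda>s. F (?c s)" "\<lambda>s. F (?c 0) + s *\<^sub>R (F (?c 1) - F (?c 0))"])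
      show "((\<lambda>s. F (?c 0) + s *\<^sub>R (F (?c 1) - F (?c 0))) has_vector_derivative F (?c 1) - F (?c 0)) (at (x $ i) within cbox 0 1)"
        by (auto intro!: derivative_eq_intros)
      show "x $ i \<in> cbox 0 1" using xi by simp
      show "F (?c s) = F (?c 0) + s *\<^sub>R (F (?c 1) - F (?c 0))" if "s \<in> cbox 0 1" for s
        using aff_line[OF x, of s i] that by simp
    qed
    ultimately show ?thesis
      using vector_derivative_unique_within_closed_interval[of 0 1 "x $ i"] xi by simp
  qed
  have line: "F (upd x i s) = F x + (s - x $ i) *\<^sub>R (J x *v axis i 1)" if "x \<in> cbox 0 1" "s \<in> {0..1}" for x i s
    using aff_line[OF that, of i] aff_line[OF that(1), of "x $ i" i] that(1)
    by (simp add: Jcol[OF that(1)] scaleR_left_diff_distrib mem_box_cart)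
  have "cell K F J ?h c1 c3 c4"
  proof (cases "CARD('n) = 2")
    case True
    obtain i0 j0 where ij0: "(UNIV :: 'n set) = {i0, j0}" "i0 \<noteq> j0"
      using iffD1[OF card_2_iff True] by (elim exE conjE) (rule that)
    note ij0 = ij0(2,1)
    have other: "\<exists>i. i \<noteq> j \<and> UNIV = {i, j}" for j :: 'n
    proof (cases "j = i0")
      case True
      then show ?thesis using ij0 by (intro exI[of _ j0]) auto
    next
      case False
      moreover have "j \<in> {i0, j0}" unfolding ij0(2)[symmetric] by simp
      ultimately show ?thesis using ij0 by (intro exI[of _ i0]) auto
    qed
    \<comment> \<open>m is the mixed second difference of the four corner values, and it is the same
      for both columns.\<close>
    have cols: "\<exists>A B m. \<forall>x\<in>cbox 0 1. J x *v axis j 1 = A + (x $ i) *\<^sub>R m \<and> J x *v axis i 1 = B + (x $ j) *\<^sub>R m"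
      if ij: "i \<noteq> j" "UNIV = {i, j}" for i j
    proof -
      define G where "G s t = F (upd (upd 0 i s) j t)" for s t
      have G: "F (upd x j t) = G (x $ i) t" "F (upd x i t) = G t (x $ j)" for x t
      proof -
        have "upd (upd 0 i (x $ i)) j t = upd x j t" "upd (upd 0 i t) j (x $ j) = upd x i t"
          unfolding vec_eq_iff using ij by auto
        then show "F (upd x j t) = G (x $ i) t" "F (upd x i t) = G t (x $ j)" unfolding G_def by simp_all
      qed
      have in01: "upd 0 i s \<in> cbox 0 1" "upd 0 j s \<in> cbox 0 1" if "s \<in> {0..1}" for s
        using upd_cube[OF zero that] by auto
      have G1: "G s t = G 0 t + s *\<^sub>R (G 1 t - G 0 t)" if "s \<in> {0..1}" "t \<in> {0..1}" for s t
        using aff_line[OF in01(2)[OF that(2)] that(1), of i] unfolding G by simp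
      have G2: "G s t = G s 0 + t *\<^sub>R (G s 1 - G s 0)" if "s \<in> {0..1}" "t \<in> {0..1}" for s t
        using aff_line[OF in01(1)[OF that(1)] that(2), of j] unfolding G using ij(1) by simp
      let ?m = "G 1 1 - G 0 1 - G 1 0 + G 0 0"
      have "J x *v axis j 1 = (G 0 1 - G 0 0) + (x $ i) *\<^sub>R ?m \<and> J x *v axis i 1 = (G 1 0 - G 0 0) + (x $ j) *\<^sub>R ?m"
        if x: "x \<in> cbox 0 1" for x
      proof -
        have x01: "x $ i \<in> {0..1}" "x $ j \<in> {0..1}" using x by (auto simp: mem_box_cart)
        note e = G1[OF x01(1), of 1] G1[OF x01(1), of 0] G2[of 1, OF _ x01(2)] G2[of 0, OF _ x01(2)]
        have e: "G (x $ i) 1 = G 0 1 + (x $ i) *\<^sub>R (G 1 1 - G 0 1)" "G (x $ i) 0 = G 0 0 + (x $ i) *\<^sub>R (G 1 0 - G 0 0)"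
           "G 1 (x $ j) = G 1 0 + (x $ j) *\<^sub>R (G 1 1 - G 1 0)" "G 0 (x $ j) = G 0 0 + (x $ j) *\<^sub>R (G 0 1 - G 0 0)"
          by (rule e; simp)+
        show ?thesis
          unfolding Jcol[OF x] G e by (simp add: algebra_simps)
      qed
      then show ?thesis by blast
    qed
    have comp: "J x $ l $ i = (J x *v axis i 1) $ l" for x l i
      by (simp add: matrix_vector_mult_basis column_def)
    show ?thesis
    proof unfold_locales
      fix i :: 'n and e :: real assume e: "e \<in> {0, 1}"
      obtain j where "j \<noteq> i \<and> UNIV = {j, i}" using other[of i] by blast
      then have ij: "i \<noteq> j" "UNIV = {i, j}" by (blast, simp add: insert_commute)
      obtain A B m where ABm: "\<And>x. x \<in> cbox 0 1 \<Longrightarrow> J x *v axis j 1 = A + (x $ i) *\<^sub>R m"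
          "\<And>x. x \<in> cbox 0 1 \<Longrightarrow> J x *v axis i 1 = B + (x $ j) *\<^sub>R m"
        using cols[OF ij] by blast
      define t where "t = A + e *\<^sub>R m"
      \<comment> \<open>The edge tangent t rotated by a right angle: a . p is the determinant with
        columns p and t. So a is normal to the edge, and its product with the other column is the
        determinant of J at the projection of x to that edge, which is positive.\<close>
      define a :: "real ^ 'n" where "a = (\<chi> l. if l = i then t $ j else - t $ i)"
      have a: "a \<bullet> p = p $ i * t $ j - t $ i * p $ j" for p
        unfolding inner_vec_def ij(2) using ij(1) by (simp add: a_def)
      have "\<exists>d>0. a \<bullet> F x = a \<bullet> F (upd (upd 0 i e) j 0) + (x $ i - e) * d" if x: "x \<in> cbox 0 1" for x
      proof (intro exI conjI)
        let ?y = "upd x i e"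
        have e01: "e \<in> {0..1}" using e by auto
        have y: "?y \<in> cbox 0 1" using upd_cube[OF x e01] .
        have Jy: "J ?y *v axis j 1 = t" "J ?y *v axis i 1 = J x *v axis i 1"
          using ABm[OF y] ABm[OF x] ij(1) by (auto simp: t_def)
        have "det (J ?y) = J ?y $ i $ i * J ?y $ j $ j - J ?y $ i $ j * J ?y $ j $ i"
          by (rule det_two[OF ij(2,1)])
        then have d: "a \<bullet> (J x *v axis i 1) = det (J ?y)"
          unfolding a comp Jy by simp
        then show "a \<bullet> (J x *v axis i 1) > 0" using J(2)[OF y] by simp
        have "upd ?y j 0 = upd (upd 0 i e) j 0" using ij by (auto simp: vec_eq_iff)
        then have "F (upd (upd 0 i e) j 0) = F ?y + (0 - ?y $ j) *\<^sub>R t"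
          using line[OF y, of 0 j] Jy by simp
        moreover have "a \<bullet> t = 0" by (simp add: a)
        ultimately have "a \<bullet> F (upd (upd 0 i e) j 0) = a \<bullet> F ?y" by (simp add: inner_diff_right)
        also have "F ?y = F x + (e - x $ i) *\<^sub>R (J x *v axis i 1)" by (rule line[OF x e01])
        finally show "a \<bullet> F x = a \<bullet> F (upd (upd 0 i e) j 0) + (x $ i - e) * (a \<bullet> (J x *v axis i 1))"
          by (simp add: inner_add_right algebra_simps)
      qed
      then show "\<exists>a b. \<forall>x\<in>cbox 0 1. \<exists>d>0. a \<bullet> F x = b + (x $ i - e) * d" by blast
    next
      fix j :: 'n and z :: "real ^ 'n" assume z: "z \<in> cbox 0 1"
      obtain i where ij: "i \<noteq> j" "UNIV = {i, j}" using other[of j] by blast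
      obtain A B m where ABm: "\<And>x. x \<in> cbox 0 1 \<Longrightarrow> J x *v axis j 1 = A + (x $ i) *\<^sub>R m"
          "\<And>x. x \<in> cbox 0 1 \<Longrightarrow> J x *v axis i 1 = B + (x $ j) *\<^sub>R m"
        using cols[OF ij] by blast
      define t where "t = A + (z $ i) *\<^sub>R m"
      have t: "t $ l = A $ l + z $ i * m $ l" for l by (simp add: t_def)
      have Jz: "J z *v axis j 1 = t" using ABm(1)[OF z] by (simp add: t_def)
      have detJ: "det (J x) = (B $ i + x $ j * m $ i) * (A $ j + x $ i * m $ j) - (A $ i + x $ i * m $ i) * (B $ j + x $ j * m $ j)"
        if x: "x \<in> cbox 0 1" for x
        unfolding det_two[OF ij(2,1)] comp ABm[OF x] by simp
      \<comment> \<open>\<alpha> + \<beta> s is the determinant with columns B + s m and t, that is,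
        det J along the line. The other component compensates the difference (x_i - z_i) m between
        the column at x and the column t at z.\<close>
      define \<alpha> where "\<alpha> = B $ i * t $ j - t $ i * B $ j"
      define \<beta> where "\<beta> = m $ i * t $ j - t $ i * m $ j"
      show "\<exists>\<alpha> \<beta>. \<beta> * (real CARD('n) - 2) = 0 \<and>
        (\<forall>s\<in>{0..1}. \<alpha> + \<beta> * s = det (J (upd z j s))) \<and>
        (\<forall>x\<in>cbox 0 1. (\<Sum>i\<in>UNIV. (if i = j then \<alpha> + \<beta> * x $ j else - \<beta> * (x $ i - z $ i)) *\<^sub>R (J x *v axis i 1))
            = det (J x) *\<^sub>R (J z *v axis j 1))"
      proof (rule exI[of _ \<alpha>], rule exI[of _ \<beta>], intro conjI ballI)
        show "\<beta> * (real CARD('n) - 2) = 0" using True by simp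
        show "\<alpha> + \<beta> * s = det (J (upd z j s))" if "s \<in> {0..1}" for s
          unfolding detJ[OF upd_cube[OF z that]] using ij(1) by (simp add: \<alpha>_def \<beta>_def t algebra_simps)
        fix x :: "real ^ 'n" assume x: "x \<in> cbox 0 1"
        have sum: "(\<Sum>l\<in>UNIV. f l) = f i + f j" for f :: "'n \<Rightarrow> real ^ 'n" unfolding ij(2) using ij(1) by simp
        have "(- \<beta> * (x $ i - z $ i)) *\<^sub>R (B + (x $ j) *\<^sub>R m) + (\<alpha> + \<beta> * x $ j) *\<^sub>R (A + (x $ i) *\<^sub>R m) = det (J x) *\<^sub>R t"
        proof (subst vec_eq_iff, rule allI)
          fix l
          have "l = i \<or> l = j" using ij(2) by auto
          then show "((- \<beta> * (x $ i - z $ i)) *\<^sub>R (B + (x $ j) *\<^sub>R m) + (\<alpha> + \<beta> * x $ j) *\<^sub>R (A + (x $ i) *\<^sub>R m)) $ l = (det (J x) *\<^sub>R t) $ l"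
            unfolding detJ[OF x] \<alpha>_def \<beta>_def by (auto simp: t algebra_simps)
        qed
        then show "(\<Sum>i\<in>UNIV. (if i = j then \<alpha> + \<beta> * x $ j else - \<beta> * (x $ i - z $ i)) *\<^sub>R (J x *v axis i 1)) = det (J x) *\<^sub>R (J z *v axis j 1)"
          unfolding sum Jz using ij(1) by (simp add: ABm[OF x])
      qed
    next
      fix y z :: "real ^ 'n"
      assume y: "y \<in> cbox 0 1" and z: "z \<in> cbox 0 1" and yz: "\<And>i. y $ i \<in> {0, 1} \<Longrightarrow> z $ i = y $ i" and ex: "\<exists>i. y $ i \<in> {0, 1}"
      obtain i where i: "y $ i \<in> {0, 1}" using ex by blast
      obtain j where "j \<noteq> i \<and> UNIV = {j, i}" using other[of i] by blast
      then have ij: "i \<noteq> j" "UNIV = {i, j}" by (blast, simp add: insert_commute)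
      have "z = upd y j (z $ j)" unfolding vec_eq_iff
      proof
        fix l
        have "l = i \<or> l = j" using ij(2) by auto
        then show "z $ l = upd y j (z $ j) $ l" using yz[OF i] ij(1) by auto
      qed
      then have eq: "z - y = (z $ j - y $ j) *\<^sub>R axis j 1" "F z = F (upd y j (z $ j))"
        by (metis add_diff_cancel_left' upd_eq_add, metis)
      have "z $ j \<in> {0..1}" using z by (simp add: mem_box_cart)
      then show "F z = F y + J y *v (z - y)"
        unfolding eq(2) using line[OF y, of "z $ j" j] by (simp add: eq(1) matrix_vector_mult_scaleR)
    qed (use bij \<open>polytope K\<close> int J J4 J5 pos \<open>?h > 0\<close> Q1 line in \<open>auto simp: abs_of_pos\<close>)
  next
    case False
    have "\<exists>g l. Qfun 1 g \<and> (\<forall>x\<in>cbox 0 1. F x $ i = g x) \<and> (\<forall>y z. g z = g y + l \<bullet> (z - y))" for i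
      using False poly by (intro P_poly_1_affine) (simp add: componentwise_def)
    then have "\<exists>l. \<forall>y\<in>cbox 0 1. \<forall>z\<in>cbox 0 1. F z $ i = F y $ i + l \<bullet> (z - y)" for i by metis
    then obtain L where L: "\<And>i y z. y \<in> cbox 0 1 \<Longrightarrow> z \<in> cbox 0 1 \<Longrightarrow> F z $ i = F y $ i + L i \<bullet> (z - y)" by metis
    define M :: "real ^ 'n ^ 'n" where "M = (\<chi> i. L i)"
    have FM: "F z = F y + M *v (z - y)" if "y \<in> cbox 0 1" "z \<in> cbox 0 1" for y z
      using L[OF that] by (simp add: vec_eq_iff M_def matrix_vector_mult_def inner_vec_def)
    have col: "J x *v axis i 1 = M *v axis i 1" if x: "x \<in> cbox 0 1" for x i
    proof -
      have "upd x i 1 - upd x i 0 = axis i 1" by (auto simp: vec_eq_iff axis_def)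
      then show ?thesis
        unfolding Jcol[OF x] using FM[OF upd_cube[OF x, of 0 i] upd_cube[OF x, of 1 i]] by simp
    qed
    have JM: "J x = M" if "x \<in> cbox 0 1" for x
      using col[OF that] by (simp add: vec_eq_iff matrix_vector_mult_basis column_def)
    have "det M > 0" using J(2)[OF zero] JM[OF zero] by simp
    then have inv: "invertible M" by (simp add: invertible_det_nz)
    show ?thesis
    proof unfold_locales
      fix i :: 'n and e :: real assume e: "e \<in> {0, 1}"
      \<comment> \<open>The i-th row of the inverse reads off the i-th reference coordinate and is
        therefore normal to both faces on which that coordinate is constant; the factor d is
        1.\<close>
      let ?a = "matrix_inv M $ i"
      have a: "?a \<bullet> (M *v \<xi>) = \<xi> $ i" for \<xi>
      proof -
        have "?a \<bullet> (M *v \<xi>) = (matrix_inv M *v (M *v \<xi>)) $ i"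
          by (simp add: matrix_vector_mult_def inner_vec_def)
        also have "\<dots> = \<xi> $ i" using inv by (simp add: matrix_vector_mul_assoc matrix_inv_left)
        finally show ?thesis .
      qed
      have "?a \<bullet> F x = (?a \<bullet> F 0 + e) + (x $ i - e) * 1" if "x \<in> cbox 0 1" for x
        using FM[OF zero that] a[of "x - 0"] by (simp add: inner_add_right)
      then show "\<exists>a b. \<forall>x\<in>cbox 0 1. \<exists>d>0. a \<bullet> F x = b + (x $ i - e) * d"
        by (meson zero_less_one)
    next
      fix j :: 'n and z :: "real ^ 'n" assume z: "z \<in> cbox 0 1"
      show "\<exists>\<alpha> \<beta>. \<beta> * (real CARD('n) - 2) = 0 \<and>
        (\<forall>s\<in>{0..1}. \<alpha> + \<beta> * s = det (J (upd z j s))) \<and>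
        (\<forall>x\<in>cbox 0 1. (\<Sum>i\<in>UNIV. (if i = j then \<alpha> + \<beta> * x $ j else - \<beta> * (x $ i - z $ i)) *\<^sub>R (J x *v axis i 1))
            = det (J x) *\<^sub>R (J z *v axis j 1))"
      proof (rule exI[of _ "det M"], rule exI[of _ 0], intro conjI ballI)
        show "det M + 0 * s = det (J (upd z j s))" if "s \<in> {0..1}" for s
          using JM[OF upd_cube[OF z that]] by simp
        fix x :: "real ^ 'n" assume x: "x \<in> cbox 0 1"
        have "(\<Sum>i\<in>UNIV. (if i = j then det M + 0 * x $ j else - 0 * (x $ i - z $ i)) *\<^sub>R (J x *v axis i 1))
           = (\<Sum>i\<in>UNIV. if i = j then det M *\<^sub>R (M *v axis j 1) else 0)"
          by (intro sum.cong) (auto simp: JM[OF x])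
        then show "(\<Sum>i\<in>UNIV. (if i = j then det M + 0 * x $ j else - 0 * (x $ i - z $ i)) *\<^sub>R (J x *v axis i 1)) = det (J x) *\<^sub>R (J z *v axis j 1)"
          by (simp add: JM[OF x] JM[OF z])
      qed simp
    next
      fix y z :: "real ^ 'n"
      assume yz: "y \<in> cbox 0 1" "z \<in> cbox 0 1"
      show "F z = F y + J y *v (z - y)" unfolding JM[OF yz(1)] by (rule FM[OF yz])
    qed (use bij \<open>polytope K\<close> int J J4 J5 pos \<open>?h > 0\<close> Q1 line in \<open>auto simp: abs_of_pos\<close>)
  qed
  then show ?thesis using that contJ by blast
qed

section \<open>The faces of a cell in terms of reference coordinates\<close>

context cell
begin

lemma K: "convex K" "compact K"
  using poly polytope_imp_convex polytope_imp_compact by auto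

abbreviation "Cub \<equiv> cbox (0 :: real ^ 'n) 1"

lemma inj: "inj_on F Cub" and img: "F ` Cub = K"
  using bij by (auto simp: bij_betw_def)

lemma K_obtain: "p \<in> K \<Longrightarrow> \<exists>x. x \<in> Cub \<and> p = F x"
  using img by auto

lemma F_eq_iff: "x \<in> Cub \<Longrightarrow> y \<in> Cub \<Longrightarrow> F x = F y \<longleftrightarrow> x = y"
  using inj by (auto dest: inj_onD)

lemma F_in [simp]: "x \<in> Cub \<Longrightarrow> F x \<in> K"
  using img by blast

lemma F_cont: "continuous_on Cub F"
  using der has_derivative_continuous by (fastforce simp: continuous_on_eq_continuous_within)

lemma J_inj: "x \<in> Cub \<Longrightarrow> J x *v \<xi> = 0 \<Longrightarrow> \<xi> = 0"
  using J_ge[of x \<xi>] cpos h(2) by (simp add: mult_le_0_iff)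

lemma J_invertible: "x \<in> Cub \<Longrightarrow> invertible (J x)"
  using det_pos[of x] by (simp add: invertible_det_nz)

lemma tangent_nz: "x \<in> Cub \<Longrightarrow> J x *v axis i 1 \<noteq> 0"
  using J_inj[of x "axis i 1"] by (auto simp: axis_eq_0_iff)

lemma tangent_norm: 
  assumes "x \<in> Cub"
  shows "c3 * h\<^sup>2 \<le> (norm (J x *v axis i 1))\<^sup>2" "(norm (J x *v axis i 1))\<^sup>2 \<le> c4 * h\<^sup>2"
  using J_ge[OF assms, of "axis i 1"] J_le[OF assms, of "axis i 1"] by simp_all

lemma coords: "x \<in> Cub \<Longrightarrow> x $ i \<in> {0..1}"
  by (simp add: mem_box_cart)

text \<open>The hyperplane from \<open>facet\<close> has \<open>F x\<close> on the side given by the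
  sign of x $ i - e, so it supports \<open>K\<close> and touches it exactly along this
  image.\<close>

lemma facet_face:
  assumes e: "e \<in> {0, 1}"
  shows "F ` {x \<in> Cub. x $ i = e} face_of K"
proof -
  obtain a b where ab: "\<forall>x\<in>Cub. \<exists>d>0. a \<bullet> F x = b + (x $ i - e) * d" using facet[OF e, of i] by blast
  have eq: "F ` {x \<in> Cub. x $ i = e} = K \<inter> {p. a \<bullet> p = b}"
  proof (intro set_eqI iffI)
    fix p assume "p \<in> F ` {x \<in> Cub. x $ i = e}"
    then show "p \<in> K \<inter> {p. a \<bullet> p = b}" using ab by force
  next
    fix p assume p: "p \<in> K \<inter> {p. a \<bullet> p = b}"
    then obtain x where x: "x \<in> Cub" "p = F x" using K_obtain by blast
    then obtain d where "d > 0" "a \<bullet> F x = b + (x $ i - e) * d" using ab by blast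
    then have "x $ i = e" using p x(2) by simp
    then show "p \<in> F ` {x \<in> Cub. x $ i = e}" using x by blast
  qed
  show ?thesis
  proof (cases "e = 0")
    case True
    have "a \<bullet> p \<ge> b" if "p \<in> K" for p
    proof -
      obtain x where x: "x \<in> Cub" "p = F x" using K_obtain[OF \<open>p \<in> K\<close>] by blast
      then obtain d where "d > 0" "a \<bullet> F x = b + (x $ i - e) * d" using ab by blast
      then show ?thesis using coords[OF x(1), of i] x(2) True by simp
    qed
    then show ?thesis unfolding eq by (rule face_of_Int_supporting_hyperplane_ge[OF K(1)])
  next
    case False
    then have e1: "e = 1" using e by simp
    have "a \<bullet> p \<le> b" if "p \<in> K" for p
    proof -
      obtain x where x: "x \<in> Cub" "p = F x" using K_obtain[OF \<open>p \<in> K\<close>] by blast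
      then obtain d where "d > 0" "a \<bullet> F x = b + (x $ i - e) * d" using ab by blast
      then show ?thesis using coords[OF x(1), of i] x(2) e1 by (simp add: mult_le_0_iff)
    qed
    then show ?thesis unfolding eq by (rule face_of_Int_supporting_hyperplane_le[OF K(1)])
  qed
qed

text \<open>The smallest face of the cube containing \<open>y\<close>; for \<open>y\<close> in the
  cube, \<open>F\<close> maps it onto the smallest face of \<open>K\<close> containing
  \<open>F y\<close>.\<close>

definition carrier :: "real ^ 'n \<Rightarrow> (real ^ 'n) set" where
  "carrier y = {z \<in> Cub. \<forall>i. y $ i \<in> {0, 1} \<longrightarrow> z $ i = y $ i}"

lemma carrier_face: "y \<in> Cub \<Longrightarrow> F ` carrier y face_of K"
proof -
  assume y: "y \<in> Cub"
  have "F ` {z \<in> Cub. \<forall>i\<in>I. z $ i = y $ i} face_of K" if "finite I" "\<forall>i\<in>I. y $ i \<in> {0, 1}" for I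
    using that
  proof (induction I)
    case empty
    then show ?case using face_of_refl[OF K(1)] by (simp add: img)
  next
    case (insert i I)
    have "{z \<in> Cub. \<forall>l\<in>insert i I. z $ l = y $ l} = {z \<in> Cub. z $ i = y $ i} \<inter> {z \<in> Cub. \<forall>l\<in>I. z $ l = y $ l}"
      by auto
    moreover have "F ` ({z \<in> Cub. z $ i = y $ i} \<inter> {z \<in> Cub. \<forall>l\<in>I. z $ l = y $ l})
        = F ` {z \<in> Cub. z $ i = y $ i} \<inter> F ` {z \<in> Cub. \<forall>l\<in>I. z $ l = y $ l}"
      by (rule inj_on_image_Int[OF inj]) auto
    ultimately show ?case
      using insert facet_face[of "y $ i" i] face_of_Int by auto
  qed
  from this[of "{i. y $ i \<in> {0, 1}}"] show ?thesis by (simp add: carrier_def)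
qed

text \<open>The coordinates of y are exchanged for those of z one at a time. A free coordinate has
  an open segment of the image through the current point, so by the defining property a face
  contains both ends of that segment and, being convex, all of it.\<close>

lemma move:
  assumes G: "G face_of K" and y: "y \<in> Cub" "F y \<in> G" and z: "z \<in> carrier y"
  shows "F z \<in> G"
proof -
  define w where "w A = (\<chi> l. if l \<in> A then z $ l else y $ l)" for A
  have z01: "z \<in> Cub" "\<And>i. y $ i \<in> {0, 1} \<Longrightarrow> z $ i = y $ i" using z by (auto simp: carrier_def)
  have wC: "w A \<in> Cub" for A using z01(1) y(1) by (auto simp: w_def mem_box_cart)
  have "F (w A) \<in> G" if "finite A" for A
    using that
  proof (induction A)
    case empty
    have "w {} = y" by (simp add: w_def vec_eq_iff)
    then show ?case using y(2) by simp
  next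
    case (insert i A)
    let ?x = "w A"
    have xi: "?x $ i = y $ i" using insert.hyps by (simp add: w_def)
    have up: "w (insert i A) = upd ?x i (z $ i)" by (auto simp: w_def vec_eq_iff)
    show ?case
    proof (cases "y $ i \<in> {0, 1}")
      case True
      then have "w (insert i A) = w A" unfolding up z01(2)[OF True] xi[symmetric] by simp
      then show ?thesis using insert.IH by simp
    next
      case False
      then have s: "0 < ?x $ i" "?x $ i < 1" using coords[OF y(1), of i] xi by auto
      let ?a = "F (upd ?x i 0)" and ?b = "F (upd ?x i 1)" and ?t = "J ?x *v axis i 1"
      have ab: "?a = F ?x + (0 - ?x $ i) *\<^sub>R ?t" "?b = F ?x + (1 - ?x $ i) *\<^sub>R ?t"
        using line[OF wC, of 0 A i] line[OF wC, of 1 A i] by auto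
      have ba: "?b - ?a = ?t" unfolding ab by (simp add: algebra_simps)
      have "?a \<noteq> ?b" using ba tangent_nz[OF wC, of A i] by auto
      moreover have "F ?x = (1 - ?x $ i) *\<^sub>R ?a + (?x $ i) *\<^sub>R ?b" unfolding ab by (simp add: algebra_simps)
      ultimately have "F ?x \<in> open_segment ?a ?b" using s unfolding in_segment by blast
      moreover have abK: "?a \<in> K" "?b \<in> K" using upd_cube[OF wC] by auto
      ultimately have abG: "?a \<in> G" "?b \<in> G" using face_ofD[OF G] insert.IH by blast+
      have zi: "z $ i \<in> {0..1}" using coords[OF z01(1)] .
      have "F (upd ?x i (z $ i)) = (1 - z $ i) *\<^sub>R ?a + (z $ i) *\<^sub>R ?b"
        using line[OF wC zi, of A i] unfolding ab by (simp add: algebra_simps)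
      also have "\<dots> \<in> G"
        using zi by (intro convexD[OF face_of_imp_convex[OF G] abG]) auto
      finally show ?thesis unfolding up .
    qed
  qed
  from this[of UNIV] have "F (w UNIV) \<in> G" by simp
  moreover have "w UNIV = z" by (simp add: w_def vec_eq_iff)
  ultimately show ?thesis by simp
qed

lemma carrier_self: "y \<in> Cub \<Longrightarrow> y \<in> carrier y"
  by (simp add: carrier_def)

text \<open>A free coordinate could be moved to 0 without leaving the one-point face, against
  injectivity of \<open>F\<close>.\<close>

lemma extreme_corner:
  assumes "y \<in> Cub" "{F y} face_of K"
  shows "y $ i \<in> {0, 1}"
proof (rule ccontr)
  assume ni: "y $ i \<notin> {0, 1}"
  then have "upd y i 0 \<in> carrier y" using upd_cube[OF assms(1), of 0 i] by (auto simp: carrier_def)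
  from move[OF assms(2,1) _ this] have "F (upd y i 0) = F y" by simp
  then have "upd y i 0 = y" using F_eq_iff upd_cube[OF assms(1), of 0 i] assms(1) by auto
  then have "y $ i = 0" by (metis upd_nth)
  then show False using ni by simp
qed

lemma corner_face:
  assumes "y \<in> Cub" "\<And>i. y $ i \<in> {0, 1}"
  shows "{F y} face_of K"
proof -
  have "carrier y = {y}" using assms by (auto simp: carrier_def vec_eq_iff)
  then show ?thesis using carrier_face[OF assms(1)] by simp
qed

lemma interior_box:
  assumes "x \<in> Cub" "F x \<in> interior K"
  shows "x \<in> box 0 1"
proof -
  have "x $ i \<notin> {0, 1}" for i
  proof
    assume e: "x $ i \<in> {0, 1}"
    let ?G = "F ` {y \<in> Cub. y $ i = x $ i}"
    have "upd x i (1 - x $ i) \<in> Cub" using e by (intro upd_cube[OF assms(1)]) auto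
    moreover have "upd x i (1 - x $ i) \<notin> {y \<in> Cub. y $ i = x $ i}" using e by auto
    ultimately have "F (upd x i (1 - x $ i)) \<notin> ?G" "F (upd x i (1 - x $ i)) \<in> K"
      using F_eq_iff by auto
    then have "?G \<noteq> K" by blast
    then have "?G \<inter> interior K = {}" using face_of_disjoint_interior[OF facet_face[OF e]] by blast
    then show False using assms by blast
  qed
  then show ?thesis using coords[OF assms(1)] by (auto simp: mem_box_cart order_less_le)
qed

text \<open>A boundary point of \<open>K\<close> lies on a proper face, but the carrier of a point
  of the open cube is the whole cube, so by \<open>move\<close> that face would be all of
  \<open>K\<close>.\<close>

lemma box_interior:
  assumes "x \<in> box 0 1"
  shows "F x \<in> interior K"
proof (rule ccontr)
  assume ni: "F x \<notin> interior K"
  have xC: "x \<in> Cub" using assms box_subset_cbox by blast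
  have "rel_interior K = interior K" by (rule rel_interior_nonempty_interior[OF int])
  moreover have "F x \<in> closure K" using xC closure_subset[of K] by auto
  ultimately have "F x \<in> rel_frontier K" using ni by (simp add: rel_frontier_def)
  then obtain G where G: "G face_of K" "G \<noteq> K" "F x \<in> G"
    using rel_frontier_of_polyhedron_alt[OF polytope_imp_polyhedron[OF poly]] by blast
  have "x $ i \<notin> {0, 1}" for i using assms by (auto simp: mem_box_cart dest: spec[of _ i])
  then have "carrier x = Cub" by (auto simp: carrier_def)
  then have "K \<subseteq> G" using move[OF G(1) xC G(3)] img by blast
  then show False using G face_of_imp_subset by blast
qed

end

text \<open>The smallest face of \<open>K\<close> at the common point lies in K \<inter> K', hence
  is a face of K \<inter> K' and so of \<open>K'\<close>; therefore it contains the smallest face of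
  \<open>K'\<close> at that point. By symmetry the two images coincide.\<close>

lemma carrier_image_eq:
  assumes c: "cell K F J h c1 c3 c4" "cell K' F' J' h' c1' c3' c4'"
    and fc: "(K \<inter> K') face_of K" "(K \<inter> K') face_of K'"
    and y: "y \<in> cbox 0 1" "y' \<in> cbox 0 1" "F y = F' y'"
  shows "F' ` cell.carrier y' \<subseteq> F ` cell.carrier y"
proof -
  interpret c: cell K F J h c1 c3 c4 by (rule c(1))
  interpret d: cell K' F' J' h' c1' c3' c4' by (rule c(2))
  have Fy: "F y \<in> K \<inter> K'" using y by (metis IntI c.F_in d.F_in)
  have sub: "F ` c.carrier y \<subseteq> K \<inter> K'" using c.move[OF fc(1) y(1) Fy] by blast
  have "F ` c.carrier y face_of (K \<inter> K')"
    by (rule face_of_subset[OF c.carrier_face[OF y(1)] sub]) auto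
  then have "F ` c.carrier y face_of K'" using fc(2) by (rule face_of_trans)
  moreover have "F' y' \<in> F ` c.carrier y" using c.carrier_self[OF y(1)] y(3) by (metis imageI)
  ultimately show ?thesis using d.move[OF _ y(2)] by blast
qed

text \<open>Otherwise \<open>move\<close> puts all of \<open>K\<close> into \<open>K'\<close>. Then
  \<open>K\<close> would be a proper face of \<open>K'\<close>, disjoint from the interior of
  \<open>K'\<close>, and yet have interior points itself.\<close>

lemma carrier_proper:
  assumes c: "cell K F J h c1 c3 c4" "cell K' F' J' h' c1' c3' c4'"
    and fc: "(K \<inter> K') face_of K" "(K \<inter> K') face_of K'" "K \<noteq> K'"
    and y: "y \<in> cbox 0 1" "y' \<in> cbox 0 1" "F y = F' y'"
  shows "\<exists>i. y $ i \<in> {0, 1}"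
proof (rule ccontr)
  interpret c: cell K F J h c1 c3 c4 by (rule c(1))
  interpret d: cell K' F' J' h' c1' c3' c4' by (rule c(2))
  assume "\<not> ?thesis"
  then have all: "c.carrier y = cbox 0 1" by (auto simp: c.carrier_def)
  have Fy: "F y \<in> K \<inter> K'" using y by (metis IntI c.F_in d.F_in)
  have "K \<subseteq> K'"
  proof
    fix p assume "p \<in> K"
    then obtain x where x: "x \<in> cbox 0 1" "p = F x" using c.K_obtain by blast
    then show "p \<in> K'" using c.move[OF fc(1) y(1) Fy, of x] all by simp
  qed
  then have sub: "interior K \<subseteq> interior K'" and "K \<inter> K' = K" using interior_mono by auto
  then have "K \<inter> interior K' = {}" using face_of_disjoint_interior[of K K'] fc(2,3) by simp
  then show False using sub c.int interior_subset[of K] by blast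
qed

text \<open>The transition between the two parametrisations of a common face is affine and maps
  corners of the cube to corners. Such a map can only permute the free coordinates and reflect some
  of them; \<tau> is the permutation and S the set of reflected coordinates.\<close>

lemma cells_matching:
  fixes K K' :: "(real ^ 'n::finite) set"
  assumes c: "cell K F J h c1 c3 c4" "cell K' F' J' h' c1' c3' c4'"
    and fc: "(K \<inter> K') face_of K" "(K \<inter> K') face_of K'" "K \<noteq> K'"
    and y: "y \<in> cbox 0 1" "y' \<in> cbox 0 1" "F y = F' y'"
  shows "\<exists>T \<tau> S. bij_betw \<tau> {i. y' $ i \<notin> {0, 1}} {i. y $ i \<notin> {0, 1}} \<and>
     (\<forall>z\<in>cell.carrier y. T z \<in> cell.carrier y' \<and> F' (T z) = F z \<and>
        (\<forall>i. y' $ i \<notin> {0, 1} \<longrightarrow> T z $ i = (if i \<in> S then 1 - z $ \<tau> i else z $ \<tau> i))) \<and>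
     (\<forall>w\<in>cell.carrier y'. \<exists>z\<in>cell.carrier y. T z = w)"
proof -
  interpret c: cell K F J h c1 c3 c4 by (rule c(1))
  interpret d: cell K' F' J' h' c1' c3' c4' by (rule c(2))
  have fc': "(K' \<inter> K) face_of K'" "(K' \<inter> K) face_of K" using fc by (simp_all add: Int_commute)
  note proper = carrier_proper
  define A where "A = {i. y $ i \<notin> {0, 1}}"
  define A' where "A' = {i. y' $ i \<notin> {0, 1}}"
  let ?C = "c.carrier y" and ?C' = "d.carrier y'"
  have eqC: "F ` ?C = F' ` ?C'"
    using carrier_image_eq[OF c fc(1,2) y] carrier_image_eq[OF c(2,1) fc' y(2,1) y(3)[symmetric]] by blast
  \<comment> \<open>On a proper face both element maps are affine, so equating them and inverting
    the Jacobian of the second one determines the transition.\<close>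
  define B where "B = matrix_inv (J' y') ** J y"
  define T where "T z = y' + B *v (z - y)" for z
  have aff: "F z = F y + J y *v (z - y)" if "z \<in> ?C" for z
    using that proper[OF c fc y] y(1) by (intro c.affine_on_faces) (auto simp: c.carrier_def)
  have aff': "F' w = F' y' + J' y' *v (w - y')" if "w \<in> ?C'" for w
    using that proper[OF c(2,1) fc' fc(3)[symmetric] y(2,1) y(3)[symmetric]] y(2)
    by (intro d.affine_on_faces) (auto simp: d.carrier_def)
  have T_eq: "T z = w" if "z \<in> ?C" "w \<in> ?C'" "F' w = F z" for z w
  proof -
    have "J' y' *v (w - y') = J y *v (z - y)" using aff[OF that(1)] aff'[OF that(2)] that(3) y(3) by simp
    then have "matrix_inv (J' y') *v (J' y' *v (w - y')) = matrix_inv (J' y') *v (J y *v (z - y))" by simp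
    then have "w - y' = B *v (z - y)"
      using d.J_invertible[OF y(2)] by (simp add: matrix_vector_mul_assoc matrix_inv_left B_def)
    then show ?thesis unfolding T_def by (metis add.commute diff_add_cancel)
  qed
  have T: "T z \<in> ?C'" "F' (T z) = F z" if z: "z \<in> ?C" for z
  proof -
    obtain w where w: "w \<in> ?C'" "F' w = F z" using eqC z by (metis imageE imageI)
    with T_eq[OF z w] show "T z \<in> ?C'" "F' (T z) = F z" by auto
  qed
  have onto: "\<exists>z\<in>?C. T z = w" if w: "w \<in> ?C'" for w
  proof -
    obtain z where z: "z \<in> ?C" "F z = F' w" using eqC w by (metis imageE imageI)
    then show ?thesis using T_eq[OF z(1) w] by auto
  qed
  have inC: "z \<in> cbox 0 1" if "z \<in> ?C" for z using that by (simp add: c.carrier_def)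
  have inC': "z \<in> cbox 0 1" if "z \<in> ?C'" for z using that by (simp add: d.carrier_def)
  have T_inj: "z = w" if "z \<in> ?C" "w \<in> ?C" "T z = T w" for z w
    using T(2)[OF that(1)] T(2)[OF that(2)] that(3) c.F_eq_iff[OF inC[OF that(1)] inC[OF that(2)]] by simp
  have corner: "T z $ i \<in> {0, 1}" if z: "z \<in> ?C" "\<And>l. z $ l \<in> {0, 1}" for z i
  proof -
    have "{F z} face_of K" using c.corner_face[OF inC[OF z(1)] z(2)] .
    moreover have Fz: "F z \<in> K" "F z \<in> K'"
      using c.F_in[OF inC[OF z(1)]] d.F_in[OF inC'[OF T(1)[OF z(1)]]] by (simp_all add: T(2)[OF z(1)])
    ultimately have "{F z} face_of (K \<inter> K')" by (auto intro!: face_of_subset[of "{F z}" K "K \<inter> K'"])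
    then have "{F' (T z)} face_of K'" unfolding T(2)[OF z(1)] using fc(2) by (rule face_of_trans)
    then show ?thesis by (rule d.extreme_corner[OF inC'[OF T(1)[OF z(1)]]])
  qed
  have updC: "upd z i s \<in> ?C" if "z \<in> ?C" "i \<in> A" "s \<in> {0..1}" for z i s
    using that upd_cube[OF inC[OF that(1)] that(3), of i] by (auto simp: c.carrier_def A_def)
  have updC': "upd z i s \<in> ?C'" if "z \<in> ?C'" "i \<in> A'" "s \<in> {0..1}" for z i s
    using that upd_cube[OF inC'[OF that(1)] that(3), of i] by (auto simp: d.carrier_def A'_def)
  have T_upd: "T (upd z i s) $ l = T z $ l + (s - z $ i) * B $ l $ i" for z i s l
  proof -
    have e: "upd z i s - y = (z - y) + (s - z $ i) *\<^sub>R axis i 1" by (simp add: upd_eq_add)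
    have "B *v (upd z i s - y) = B *v (z - y) + (s - z $ i) *\<^sub>R (B *v axis i 1)"
      unfolding e matrix_vector_right_distrib matrix_vector_mult_scaleR ..
    then show ?thesis by (simp add: T_def matrix_vector_mult_basis column_def)
  qed
  define z0 where "z0 = (\<chi> i. if i \<in> A then 0 else y $ i)"
  have z0C: "z0 \<in> ?C" using y(1) by (auto simp: z0_def c.carrier_def A_def mem_box_cart)
  have z0c: "z0 $ i \<in> {0, 1}" for i by (auto simp: z0_def A_def)
  have z0A: "z0 $ i = 0" if "i \<in> A" for i using that by (simp add: z0_def)
  \<comment> \<open>A coordinate of the transition lies in {0, 1} at the base corner, after one unit
    step and after two. Two nonzero increments in one row would both be 1 or both be -1, and
    together they would leave {0, 1}.\<close>
  have g0: "T z0 $ i' \<in> {0, 1}" for i' using corner[OF z0C z0c] .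
  have g1: "T z0 $ i' + B $ i' $ i \<in> {0, 1}" if "i \<in> A" for i i'
    using corner[OF updC[OF z0C that, of 1], of i'] z0c z0A[OF that] by (auto simp: T_upd)
  have g2: "T z0 $ i' + B $ i' $ i + B $ i' $ l \<in> {0, 1}" if "i \<in> A" "l \<in> A" "i \<noteq> l" for i i' l
    using corner[OF updC[OF updC[OF z0C that(1), of 1] that(2), of 1], of i'] z0c z0A that by (auto simp: T_upd)
  have unique: "i = l" if "i \<in> A" "l \<in> A" "B $ i' $ i \<noteq> 0" "B $ i' $ l \<noteq> 0" for i l i'
  proof (rule ccontr)
    assume "i \<noteq> l"
    then show False using g0[of i'] g1[OF that(1), of i'] g1[OF that(2), of i'] g2[OF that(1,2), of i'] that(3,4) by auto
  qed
  have Tsum: "T z $ i' = T z0 $ i' + (\<Sum>i\<in>A. B $ i' $ i * z $ i)" if z: "z \<in> ?C" for z i'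
  proof -
    have "T z - T z0 = B *v (z - z0)"
      by (simp add: T_def flip: matrix_vector_mult_diff_distrib)
    then have "T z $ i' - T z0 $ i' = (B *v (z - z0)) $ i'" by (metis vector_minus_component)
    also have "\<dots> = (\<Sum>i\<in>UNIV. B $ i' $ i * (z - z0) $ i)" by (simp add: matrix_vector_mult_def)
    also have "\<dots> = (\<Sum>i\<in>A. B $ i' $ i * (z - z0) $ i)"
      using z by (intro sum.mono_neutral_right) (auto simp: z0_def c.carrier_def A_def)
    also have "\<dots> = (\<Sum>i\<in>A. B $ i' $ i * z $ i)" by (intro sum.cong) (auto simp: z0_def)
    finally show ?thesis by simp
  qed
  have ex: "\<exists>i\<in>A. B $ i' $ i \<noteq> 0" if i': "i' \<in> A'" for i'
  proof (rule ccontr)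
    assume "\<not> ?thesis"
    then have const: "T z $ i' = T z0 $ i'" if "z \<in> ?C" for z using Tsum[OF that, of i'] by simp
    obtain u where u: "u \<in> ?C" "T u = upd y' i' 0" using onto updC'[OF d.carrier_self[OF y(2)] i', of 0] by auto
    obtain w where w: "w \<in> ?C" "T w = upd y' i' 1" using onto updC'[OF d.carrier_self[OF y(2)] i', of 1] by auto
    have "T u $ i' = 0" "T w $ i' = 1" using u(2) w(2) by auto
    then show False using const[OF u(1)] const[OF w(1)] by simp
  qed
  define \<tau> where "\<tau> i' = (SOME i. i \<in> A \<and> B $ i' $ i \<noteq> 0)" for i'
  have \<tau>: "\<tau> i' \<in> A" "B $ i' $ \<tau> i' \<noteq> 0" if "i' \<in> A'" for i'
  proof -
    have "\<exists>i. i \<in> A \<and> B $ i' $ i \<noteq> 0" using ex[OF that] by blast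
    from someI_ex[OF this] show "\<tau> i' \<in> A" "B $ i' $ \<tau> i' \<noteq> 0" unfolding \<tau>_def by auto
  qed
  define S where "S = {i'. T z0 $ i' = 1}"
  have form: "T z $ i' = (if i' \<in> S then 1 - z $ \<tau> i' else z $ \<tau> i')" if z: "z \<in> ?C" and i': "i' \<in> A'" for z i'
  proof -
    have "(\<Sum>i\<in>A. B $ i' $ i * z $ i) = (\<Sum>i\<in>A. if i = \<tau> i' then B $ i' $ \<tau> i' * z $ \<tau> i' else 0)"
      using unique \<tau>[OF i'] by (intro sum.cong) auto
    also have "\<dots> = B $ i' $ \<tau> i' * z $ \<tau> i'" using \<tau>(1)[OF i'] by simp
    finally have "T z $ i' = T z0 $ i' + B $ i' $ \<tau> i' * z $ \<tau> i'" using Tsum[OF z] by simp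
    moreover have "B $ i' $ \<tau> i' = (if i' \<in> S then - 1 else 1)" "T z0 $ i' = (if i' \<in> S then 1 else 0)"
      using g0[of i'] g1[OF \<tau>(1)[OF i'], of i'] \<tau>(2)[OF i'] by (auto simp: S_def)
    ultimately show ?thesis by simp
  qed
  have bij: "bij_betw \<tau> A' A"
  proof (rule bij_betwI')
    fix i l assume il: "i \<in> A'" "l \<in> A'"
    show "\<tau> i = \<tau> l \<longleftrightarrow> i = l"
    proof
      assume eq: "\<tau> i = \<tau> l"
      show "i = l"
      proof (rule ccontr)
        assume ne: "i \<noteq> l"
        have "upd (upd y' i (1 / 2)) l 0 \<in> ?C'"
          using updC'[OF updC'[OF d.carrier_self[OF y(2)] il(1), of "1 / 2"] il(2), of 0] by simp
        then obtain z where z: "z \<in> ?C" "T z = upd (upd y' i (1 / 2)) l 0" using onto by blast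
        have "T z $ i = 1 / 2" "T z $ l = 0" using z(2) ne by auto
        then show False using form[OF z(1) il(1)] form[OF z(1) il(2)] eq by (auto split: if_splits)
      qed
    qed simp
  next
    show "\<tau> i \<in> A" if "i \<in> A'" for i using \<tau>(1)[OF that] .
    fix i assume i: "i \<in> A"
    show "\<exists>i'\<in>A'. i = \<tau> i'"
    proof (rule ccontr)
      assume no: "\<not> ?thesis"
      let ?u = "upd y i 0" and ?w = "upd y i 1"
      have uw: "?u \<in> ?C" "?w \<in> ?C" using updC[OF c.carrier_self[OF y(1)] i] by auto
      have "T ?u $ l = T ?w $ l" for l
      proof (cases "l \<in> A'")
        case True
        then have "\<tau> l \<noteq> i" using no by auto
        then show ?thesis using form[OF uw(1) True] form[OF uw(2) True] by simp
      next
        case False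
        then show ?thesis using T(1)[OF uw(1)] T(1)[OF uw(2)] by (auto simp: d.carrier_def A'_def)
      qed
      then have "?u = ?w" using T_inj[OF uw] by (simp add: vec_eq_iff)
      then have "?u $ i = ?w $ i" by simp
      then show False by simp
    qed
  qed
  show ?thesis
    using bij T form onto unfolding A_def A'_def
    by (intro exI[of _ T] exI[of _ \<tau>] exI[of _ S] conjI ballI) auto
qed

section \<open>Energies on the lines of the Lobatto grid\<close>

locale lobatto =
  fixes k :: nat and N :: "real set" and w :: "real \<Rightarrow> real"
  assumes k: "k \<ge> 2" and N: "finite N" "card N = Suc k" "N \<subseteq> {0..1}" "0 \<in> N" "1 \<in> N"
    and reflect: "\<And>u. u \<in> N \<Longrightarrow> 1 - u \<in> N" and w_pos: "\<And>u. u \<in> N \<Longrightarrow> w u > 0"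
    and exact: "\<And>p. degree p \<le> 2 * k - 1 \<Longrightarrow> ip p = (\<Sum>u\<in>N. w u * poly p u)"
begin

lemma degree_l: "y \<in> N \<Longrightarrow> degree (lagr N y) \<le> k"
  using degree_lagr[of N y] N by simp

text \<open>The product has degree at most k + (k - 1) = 2k - 1, the limit of exactness, and the
  basis polynomial leaves only the node \<open>y\<close>.\<close>

lemma l_quadrature:
  assumes "y \<in> N" "degree p \<le> k - 1"
  shows "ip (lagr N y * p) = w y * poly p y"
proof -
  have "degree (lagr N y * p) \<le> k + (k - 1)"
    using degree_l[OF assms(1)] assms(2) by (intro order.trans[OF degree_mult_le] add_mono)
  then have "ip (lagr N y * p) = (\<Sum>u\<in>N. w u * poly (lagr N y * p) u)" using k by (intro exact) simp
  also have "\<dots> = (\<Sum>u\<in>N. if u = y then w y * poly p y else 0)"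
    by (intro sum.cong) (auto simp: lagr_delta[OF N(1)])
  also have "\<dots> = w y * poly p y" using N(1) assms(1) by simp
  finally show ?thesis .
qed

text \<open>Applied directly, the rule would involve all nodes. Integration by parts reduces to the
  preceding case with the derivative of (s - y) p; the boundary terms vanish because each endpoint
  is a node, where either the basis polynomial or s - y is zero.\<close>

lemma l_quadrature_deriv:
  assumes y: "y \<in> N" and p: "degree p \<le> k - 1"
  shows "ip ([:- y, 1:] * pderiv (lagr N y) * p) = - w y * poly p y"
proof -
  have l: "poly (lagr N y) 0 * (0 - y) = 0" "poly (lagr N y) 1 * (1 - y) = 0"
    using N(4,5) by (auto simp: lagr_delta[OF N(1)])
  have "ip ([:- y, 1:] * pderiv (lagr N y) * p) = ip (pderiv (lagr N y) * ([:- y, 1:] * p))"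
    by (simp only: mult_ac)
  also have "\<dots> = - ip (lagr N y * pderiv ([:- y, 1:] * p))"
  proof (rule ip_parts)
    show "poly (lagr N y * ([:- y, 1:] * p)) 0 = 0" "poly (lagr N y * ([:- y, 1:] * p)) 1 = 0"
      using l by auto
  qed
  also have "ip (lagr N y * pderiv ([:- y, 1:] * p)) = w y * poly (pderiv ([:- y, 1:] * p)) y"
  proof (rule l_quadrature[OF y])
    have "degree ([:- y, 1:] * p) \<le> 1 + (k - 1)"
      using p by (intro order.trans[OF degree_mult_le] add_mono) auto
    then show "degree (pderiv ([:- y, 1:] * p)) \<le> k - 1" unfolding degree_pderiv by simp
  qed
  also have "poly (pderiv ([:- y, 1:] * p)) y = poly p y"
    unfolding pderiv_mult by (simp add: pderiv_pCons)
  finally show ?thesis by simp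
qed

section \<open>Basis functions of the grid lines and the exact energy identity\<close>

definition gline :: "'n::finite \<Rightarrow> real ^ 'n \<Rightarrow> real poly \<Rightarrow> 'n \<Rightarrow> real poly" where
  "gline j z f i = (if i = j then f else lagr N (z $ i))"

definition \<phi> :: "'n::finite \<Rightarrow> real ^ 'n \<Rightarrow> real poly \<Rightarrow> real ^ 'n \<Rightarrow> real" where
  "\<phi> j z f x = (\<Prod>i\<in>UNIV. poly (gline j z f i) (x $ i))"

definition d\<phi> :: "'n::finite \<Rightarrow> real ^ 'n \<Rightarrow> real poly \<Rightarrow> real ^ 'n \<Rightarrow> real ^ 'n" where
  "d\<phi> j z f x = (\<chi> i. poly (pderiv (gline j z f i)) (x $ i) * (\<Prod>l\<in>UNIV - {i}. poly (gline j z f l) (x $ l)))"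

lemma \<phi>_has_derivative: "(\<phi> j z f has_derivative (\<lambda>h. d\<phi> j z f x \<bullet> h)) (at x)"
proof -
  have "((\<lambda>x. \<Prod>i\<in>UNIV. poly (gline j z f i) (x $ i)) has_derivative
     (\<lambda>h. \<Sum>i\<in>UNIV. (poly (pderiv (gline j z f i)) (x $ i) * (h $ i)) * (\<Prod>l\<in>UNIV - {i}. poly (gline j z f l) (x $ l)))) (at x)"
  proof (rule has_derivative_prod)
    fix i
    have "((\<lambda>x :: real ^ 'a. x $ i) has_derivative (\<lambda>h. h $ i)) (at x)"
      by (intro bounded_linear_imp_has_derivative bounded_linear_vec_nth)
    moreover have "(poly (gline j z f i) has_derivative (\<lambda>t. poly (pderiv (gline j z f i)) (x $ i) * t)) (at (x $ i))"
      using poly_DERIV[of "gline j z f i" "x $ i"] by (simp add: has_field_derivative_def)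
    ultimately show "((\<lambda>x. poly (gline j z f i) (x $ i)) has_derivative (\<lambda>h. poly (pderiv (gline j z f i)) (x $ i) * (h $ i))) (at x)"
      by (rule has_derivative_compose)
  qed
  moreover have "(\<phi> j z f) = (\<lambda>x. \<Prod>i\<in>UNIV. poly (gline j z f i) (x $ i))" by (auto simp: \<phi>_def)
  moreover have "(\<lambda>h. \<Sum>i\<in>UNIV. (poly (pderiv (gline j z f i)) (x $ i) * (h $ i)) * (\<Prod>l\<in>UNIV - {i}. poly (gline j z f l) (x $ l)))
     = (\<lambda>h. d\<phi> j z f x \<bullet> h)"
    by (auto simp: inner_vec_def d\<phi>_def mult_ac)
  ultimately show ?thesis by simp
qed

lemma \<phi>_Qfun:
  assumes "degree f \<le> k" "\<And>i. i \<noteq> j \<Longrightarrow> z $ i \<in> N"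
  shows "Qfun k (\<phi> j z f)"
  unfolding \<phi>_def[abs_def] by (rule Qfun_prod) (use assms degree_l in \<open>auto simp: gline_def\<close>)

lemma d\<phi>_continuous: "continuous_on S (\<lambda>x. d\<phi> j z f x $ i)"
  unfolding d\<phi>_def by (simp, intro continuous_intros)

text \<open>Quadrature in the transversal directions localises the integral on the line through z.
  The longitudinal component gives the integral of (\<alpha> + \<beta> s) f' p and the transversal
  ones supply \<beta> f p; together they are the derivative of (\<alpha> + \<beta> s) f against p,
  and a last integration by parts moves it to p.\<close>

lemma line_energy:
  fixes z :: "real ^ 'n::finite"
  assumes q: "Qfun (k - 1) q" and z: "\<And>i. i \<noteq> j \<Longrightarrow> z $ i \<in> N" and f: "poly f 0 = 0" "poly f 1 = 0"
    and \<beta>: "\<beta> * (real CARD('n) - 2) = 0" and p: "\<And>s. q (upd z j s) = poly p s"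
  shows "integral (cbox 0 1) (\<lambda>x. q x * (\<Sum>i\<in>UNIV. (if i = j then \<alpha> + \<beta> * x $ j else - \<beta> * (x $ i - z $ i)) * d\<phi> j z f x $ i))
     = - (\<Prod>i\<in>UNIV - {j}. w (z $ i)) * ip ([:\<alpha>, \<beta>:] * f * pderiv p)"
proof -
  let ?W = "\<Prod>i\<in>UNIV - {j}. w (z $ i)"
  let ?E = "\<lambda>i x. if i = j then \<alpha> + \<beta> * x $ j else - \<beta> * (x $ i - z $ i)"
  let ?h = "\<lambda>i x. q x * (?E i x * d\<phi> j z f x $ i)"
  have int: "?h i integrable_on cbox 0 1" for i
    by (cases "i = j") (auto intro!: integrable_continuous continuous_intros d\<phi>_continuous Qfun_continuous[OF q])
  have tj: "integral (cbox 0 1) (?h j) = ?W * ip ([:\<alpha>, \<beta>:] * pderiv f * p)"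
  proof -
    have "?h j = (\<lambda>x. (poly ([:\<alpha>, \<beta>:] * pderiv f) (x $ j) * (\<Prod>i\<in>UNIV - {j}. poly (lagr N (z $ i)) (x $ i))) * q x)"
    proof
      fix x
      have "(\<Prod>l\<in>UNIV - {j}. poly (gline j z f l) (x $ l)) = (\<Prod>i\<in>UNIV - {j}. poly (lagr N (z $ i)) (x $ i))"
        by (intro prod.cong) (auto simp: gline_def)
      then show "?h j x = (poly ([:\<alpha>, \<beta>:] * pderiv f) (x $ j) * (\<Prod>i\<in>UNIV - {j}. poly (lagr N (z $ i)) (x $ i))) * q x"
        by (simp add: d\<phi>_def gline_def[of j z f j] algebra_simps)
    qed
    then show ?thesis
      using line_quadrature[OF q, of j "\<lambda>i. lagr N (z $ i)" "\<lambda>i. w (z $ i)" z p "[:\<alpha>, \<beta>:] * pderiv f"] l_quadrature z p by simp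
  qed
  have ti: "integral (cbox 0 1) (?h i) = \<beta> * (?W * ip (f * p))" if ij: "i \<noteq> j" for i
  proof -
    define g where "g l = (if l = i then [:- (z $ i), 1:] * pderiv (lagr N (z $ i)) else lagr N (z $ l))" for l
    define \<kappa> where "\<kappa> l = (if l = i then - w (z $ i) else w (z $ l))" for l
    have "?h i = (\<lambda>x. (poly (smult (- \<beta>) f) (x $ j) * (\<Prod>l\<in>UNIV - {j}. poly (g l) (x $ l))) * q x)"
    proof
      fix x
      have j: "j \<in> UNIV - {i}" "i \<in> UNIV - {j}" using ij by auto
      have s: "UNIV - {i} - {j} = UNIV - {j} - {i}" by auto
      have "(\<Prod>l\<in>UNIV - {i}. poly (gline j z f l) (x $ l)) = poly f (x $ j) * (\<Prod>l\<in>UNIV - {i} - {j}. poly (gline j z f l) (x $ l))"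
        by (subst prod.remove[OF _ j(1)]) (simp_all add: gline_def)
      also have "(\<Prod>l\<in>UNIV - {i} - {j}. poly (gline j z f l) (x $ l)) = (\<Prod>l\<in>UNIV - {j} - {i}. poly (g l) (x $ l))"
        unfolding s by (intro prod.cong) (auto simp: gline_def g_def)
      finally have e1: "(\<Prod>l\<in>UNIV - {i}. poly (gline j z f l) (x $ l)) = poly f (x $ j) * (\<Prod>l\<in>UNIV - {j} - {i}. poly (g l) (x $ l))" .
      have e2: "(\<Prod>l\<in>UNIV - {j}. poly (g l) (x $ l)) = (x $ i - z $ i) * poly (pderiv (lagr N (z $ i))) (x $ i) * (\<Prod>l\<in>UNIV - {j} - {i}. poly (g l) (x $ l))"
        by (subst prod.remove[OF _ j(2)]) (simp_all add: g_def left_diff_distrib)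
      show "?h i x = (poly (smult (- \<beta>) f) (x $ j) * (\<Prod>l\<in>UNIV - {j}. poly (g l) (x $ l))) * q x"
        unfolding e2 d\<phi>_def using ij by (simp add: e1 gline_def[of j z f i])
    qed
    moreover have "ip (g l * p') = \<kappa> l * poly p' (z $ l)" if "l \<noteq> j" "degree p' \<le> k - 1" for l p'
    proof (cases "l = i")
      case True
      then show ?thesis using l_quadrature_deriv[OF z[OF ij] that(2)] by (simp only: g_def \<kappa>_def if_True simp_thms)
    next
      case False
      then show ?thesis using l_quadrature[OF z[OF that(1)] that(2)] by (simp only: g_def \<kappa>_def if_False)
    qed
    ultimately have "integral (cbox 0 1) (?h i) = (\<Prod>l\<in>UNIV - {j}. \<kappa> l) * ip (smult (- \<beta>) f * p)"
      using line_quadrature[OF q, of j g \<kappa> z p "smult (- \<beta>) f"] p by simp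
    moreover have "(\<Prod>l\<in>UNIV - {j}. \<kappa> l) = - ?W"
    proof -
      have i: "i \<in> UNIV - {j}" using ij by auto
      have "(\<Prod>l\<in>UNIV - {j}. \<kappa> l) = - w (z $ i) * (\<Prod>l\<in>UNIV - {j} - {i}. \<kappa> l)"
        by (subst prod.remove[OF _ i]) (simp_all add: \<kappa>_def)
      also have "(\<Prod>l\<in>UNIV - {j} - {i}. \<kappa> l) = (\<Prod>l\<in>UNIV - {j} - {i}. w (z $ l))"
        by (intro prod.cong) (auto simp: \<kappa>_def)
      also have "- w (z $ i) * \<dots> = - ?W" using prod.remove[OF _ i, of "\<lambda>l. w (z $ l)"] by simp
      finally show ?thesis .
    qed
    moreover have "ip (smult (- \<beta>) f * p) = - \<beta> * ip (f * p)"
      using ip_smult[of "- \<beta>" "f * p"] by (simp only: mult_smult_left)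
    moreover have "- ?W * (- \<beta> * ip (f * p)) = \<beta> * (?W * ip (f * p))" by (simp add: mult_ac)
    ultimately show ?thesis by (simp only:)
  qed
  have "integral (cbox 0 1) (\<lambda>x. q x * (\<Sum>i\<in>UNIV. ?E i x * d\<phi> j z f x $ i)) = integral (cbox 0 1) (\<lambda>x. \<Sum>i\<in>UNIV. ?h i x)"
    by (simp add: sum_distrib_left)
  also have "\<dots> = (\<Sum>i\<in>UNIV. integral (cbox 0 1) (?h i))"
    by (rule Henstock_Kurzweil_Integration.integral_sum) (use int in auto)
  also have "\<dots> = integral (cbox 0 1) (?h j) + (\<Sum>i\<in>UNIV - {j}. integral (cbox 0 1) (?h i))"
    by (rule sum.remove) auto
  also have "(\<Sum>i\<in>UNIV - {j}. integral (cbox 0 1) (?h i)) = (\<Sum>i\<in>UNIV - {j}. \<beta> * (?W * ip (f * p)))"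
    using ti by (intro sum.cong) auto
  \<comment> \<open>The d - 1 transversal directions contribute equal terms, and (d - 1) \<beta> =
    \<beta> because either d = 2 or \<beta> = 0. Exactly one copy remains, as the product rule
    requires.\<close>
  also have "\<dots> = ?W * (\<beta> * ip (f * p))"
  proof -
    have "(\<Sum>i\<in>UNIV - {j}. \<beta> * (?W * ip (f * p))) = (real CARD('n) - 1) * \<beta> * (?W * ip (f * p))"
      by (simp add: of_nat_diff Suc_leI)
    moreover have "(real CARD('n) - 1) * \<beta> = \<beta>" using \<beta> by (simp add: algebra_simps)
    ultimately show ?thesis by simp
  qed
  also note tj
  also have "?W * ip ([:\<alpha>, \<beta>:] * pderiv f * p) + ?W * (\<beta> * ip (f * p)) = ?W * ip (pderiv ([:\<alpha>, \<beta>:] * f) * p)"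
  proof -
    have "pderiv ([:\<alpha>, \<beta>:] * f) * p = [:\<alpha>, \<beta>:] * pderiv f * p + smult \<beta> (f * p)"
      unfolding pderiv_mult by (simp add: pderiv_pCons algebra_simps)
    then have "ip (pderiv ([:\<alpha>, \<beta>:] * f) * p) = ip ([:\<alpha>, \<beta>:] * pderiv f * p) + \<beta> * ip (f * p)"
      by (simp only: ip_add ip_smult)
    then show ?thesis by (simp add: distrib_left)
  qed
  also have "ip (pderiv ([:\<alpha>, \<beta>:] * f) * p) = - ip ([:\<alpha>, \<beta>:] * f * pderiv p)"
    by (rule ip_parts) (use f in simp_all)
  finally show ?thesis by simp
qed

text \<open>The coordinate 1/2 picks one representative per line and is fixed by reflection. As the
  midpoint is interior to the line, a face of the cell that contains its image contains the image of
  the whole line.\<close>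

definition lines :: "('n::finite \<times> (real ^ 'n)) set" where
  "lines = {(j, z). z $ j = 1 / 2 \<and> (\<forall>i. i \<noteq> j \<longrightarrow> z $ i \<in> N)}"

lemma finite_lines: "finite (lines :: ('n::finite \<times> (real ^ 'n)) set)"
proof -
  have "(lines :: ('n \<times> (real ^ 'n)) set) \<subseteq> UNIV \<times> {z. \<forall>i. z $ i \<in> insert (1 / 2) N}"
  proof (rule subsetI)
    fix jz :: "'n \<times> (real ^ 'n)" assume "jz \<in> lines"
    then obtain j z where jz: "jz = (j, z)" "z $ j = 1 / 2" "\<And>i. i \<noteq> j \<Longrightarrow> z $ i \<in> N"
      unfolding lines_def by blast
    then have "z $ i \<in> insert (1 / 2) N" for i by (cases "i = j") auto
    then show "jz \<in> UNIV \<times> {z. \<forall>i. z $ i \<in> insert (1 / 2) N}" unfolding jz(1) by blast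
  qed
  moreover have "finite {z :: real ^ 'n. \<forall>i. z $ i \<in> insert (1 / 2) N}"
  proof -
    have "{z :: real ^ 'n. \<forall>i. z $ i \<in> insert (1 / 2) N} \<subseteq> vec_lambda ` PiE UNIV (\<lambda>_. insert (1 / 2) N)"
    proof
      fix z :: "real ^ 'n" assume "z \<in> {z. \<forall>i. z $ i \<in> insert (1 / 2) N}"
      then have "vec_nth z \<in> PiE UNIV (\<lambda>_. insert (1 / 2) N)" by auto
      from imageI[OF this, of vec_lambda] show "z \<in> vec_lambda ` PiE UNIV (\<lambda>_. insert (1 / 2) N)"
        by (simp only: vec_lambda_eta)
    qed
    moreover have "finite (PiE (UNIV :: 'n set) (\<lambda>_. insert (1 / 2) N))" using N(1) by (intro finite_PiE) auto
    ultimately show ?thesis by (meson finite_imageI finite_subset)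
  qed
  ultimately show ?thesis by (intro finite_subset[OF _ finite_cartesian_product[OF finite]])
qed

lemma lines_cube:
  assumes "(j, z) \<in> lines"
  shows "z \<in> cbox 0 1"
  unfolding mem_box_cart
proof
  fix i
  show "0 $ i \<le> z $ i \<and> z $ i \<le> 1 $ i"
    using assms N(3) by (cases "i = j") (auto simp: lines_def)
qed

definition lp :: "(real ^ 'n::finite \<Rightarrow> real) \<Rightarrow> real ^ 'n \<Rightarrow> 'n \<Rightarrow> real poly" where
  "lp g z j = (THE p. \<forall>s. g (upd z j s) = poly p s)"

lemma lp:
  assumes "Qfun m g"
  shows "g (upd z j s) = poly (lp g z j) s" "degree (lp g z j) \<le> m"
proof -
  obtain p where p: "degree p \<le> m" "\<forall>s. g (upd z j s) = poly p s" using Qfun_line[OF assms] by blast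
  have "lp g z j = p"
    unfolding lp_def by (rule the_equality) (use p(2) in \<open>auto intro!: poly_ext\<close>)
  then show "g (upd z j s) = poly (lp g z j) s" "degree (lp g z j) \<le> m" using p by auto
qed

lemma lp_deriv:
  assumes "Qfun m g" "(g has_derivative (\<lambda>h. D \<bullet> h)) (at (upd z j s))"
  shows "D $ j = poly (pderiv (lp g z j)) s"
proof -
  have "((\<lambda>s. upd z j s) has_derivative (\<lambda>s. s *\<^sub>R axis j 1)) (at s)"
    unfolding upd_eq_add by (auto intro!: derivative_eq_intros)
  from has_derivative_compose[OF this assms(2)]
  have "((\<lambda>s. g (upd z j s)) has_derivative (\<lambda>s. s * (D $ j))) (at s)"
    by (simp add: inner_axis)
  then have "(poly (lp g z j) has_real_derivative D $ j) (at s)"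
    by (simp add: lp(1)[OF assms(1)] has_field_derivative_def mult_commute_abs)
  then show ?thesis using DERIV_unique[OF poly_DERIV] by metis
qed

definition fl :: "(real ^ 'n::finite \<Rightarrow> real) \<Rightarrow> real ^ 'n \<Rightarrow> 'n \<Rightarrow> real poly" where
  "fl g z j = [:0, 1, - 1:] * pderiv (lp g z j)"

lemma fl_ends: "poly (fl g z j) 0 = 0" "poly (fl g z j) 1 = 0"
  by (simp_all add: fl_def)

text \<open>Differentiation lowers k - 1 to k - 2 and the quadratic factor restores k;
  \<open>k \<ge> 2\<close> makes the truncated subtraction exact.\<close>

lemma degree_fl:
  assumes "Qfun (k - 1) g"
  shows "degree (fl g z j) \<le> k"
proof -
  have "degree (fl g z j) \<le> 2 + (k - 2)"
    unfolding fl_def using lp(2)[OF assms, of z j] k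
    by (intro order.trans[OF degree_mult_le] add_mono) (auto simp: degree_pderiv)
  then show ?thesis using k by simp
qed

definition opposite_free :: "real ^ 'n::finite \<Rightarrow> 'n \<times> (real ^ 'n) \<Rightarrow> bool" where
  "opposite_free v jz \<longleftrightarrow> (\<forall>i. i \<noteq> fst jz \<longrightarrow> snd jz $ i \<noteq> 1 - v $ i)"

text \<open>Of the k + 1 nodes in each transversal direction the one opposite to the corner v is
  discarded; the remaining k still determine a polynomial of degree k - 1. So the derivative at x is
  bounded by its value at a point of a line that avoids the opposite faces, and there by the
  weighted norm along the line.\<close>

lemma derivative_sup_bound:
  "\<exists>C>0. \<forall>(g :: real ^ 'n::finite \<Rightarrow> real) g'. Qfun (k - 1) g \<longrightarrow>
     (\<forall>x. (g has_derivative (\<lambda>h. g' x \<bullet> h)) (at x)) \<longrightarrow>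
     (\<forall>v j. \<forall>x\<in>cbox 0 1. (\<forall>i. v $ i \<in> {0, 1}) \<longrightarrow>
       (\<exists>z. (j, z) \<in> lines \<and> opposite_free v (j, z) \<and>
          (g' x $ j)\<^sup>2 \<le> C * ip ([:0, 1, - 1:] * (pderiv (lp g z j)) ^ 2)))"
proof -
  have card: "card (N - {e}) = k" if "e \<in> {0, 1}" for e
    using that N by (auto simp: card_Diff_singleton)
  have "\<exists>D\<ge>1. \<forall>p. degree p < card (N - {e}) \<longrightarrow> (\<forall>x\<in>{0..1}. \<exists>u\<in>N - {e}. \<bar>poly p x\<bar> \<le> D * \<bar>poly p u\<bar>)" for e
    by (rule node_bound) (use N(1) in auto)
  then obtain D where D: "\<And>e. D e \<ge> 1" "\<And>e p x. degree p < card (N - {e}) \<Longrightarrow> x \<in> {0..1} \<Longrightarrow> \<exists>u\<in>N - {e}. \<bar>poly p x\<bar> \<le> D e * \<bar>poly p u\<bar>"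
    by metis
  obtain C where C: "C > 0" "\<And>p x. degree p \<le> k \<Longrightarrow> x \<in> {0..1} \<Longrightarrow> (poly p x)\<^sup>2 \<le> C * ip ([:0, 1, - 1:] * p ^ 2)"
    using weighted_sup_bound[of k] by blast
  define E where "E = max (D 0) (D 1)"
  have E: "E \<ge> 1" "D 0 \<le> E" "D 1 \<le> E" using D(1)[of 0] by (auto simp: E_def)
  define M where "M = (E ^ CARD('n))\<^sup>2 * C"
  have "M > 0" unfolding M_def using E(1) C(1) by (intro mult_pos_pos zero_less_power) auto
  moreover have "\<exists>z. (j, z) \<in> lines \<and> opposite_free v (j, z) \<and> (g' x $ j)\<^sup>2 \<le> M * ip ([:0, 1, - 1:] * (pderiv (lp g z j)) ^ 2)"
    if g: "Qfun (k - 1) g" and g': "\<And>x. (g has_derivative (\<lambda>h. g' x \<bullet> h)) (at x)"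
      and x: "x \<in> cbox 0 1" and v: "\<And>i. v $ i \<in> {0, 1}" for g :: "real ^ 'n \<Rightarrow> real" and g' v j x
  proof -
    obtain d where d: "\<And>i. Qfun (k - 1) (d i)" "\<And>x. (g has_derivative (\<lambda>h. \<Sum>i\<in>UNIV. d i x * h $ i)) (at x)"
      using Qfun_derivative[OF g] by blast
    have dg: "g' y $ i = d i y" for y i
    proof -
      have "(\<lambda>h. g' y \<bullet> h) = (\<lambda>h. \<Sum>i\<in>UNIV. d i y * h $ i)"
        by (rule has_derivative_unique[OF g' d(2)])
      from fun_cong[OF this, of "axis i 1"] have "g' y $ i = (\<Sum>l\<in>UNIV. d l y * axis i 1 $ l)"
        by (simp only: inner_axis) simp
      also have "\<dots> = (\<Sum>l\<in>UNIV. if l = i then d i y else 0)" by (intro sum.cong) (auto simp: axis_def)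
      finally show ?thesis by simp
    qed
    \<comment> \<open>The discarded node is 0 or 1 according to the corner, so \<open>E\<close>, the
      larger of the constants for these two node sets, serves every direction.\<close>
    let ?N = "\<lambda>i. N - {1 - v $ i}"
    have Dn: "\<exists>u\<in>?N i. \<bar>poly p t\<bar> \<le> E * \<bar>poly p u\<bar>" if p: "degree p \<le> k - 1" and t: "t \<in> {0..1}" for i p t
    proof -
      have e: "1 - v $ i \<in> {0, 1}" using v[of i] by auto
      have "degree p < card (?N i)" using p k card[OF e] by simp
      from D(2)[OF this t] obtain u where u: "u \<in> ?N i" "\<bar>poly p t\<bar> \<le> D (1 - v $ i) * \<bar>poly p u\<bar>" by blast
      moreover have "D (1 - v $ i) \<le> E" using e E by auto
      ultimately have "\<bar>poly p t\<bar> \<le> E * \<bar>poly p u\<bar>" by (meson abs_ge_zero mult_right_mono order_trans)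
      then show ?thesis using u(1) by blast
    qed
    have sub: "?N i \<subseteq> {0..1}" for i using N(3) by blast
    have "\<exists>y. (\<forall>i\<in>UNIV - {j}. y $ i \<in> ?N i) \<and> (\<forall>i. i \<notin> UNIV - {j} \<longrightarrow> y $ i = x $ i) \<and>
        \<bar>d j x\<bar> \<le> E ^ card (UNIV - {j}) * \<bar>d j y\<bar>"
      by (rule Qfun_node_bound[where N = ?N, OF d(1)[of j] E(1)]) (use Dn sub x in auto)
    then obtain y where y: "\<forall>i\<in>UNIV - {j}. y $ i \<in> ?N i" "\<forall>i. i \<notin> UNIV - {j} \<longrightarrow> y $ i = x $ i"
        "\<bar>d j x\<bar> \<le> E ^ card (UNIV - {j}) * \<bar>d j y\<bar>" by blast
    let ?z = "upd y j (1 / 2)"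
    have yj: "y $ j = x $ j" "y $ j \<in> {0..1}" using y(2) x by (auto simp: mem_box_cart)
    have l: "(j, ?z) \<in> lines" "opposite_free v (j, ?z)" using y(1) by (auto simp: lines_def opposite_free_def)
    have "d j y = poly (pderiv (lp g ?z j)) (y $ j)"
      using lp_deriv[OF g, of "g' (upd ?z j (y $ j))" ?z j "y $ j"] g' by (simp add: dg)
    moreover have "degree (pderiv (lp g ?z j)) \<le> k" using lp(2)[OF g, of ?z j] by (simp add: degree_pderiv)
    ultimately have b: "(d j y)\<^sup>2 \<le> C * ip ([:0, 1, - 1:] * (pderiv (lp g ?z j)) ^ 2)" using C(2) yj(2) by simp
    have "E ^ card (UNIV - {j}) \<le> E ^ CARD('n)" using E(1) by (intro power_increasing card_mono) auto
    then have "E ^ card (UNIV - {j}) * \<bar>d j y\<bar> \<le> E ^ CARD('n) * \<bar>d j y\<bar>" by (rule mult_right_mono) simp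
    then have "\<bar>d j x\<bar> \<le> E ^ CARD('n) * \<bar>d j y\<bar>" using y(3) by (rule order_trans[rotated])
    then have "\<bar>d j x\<bar>\<^sup>2 \<le> (E ^ CARD('n) * \<bar>d j y\<bar>)\<^sup>2" by (rule power_mono) simp
    then have "(d j x)\<^sup>2 \<le> (E ^ CARD('n))\<^sup>2 * (d j y)\<^sup>2" by (simp add: power_mult_distrib)
    also have "\<dots> \<le> (E ^ CARD('n))\<^sup>2 * (C * ip ([:0, 1, - 1:] * (pderiv (lp g ?z j)) ^ 2))"
      by (rule mult_left_mono[OF b]) simp
    finally show ?thesis using l by (auto simp: dg M_def mult.assoc)
  qed
  ultimately show ?thesis by blast
qed

end

section \<open>The velocity on a cell\<close>

lemma ip_mono:
  assumes "\<And>x. x \<in> {0..1} \<Longrightarrow> poly p x \<le> poly q x"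
  shows "ip p \<le> ip q"
  unfolding ip_def by (intro integral_le poly_integrable_on assms)

definition wsq :: "real poly \<Rightarrow> real" where
  "wsq p = ip ([:0, 1, - 1:] * p ^ 2)"

lemma wsq_nonneg: "wsq p \<ge> 0"
proof -
  have "ip 0 \<le> ip ([:0, 1, - 1:] * p ^ 2)"
  proof (rule ip_mono)
    fix x :: real assume "x \<in> {0..1}"
    then have "0 \<le> x * (1 - x) * (poly p x)\<^sup>2" by simp
    then show "poly 0 x \<le> poly ([:0, 1, - 1:] * p ^ 2) x" by (simp add: algebra_simps)
  qed
  then show ?thesis by (simp only: wsq_def ip_0)
qed

lemma wsq_eq_0:
  assumes "wsq p = 0"
  shows "p = 0"
proof (rule ccontr)
  assume "p \<noteq> 0"
  then have "[:0, 1, - 1:] * p ^ 2 \<noteq> 0" by (simp del: mult_pCons_left)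
  then have "ip ([:0, 1, - 1:] * p ^ 2) > 0"
  proof (rule ip_pos)
    fix x :: real assume "x \<in> {0..1}"
    then have "0 \<le> x * (1 - x) * (poly p x)\<^sup>2" by simp
    then show "0 \<le> poly ([:0, 1, - 1:] * p ^ 2) x" by (simp add: algebra_simps)
  qed
  then show False using assms by (simp only: wsq_def)
qed

context cell
begin

lemma pullback_derivative:
  assumes u: "\<And>y. y \<in> Cub \<Longrightarrow> u (F y) = g y" and x: "x \<in> box 0 1" and g: "(g has_derivative (\<lambda>h. D \<bullet> h)) (at x)"
  shows "(u has_derivative (\<lambda>\<xi>. (D v* matrix_inv (J x)) \<bullet> \<xi>)) (at (F x))"
proof -
  let ?Fi = "inv_into Cub F"
  have xC: "x \<in> Cub" using x box_subset_cbox by blast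
  have Fi: "?Fi (F y) = y" if "y \<in> Cub" for y using inv_into_f_f[OF inj that] .
  have "at x within Cub = at x" using x by (intro at_within_interior) (simp add: interior_cbox)
  then have dF: "(F has_derivative (\<lambda>\<xi>. J x *v \<xi>)) (at x)" using der[OF xC] by simp
  have "(?Fi has_derivative (\<lambda>\<xi>. matrix_inv (J x) *v \<xi>)) (at (F x))"
  proof (rule has_derivative_inverse[OF compact_cbox xC _ F_cont Fi dF])
    show "F x \<in> interior (F ` Cub)" using box_interior[OF x] by (simp add: img)
    show "bounded_linear ((*v) (matrix_inv (J x)))" by (rule matrix_vector_mul_bounded_linear)
    show "(*v) (matrix_inv (J x)) \<circ> (*v) (J x) = id"
      using matrix_inv_left[OF J_invertible[OF xC]] by (simp add: fun_eq_iff matrix_vector_mul_assoc)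
  qed
  from has_derivative_compose[OF this, of g "\<lambda>h. D \<bullet> h"] g
  have "((\<lambda>p. g (?Fi p)) has_derivative (\<lambda>\<xi>. D \<bullet> (matrix_inv (J x) *v \<xi>))) (at (F x))"
    by (simp add: Fi[OF xC])
  then have "(u has_derivative (\<lambda>\<xi>. D \<bullet> (matrix_inv (J x) *v \<xi>))) (at (F x))"
  proof (rule has_derivative_transform_within_open[OF _ open_interior box_interior[OF x]])
    fix p assume "p \<in> interior K"
    then have "p \<in> K" using interior_subset by blast
    then obtain y where y: "y \<in> Cub" "p = F y" using K_obtain by blast
    then show "g (?Fi p) = u p" by (simp add: Fi u)
  qed
  then show ?thesis by (simp add: dot_lmul_matrix)
qed

text \<open>With e the inverse Jacobian applied to the pulled-back gradient g, one has J e = g and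
  |g|^2 = D . e. Cauchy-Schwarz and the lower bound for |J e| then bound |g| by |D|.\<close>

lemma pullback_gradient_bound:
  assumes x: "x \<in> Cub"
  shows "c3 * h\<^sup>2 * (norm (D v* matrix_inv (J x)))\<^sup>2 \<le> (norm D)\<^sup>2"
proof -
  let ?g = "D v* matrix_inv (J x)" and ?e = "matrix_inv (J x) *v (D v* matrix_inv (J x))"
  have inv: "J x ** matrix_inv (J x) = mat 1"
    using someI_ex[OF J_invertible[OF x, unfolded invertible_def]] by (simp add: matrix_inv_def)
  have "J x *v ?e = ?g" using inv by (simp add: matrix_vector_mul_assoc)
  then have e: "c3 * h\<^sup>2 * (norm ?e)\<^sup>2 \<le> (norm ?g)\<^sup>2" using J_ge[OF x, of ?e] by simp
  have "(norm ?g)\<^sup>2 = D \<bullet> ?e" by (simp add: dot_square_norm[symmetric] dot_lmul_matrix)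
  also have "\<dots> \<le> norm D * norm ?e" by (rule norm_cauchy_schwarz)
  finally have "((norm ?g)\<^sup>2)\<^sup>2 \<le> (norm D * norm ?e)\<^sup>2" by (rule power_mono) simp
  then have "(norm ?g)\<^sup>2 * (norm ?g)\<^sup>2 \<le> (norm D)\<^sup>2 * (norm ?e)\<^sup>2" by (simp only: power_mult_distrib power2_eq_square mult_ac)
  then have "(c3 * h\<^sup>2) * ((norm ?g)\<^sup>2 * (norm ?g)\<^sup>2) \<le> (c3 * h\<^sup>2) * ((norm D)\<^sup>2 * (norm ?e)\<^sup>2)"
    by (rule mult_left_mono) (use cpos in simp)
  also have "\<dots> = (norm D)\<^sup>2 * (c3 * h\<^sup>2 * (norm ?e)\<^sup>2)" by (simp only: mult_ac)
  also have "\<dots> \<le> (norm D)\<^sup>2 * (norm ?g)\<^sup>2" by (rule mult_left_mono[OF e]) simp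
  finally have "(c3 * h\<^sup>2 * (norm ?g)\<^sup>2) * (norm ?g)\<^sup>2 \<le> (norm D)\<^sup>2 * (norm ?g)\<^sup>2" by (simp only: mult_ac)
  then show ?thesis by (cases "?g = 0") (simp_all add: mult_le_cancel_right)
qed

text \<open>The face f may belong to a neighbour. Intersected with K \<inter> K' it becomes a face
  of \<open>K\<close>; by \<open>move\<close> it would contain the image of the carrier of y, and v
  lies in that carrier because y can agree on the boundary of the cube only with coordinates of
  v.\<close>

lemma opposite_free_retained:
  assumes f: "f face_of K'" "(K \<inter> K') face_of K" "(K \<inter> K') face_of K'"
    and v: "v \<in> Cub" "\<And>i. v $ i \<in> {0, 1}" "F v \<notin> f"
    and y: "y \<in> Cub" "\<And>i. y $ i \<noteq> 1 - v $ i"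
  shows "F y \<notin> f"
proof
  assume yf: "F y \<in> f"
  have "f \<subseteq> K'" using f(1) face_of_imp_subset by blast
  have "(f \<inter> (K \<inter> K')) face_of K'" using f(1,3) by (rule face_of_Int)
  then have "(f \<inter> (K \<inter> K')) face_of (K \<inter> K')" by (rule face_of_subset) auto
  then have G: "(f \<inter> (K \<inter> K')) face_of K" using f(2) by (rule face_of_trans)
  have "F y \<in> f \<inter> (K \<inter> K')" using yf y(1) \<open>f \<subseteq> K'\<close> by auto
  moreover have "v \<in> carrier y"
  proof -
    have "v $ i = y $ i" if "y $ i \<in> {0, 1}" for i using y(2)[of i] v(2)[of i] that by auto
    then show ?thesis using v(1) by (auto simp: carrier_def)
  qed
  ultimately have "F v \<in> f \<inter> (K \<inter> K')" using move[OF G y(1)] by blast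
  then show False using v(3) by blast
qed

end

text \<open>\<open>chi\<close> decides from the image of the midpoint whether a line is retained. It
  is a parameter, so the estimates on a cell do not mention the boundary of the domain.\<close>

locale line_fields = cell K F J h c1 c3 c4 + lobatto k N w
  for K :: "(real ^ 'n::finite) set" and F J h c1 c3 c4 k N w +
  fixes chi :: "real ^ 'n \<Rightarrow> bool"
begin

definition tang :: "'n \<Rightarrow> real ^ 'n \<Rightarrow> real ^ 'n" where "tang j z = J z *v axis j 1"

definition coef :: "'n \<Rightarrow> real ^ 'n \<Rightarrow> real" where
  "coef j z = (if chi (F z) then 1 / (norm (tang j z))\<^sup>2 else 0)"

definition V :: "(real ^ 'n \<Rightarrow> real) \<Rightarrow> real ^ 'n \<Rightarrow> real ^ 'n" where
  "V g x = (\<Sum>(j, z)\<in>lines. (coef j z * \<phi> j z (fl g z j) x) *\<^sub>R tang j z)"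

text \<open>The gradient of component \<open>c\<close> of \<open>V g\<close> with respect to the
  reference coordinates.\<close>

definition DV :: "(real ^ 'n \<Rightarrow> real) \<Rightarrow> 'n \<Rightarrow> real ^ 'n \<Rightarrow> real ^ 'n" where
  "DV g c x = (\<Sum>(j, z)\<in>lines. (coef j z * tang j z $ c) *\<^sub>R d\<phi> j z (fl g z j) x)"

definition energy :: "(real ^ 'n \<Rightarrow> real) \<Rightarrow> real" where
  "energy g = (\<Sum>(j, z)\<in>lines. if chi (F z) then wsq (pderiv (lp g z j)) else 0)"

lemma energy_nonneg: "energy g \<ge> 0"
  unfolding energy_def by (intro sum_nonneg) (auto simp: wsq_nonneg)

lemma energy_line: "(j, z) \<in> lines \<Longrightarrow> chi (F z) \<Longrightarrow> wsq (pderiv (lp g z j)) \<le> energy g"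
  unfolding energy_def
  using member_le_sum[of "(j, z)" lines "\<lambda>(j, z). if chi (F z) then wsq (pderiv (lp g z j)) else 0"]
  by (auto simp: finite_lines wsq_nonneg)

lemma V_component: "V g x $ c = (\<Sum>(j, z)\<in>lines. (coef j z * tang j z $ c) * \<phi> j z (fl g z j) x)"
  unfolding V_def by (simp add: sum_component case_prod_unfold mult_ac)

lemma V_Qfun:
  assumes "Qfun (k - 1) g"
  shows "Qfun k (\<lambda>x. V g x $ c)"
proof -
  have "Qfun k (\<lambda>x. \<Sum>jz\<in>lines. (case jz of (j, z) \<Rightarrow> coef j z * tang j z $ c * \<phi> j z (fl g z j) x))"
  proof (rule Qfun_sum)
    fix jz :: "'n \<times> (real ^ 'n)" assume jz: "jz \<in> lines"
    obtain j z where [simp]: "jz = (j, z)" by (cases jz)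
    have "Qfun k (\<phi> j z (fl g z j))"
      by (rule \<phi>_Qfun[OF degree_fl[OF assms]]) (use jz in \<open>auto simp: lines_def\<close>)
    then show "Qfun k (\<lambda>x. case jz of (j, z) \<Rightarrow> coef j z * tang j z $ c * \<phi> j z (fl g z j) x)"
      by (simp add: Qspan_mult)
  qed
  then show ?thesis by (simp add: V_component[abs_def])
qed

lemma V_has_derivative: "((\<lambda>x. V g x $ c) has_derivative (\<lambda>h. DV g c x \<bullet> h)) (at x)"
proof -
  have "((\<lambda>x. \<Sum>jz\<in>lines. (coef (fst jz) (snd jz) * tang (fst jz) (snd jz) $ c) * \<phi> (fst jz) (snd jz) (fl g (snd jz) (fst jz)) x)
     has_derivative (\<lambda>h. \<Sum>jz\<in>lines. (coef (fst jz) (snd jz) * tang (fst jz) (snd jz) $ c) * (d\<phi> (fst jz) (snd jz) (fl g (snd jz) (fst jz)) x \<bullet> h))) (at x)"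
    by (intro has_derivative_sum has_derivative_mult_right \<phi>_has_derivative)
  then show ?thesis
    by (simp add: V_component case_prod_unfold DV_def inner_sum_left)
qed

text \<open>The divergence in physical coordinates, expressed at the reference point by the chain
  rule.\<close>

definition divV :: "(real ^ 'n \<Rightarrow> real) \<Rightarrow> real ^ 'n \<Rightarrow> real" where
  "divV g x = (\<Sum>c\<in>UNIV. (DV g c x v* matrix_inv (J x)) $ c)"

text \<open>If J E = det J * \<tau>, then det J times the inverse Jacobian applied to \<tau> equals
  E. The determinant from the change of variables thus cancels the denominator of the inverse, which
  brings the integrand within reach of quadrature.\<close>

lemma divV_eq:
  assumes x: "x \<in> Cub"
    and E: "\<And>j z. (j, z) \<in> lines \<Longrightarrow> (\<Sum>i\<in>UNIV. E j z i *\<^sub>R (J x *v axis i 1)) = det (J x) *\<^sub>R tang j z"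
  shows "det (J x) * divV g x = (\<Sum>(j, z)\<in>lines. coef j z * (\<Sum>i\<in>UNIV. E j z i * d\<phi> j z (fl g z j) x $ i))"
proof -
  let ?M = "matrix_inv (J x)"
  have comp: "(D v* ?M) $ c = D \<bullet> (?M *v axis c 1)" for D c
    using dot_lmul_matrix[of D ?M "axis c 1"] by (simp add: inner_axis)
  have ax: "(\<Sum>c\<in>UNIV. t $ c *\<^sub>R axis c 1) = t" for t :: "real ^ 'n"
    using basis_expansion[of t] by (simp add: scalar_mult_eq_scaleR)
  have expand: "A *v t = (\<Sum>c\<in>UNIV. t $ c *\<^sub>R (A *v axis c 1))" for A :: "real ^ 'n ^ 'n" and t
  proof -
    have "A *v t = A *v (\<Sum>c\<in>UNIV. t $ c *\<^sub>R axis c 1)" by (simp only: ax)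
    also have "\<dots> = (\<Sum>c\<in>UNIV. A *v (t $ c *\<^sub>R axis c 1))"
      by (rule linear_sum[OF matrix_vector_mul_linear, of A, unfolded o_def])
    finally show ?thesis by (simp only: matrix_vector_mult_scaleR)
  qed
  have "divV g x = (\<Sum>c\<in>UNIV. \<Sum>(j, z)\<in>lines. coef j z * (d\<phi> j z (fl g z j) x \<bullet> (tang j z $ c *\<^sub>R (?M *v axis c 1))))"
    unfolding divV_def comp DV_def by (simp add: inner_sum_left case_prod_unfold mult_ac)
  also have "\<dots> = (\<Sum>(j, z)\<in>lines. \<Sum>c\<in>UNIV. coef j z * (d\<phi> j z (fl g z j) x \<bullet> (tang j z $ c *\<^sub>R (?M *v axis c 1))))"
    by (subst sum.swap) (simp add: case_prod_unfold)
  also have "\<dots> = (\<Sum>(j, z)\<in>lines. coef j z * (d\<phi> j z (fl g z j) x \<bullet> (?M *v tang j z)))"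
    by (intro sum.cong refl) (simp add: case_prod_unfold expand[of ?M "tang _ _"] inner_sum_right sum_distrib_left del: inner_scaleR_right)
  finally have dV: "divV g x = (\<Sum>(j, z)\<in>lines. coef j z * (d\<phi> j z (fl g z j) x \<bullet> (?M *v tang j z)))" .
  have d1: "det (J x) * divV g x = (\<Sum>(j, z)\<in>lines. det (J x) * (coef j z * (d\<phi> j z (fl g z j) x \<bullet> (?M *v tang j z))))"
    unfolding dV by (simp only: sum_distrib_left case_prod_unfold)
  have d2: "(\<Sum>(j, z)\<in>lines. det (J x) * (coef j z * (d\<phi> j z (fl g z j) x \<bullet> (?M *v tang j z)))) = (\<Sum>(j, z)\<in>lines. coef j z * (d\<phi> j z (fl g z j) x \<bullet> (det (J x) *\<^sub>R (?M *v tang j z))))"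
  proof (rule sum.cong[OF refl])
    fix jz :: "'n \<times> (real ^ 'n)"
    have "a * (b * (D \<bullet> X)) = b * (D \<bullet> (a *\<^sub>R X))" for a b and D X :: "real ^ 'n" by simp
    then show "(case jz of (j, z) \<Rightarrow> det (J x) * (coef j z * (d\<phi> j z (fl g z j) x \<bullet> (?M *v tang j z))))
       = (case jz of (j, z) \<Rightarrow> coef j z * (d\<phi> j z (fl g z j) x \<bullet> (det (J x) *\<^sub>R (?M *v tang j z))))"
      unfolding case_prod_unfold .
  qed
  have d3: "(\<Sum>(j, z)\<in>lines. coef j z * (d\<phi> j z (fl g z j) x \<bullet> (det (J x) *\<^sub>R (?M *v tang j z)))) = (\<Sum>(j, z)\<in>lines. coef j z * (\<Sum>i\<in>UNIV. E j z i * d\<phi> j z (fl g z j) x $ i))"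
  proof (rule sum.cong[OF refl])
    fix jz :: "'n \<times> (real ^ 'n)" assume jz: "jz \<in> lines"
    obtain j z where jzeq: "jz = (j, z)" by (cases jz)
    have l: "(j, z) \<in> lines" using jz by (simp only: jzeq)
    let ?E = "\<chi> i. E j z i"
    have "J x *v ?E = (\<Sum>c\<in>UNIV. ?E $ c *\<^sub>R (J x *v axis c 1))" by (rule expand)
    then have "J x *v ?E = det (J x) *\<^sub>R tang j z" using E[OF l] by (simp only: vec_lambda_beta)
    then have "?M *v (J x *v ?E) = ?M *v (det (J x) *\<^sub>R tang j z)" by simp
    then have "det (J x) *\<^sub>R (?M *v tang j z) = ?E"
      using matrix_inv_left[OF J_invertible[OF x]] by (simp add: matrix_vector_mul_assoc matrix_vector_mult_scaleR)
    then have "d\<phi> j z (fl g z j) x \<bullet> (det (J x) *\<^sub>R (?M *v tang j z)) = (\<Sum>i\<in>UNIV. E j z i * d\<phi> j z (fl g z j) x $ i)"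
      by (simp only: inner_vec_def vec_lambda_beta inner_real_def mult.commute)
    then show "(case jz of (j, z) \<Rightarrow> coef j z * (d\<phi> j z (fl g z j) x \<bullet> (det (J x) *\<^sub>R (?M *v tang j z))))
       = (case jz of (j, z) \<Rightarrow> coef j z * (\<Sum>i\<in>UNIV. E j z i * d\<phi> j z (fl g z j) x $ i))"
      by (simp only: jzeq prod.case)
  qed
  show ?thesis by (rule trans[OF d1 trans[OF d2 d3]])
qed

text \<open>The generator \<open>g\<close> of the velocity and the tested function \<open>q\<close>
  are kept apart: when \<open>q\<close> has no energy, a velocity generated by another function must
  also give zero. The lower bound is needed only for \<open>g = q\<close>.\<close>

lemma cell_energy:
  assumes g: "Qfun (k - 1) g" and q: "Qfun (k - 1) q" 
  obtains e where "integral Cub (\<lambda>x. det (J x) * (q x * divV g x)) = - e"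
    "energy q = 0 \<Longrightarrow> e = 0"
    "\<And>m. g = q \<Longrightarrow> (\<And>u. u \<in> N \<Longrightarrow> m \<le> w u) \<Longrightarrow> m > 0 \<Longrightarrow> e \<ge> min 1 m ^ CARD('n) * c1 / c4 * (h ^ CARD('n) / h\<^sup>2) * energy q"
proof -
  have "\<forall>l\<in>lines. \<exists>ab. snd ab * (real CARD('n) - 2) = 0 \<and> (\<forall>s\<in>{0..1}. fst ab + snd ab * s = det (J (upd (snd l) (fst l) s))) \<and>
        (\<forall>x\<in>Cub. (\<Sum>i\<in>UNIV. (if i = fst l then fst ab + snd ab * x $ fst l else - snd ab * (x $ i - snd l $ i)) *\<^sub>R (J x *v axis i 1))
            = det (J x) *\<^sub>R tang (fst l) (snd l))"
  proof
    fix l :: "'n \<times> (real ^ 'n)" assume "l \<in> lines"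
    then have "snd l \<in> Cub" using lines_cube[of "fst l" "snd l"] by simp
    from piola[OF this, of "fst l"] obtain \<alpha> \<beta> where "\<beta> * (real CARD('n) - 2) = 0 \<and>
        (\<forall>s\<in>{0..1}. \<alpha> + \<beta> * s = det (J (upd (snd l) (fst l) s))) \<and>
        (\<forall>x\<in>Cub. (\<Sum>i\<in>UNIV. (if i = fst l then \<alpha> + \<beta> * x $ fst l else - \<beta> * (x $ i - snd l $ i)) *\<^sub>R (J x *v axis i 1))
            = det (J x) *\<^sub>R (J (snd l) *v axis (fst l) 1))" by (elim exE) (rule that)
    then show "\<exists>ab. snd ab * (real CARD('n) - 2) = 0 \<and> (\<forall>s\<in>{0..1}. fst ab + snd ab * s = det (J (upd (snd l) (fst l) s))) \<and>
        (\<forall>x\<in>Cub. (\<Sum>i\<in>UNIV. (if i = fst l then fst ab + snd ab * x $ fst l else - snd ab * (x $ i - snd l $ i)) *\<^sub>R (J x *v axis i 1))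
            = det (J x) *\<^sub>R tang (fst l) (snd l))"
      unfolding tang_def by (intro exI[of _ "(\<alpha>, \<beta>)"], unfold fst_conv snd_conv)
  qed
  from bchoice[OF this] obtain ab0 where ab0: "\<forall>l\<in>lines. snd (ab0 l) * (real CARD('n) - 2) = 0 \<and>
        (\<forall>s\<in>{0..1}. fst (ab0 l) + snd (ab0 l) * s = det (J (upd (snd l) (fst l) s))) \<and>
        (\<forall>x\<in>Cub. (\<Sum>i\<in>UNIV. (if i = fst l then fst (ab0 l) + snd (ab0 l) * x $ fst l else - snd (ab0 l) * (x $ i - snd l $ i)) *\<^sub>R (J x *v axis i 1))
            = det (J x) *\<^sub>R tang (fst l) (snd l))" by (elim exE) (rule that)
  define \<alpha> where "\<alpha> l = fst (ab0 l)" for l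
  define \<beta> where "\<beta> l = snd (ab0 l)" for l
  have ab: "\<beta> (j, z) * (real CARD('n) - 2) = 0" "s \<in> {0..1} \<Longrightarrow> \<alpha> (j, z) + \<beta> (j, z) * s = det (J (upd z j s))"
      "x \<in> Cub \<Longrightarrow> (\<Sum>i\<in>UNIV. (if i = j then \<alpha> (j, z) + \<beta> (j, z) * x $ j else - \<beta> (j, z) * (x $ i - z $ i)) *\<^sub>R (J x *v axis i 1))
            = det (J x) *\<^sub>R tang j z" if "(j, z) \<in> lines" for j z s x
    using bspec[OF ab0 that] unfolding \<alpha>_def \<beta>_def fst_conv snd_conv by blast+
  define E where "E x j z i = (if i = j then \<alpha> (j, z) + \<beta> (j, z) * x $ j else - \<beta> (j, z) * (x $ i - z $ i))" for x :: "real ^ 'n" and j z i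
  define W where "W j z = (\<Prod>i\<in>UNIV - {j}. w (z $ i))" for j and z :: "real ^ 'n"
  define I where "I j z = ip ([:\<alpha> (j, z), \<beta> (j, z):] * fl g z j * pderiv (lp q z j))" for j z
  define e where "e = (\<Sum>(j, z)\<in>lines. coef j z * (W j z * I j z))"
  have E_cont: "continuous_on S (\<lambda>x. E x j z i)" for S j z i
    unfolding E_def by (cases "i = j") (auto intro!: continuous_intros)
  have "integral Cub (\<lambda>x. det (J x) * (q x * divV g x)) =
      integral Cub (\<lambda>x. \<Sum>jz\<in>lines. coef (fst jz) (snd jz) * (q x * (\<Sum>i\<in>UNIV. E x (fst jz) (snd jz) i * d\<phi> (fst jz) (snd jz) (fl g (snd jz) (fst jz)) x $ i)))"
  proof (rule Henstock_Kurzweil_Integration.integral_cong)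
    fix x assume x: "x \<in> Cub"
    have "det (J x) * divV g x = (\<Sum>(j, z)\<in>lines. coef j z * (\<Sum>i\<in>UNIV. E x j z i * d\<phi> j z (fl g z j) x $ i))"
      by (rule divV_eq[OF x]) (unfold E_def, rule ab(3)[OF _ x])
    then have "det (J x) * (q x * divV g x) = q x * (\<Sum>(j, z)\<in>lines. coef j z * (\<Sum>i\<in>UNIV. E x j z i * d\<phi> j z (fl g z j) x $ i))"
      by (simp only: mult.left_commute[of "det (J x)"])
    also have "\<dots> = (\<Sum>jz\<in>lines. q x * (coef (fst jz) (snd jz) * (\<Sum>i\<in>UNIV. E x (fst jz) (snd jz) i * d\<phi> (fst jz) (snd jz) (fl g (snd jz) (fst jz)) x $ i)))"
      by (simp only: sum_distrib_left[of "q x"] case_prod_unfold)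
    also have "\<dots> = (\<Sum>jz\<in>lines. coef (fst jz) (snd jz) * (q x * (\<Sum>i\<in>UNIV. E x (fst jz) (snd jz) i * d\<phi> (fst jz) (snd jz) (fl g (snd jz) (fst jz)) x $ i)))"
    proof (rule sum.cong[OF refl])
      fix jz :: "'n \<times> (real ^ 'n)"
      show "q x * (coef (fst jz) (snd jz) * (\<Sum>i\<in>UNIV. E x (fst jz) (snd jz) i * d\<phi> (fst jz) (snd jz) (fl g (snd jz) (fst jz)) x $ i))
         = coef (fst jz) (snd jz) * (q x * (\<Sum>i\<in>UNIV. E x (fst jz) (snd jz) i * d\<phi> (fst jz) (snd jz) (fl g (snd jz) (fst jz)) x $ i))"
        by (rule mult.left_commute)
    qed
    finally show "det (J x) * (q x * divV g x) = (\<Sum>jz\<in>lines. coef (fst jz) (snd jz) * (q x * (\<Sum>i\<in>UNIV. E x (fst jz) (snd jz) i * d\<phi> (fst jz) (snd jz) (fl g (snd jz) (fst jz)) x $ i)))" .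
  qed
  also have "\<dots> = (\<Sum>jz\<in>lines. integral Cub (\<lambda>x. coef (fst jz) (snd jz) * (q x * (\<Sum>i\<in>UNIV. E x (fst jz) (snd jz) i * d\<phi> (fst jz) (snd jz) (fl g (snd jz) (fst jz)) x $ i))))"
    by (intro Henstock_Kurzweil_Integration.integral_sum finite_lines integrable_continuous continuous_intros
         d\<phi>_continuous Qfun_continuous[OF q] E_cont)
  also have "\<dots> = (\<Sum>jz\<in>lines. - (coef (fst jz) (snd jz) * (W (fst jz) (snd jz) * I (fst jz) (snd jz))))"
  proof (rule sum.cong[OF refl])
    fix jz :: "'n \<times> (real ^ 'n)" assume "jz \<in> lines"
    then have l: "(fst jz, snd jz) \<in> lines" by simp
    have "integral Cub (\<lambda>x. q x * (\<Sum>i\<in>UNIV. E x (fst jz) (snd jz) i * d\<phi> (fst jz) (snd jz) (fl g (snd jz) (fst jz)) x $ i)) = - W (fst jz) (snd jz) * I (fst jz) (snd jz)"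
      unfolding E_def W_def I_def
      by (rule line_energy[OF q _ fl_ends ab(1)[OF l] lp(1)[OF q]]) (use l in \<open>auto simp: lines_def\<close>)
    then show "integral Cub (\<lambda>x. coef (fst jz) (snd jz) * (q x * (\<Sum>i\<in>UNIV. E x (fst jz) (snd jz) i * d\<phi> (fst jz) (snd jz) (fl g (snd jz) (fst jz)) x $ i)))
       = - (coef (fst jz) (snd jz) * (W (fst jz) (snd jz) * I (fst jz) (snd jz)))"
      by (simp add: integral_mult_right)
  qed
  also have "\<dots> = - e" by (simp add: e_def case_prod_unfold sum_negf)
  finally have main: "integral Cub (\<lambda>x. det (J x) * (q x * divV g x)) = - e" .
  have W_pos: "W j z \<ge> 0" if "(j, z) \<in> lines" for j z
    unfolding W_def using that w_pos by (intro prod_nonneg) (auto simp: lines_def less_imp_le)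
  show ?thesis
  proof (rule that[OF main])
    assume 0: "energy q = 0"
    have "coef j z * (W j z * I j z) = 0" if l: "(j, z) \<in> lines" for j z
    proof (cases "chi (F z)")
      case True
      have "wsq (pderiv (lp q z j)) \<le> 0" using energy_line[OF l True, of q] 0 by simp
      then have "wsq (pderiv (lp q z j)) = 0" using wsq_nonneg by (rule order_antisym)
      then have "pderiv (lp q z j) = 0" by (rule wsq_eq_0)
      then show ?thesis by (simp add: I_def)
    qed (simp add: coef_def)
    then show "e = 0" unfolding e_def by (intro sum.neutral) auto
  next
    fix m assume gq: "g = q" and m: "\<And>u. u \<in> N \<Longrightarrow> m \<le> w u" "m > 0"
    \<comment> \<open>Lower bounds for the d - 1 transversal weights, for the determinant and for
      the inverse squared tangent length are collected here; \<open>min 1 m\<close> permits the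
      exponent d in place of d - 1.\<close>
    let ?b = "min 1 m ^ CARD('n) * c1 / c4 * (h ^ CARD('n) / h\<^sup>2)"
    have "?b * energy q = (\<Sum>(j, z)\<in>lines. ?b * (if chi (F z) then wsq (pderiv (lp q z j)) else 0))"
      by (simp only: energy_def sum_distrib_left case_prod_unfold)
    also have "\<dots> \<le> e" unfolding e_def
    proof (intro sum_mono, clarify)
      fix j :: 'n and z :: "real ^ 'n" assume l: "(j, z) \<in> lines"
      show "?b * (if chi (F z) then wsq (pderiv (lp q z j)) else 0) \<le> coef j z * (W j z * I j z)"
      proof (cases "chi (F z)")
        case True
        let ?P = "pderiv (lp q z j)"
        let ?s = "wsq ?P"
        have zC: "z \<in> Cub" by (rule lines_cube[OF l])
        have t: "(norm (tang j z))\<^sup>2 > 0" "(norm (tang j z))\<^sup>2 \<le> c4 * h\<^sup>2"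
          using tangent_norm[OF zC, of j] tangent_nz[OF zC, of j] by (simp_all add: tang_def)
        have c: "1 / (c4 * h\<^sup>2) \<le> coef j z" using t True by (simp add: coef_def frac_le)
        have Wm: "min 1 m ^ CARD('n) \<le> W j z"
        proof -
          have "min 1 m ^ CARD('n) \<le> min 1 m ^ card (UNIV - {j})"
            using m(2) by (intro power_decreasing card_mono) auto
          also have "\<dots> = (\<Prod>i\<in>UNIV - {j}. min 1 m)" by simp
          also have "\<dots> \<le> W j z" unfolding W_def
            using m l by (intro prod_mono) (auto simp: lines_def intro: min.coboundedI2)
          finally show ?thesis .
        qed
        have I: "c1 * h ^ CARD('n) * ?s \<le> I j z"
        proof -
          have "c1 * h ^ CARD('n) * ?s = ip (smult (c1 * h ^ CARD('n)) ([:0, 1, - 1:] * ?P ^ 2))" by (simp only: ip_smult wsq_def)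
          also have "\<dots> \<le> I j z" unfolding I_def gq
          proof (rule ip_mono)
            fix x :: real assume x: "x \<in> {0..1}"
            have "c1 * h ^ CARD('n) \<le> \<alpha> (j, z) + \<beta> (j, z) * x"
              unfolding ab(2)[OF l x] by (rule det_ge[OF upd_cube[OF zC x]])
            then have "c1 * h ^ CARD('n) * (x * (1 - x) * (poly ?P x)\<^sup>2) \<le> (\<alpha> (j, z) + \<beta> (j, z) * x) * (x * (1 - x) * (poly ?P x)\<^sup>2)"
              using x by (intro mult_right_mono) auto
            then show "poly (smult (c1 * h ^ CARD('n)) ([:0, 1, - 1:] * ?P ^ 2)) x \<le> poly ([:\<alpha> (j, z), \<beta> (j, z):] * fl q z j * ?P) x"
              by (simp add: fl_def power2_eq_square algebra_simps)
          qed
          finally show ?thesis .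
        qed
        have s0: "?s \<ge> 0" by (rule wsq_nonneg)
        have "min 1 m ^ CARD('n) * (c1 * h ^ CARD('n) * ?s) \<le> W j z * I j z"
          using Wm I s0 m(2) cpos h(2) W_pos[OF l] by (intro mult_mono) auto
        then have "1 / (c4 * h\<^sup>2) * (min 1 m ^ CARD('n) * (c1 * h ^ CARD('n) * ?s)) \<le> coef j z * (W j z * I j z)"
          by (rule mult_mono[OF c]) (use s0 m(2) cpos h(2) in \<open>auto simp: coef_def\<close>)
        moreover have "?b * ?s = 1 / (c4 * h\<^sup>2) * (min 1 m ^ CARD('n) * (c1 * h ^ CARD('n) * ?s))"
          unfolding times_divide_eq_right times_divide_eq_left divide_divide_eq_left mult_1 by (simp only: mult_ac)
        ultimately show ?thesis using True by (simp only: if_True)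
      qed (simp add: coef_def)
    qed
    finally show "?b * energy q \<le> e" .
  qed
qed

end

context lobatto
begin

text \<open>Cells, Jacobians and selections are quantified after \<open>C\<close>, so the constant
  depends only on the Lobatto rule and the dimension. A retained summand has norm |\<phi>| /
  |\<tau>|, where |\<tau>| is at least sqrt(c3) h, the Lagrange factors are bounded by a constant, s
  (1 - s) is at most 1, and the derivative is bounded by its weighted norm.\<close>

lemma line_field_bound:
  "\<exists>C>0. \<forall>K F J h c1 c3 c4 chi. line_fields K F J h c1 c3 c4 k N w \<longrightarrow>
     (\<forall>(g :: real ^ 'n::finite \<Rightarrow> real) x. Qfun (k - 1) g \<longrightarrow> x \<in> cbox 0 1 \<longrightarrow>
       c3 * h\<^sup>2 * (norm (line_fields.V F J N chi g x))\<^sup>2 \<le> C * line_fields.energy F N chi g)"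
proof -
  obtain C where C: "C > 0" "\<And>p x. degree p \<le> k \<Longrightarrow> x \<in> {0..1} \<Longrightarrow> (poly p x)\<^sup>2 \<le> C * wsq p"
    using weighted_sup_bound[of k] unfolding wsq_def[symmetric] by blast
  have "\<exists>b. \<forall>x\<in>{0..1}. \<bar>poly (lagr N u) x\<bar> \<le> b" for u
  proof -
    have "bounded (poly (lagr N u) ` {0..1})"
      by (intro compact_imp_bounded compact_continuous_image continuous_intros) auto
    then show ?thesis by (auto simp: bounded_iff)
  qed
  then obtain b where b: "\<And>u x. x \<in> {0..1} \<Longrightarrow> \<bar>poly (lagr N u) x\<bar> \<le> b u" by metis
  define \<Lambda> where "\<Lambda> = 1 + (\<Sum>u\<in>N. \<bar>b u\<bar>)"
  have \<Lambda>: "\<Lambda> \<ge> 1" unfolding \<Lambda>_def by (simp add: sum_nonneg)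
  have b\<Lambda>: "\<bar>poly (lagr N u) x\<bar> \<le> \<Lambda>" if "u \<in> N" "x \<in> {0..1}" for u x
  proof -
    have "b u \<le> \<bar>b u\<bar>" by simp
    also have "\<dots> \<le> (\<Sum>u\<in>N. \<bar>b u\<bar>)" using that(1) N(1) by (intro member_le_sum) auto
    finally show ?thesis using b[OF that(2), of u] by (simp add: \<Lambda>_def)
  qed
  let ?L = "real (card (lines :: ('n \<times> (real ^ 'n)) set))"
  \<comment> \<open>The added 1 makes the constant positive without exhibiting a line.\<close>
  define M where "M = (?L + 1)\<^sup>2 * (\<Lambda> ^ CARD('n))\<^sup>2 * C"
  have "M > 0" unfolding M_def using \<Lambda> C(1) by (intro mult_pos_pos zero_less_power) auto
  moreover have "c3 * h\<^sup>2 * (norm (line_fields.V F J N chi g x))\<^sup>2 \<le> M * line_fields.energy F N chi g"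
    if lf: "line_fields K F J h c1 c3 c4 k N w" and g: "Qfun (k - 1) g" and x: "x \<in> cbox 0 1"
    for K F J h c1 c3 c4 chi and g :: "real ^ 'n \<Rightarrow> real" and x
  proof -
    interpret L: line_fields K F J h c1 c3 c4 k N w chi by (rule lf)
    let ?S = "L.energy g" and ?r = "sqrt (c3 * h\<^sup>2)"
    have S: "?S \<ge> 0" by (rule L.energy_nonneg)
    have r: "?r > 0" using L.cpos L.h(2) by simp
    have tbound: "?r * norm ((L.coef j z * \<phi> j z (fl g z j) x) *\<^sub>R L.tang j z) \<le> \<Lambda> ^ CARD('n) * sqrt (C * ?S)"
      if l: "(j, z) \<in> lines" for j z
    proof (cases "chi (F z)")
      case True
      let ?P = "pderiv (lp g z j)"
      have zC: "z \<in> cbox 0 1" by (rule lines_cube[OF l])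
      have xj: "x $ i \<in> {0..1}" for i using x by (simp add: mem_box_cart)
      have t: "norm (L.tang j z) > 0" using L.tangent_nz[OF zC, of j] by (simp add: L.tang_def)
      have t2: "?r \<le> norm (L.tang j z)"
        unfolding L.tang_def by (rule real_le_lsqrt[OF norm_ge_zero L.tangent_norm(1)[OF zC]])
      note t = t t2
      have P: "\<bar>poly ?P (x $ j)\<bar> \<le> sqrt (C * ?S)"
      proof (rule real_le_rsqrt)
        have "degree ?P \<le> k" using lp(2)[OF g, of z j] by (simp add: degree_pderiv)
        then have "(poly ?P (x $ j))\<^sup>2 \<le> C * wsq ?P" by (rule C(2)[OF _ xj])
        also have "\<dots> \<le> C * ?S" using L.energy_line[OF l True] C(1) by (intro mult_left_mono) auto
        finally show "\<bar>poly ?P (x $ j)\<bar>\<^sup>2 \<le> C * ?S" by simp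
      qed
      have fl: "\<bar>poly (fl g z j) (x $ j)\<bar> \<le> sqrt (C * ?S)"
      proof -
        have xx: "0 \<le> x $ j * (1 - x $ j)" "x $ j * (1 - x $ j) \<le> 1" using xj[of j] by (auto intro: mult_le_one)
        have "poly (fl g z j) (x $ j) = (x $ j * (1 - x $ j)) * poly ?P (x $ j)" by (simp add: fl_def algebra_simps)
        then have "\<bar>poly (fl g z j) (x $ j)\<bar> = (x $ j * (1 - x $ j)) * \<bar>poly ?P (x $ j)\<bar>" using xx(1) by (simp only: abs_mult[of "x $ j * (1 - x $ j)"] abs_of_nonneg)
        also have "\<dots> \<le> 1 * \<bar>poly ?P (x $ j)\<bar>" by (rule mult_right_mono[OF xx(2)]) simp
        finally show ?thesis using P by simp
      qed
      have "\<bar>\<phi> j z (fl g z j) x\<bar> = \<bar>poly (fl g z j) (x $ j)\<bar> * (\<Prod>i\<in>UNIV - {j}. \<bar>poly (lagr N (z $ i)) (x $ i)\<bar>)"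
        unfolding \<phi>_def abs_prod by (subst prod.remove[of _ j]) (auto simp: gline_def intro!: prod.cong)
      also have "\<dots> \<le> sqrt (C * ?S) * (\<Prod>i\<in>UNIV - {j}. \<Lambda>)"
        using l xj by (intro mult_mono fl prod_mono prod_nonneg) (auto simp: lines_def b\<Lambda> C(1) S less_imp_le)
      finally have le: "\<bar>\<phi> j z (fl g z j) x\<bar> \<le> sqrt (C * ?S) * (\<Prod>i\<in>UNIV - {j}. \<Lambda>)" .
      have pr: "(\<Prod>i\<in>UNIV - {j}. \<Lambda>) \<le> \<Lambda> ^ CARD('n)"
        using \<Lambda> by (simp, intro power_increasing) auto
      have "sqrt (C * ?S) * (\<Prod>i\<in>UNIV - {j}. \<Lambda>) \<le> sqrt (C * ?S) * \<Lambda> ^ CARD('n)"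
        using C(1) S by (intro mult_left_mono[OF pr]) simp
      with le have \<phi>: "\<bar>\<phi> j z (fl g z j) x\<bar> \<le> \<Lambda> ^ CARD('n) * sqrt (C * ?S)"
        by (simp only: mult.commute[of "\<Lambda> ^ CARD('n)"])
      have "norm ((L.coef j z * \<phi> j z (fl g z j) x) *\<^sub>R L.tang j z) = \<bar>\<phi> j z (fl g z j) x\<bar> / norm (L.tang j z)"
        using True t(1) by (simp add: L.coef_def abs_mult power2_eq_square)
      then have "?r * norm ((L.coef j z * \<phi> j z (fl g z j) x) *\<^sub>R L.tang j z) = (?r / norm (L.tang j z)) * \<bar>\<phi> j z (fl g z j) x\<bar>"
        by simp
      also have "\<dots> \<le> 1 * \<bar>\<phi> j z (fl g z j) x\<bar>"
        using t by (intro mult_right_mono) (auto simp: divide_le_eq)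
      finally show ?thesis using \<phi> by simp
    next
      case False
      then show ?thesis using \<Lambda> C(1) S by (simp add: L.coef_def)
    qed
    have "?r * norm (L.V g x) \<le> (\<Sum>jz\<in>lines. ?r * norm ((L.coef (fst jz) (snd jz) * \<phi> (fst jz) (snd jz) (fl g (snd jz) (fst jz)) x) *\<^sub>R L.tang (fst jz) (snd jz)))"
      unfolding L.V_def case_prod_unfold sum_distrib_left[symmetric] using r by (intro mult_left_mono norm_sum) auto
    also have "\<dots> \<le> (\<Sum>jz\<in>(lines :: ('n \<times> (real ^ 'n)) set). \<Lambda> ^ CARD('n) * sqrt (C * ?S))"
      by (intro sum_mono tbound) simp
    also have "\<dots> \<le> (?L + 1) * (\<Lambda> ^ CARD('n) * sqrt (C * ?S))"
      using \<Lambda> C(1) S by (simp add: distrib_right)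
    finally have "(?r * norm (L.V g x))\<^sup>2 \<le> ((?L + 1) * (\<Lambda> ^ CARD('n) * sqrt (C * ?S)))\<^sup>2"
      by (rule power_mono) (use r in simp)
    then show ?thesis
      using L.cpos L.h(2) C(1) S by (simp add: power_mult_distrib M_def mult_ac)
  qed
  ultimately show ?thesis by blast
qed

end

section \<open>Continuity across faces\<close>

text \<open>Since 0 and 1 are nodes, a Lagrange factor vanishes at a boundary coordinate of
  \<open>y\<close> unless the line has the same coordinate, and the longitudinal factor vanishes at
  the ends of its line. So the value at \<open>y\<close> involves only lines in the smallest face
  containing it, which is what neighbouring cells share.\<close>

lemma (in line_fields) V_good_lines:
  assumes y: "y \<in> Cub"
  shows "V g y = (\<Sum>(j, z)\<in>{(j, z) \<in> lines. y $ j \<notin> {0, 1} \<and> z \<in> carrier y}. (coef j z * \<phi> j z (fl g z j) y) *\<^sub>R tang j z)"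
  unfolding V_def
proof (rule sum.mono_neutral_right[OF finite_lines])
  show "\<forall>jz\<in>lines - {(j, z) \<in> lines. y $ j \<notin> {0, 1} \<and> z \<in> carrier y}. (case jz of (j, z) \<Rightarrow> (coef j z * \<phi> j z (fl g z j) y) *\<^sub>R tang j z) = 0"
  proof
    fix jz :: "'n \<times> (real ^ 'n)" assume jz: "jz \<in> lines - {(j, z) \<in> lines. y $ j \<notin> {0, 1} \<and> z \<in> carrier y}"
    obtain j z where [simp]: "jz = (j, z)" by (cases jz)
    have l: "(j, z) \<in> lines" and no: "y $ j \<in> {0, 1} \<or> z \<notin> carrier y" using jz by auto
    have "\<phi> j z (fl g z j) y = 0"
    proof (cases "y $ j \<in> {0, 1}")
      case True
      then have "poly (gline j z (fl g z j) j) (y $ j) = 0" using fl_ends[of g z j] by (auto simp: gline_def)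
      then show ?thesis unfolding \<phi>_def by (intro prod_zero) auto
    next
      case False
      then have "\<exists>i. y $ i \<in> {0, 1} \<and> z $ i \<noteq> y $ i"
        using no lines_cube[OF l] unfolding carrier_def by blast
      then obtain i where i: "y $ i \<in> {0, 1}" "z $ i \<noteq> y $ i" by blast
      then have ij: "i \<noteq> j" using False by auto
      have "y $ i \<in> N" using i(1) N(4,5) by auto
      then have "poly (gline j z (fl g z j) i) (y $ i) = 0"
        using ij i(2) by (simp add: gline_def lagr_delta[OF N(1)])
      then show ?thesis unfolding \<phi>_def by (intro prod_zero) auto
    qed
    then show "(case jz of (j, z) \<Rightarrow> (coef j z * \<phi> j z (fl g z j) y) *\<^sub>R tang j z) = 0" by simp
  qed
qed auto

text \<open>By \<open>move\<close> every line that can contribute at \<open>y\<close> has its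
  midpoint in \<open>f\<close>, where \<open>chi\<close> rejects it.\<close>

lemma (in line_fields) V_vanish:
  assumes y: "y \<in> Cub" and f: "f face_of K" "F y \<in> f" "\<And>p. p \<in> f \<Longrightarrow> \<not> chi p"
  shows "V g y = 0"
  unfolding V_good_lines[OF y]
proof (rule sum.neutral, rule ballI)
  fix jz :: "'n \<times> (real ^ 'n)"
  assume jz0: "jz \<in> {(j, z) \<in> lines. y $ j \<notin> {0, 1} \<and> z \<in> carrier y}"
  obtain j z where jz: "jz = (j, z)" by (cases jz)
  have "z \<in> carrier y" using jz0 jz by simp
  then have "\<not> chi (F z)" using f(3)[OF move[OF f(1) y f(2)]] by simp
  then show "(case jz of (j, z) \<Rightarrow> (coef j z * \<phi> j z (fl g z j) y) *\<^sub>R tang j z) = 0" by (simp add: coef_def jz)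
qed

text \<open>The matching of the common face maps grid lines to grid lines, because the node set is
  symmetric, and it preserves every summand: selection and coefficient depend only on the image of
  the midpoint and the squared tangent length, and the two signs of a reversed line cancel.\<close>

lemma V_agree:
  fixes K K' :: "(real ^ 'n::finite) set" and q :: "real ^ 'n \<Rightarrow> real"
  assumes c: "line_fields K F J h c1 c3 c4 k N w" "line_fields K' F' J' h' c1' c3' c4' k N w"
    and fc: "(K \<inter> K') face_of K" "(K \<inter> K') face_of K'" "K \<noteq> K'"
    and y: "y \<in> cbox 0 1" "y' \<in> cbox 0 1" "F y = F' y'"
    and g: "Qfun (k - 1) g" "\<And>x. x \<in> cbox 0 1 \<Longrightarrow> q (F x) = g x"
    and g': "Qfun (k - 1) g'" "\<And>x. x \<in> cbox 0 1 \<Longrightarrow> q (F' x) = g' x"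
  shows "line_fields.V F J N chi g y = line_fields.V F' J' N chi g' y'"
proof -
  interpret c: line_fields K F J h c1 c3 c4 k N w chi by (rule c(1))
  interpret d: line_fields K' F' J' h' c1' c3' c4' k N w chi by (rule c(2))
  define A where "A = {i. y $ i \<notin> {0, 1}}"
  define A' where "A' = {i. y' $ i \<notin> {0, 1}}"
  have cc: "cell K F J h c1 c3 c4" "cell K' F' J' h' c1' c3' c4'" by unfold_locales
  obtain T \<tau> S where \<tau>0: "bij_betw \<tau> {i. y' $ i \<notin> {0, 1}} {i. y $ i \<notin> {0, 1}}"
    and T0: "\<forall>z\<in>c.carrier y. T z \<in> d.carrier y' \<and> F' (T z) = F z \<and>
        (\<forall>i. y' $ i \<notin> {0, 1} \<longrightarrow> T z $ i = (if i \<in> S then 1 - z $ \<tau> i else z $ \<tau> i))"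
    and onto0: "\<forall>w\<in>d.carrier y'. \<exists>z\<in>c.carrier y. T z = w"
    using cells_matching[OF cc fc y] by (elim exE conjE) (rule that)
  have \<tau>: "bij_betw \<tau> A' A" using \<tau>0 by (simp only: A_def A'_def)
  have T: "T z \<in> d.carrier y'" "F' (T z) = F z" if "z \<in> c.carrier y" for z using T0 that by auto
  have Tn: "T z $ i = (if i \<in> S then 1 - z $ \<tau> i else z $ \<tau> i)" if "z \<in> c.carrier y" "i \<in> A'" for z i
    using T0 that by (simp add: A'_def)
  have inC: "z \<in> cbox 0 1" if "z \<in> c.carrier y" for z using that by (simp add: c.carrier_def)
  have inC': "z \<in> cbox 0 1" if "z \<in> d.carrier y'" for z using that by (simp add: d.carrier_def)
  have out: "z $ i = y $ i" if "z \<in> c.carrier y" "i \<notin> A" for z i using that by (auto simp: c.carrier_def A_def)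
  have out': "z $ i = y' $ i" if "z \<in> d.carrier y'" "i \<notin> A'" for z i using that by (auto simp: d.carrier_def A'_def)
  have T_inj: "z = u" if "z \<in> c.carrier y" "u \<in> c.carrier y" "T z = T u" for z u
    using T(2)[OF that(1)] T(2)[OF that(2)] that(3) c.F_eq_iff[OF inC[OF that(1)] inC[OF that(2)]] by simp
  have Ty: "T y = y'"
    using T[OF c.carrier_self[OF y(1)]] y(3) d.F_eq_iff[OF inC'[OF T(1)[OF c.carrier_self[OF y(1)]]] y(2)] by simp
  have y'n: "y' $ i = (if i \<in> S then 1 - y $ \<tau> i else y $ \<tau> i)" if "i \<in> A'" for i
    using Tn[OF c.carrier_self[OF y(1)] that] by (simp add: Ty)
  have \<tau>A: "\<tau> i \<in> A" if "i \<in> A'" for i using \<tau> that by (auto simp: bij_betw_def)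
  have \<tau>_inj: "\<tau> i = \<tau> l \<longleftrightarrow> i = l" if "i \<in> A'" "l \<in> A'" for i l
    using \<tau> that by (auto simp: bij_betw_def dest: inj_onD)
  have \<tau>_onto: "\<exists>i'. i' \<in> A' \<and> i = \<tau> i'" if "i \<in> A" for i
    using \<tau> that by (auto simp: bij_betw_def)
  define Ti where "Ti u = (SOME z. z \<in> c.carrier y \<and> T z = u)" for u
  have Ti: "Ti u \<in> c.carrier y" "T (Ti u) = u" if "u \<in> d.carrier y'" for u
  proof -
    have "\<exists>z. z \<in> c.carrier y \<and> T z = u" using onto0 that by blast
    from someI_ex[OF this] show "Ti u \<in> c.carrier y" "T (Ti u) = u" unfolding Ti_def by auto
  qed
  have TiT: "Ti (T z) = z" if "z \<in> c.carrier y" for z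
    using T_inj[OF Ti(1)[OF T(1)[OF that]] that] Ti(2)[OF T(1)[OF that]] by simp
  have zeroone: "0 \<in> N" "1 \<in> N" using c.N(4,5) by auto
  let ?G = "{(j, z) \<in> c.lines. y $ j \<notin> {0, 1} \<and> z \<in> c.carrier y}"
  let ?G' = "{(j, z) \<in> c.lines. y' $ j \<notin> {0, 1} \<and> z \<in> d.carrier y'}"
  have termeq: "(c.coef (\<tau> j') z * c.\<phi> (\<tau> j') z (c.fl g z (\<tau> j')) y) *\<^sub>R c.tang (\<tau> j') z
      = (d.coef j' (T z) * c.\<phi> j' (T z) (c.fl g' (T z) j') y') *\<^sub>R d.tang j' (T z)"
    if l: "(\<tau> j', z) \<in> c.lines" and j': "j' \<in> A'" and z: "z \<in> c.carrier y" for j' z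
  proof -
    define j where "j = \<tau> j'"
    define \<sigma> where "\<sigma> s = (if j' \<in> S then 1 - s else s)" for s :: real
    \<comment> \<open>The sign of a reversed line. It enters through the tangent and again through
      the derivative of q along the line, so it disappears from the product.\<close>
    define \<epsilon> :: real where "\<epsilon> = (if j' \<in> S then - 1 else 1)"
    have jA: "j \<in> A" using \<tau>A[OF j'] by (simp add: j_def)
    have zC: "z \<in> cbox 0 1" "T z \<in> cbox 0 1" using inC[OF z] inC'[OF T(1)[OF z]] .
    have \<sigma>01: "\<sigma> s \<in> {0..1}" if "s \<in> {0..1}" for s using that by (simp add: \<sigma>_def)
    have Fline: "F (upd z j s) = F' (upd (T z) j' (\<sigma> s))" if s: "s \<in> {0..1}" for s
    proof -
      have u: "upd z j s \<in> c.carrier y" using z jA upd_cube[OF zC(1) s] by (auto simp: c.carrier_def A_def)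
      have "T (upd z j s) = upd (T z) j' (\<sigma> s)"
      proof (subst vec_eq_iff, rule allI)
        fix i
        show "T (upd z j s) $ i = upd (T z) j' (\<sigma> s) $ i"
        proof (cases "i \<in> A'")
          case True
          then show ?thesis
            using Tn[OF u True] Tn[OF z True] \<tau>_inj[OF True j'] by (auto simp: \<sigma>_def j_def)
        next
          case False
          then show ?thesis using out'[OF T(1)[OF u] False] out'[OF T(1)[OF z] False] j' by auto
        qed
      qed
      then show ?thesis using T(2)[OF u] by simp
    qed
    have tg: "c.tang j z = F (upd z j 1) - F (upd z j 0)"
    proof -
      have l: "F (upd z j s) = F z + (s - z $ j) *\<^sub>R (J z *v axis j 1)" if "s \<in> {0..1}" for s
        by (rule c.line[OF zC(1) that])
      have "F (upd z j 1) = F z + (1 - z $ j) *\<^sub>R (J z *v axis j 1)"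
        "F (upd z j 0) = F z + (0 - z $ j) *\<^sub>R (J z *v axis j 1)" by (rule l, simp)+
      then show ?thesis unfolding c.tang_def by (simp only:) (simp add: scaleR_left_diff_distrib)
    qed
    have tg': "d.tang j' (T z) = F' (upd (T z) j' 1) - F' (upd (T z) j' 0)"
    proof -
      have l: "F' (upd (T z) j' s) = F' (T z) + (s - (T z) $ j') *\<^sub>R (J' (T z) *v axis j' 1)" if "s \<in> {0..1}" for s
        by (rule d.line[OF zC(2) that])
      have "F' (upd (T z) j' 1) = F' (T z) + (1 - (T z) $ j') *\<^sub>R (J' (T z) *v axis j' 1)"
        "F' (upd (T z) j' 0) = F' (T z) + (0 - (T z) $ j') *\<^sub>R (J' (T z) *v axis j' 1)" by (rule l, simp)+
      then show ?thesis unfolding d.tang_def by (simp only:) (simp add: scaleR_left_diff_distrib)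
    qed
    have tang: "c.tang j z = \<epsilon> *\<^sub>R d.tang j' (T z)"
      unfolding tg tg' using Fline[of 0] Fline[of 1] by (simp add: \<sigma>_def \<epsilon>_def)
    have coef: "c.coef j z = d.coef j' (T z)"
      unfolding c.coef_def d.coef_def tang T(2)[OF z] by (simp add: \<epsilon>_def)
    define r where "r = (if j' \<in> S then [:1, - 1:] else [:0, 1 :: real:])"
    have r: "poly r s = \<sigma> s" for s by (simp add: r_def \<sigma>_def)
    \<comment> \<open>Both polynomials describe q on the same segment, so they agree at infinitely
      many parameters.\<close>
    have lpeq: "c.lp g z j = pcompose (c.lp g' (T z) j') r"
    proof (rule ccontr)
      assume "c.lp g z j \<noteq> pcompose (c.lp g' (T z) j') r"
      then have nz: "c.lp g z j - pcompose (c.lp g' (T z) j') r \<noteq> 0" by simp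
      have "poly (c.lp g z j) s = poly (c.lp g' (T z) j') (\<sigma> s)" if s: "s \<in> {0..1}" for s
        using g(2)[OF upd_cube[OF zC(1) s, of j]] g'(2)[OF upd_cube[OF zC(2) \<sigma>01[OF s], of j']] Fline[OF s]
        by (simp add: c.lp(1)[OF g(1)] c.lp(1)[OF g'(1)])
      then have "{0..1} \<subseteq> {s. poly (c.lp g z j - pcompose (c.lp g' (T z) j') r) s = 0}"
        by (auto simp: poly_pcompose r)
      then have "finite {0..1 :: real}" using poly_roots_finite[OF nz] finite_subset by blast
      then show False using infinite_Icc[of "0 :: real" 1] by simp
    qed
    have pd: "pderiv (c.lp g z j) = smult \<epsilon> (pcompose (pderiv (c.lp g' (T z) j')) r)"
      unfolding lpeq pderiv_pcompose by (simp add: r_def \<epsilon>_def pderiv_pCons)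
    have yj: "y' $ j' = \<sigma> (y $ j)" using y'n[OF j'] by (simp add: \<sigma>_def j_def)
    have fl: "poly (c.fl g z j) (y $ j) = \<epsilon> * poly (c.fl g' (T z) j') (y' $ j')"
      unfolding c.fl_def pd yj by (simp add: poly_pcompose r) (simp add: \<sigma>_def algebra_simps)
    \<comment> \<open>At a coordinate fixed on the face, point and line share a node and the factor
      is 1 in either cell. The free coordinates correspond under \<tau>, and reflected factors agree
      by \<open>lagr_reflect\<close>.\<close>
    have prod: "(\<Prod>i\<in>UNIV - {j}. poly (lagr N (z $ i)) (y $ i)) = (\<Prod>i\<in>UNIV - {j'}. poly (lagr N (T z $ i)) (y' $ i))"
    proof -
      have "(\<Prod>i\<in>UNIV - {j}. poly (lagr N (z $ i)) (y $ i)) = (\<Prod>i\<in>A - {j}. poly (lagr N (z $ i)) (y $ i))"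
      proof (rule prod.mono_neutral_right)
        show "\<forall>i\<in>UNIV - {j} - (A - {j}). poly (lagr N (z $ i)) (y $ i) = 1"
        proof
          fix i assume "i \<in> UNIV - {j} - (A - {j})"
          then have i: "i \<notin> A" by auto
          then have "y $ i \<in> N" using zeroone by (auto simp: A_def)
          then show "poly (lagr N (z $ i)) (y $ i) = 1" using out[OF z i] by (simp add: lagr_delta[OF c.N(1)])
        qed
      qed auto
      also have "\<dots> = (\<Prod>i\<in>A' - {j'}. poly (lagr N (z $ \<tau> i)) (y $ \<tau> i))"
      proof -
        have "bij_betw \<tau> (A' - {j'}) (A - {j})"
          unfolding j_def using bij_betw_DiffI[OF \<tau>, of "{j'}" "{\<tau> j'}"] j' \<tau>A[OF j'] by (simp add: bij_betw_def)
        from prod.reindex_bij_betw[OF this, of "\<lambda>i. poly (lagr N (z $ i)) (y $ i)"] show ?thesis by simp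
      qed
      also have "\<dots> = (\<Prod>i\<in>A' - {j'}. poly (lagr N (T z $ i)) (y' $ i))"
      proof (rule prod.cong[OF refl])
        fix i assume "i \<in> A' - {j'}"
        then have i: "i \<in> A'" by simp
        show "poly (lagr N (z $ \<tau> i)) (y $ \<tau> i) = poly (lagr N (T z $ i)) (y' $ i)"
          unfolding Tn[OF z i] y'n[OF i] using lagr_reflect[OF c.reflect, of "z $ \<tau> i" "y $ \<tau> i"] by simp
      qed
      also have "\<dots> = (\<Prod>i\<in>UNIV - {j'}. poly (lagr N (T z $ i)) (y' $ i))"
      proof (rule prod.mono_neutral_left)
        show "\<forall>i\<in>UNIV - {j'} - (A' - {j'}). poly (lagr N (T z $ i)) (y' $ i) = 1"
        proof
          fix i assume "i \<in> UNIV - {j'} - (A' - {j'})"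
          then have i: "i \<notin> A'" by auto
          then have "y' $ i \<in> N" using zeroone by (auto simp: A'_def)
          then show "poly (lagr N (T z $ i)) (y' $ i) = 1" using out'[OF T(1)[OF z] i] by (simp add: lagr_delta[OF c.N(1)])
        qed
      qed auto
      finally show ?thesis .
    qed
    have \<phi>_split: "c.\<phi> i u f x = poly f (x $ i) * (\<Prod>l\<in>UNIV - {i}. poly (lagr N (u $ l)) (x $ l))" for i u f and x :: "real ^ 'n"
      unfolding c.\<phi>_def by (subst prod.remove[of _ i]) (auto simp: c.gline_def intro!: prod.cong)
    have "c.\<phi> j z (c.fl g z j) y = \<epsilon> * c.\<phi> j' (T z) (c.fl g' (T z) j') y'"
      unfolding \<phi>_split fl prod by simp
    moreover have "\<epsilon> * \<epsilon> = 1" by (simp add: \<epsilon>_def)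
    ultimately have "(c.coef j z * c.\<phi> j z (c.fl g z j) y) *\<^sub>R c.tang j z = (d.coef j' (T z) * c.\<phi> j' (T z) (c.fl g' (T z) j') y') *\<^sub>R d.tang j' (T z)"
      unfolding coef tang by (simp add: mult_ac)
    then show ?thesis by (simp add: j_def)
  qed
  have "(\<Sum>(j, z)\<in>?G. (c.coef j z * c.\<phi> j z (c.fl g z j) y) *\<^sub>R c.tang j z)
      = (\<Sum>(j, z)\<in>?G'. (d.coef j z * c.\<phi> j z (c.fl g' z j) y') *\<^sub>R d.tang j z)"
  proof (rule sum.reindex_bij_witness[of _ "\<lambda>(j', u). (\<tau> j', Ti u)" "\<lambda>(j, z). (inv_into A' \<tau> j, T z)"])
    have inv: "inv_into A' \<tau> (\<tau> j') = j'" if "j' \<in> A'" for j'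
      using \<tau> that by (simp add: bij_betw_def)
    have inv2: "\<tau> (inv_into A' \<tau> j) = j" "inv_into A' \<tau> j \<in> A'" if "j \<in> A" for j
      using \<tau> that by (auto simp: bij_betw_def f_inv_into_f inv_into_into)
    fix jz :: "'n \<times> (real ^ 'n)" assume "jz \<in> ?G"
    then obtain j z where jz: "jz = (j, z)" "(j, z) \<in> c.lines" "j \<in> A" "z \<in> c.carrier y" by (auto simp: A_def)
    let ?j = "inv_into A' \<tau> j"
    note j' = inv2[OF jz(3)]
    show "(case case jz of (j, z) \<Rightarrow> (inv_into A' \<tau> j, T z) of (j', u) \<Rightarrow> (\<tau> j', Ti u)) = jz"
      using j' TiT[OF jz(4)] by (simp add: jz(1))
    have "(?j, T z) \<in> c.lines"
    proof -
      have "T z $ ?j = 1 / 2" using Tn[OF jz(4) j'(2)] j'(1) jz(2) by (simp add: c.lines_def)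
      moreover have "T z $ i \<in> N" if "i \<noteq> ?j" for i
      proof (cases "i \<in> A'")
        case True
        then have "\<tau> i \<noteq> j" using \<tau>_inj[OF True j'(2)] j'(1) that by auto
        then have "z $ \<tau> i \<in> N" using jz(2) by (simp add: c.lines_def)
        then show ?thesis using Tn[OF jz(4) True] c.reflect by simp
      next
        case False
        then show ?thesis using out'[OF T(1)[OF jz(4)] False] zeroone by (auto simp: A'_def)
      qed
      ultimately show ?thesis by (simp add: c.lines_def)
    qed
    then show "(case jz of (j, z) \<Rightarrow> (inv_into A' \<tau> j, T z)) \<in> ?G'"
      using j'(2) T(1)[OF jz(4)] by (simp add: jz(1) A'_def)
    show "(case case jz of (j, z) \<Rightarrow> (inv_into A' \<tau> j, T z) of (j, z) \<Rightarrow> (d.coef j z * c.\<phi> j z (c.fl g' z j) y') *\<^sub>R d.tang j z)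
       = (case jz of (j, z) \<Rightarrow> (c.coef j z * c.\<phi> j z (c.fl g z j) y) *\<^sub>R c.tang j z)"
      using termeq[of ?j z] jz(2,4) j' by (simp add: jz(1))
  next
    have inv: "inv_into A' \<tau> (\<tau> j') = j'" if "j' \<in> A'" for j'
      using \<tau> that by (simp add: bij_betw_def)
    fix ju :: "'n \<times> (real ^ 'n)" assume "ju \<in> ?G'"
    then obtain j' u where ju: "ju = (j', u)" "(j', u) \<in> c.lines" "j' \<in> A'" "u \<in> d.carrier y'" by (auto simp: A'_def)
    note z = Ti[OF ju(4)]
    show "(case case ju of (j', u) \<Rightarrow> (\<tau> j', Ti u) of (j, z) \<Rightarrow> (inv_into A' \<tau> j, T z)) = ju"
      using inv[OF ju(3)] z by (simp add: ju(1))
    have "(\<tau> j', Ti u) \<in> c.lines"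
    proof -
      have "u $ j' = 1 / 2" using ju(2) by (simp add: c.lines_def)
      then have "Ti u $ \<tau> j' = 1 / 2" using Tn[OF z(1) ju(3)] z(2) by (auto split: if_splits)
      moreover have "Ti u $ i \<in> N" if "i \<noteq> \<tau> j'" for i
      proof (cases "i \<in> A")
        case True
        then obtain i' where i': "i' \<in> A'" "i = \<tau> i'" using \<tau>_onto by blast
        then have "u $ i' \<in> N" using that ju(2) by (auto simp: c.lines_def)
        moreover have "Ti u $ i = u $ i' \<or> Ti u $ i = 1 - u $ i'" using Tn[OF z(1) i'(1)] z(2) i'(2) by (auto split: if_splits)
        ultimately show ?thesis using c.reflect by auto
      next
        case False
        then show ?thesis using out[OF z(1) False] zeroone by (auto simp: A_def)
      qed
      ultimately show ?thesis by (simp add: c.lines_def)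
    qed
    then show "(case ju of (j', u) \<Rightarrow> (\<tau> j', Ti u)) \<in> ?G"
      using z(1) \<tau>A[OF ju(3)] by (simp add: ju(1) A_def)
  qed
  then show ?thesis unfolding c.V_good_lines[OF y(1)] d.V_good_lines[OF y(2)] .
qed

section \<open>Finite element functions\<close>

lemma change_of_variables_2_3:
  fixes F :: "real ^ 'n::finite \<Rightarrow> real ^ 'n" and G :: "real ^ 'n \<Rightarrow> real"
  assumes card: "CARD('n) = 2 \<or> CARD('n) = 3"
    and der: "\<And>x. x \<in> cbox 0 1 \<Longrightarrow> (F has_derivative (\<lambda>\<xi>. J x *v \<xi>)) (at x within cbox 0 1)"
    and inj: "inj_on F (cbox 0 1)" and K: "F ` cbox 0 1 = K" "bounded K"
    and G: "G integrable_on K" "(\<lambda>x. norm (G x)) integrable_on K"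
  shows "integral K G = integral (cbox 0 1) (\<lambda>x. \<bar>det (J x)\<bar> * G (F x))"
  using card
proof
  assume "CARD('n) = 2"
  then have "card (UNIV :: 2 set) = card (UNIV :: 'n set)" by simp
  then obtain \<pi> :: "2 \<Rightarrow> 'n" where "bij_betw \<pi> UNIV UNIV"
    using finite_same_card_bij[of "UNIV :: 2 set" "UNIV :: 'n set"] by auto
  then show ?thesis by (intro change_of_variables_reindex[OF _ der inj K G]) auto
next
  assume "CARD('n) = 3"
  then have "card (UNIV :: 3 set) = card (UNIV :: 'n set)" by simp
  then obtain \<pi> :: "3 \<Rightarrow> 'n" where "bij_betw \<pi> UNIV UNIV"
    using finite_same_card_bij[of "UNIV :: 3 set" "UNIV :: 'n set"] by auto
  then show ?thesis by (intro change_of_variables_reindex[OF _ der inj K G]) auto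
qed

lemma norm_gradient_pairing: "onorm (\<lambda>h. \<gamma> \<bullet> h) \<le> norm (\<gamma> :: real ^ 'n::finite)"
  by (rule onorm_le) (simp add: Cauchy_Schwarz_ineq2)

locale mesh =
  fixes \<Omega> :: "(real ^ 'n::finite) set" and T :: "(real ^ 'n) set set" and F J c1 c3 c4
  assumes \<Omega>: "open \<Omega>" "bounded \<Omega>" and card: "CARD('n) = 2 \<or> CARD('n) = 3"
    and T: "finite T" "\<Union>T = closure \<Omega>"
    and cells: "\<And>K. K \<in> T \<Longrightarrow> cell K (F K) (J K) (diameter K) c1 c3 c4"
    and int\<Omega>: "\<And>K. K \<in> T \<Longrightarrow> interior K \<subseteq> \<Omega>"
    and faces: "\<And>K K'. K \<in> T \<Longrightarrow> K' \<in> T \<Longrightarrow> K \<noteq> K' \<Longrightarrow> (K \<inter> K') face_of K"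
begin

abbreviation "Cub \<equiv> cbox (0 :: real ^ 'n) 1"

text \<open>The identity is required at every point of the closed cell. As u is a single function,
  the values of neighbouring cells agree on common faces, so continuity is automatic.\<close>

definition FE :: "nat \<Rightarrow> (real ^ 'n \<Rightarrow> real) \<Rightarrow> bool" where
  "FE m u \<longleftrightarrow> (\<forall>K\<in>T. \<exists>g. Qfun m g \<and> (\<forall>y\<in>Cub. u (F K y) = g y))"

definition "U = (\<Union>K\<in>T. interior K)"

definition grad :: "(real ^ 'n \<Rightarrow> real) \<Rightarrow> real ^ 'n \<Rightarrow> real ^ 'n" where
  "grad u x = (if x \<in> U then \<chi> i. frechet_derivative u (at x) (axis i 1) else 0)"

lemma U: "open U" "U \<subseteq> \<Omega>" "negligible (closure \<Omega> - U)"
proof -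
  show "open U" "U \<subseteq> \<Omega>" using int\<Omega> by (auto simp: U_def)
  have "negligible (\<Union>K\<in>T. frontier K)"
  proof (rule negligible_Union)
    show "finite (frontier ` T)" using T(1) by simp
    fix X assume "X \<in> frontier ` T"
    then obtain K where K: "K \<in> T" "X = frontier K" by blast
    show "negligible X" unfolding K(2) by (rule negligible_convex_frontier[OF cell.K(1)[OF cells[OF K(1)]]])
  qed
  moreover have "closure \<Omega> - U \<subseteq> (\<Union>K\<in>T. frontier K)"
    unfolding T(2)[symmetric] U_def frontier_def using closure_subset by fastforce
  ultimately show "negligible (closure \<Omega> - U)" by (rule negligible_subset)
qed

lemma cell_point:
  assumes "K \<in> T" "x \<in> interior K"
  shows "\<exists>y\<in>box 0 1. x = F K y"
proof -
  interpret c: cell K "F K" "J K" "diameter K" c1 c3 c4 by (rule cells[OF assms(1)])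
  have "x \<in> K" using assms(2) interior_subset by blast
  then obtain y where y: "y \<in> Cub" "x = F K y" using c.K_obtain by blast
  then have "y \<in> box 0 1" using c.interior_box[OF y(1)] assms(2) by simp
  then show ?thesis using y by blast
qed

lemma grad_at:
  assumes K: "K \<in> T" and u: "\<And>y. y \<in> Cub \<Longrightarrow> u (F K y) = g y" and x: "x \<in> box 0 1"
    and g: "(g has_derivative (\<lambda>h. D \<bullet> h)) (at x)"
  shows "grad u (F K x) = D v* matrix_inv (J K x)" "(u has_derivative (\<lambda>h. grad u (F K x) \<bullet> h)) (at (F K x))"
proof -
  interpret c: cell K "F K" "J K" "diameter K" c1 c3 c4 by (rule cells[OF K])
  have d: "(u has_derivative (\<lambda>\<xi>. (D v* matrix_inv (J K x)) \<bullet> \<xi>)) (at (F K x))"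
    by (rule c.pullback_derivative[OF u x g])
  have "F K x \<in> U" using c.box_interior[OF x] K by (auto simp: U_def)
  then show e: "grad u (F K x) = D v* matrix_inv (J K x)"
    by (simp add: grad_def frechet_derivative_at[OF d, symmetric] inner_axis vec_eq_iff)
  show "(u has_derivative (\<lambda>h. grad u (F K x) \<bullet> h)) (at (F K x))" using d by (simp only: e)
qed

lemma FE_gradient:
  assumes "FE m u" "K \<in> T"
  shows "\<exists>g D. Qfun m g \<and> (\<forall>y\<in>Cub. u (F K y) = g y) \<and> (\<forall>x. (g has_derivative (\<lambda>h. D x \<bullet> h)) (at x)) \<and>
    (\<forall>i. continuous_on UNIV (\<lambda>x. D x $ i))"
proof -
  obtain g where g: "Qfun m g" "\<forall>y\<in>Cub. u (F K y) = g y" using assms by (auto simp: FE_def)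
  obtain d where d: "\<forall>i. Qfun m (d i)" "\<forall>x. (g has_derivative (\<lambda>h. \<Sum>i\<in>UNIV. d i x * h $ i)) (at x)"
    using Qfun_derivative[OF g(1)] by (elim exE conjE) (rule that)
  define D where "D x = (\<chi> i. d i x)" for x
  have "(g has_derivative (\<lambda>h. D x \<bullet> h)) (at x)" for x
    using d(2) by (simp add: inner_vec_def D_def)
  moreover have "continuous_on UNIV (\<lambda>x. D x $ i)" for i
    using Qfun_continuous[OF d(1)[rule_format]] by (simp add: D_def)
  ultimately show ?thesis using g by (intro exI[of _ g] exI[of _ D] conjI allI)
qed

text \<open>The gradient is bounded on the convex interior, the mean value inequality gives a
  Lipschitz constant there, and continuity extends it to the closed cell. The constant may depend on
  u and the mesh, since it serves only weak differentiability.\<close>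

lemma FE_cell_lipschitz:
  assumes u: "FE m u" and K: "K \<in> T"
  shows "continuous_on K u \<and> (\<exists>L\<ge>0. L-lipschitz_on K u)"
proof -
  interpret c: cell K "F K" "J K" "diameter K" c1 c3 c4 by (rule cells[OF K])
  obtain g D where g0: "Qfun m g" "\<forall>y\<in>Cub. u (F K y) = g y" "\<forall>x. (g has_derivative (\<lambda>h. D x \<bullet> h)) (at x)"
      and Dc0: "\<forall>i. continuous_on UNIV (\<lambda>x. D x $ i)" using FE_gradient[OF u K] by (elim exE conjE) (rule that)
  note g = g0(1) bspec[OF g0(2)] spec[OF g0(3)] and Dc = spec[OF Dc0]
  have "continuous_on K (inv_into Cub (F K))"
    using continuous_on_inv[OF c.F_cont compact_cbox, of "inv_into Cub (F K)"] inv_into_f_f[OF c.inj] by (simp add: c.img)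
  then have "continuous_on K (\<lambda>p. g (inv_into Cub (F K) p))"
    by (rule continuous_on_compose2[OF Qfun_continuous[OF g(1), of UNIV]]) auto
  moreover have "g (inv_into Cub (F K) p) = u p" if p: "p \<in> K" for p
  proof -
    obtain y where y: "y \<in> Cub" "p = F K y" using c.K_obtain[OF p] by blast
    then show ?thesis using inv_into_f_f[OF c.inj y(1)] g(2)[OF y(1)] by simp
  qed
  ultimately have cont: "continuous_on K u" by (simp cong: continuous_on_cong)
  have "\<forall>i. \<exists>b. \<forall>x\<in>Cub. \<bar>D x $ i\<bar> \<le> b"
  proof
    fix i
    have "bounded ((\<lambda>x. D x $ i) ` Cub)"
      by (intro compact_imp_bounded compact_continuous_image continuous_on_subset[OF Dc]) auto
    then show "\<exists>b. \<forall>x\<in>Cub. \<bar>D x $ i\<bar> \<le> b" by (auto simp: bounded_iff)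
  qed
  from choice[OF this] obtain b where b0: "\<forall>i. \<forall>x\<in>Cub. \<bar>D x $ i\<bar> \<le> b i" by blast
  have b: "\<bar>D x $ i\<bar> \<le> \<bar>b i\<bar>" if "x \<in> Cub" for i x
    using b0 that abs_ge_self[of "b i"] order.trans by blast
  define B where "B = (\<Sum>i\<in>UNIV. \<bar>b i\<bar>)"
  have B: "norm (D x) \<le> B" if "x \<in> Cub" for x
    unfolding B_def by (rule order.trans[OF norm_le_l1_cart sum_mono]) (rule b[OF that])
  have r: "c3 * (diameter K)\<^sup>2 > 0" using c.cpos c.h(2) by simp
  define L where "L = B / sqrt (c3 * (diameter K)\<^sup>2)"
  have "B \<ge> 0" unfolding B_def by (simp add: sum_nonneg)
  then have L: "L \<ge> 0" using r by (simp add: L_def)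
  have gradL: "norm (grad u p) \<le> L" if p: "p \<in> interior K" for p
  proof -
    obtain x where x: "x \<in> box 0 1" "p = F K x" using cell_point[OF K p] by blast
    have xC: "x \<in> Cub" using x(1) box_subset_cbox by blast
    have gp: "grad u (F K x) = D x v* matrix_inv (J K x)" by (rule grad_at(1)[OF K g(2) x(1) g(3)])
    have "c3 * (diameter K)\<^sup>2 * (norm (grad u p))\<^sup>2 \<le> (norm (D x))\<^sup>2"
      unfolding x(2) gp by (rule c.pullback_gradient_bound[OF xC])
    also have "\<dots> \<le> B\<^sup>2" using B[OF xC] by (intro power_mono) auto
    finally have "sqrt (c3 * (diameter K)\<^sup>2 * (norm (grad u p))\<^sup>2) \<le> sqrt (B\<^sup>2)" by (rule real_sqrt_le_mono)
    then have "sqrt (c3 * (diameter K)\<^sup>2) * norm (grad u p) \<le> B"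
      using \<open>B \<ge> 0\<close> by (simp only: real_sqrt_mult[of _ "(norm (grad u p))\<^sup>2"] real_sqrt_abs abs_norm_cancel abs_of_nonneg)
    then show ?thesis using r by (simp add: L_def pos_le_divide_eq mult.commute)
  qed
  have "L-lipschitz_on (interior K) u"
  proof (rule lipschitz_onI)
    fix p p' assume p: "p \<in> interior K" "p' \<in> interior K"
    have "norm (u p - u p') \<le> L * norm (p - p')"
    proof (rule differentiable_bound[of "interior K" u "\<lambda>x h. grad u x \<bullet> h"])
      show "convex (interior K)" by (rule convex_interior[OF c.K(1)])
      fix p assume p: "p \<in> interior K"
      then obtain x where x: "x \<in> box 0 1" "p = F K x" using cell_point[OF K] by blast
      show "(u has_derivative (\<lambda>h. grad u p \<bullet> h)) (at p within interior K)"
        unfolding x(2) by (rule has_derivative_at_withinI[OF grad_at(2)[OF K g(2) x(1) g(3)]])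
      show "onorm (\<lambda>h. grad u p \<bullet> h) \<le> L" by (rule order.trans[OF norm_gradient_pairing gradL[OF p]])
    qed (use p in auto)
    then show "dist (u p) (u p') \<le> L * dist p p'" by (simp add: dist_norm)
  qed (rule L)
  moreover have "closure (interior K) = K"
    using convex_closure_interior[OF c.K(1) c.int] compact_imp_closed[OF c.K(2)] by (simp add: closure_closed)
  ultimately have "L-lipschitz_on K u" using lipschitz_on_closure[of L "interior K" u] cont by simp
  then show ?thesis using cont L by blast
qed

lemma FE_piecewise_smooth:
  assumes u: "FE m u"
  shows "\<exists>L B. piecewise_smooth \<Omega> T U u (grad u) L B"
proof -
  have "\<forall>K\<in>T. \<exists>L\<ge>0. L-lipschitz_on K u" using FE_cell_lipschitz[OF u] by blast
  from bchoice[OF this] obtain L where L: "\<forall>K\<in>T. L K \<ge> 0 \<and> (L K)-lipschitz_on K u" by blast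
  have closedK: "closed K" if "K \<in> T" for K using cell.K(2)[OF cells[OF that]] by (rule compact_imp_closed)
  have "continuous_on (\<Union>K\<in>T. K) u"
    using T(1) closedK FE_cell_lipschitz[OF u] by (intro continuous_on_closed_Union) auto
  then have "continuous_on (closure \<Omega>) u" using T(2) by simp
  then have "bounded (u ` closure \<Omega>)"
    using \<Omega>(2) by (intro compact_imp_bounded compact_continuous_image) (auto simp: compact_closure)
  then obtain B where B: "\<forall>y\<in>u ` closure \<Omega>. norm y \<le> B" unfolding bounded_iff by blast
  \<comment> \<open>The sum of the local constants is a Lipschitz constant for all cells at
    once.\<close>
  have "piecewise_smooth \<Omega> T U u (grad u) (\<Sum>K\<in>T. L K) B"
  proof
    show "open \<Omega>" "bounded \<Omega>" "finite T" "open U" "U \<subseteq> \<Omega>" by (fact \<Omega> T U)+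
    show "closed K" if "K \<in> T" for K using closedK[OF that] .
    show "\<Omega> \<subseteq> \<Union>T" unfolding T(2) by (rule closure_subset)
    show "(\<Sum>K\<in>T. L K)-lipschitz_on K u" if "K \<in> T" for K
    proof -
      have "L K \<le> (\<Sum>K\<in>T. L K)" by (rule member_le_sum) (use L that T(1) in auto)
      then show ?thesis by (rule lipschitz_on_le[OF conjunct2[OF bspec[OF L that]]])
    qed
    show "(\<Sum>K\<in>T. L K) \<ge> 0" using L by (intro sum_nonneg) auto
    show "negligible (\<Omega> - U)" by (rule negligible_subset[OF U(3)]) (use closure_subset[of \<Omega>] in auto)
    show "(u has_derivative (\<lambda>h. grad u x \<bullet> h)) (at x)" if x: "x \<in> U" for x
    proof -
      obtain K where K: "K \<in> T" "x \<in> interior K" using x unfolding U_def by blast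
      obtain y where y: "y \<in> box 0 1" "x = F K y" using cell_point[OF K] by blast
      obtain g D where g0: "Qfun m g" "\<forall>y\<in>Cub. u (F K y) = g y" "\<forall>x. (g has_derivative (\<lambda>h. D x \<bullet> h)) (at x)"
        "\<forall>i. continuous_on UNIV (\<lambda>x. D x $ i)" using FE_gradient[OF u K(1)] by (elim exE conjE) (rule that)
      note g = g0(1) bspec[OF g0(2)] spec[OF g0(3)]
      show ?thesis unfolding y(2) by (rule grad_at(2)[OF K(1) g(2) y(1) g(3)])
    qed
    show "grad u x = 0" if "x \<notin> U" for x using that by (simp add: grad_def)
    show "\<bar>u x\<bar> \<le> B" if "x \<in> \<Omega>" for x using B that closure_subset[of \<Omega>] by auto
  qed
  then show ?thesis by blast
qed

lemma FE_facts:
  assumes "FE m u"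
  shows "u \<in> L2 \<Omega>" "grad u \<in> L2 \<Omega>" "is_weak_grad \<Omega> u (grad u)" "u \<in> H1 \<Omega>"
    "AE x in lebesgue_on \<Omega>. weak_grad \<Omega> u x = grad u x" "continuous_on (closure \<Omega>) u"
    "\<exists>B. \<forall>x\<in>\<Omega>. \<bar>u x\<bar> \<le> B"
proof -
  obtain L B where "piecewise_smooth \<Omega> T U u (grad u) L B" using FE_piecewise_smooth[OF assms] by blast
  then interpret p: piecewise_smooth \<Omega> T U u "grad u" L B .
  show "u \<in> L2 \<Omega>" "grad u \<in> L2 \<Omega>" "is_weak_grad \<Omega> u (grad u)" by (rule p.f_L2 p.g_L2 p.weak)+
  then show "u \<in> H1 \<Omega>" by (auto simp: H1_def)
  show "AE x in lebesgue_on \<Omega>. weak_grad \<Omega> u x = grad u x"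
    by (rule weak_grad_eq[OF \<Omega> p.g_L2 p.weak])
  have "continuous_on (\<Union>K\<in>T. K) u"
    using T(1) p.T(2) FE_cell_lipschitz[OF assms] by (intro continuous_on_closed_Union) auto
  then show "continuous_on (closure \<Omega>) u" using T(2) by simp
  show "\<exists>B. \<forall>x\<in>\<Omega>. \<bar>u x\<bar> \<le> B" using p.B by blast
qed

text \<open>A face that meets the interior is the whole cell; applied on both sides, this would
  identify the two cells.\<close>

lemma interiors_disjoint:
  assumes "K \<in> T" "K' \<in> T" "K \<noteq> K'"
  shows "interior K \<inter> interior K' = {}"
proof (rule ccontr)
  assume "interior K \<inter> interior K' \<noteq> {}"
  then obtain p where p: "p \<in> interior K" "p \<in> interior K'" by blast
  then have pp: "p \<in> K \<inter> K'" using interior_subset by blast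
  have "K \<inter> K' = K" using face_of_disjoint_interior[OF faces[OF assms]] p pp by blast
  moreover have "K' \<inter> K = K'" using face_of_disjoint_interior[OF faces[OF assms(2,1) assms(3)[symmetric]]] p pp by blast
  ultimately show False using assms(3) by blast
qed

lemma integral_cells:
  fixes f :: "real ^ 'n \<Rightarrow> real"
  assumes f: "integrable (lebesgue_on \<Omega>) f"
  shows "\<And>K. K \<in> T \<Longrightarrow> f integrable_on K" "\<And>K. K \<in> T \<Longrightarrow> (\<lambda>x. norm (f x)) integrable_on K"
    "(LINT x|lebesgue_on \<Omega>. f x) = (\<Sum>K\<in>T. integral K f)"
proof -
  have abs: "f absolutely_integrable_on \<Omega>"
    using f \<Omega>(1) by (simp add: set_integrable_def integrable_restrict_space)
  have negfr: "negligible (frontier K)" if "K \<in> T" for K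
    by (rule negligible_convex_frontier[OF cell.K(1)[OF cells[OF that]]])
  have spike: "g integrable_on K" if K: "K \<in> T" and g: "g integrable_on interior K" for g :: "real ^ 'n \<Rightarrow> real" and K
  proof (rule integrable_spike_set[OF g])
    show "negligible {x \<in> interior K - K. g x \<noteq> 0}" using interior_subset[of K] by (simp add: Diff_eq_empty_iff[THEN iffD2])
    show "negligible {x \<in> K - interior K. g x \<noteq> 0}"
      by (rule negligible_subset[OF negfr[OF K]]) (use closure_subset[of K] in \<open>auto simp: frontier_def\<close>)
  qed
  have ai: "f absolutely_integrable_on interior K" if "K \<in> T" for K
    using set_integrable_subset[OF abs _ int\<Omega>[OF that]] by simp
  show i1: "f integrable_on K" if "K \<in> T" for K
    using spike[OF that] set_lebesgue_integral_eq_integral(1)[OF ai[OF that]] by blast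
  show "(\<lambda>x. norm (f x)) integrable_on K" if "K \<in> T" for K
    using spike[OF that] ai[OF that] unfolding absolutely_integrable_on_def by blast
  have "(f has_integral (\<Sum>K\<in>T. integral K f)) (\<Union>T)"
  proof (rule has_integral_Union[OF T(1)])
    show "(f has_integral integral K f) K" if "K \<in> T" for K using i1[OF that] by (rule integrable_integral)
    show "pairwise (\<lambda>K K'. negligible (K \<inter> K')) T"
    proof (rule pairwiseI)
      fix K K' assume K: "K \<in> T" "K' \<in> T" "K \<noteq> K'"
      have "K \<inter> K' \<subseteq> frontier K \<union> frontier K'"
      proof
        fix x assume x: "x \<in> K \<inter> K'"
        then have "x \<in> closure K" "x \<in> closure K'" using closure_subset by blast+
        moreover have "x \<notin> interior K \<or> x \<notin> interior K'" using interiors_disjoint[OF K] by blast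
        ultimately show "x \<in> frontier K \<union> frontier K'" by (auto simp: frontier_def)
      qed
      then show "negligible (K \<inter> K')"
        by (rule negligible_subset[OF negligible_Un[OF negfr[OF K(1)] negfr[OF K(2)]]])
    qed
  qed
  then have "integral (\<Union>T) f = (\<Sum>K\<in>T. integral K f)" by (rule integral_unique)
  moreover have "integral (\<Union>T) f = integral \<Omega> f"
  proof (rule integral_spike_set)
    show "negligible {x \<in> \<Union>T - \<Omega>. f x \<noteq> 0}"
      by (rule negligible_subset[OF U(3)]) (use U(2) T(2) in auto)
    show "negligible {x \<in> \<Omega> - \<Union>T. f x \<noteq> 0}"
      unfolding T(2) using closure_subset[of \<Omega>] by (simp add: Diff_eq_empty_iff[THEN iffD2])
  qed
  moreover have "(LINT x|lebesgue_on \<Omega>. f x) = integral \<Omega> f"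
    using f \<Omega>(1) by (intro lebesgue_integral_eq_integral) auto
  ultimately show "(LINT x|lebesgue_on \<Omega>. f x) = (\<Sum>K\<in>T. integral K f)" by simp
qed

lemma integral_transform:
  assumes K: "K \<in> T" and f: "f integrable_on K" "(\<lambda>x. norm (f x)) integrable_on K"
    and G: "\<And>x. x \<in> box 0 1 \<Longrightarrow> f (F K x) = G x"
  shows "integral K f = integral Cub (\<lambda>x. det (J K x) * G x)"
proof -
  interpret c: cell K "F K" "J K" "diameter K" c1 c3 c4 by (rule cells[OF K])
  have "integral K f = integral Cub (\<lambda>x. \<bar>det (J K x)\<bar> * f (F K x))"
    by (rule change_of_variables_2_3[OF card c.der c.inj c.img compact_imp_bounded[OF c.K(2)] f])
  also have "\<dots> = integral Cub (\<lambda>x. det (J K x) * G x)"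
  proof (rule integral_spike[of "Cub - box 0 1"])
    show "negligible (Cub - box 0 1)" by (rule negligible_frontier_interval)
    fix x assume "x \<in> Cub - (Cub - box 0 1)"
    then have x: "x \<in> box 0 1" "x \<in> Cub" by auto
    show "det (J K x) * G x = \<bar>det (J K x)\<bar> * f (F K x)" using G[OF x(1)] c.det_pos[OF x(2)] by simp
  qed
  finally show ?thesis .
qed

text \<open>A cell fits into a cube of side twice its diameter around one of its points; this is the
  origin of the factor 2^d in the constants. Only values in the interior matter, since the frontier
  is null.\<close>

lemma cell_integral_le:
  fixes f :: "real ^ 'n \<Rightarrow> real"
  assumes K: "K \<in> T" and f: "f integrable_on K" and M: "\<And>x. x \<in> interior K \<Longrightarrow> f x \<le> M" "M \<ge> 0"
  shows "integral K f \<le> M * (2 * diameter K) ^ CARD('n)"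
proof -
  interpret c: cell K "F K" "J K" "diameter K" c1 c3 c4 by (rule cells[OF K])
  obtain p where p: "p \<in> K" using c.int interior_subset by blast
  define a where "a = p - diameter K *\<^sub>R (1 :: real ^ 'n)"
  define b where "b = p + diameter K *\<^sub>R (1 :: real ^ 'n)"
  have sub: "K \<subseteq> cbox a b"
  proof
    fix x assume x: "x \<in> K"
    have *: "\<bar>(x - p) $ i\<bar> \<le> diameter K" for i
      using order.trans[OF component_le_norm_cart[of "x - p" i]] diameter_bounded_bound[OF compact_imp_bounded[OF c.K(2)] x p]
      by (simp add: dist_norm)
    show "x \<in> cbox a b" unfolding mem_box_cart
    proof
      fix i show "a $ i \<le> x $ i \<and> x $ i \<le> b $ i" using *[of i] by (auto simp: a_def b_def abs_le_iff)
    qed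
  qed
  have lm: "K \<in> lmeasurable" using c.K(2) by (rule lmeasurable_compact)
  have "integral K f \<le> integral K (\<lambda>x. if x \<in> interior K then M else f x)"
  proof (rule integral_le[OF f])
    show "(\<lambda>x. if x \<in> interior K then M else f x) integrable_on K"
    proof (rule integrable_spike[of "\<lambda>x. M" K "frontier K"])
      show "(\<lambda>x. M) integrable_on K" by (rule integrable_on_const[OF lm])
      show "negligible (frontier K)" by (rule negligible_convex_frontier[OF c.K(1)])
      show "(if x \<in> interior K then M else f x) = M" if "x \<in> K - frontier K" for x
        using that closure_subset[of K] by (auto simp: frontier_def)
    qed
  qed (use M in auto)
  also have "\<dots> = integral K (\<lambda>x. M)"
  proof (rule integral_spike[of "frontier K"])
    show "negligible (frontier K)" by (rule negligible_convex_frontier[OF c.K(1)])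
    show "M = (if x \<in> interior K then M else f x)" if "x \<in> K - frontier K" for x
      using that closure_subset[of K] by (auto simp: frontier_def)
  qed
  also have "\<dots> = M * measure lebesgue K"
    using integral_mult_right[of K M "\<lambda>x. 1 :: real"] by (simp only: lmeasure_integral[OF lm] mult_1_right)
  also have "\<dots> \<le> M * measure lebesgue (cbox a b)"
    by (rule mult_left_mono[OF measure_mono_fmeasurable[OF sub fmeasurableD[OF lm] lmeasurable_cbox] M(2)])
  also have "measure lebesgue (cbox a b) = (2 * diameter K) ^ CARD('n)"
  proof -
    have ne: "cbox a b \<noteq> {}" using p sub by blast
    have "measure lebesgue (cbox a b) = measure lborel (cbox a b)" by (rule measure_completion) simp
    also have "\<dots> = (\<Prod>i\<in>UNIV. b $ i - a $ i)" by (rule content_cbox_cart[OF ne])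
    also have "\<dots> = (\<Prod>i\<in>(UNIV :: 'n set). 2 * diameter K)" by (rule prod.cong) (simp_all add: a_def b_def)
    also have "\<dots> = (2 * diameter K) ^ CARD('n)" by (rule prod_constant)
    finally show ?thesis .
  qed
  finally show ?thesis .
qed

end

section \<open>The inf-sup condition\<close>

lemma Qfun_const: "Qfun k (\<lambda>x. c)"
  using Qspan.mono[of "\<lambda>_. 0" "{\<beta>. \<forall>i. \<beta> i \<le> k}" c] by (simp add: monomial_def)

text \<open>\<open>C1\<close> and \<open>C2\<close> enter with the estimates of
  \<open>line_field_bound\<close> and \<open>derivative_sup_bound\<close>. They are fixed before the
  mesh is known, which keeps the final constant uniform. The set \<Gamma> stands for the Dirichlet
  part of the boundary.\<close>

locale fem = mesh \<Omega> T F J c1 c3 c4 + lobatto k N w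
  for \<Omega> :: "(real ^ 'n::finite) set" and T F J c1 c3 c4 k N w +
  fixes \<Gamma> :: "(real ^ 'n) set" and C1 C2 :: real
  assumes ne: "\<Omega> \<noteq> {}"
    and \<Gamma>: "\<And>p. p \<in> \<Gamma> \<Longrightarrow> \<exists>K\<in>T. \<exists>f. f face_of K \<and> p \<in> f \<and> f \<subseteq> \<Gamma>"
    and vertex: "\<And>K. K \<in> T \<Longrightarrow> \<exists>v\<in>cbox 0 1. (\<forall>i. v $ i \<in> {0, 1}) \<and> F K v \<notin> \<Gamma>"
    and C1: "C1 > 0" "\<forall>K F J h c1 c3 c4 chi. line_fields K F J h c1 c3 c4 k N w \<longrightarrow>
     (\<forall>(g :: real ^ 'n \<Rightarrow> real) x. Qfun (k - 1) g \<longrightarrow> x \<in> cbox 0 1 \<longrightarrow>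
       c3 * h\<^sup>2 * (norm (line_fields.V F J N chi g x))\<^sup>2 \<le> C1 * line_fields.energy F N chi g)"
    and C2: "C2 > 0" "\<forall>(g :: real ^ 'n \<Rightarrow> real) g'. Qfun (k - 1) g \<longrightarrow>
     (\<forall>x. (g has_derivative (\<lambda>h. g' x \<bullet> h)) (at x)) \<longrightarrow>
     (\<forall>v j. \<forall>x\<in>cbox 0 1. (\<forall>i. v $ i \<in> {0, 1}) \<longrightarrow>
       (\<exists>z. (j, z) \<in> lines \<and> opposite_free v (j, z) \<and>
          (g' x $ j)\<^sup>2 \<le> C2 * ip ([:0, 1, - 1:] * (pderiv (lp g z j)) ^ 2)))"
begin

section \<open>The global velocity and its pairing with the pressure\<close>

lemma line_fields_cell:
  assumes "K \<in> T"
  shows "line_fields K (F K) (J K) (diameter K) c1 c3 c4 k N w"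
  by (rule line_fields.intro[OF cells[OF assms] lobatto_axioms])

definition rep :: "(real ^ 'n \<Rightarrow> real) \<Rightarrow> (real ^ 'n) set \<Rightarrow> real ^ 'n \<Rightarrow> real" where
  "rep q K = (SOME g. Qfun (k - 1) g \<and> (\<forall>y\<in>Cub. q (F K y) = g y))"

lemma rep:
  assumes "FE (k - 1) q" "K \<in> T"
  shows "Qfun (k - 1) (rep q K)" "\<And>y. y \<in> Cub \<Longrightarrow> q (F K y) = rep q K y"
proof -
  have "\<exists>g. Qfun (k - 1) g \<and> (\<forall>y\<in>Cub. q (F K y) = g y)" using assms by (auto simp: FE_def)
  from someI_ex[OF this] have "Qfun (k - 1) (rep q K) \<and> (\<forall>y\<in>Cub. q (F K y) = rep q K y)"
    unfolding rep_def .
  then show "Qfun (k - 1) (rep q K)" "\<And>y. y \<in> Cub \<Longrightarrow> q (F K y) = rep q K y" by blast+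
qed

definition W :: "(real ^ 'n \<Rightarrow> real) \<Rightarrow> (real ^ 'n) set \<Rightarrow> real ^ 'n \<Rightarrow> real ^ 'n" where
  "W q K = line_fields.V (F K) (J K) N (\<lambda>p. p \<notin> \<Gamma>) (rep q K)"

definition en :: "(real ^ 'n \<Rightarrow> real) \<Rightarrow> (real ^ 'n) set \<Rightarrow> real" where
  "en q K = line_fields.energy (F K) N (\<lambda>p. p \<notin> \<Gamma>) (rep q K)"

text \<open>h^(d - 2) is the scaling of a squared gradient norm, so \<open>X q\<close> is comparable
  across meshes.\<close>

definition X :: "(real ^ 'n \<Rightarrow> real) \<Rightarrow> real" where
  "X q = (\<Sum>K\<in>T. diameter K ^ CARD('n) / (diameter K)\<^sup>2 * en q K)"

text \<open>Any cell containing \<open>p\<close> may be chosen; \<open>vf_cell\<close> shows that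
  the choice is immaterial. The constant \<open>m\<close> is the mean value to be removed in the
  pure Neumann case.\<close>

definition vf :: "(real ^ 'n \<Rightarrow> real) \<Rightarrow> real ^ 'n \<Rightarrow> real ^ 'n \<Rightarrow> real ^ 'n" where
  "vf q m p = (let K = SOME K. K \<in> T \<and> p \<in> K in W q K (inv_into Cub (F K) p)) - m"

lemma vf_cell:
  assumes q: "FE (k - 1) q" and K: "K \<in> T" and y: "y \<in> Cub"
  shows "vf q m (F K y) = W q K y - m"
proof -
  define K0 where "K0 = (SOME K'. K' \<in> T \<and> F K y \<in> K')"
  have "F K y \<in> K" using cell.F_in[OF cells[OF K] y] .
  then have "K \<in> T \<and> F K y \<in> K" using K by blast
  from someI[of "\<lambda>K'. K' \<in> T \<and> F K y \<in> K'", OF this] have K0: "K0 \<in> T" "F K y \<in> K0"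
    unfolding K0_def by blast+
  obtain y0 where y0: "y0 \<in> Cub" "F K y = F K0 y0" using cell.K_obtain[OF cells[OF K0(1)] K0(2)] by blast
  have inv: "inv_into Cub (F K0) (F K y) = y0" unfolding y0(2) by (rule inv_into_f_f[OF cell.inj[OF cells[OF K0(1)]] y0(1)])
  have "W q K0 y0 = W q K y"
  proof (cases "K0 = K")
    case True
    then have "y = y0" using inj_onD[OF cell.inj[OF cells[OF K]] _ y y0(1)] y0(2) by simp
    then show ?thesis using True by simp
  next
    case False
    have f2: "(K0 \<inter> K) face_of K" using faces[OF K K0(1) False[symmetric]] by (simp only: Int_commute)
    show ?thesis unfolding W_def
      by (rule V_agree[OF line_fields_cell[OF K0(1)] line_fields_cell[OF K] faces[OF K0(1) K False] f2 False
            y0(1) y y0(2)[symmetric] rep(1)[OF q K0(1)] rep(2)[OF q K0(1)] rep(1)[OF q K] rep(2)[OF q K]])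
  qed
  then show ?thesis unfolding vf_def Let_def K0_def[symmetric] inv by simp
qed

lemma W_facts:
  assumes q: "FE (k - 1) q" and K: "K \<in> T"
  shows "Qfun k (\<lambda>x. (W q K x - m) $ c)"
proof -
  interpret l: line_fields K "F K" "J K" "diameter K" c1 c3 c4 k N w "\<lambda>p. p \<notin> \<Gamma>" by (rule line_fields_cell[OF K])
  have "Qfun k (\<lambda>x. W q K x $ c + (- m $ c))"
    unfolding W_def by (rule Qspan.add[OF l.V_Qfun[OF rep(1)[OF q K]] Qfun_const])
  then show ?thesis by simp
qed

lemma vf_FE:
  assumes q: "FE (k - 1) q"
  shows "FE k (\<lambda>p. vf q m p $ c)"
  unfolding FE_def
proof
  fix K assume K: "K \<in> T"
  have "\<forall>y\<in>Cub. vf q m (F K y) $ c = (W q K y - m) $ c" using vf_cell[OF q K] by simp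
  then show "\<exists>g. Qfun k g \<and> (\<forall>y\<in>Cub. vf q m (F K y) $ c = g y)"
    using W_facts[OF q K] by (intro exI[of _ "\<lambda>x. (W q K x - m) $ c"] conjI)
qed

lemma vf_zero:
  assumes q: "FE (k - 1) q" and p: "p \<in> \<Gamma>"
  shows "vf q 0 p = 0"
proof -
  obtain K f where K: "K \<in> T" and f: "f face_of K" "p \<in> f" "f \<subseteq> \<Gamma>" using \<Gamma>[OF p] by blast
  interpret l: line_fields K "F K" "J K" "diameter K" c1 c3 c4 k N w "\<lambda>p. p \<notin> \<Gamma>" by (rule line_fields_cell[OF K])
  have "p \<in> K" using f face_of_imp_subset by blast
  then obtain y where y: "y \<in> Cub" "p = F K y" using l.K_obtain by blast
  have "W q K y = 0" unfolding W_def
  proof (rule l.V_vanish[OF y(1) f(1)])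
    show "F K y \<in> f" using f(2) y(2) by simp
    show "\<not> p' \<notin> \<Gamma>" if "p' \<in> f" for p' using that f(3) by blast
  qed
  then show ?thesis unfolding y(2) vf_cell[OF q K y(1)] by simp
qed

lemma vf_div:
  assumes q: "FE (k - 1) q" and K: "K \<in> T" and x: "x \<in> box 0 1"
  shows "(\<Sum>c\<in>UNIV. grad (\<lambda>p. vf q m p $ c) (F K x) $ c) = line_fields.divV (F K) (J K) N (\<lambda>p. p \<notin> \<Gamma>) (rep q K) x"
proof -
  interpret l: line_fields K "F K" "J K" "diameter K" c1 c3 c4 k N w "\<lambda>p. p \<notin> \<Gamma>" by (rule line_fields_cell[OF K])
  have "grad (\<lambda>p. vf q m p $ c) (F K x) = l.DV (rep q K) c x v* matrix_inv (J K x)" for c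
  proof (rule grad_at(1)[OF K _ x])
    show "vf q m (F K y) $ c = (W q K y - m) $ c" if "y \<in> Cub" for y using vf_cell[OF q K that] by simp
    have "((\<lambda>x. W q K x $ c - m $ c) has_derivative (\<lambda>h. l.DV (rep q K) c x \<bullet> h - 0)) (at x)"
      unfolding W_def by (rule has_derivative_diff[OF l.V_has_derivative has_derivative_const])
    then show "((\<lambda>x. (W q K x - m) $ c) has_derivative (\<lambda>h. l.DV (rep q K) c x \<bullet> h)) (at x)" by simp
  qed
  then show ?thesis unfolding l.divV_def by simp
qed

text \<open>Almost everywhere the weak divergence is the cellwise classical one, so the form splits
  into cell integrals without face terms.\<close>

lemma b_form_cells:
  assumes q: "FE (k - 1) q" and q0: "FE (k - 1) q0"
  shows "b_form \<Omega> (vf q0 m) q = (\<Sum>K\<in>T. - integral Cub (\<lambda>x. det (J K x) *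
     (rep q K x * line_fields.divV (F K) (J K) N (\<lambda>p. p \<notin> \<Gamma>) (rep q0 K) x)))"
proof -
  note vF = vf_FE[OF q0, of m]
  define dv where "dv x = (\<Sum>c\<in>UNIV. grad (\<lambda>p. vf q0 m p $ c) x $ c)" for x
  have dvi: "integrable (lebesgue_on \<Omega>) dv"
    unfolding dv_def by (intro Bochner_Integration.integrable_sum L2_integrable_component[OF \<Omega> FE_facts(2)[OF vF]])
  have wdi: "integrable (lebesgue_on \<Omega>) (weak_div \<Omega> (vf q0 m))"
    unfolding weak_div_def
    by (intro Bochner_Integration.integrable_sum L2_integrable_component[OF \<Omega>]
        weak_grad_works(1)[OF FE_facts(2)[OF vF] FE_facts(3)[OF vF]])
  have "AE x in lebesgue_on \<Omega>. \<forall>c\<in>UNIV. weak_grad \<Omega> (\<lambda>p. vf q0 m p $ c) x = grad (\<lambda>p. vf q0 m p $ c) x"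
    by (rule AE_finite_allI) (auto intro: FE_facts(5)[OF vF])
  then have AE: "AE x in lebesgue_on \<Omega>. q x * weak_div \<Omega> (vf q0 m) x = q x * dv x"
    by (rule AE_mp) (auto simp: weak_div_def dv_def)
  have qm: "q \<in> borel_measurable (lebesgue_on \<Omega>)" using FE_facts(1)[OF q] by (simp add: L2_def)
  obtain B where B: "\<And>x. x \<in> \<Omega> \<Longrightarrow> \<bar>q x\<bar> \<le> B" using FE_facts(7)[OF q] by blast
  have int: "integrable (lebesgue_on \<Omega>) (\<lambda>x. q x * dv x)"
  proof (rule Bochner_Integration.integrable_bound[of _ "\<lambda>x. B * dv x"])
    show "integrable (lebesgue_on \<Omega>) (\<lambda>x. B * dv x)" using dvi by simp
    show "(\<lambda>x. q x * dv x) \<in> borel_measurable (lebesgue_on \<Omega>)"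
      by (intro borel_measurable_times qm borel_measurable_integrable[OF dvi])
    show "AE x in lebesgue_on \<Omega>. norm (q x * dv x) \<le> norm (B * dv x)"
    proof (rule AE_I2)
      fix x assume "x \<in> space (lebesgue_on \<Omega>)"
      then have "x \<in> \<Omega>" by simp
      then have "\<bar>q x\<bar> \<le> \<bar>B\<bar>" using B[of x] by linarith
      then show "norm (q x * dv x) \<le> norm (B * dv x)" by (simp add: abs_mult mult_right_mono)
    qed
  qed
  have "(LINT x|lebesgue_on \<Omega>. q x * weak_div \<Omega> (vf q0 m) x) = (LINT x|lebesgue_on \<Omega>. q x * dv x)"
    by (rule integral_cong_AE[OF borel_measurable_times[OF qm borel_measurable_integrable[OF wdi]]
        borel_measurable_integrable[OF int] AE])
  also have "\<dots> = (\<Sum>K\<in>T. integral K (\<lambda>x. q x * dv x))" by (rule integral_cells(3)[OF int])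
  also have "\<dots> = (\<Sum>K\<in>T. integral Cub (\<lambda>x. det (J K x) *
     (rep q K x * line_fields.divV (F K) (J K) N (\<lambda>p. p \<notin> \<Gamma>) (rep q0 K) x)))"
  proof (rule sum.cong[OF refl])
    fix K assume K: "K \<in> T"
    show "integral K (\<lambda>x. q x * dv x) = integral Cub (\<lambda>x. det (J K x) *
     (rep q K x * line_fields.divV (F K) (J K) N (\<lambda>p. p \<notin> \<Gamma>) (rep q0 K) x))"
    proof (rule integral_transform[OF K integral_cells(1,2)[OF int K]])
      fix x :: "real ^ 'n" assume x: "x \<in> box 0 1"
      then have xC: "x \<in> Cub" using box_subset_cbox by blast
      show "q (F K x) * dv (F K x) = rep q K x * line_fields.divV (F K) (J K) N (\<lambda>p. p \<notin> \<Gamma>) (rep q0 K) x"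
        unfolding dv_def vf_div[OF q0 K x] rep(2)[OF q K xC] ..
    qed
  qed
  finally show ?thesis unfolding b_form_def by (simp add: sum_negf)
qed

lemma en_nonneg: "K \<in> T \<Longrightarrow> en q K \<ge> 0"
  unfolding en_def by (rule line_fields.energy_nonneg[OF line_fields_cell])

lemma diam_pos: "K \<in> T \<Longrightarrow> diameter K > 0"
  using cell.h(2)[OF cells] .

lemma X_nonneg: "X q \<ge> 0"
  unfolding X_def using en_nonneg diam_pos by (intro sum_nonneg mult_nonneg_nonneg divide_nonneg_nonneg) (auto simp: less_imp_le)

lemma X_zero:
  assumes "X q = 0" "K \<in> T"
  shows "en q K = 0"
proof -
  have "\<forall>K\<in>T. diameter K ^ CARD('n) / (diameter K)\<^sup>2 * en q K = 0"
    using assms(1) unfolding X_def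
    by (subst (asm) sum_nonneg_eq_0_iff[OF T(1)]) (use en_nonneg diam_pos in \<open>auto simp: less_imp_le\<close>)
  then show ?thesis using diam_pos[OF assms(2)] assms(2) by force
qed

text \<open>Without energy on any retained line, every term of the quadrature formula vanishes,
  whatever function generated the velocity.\<close>

lemma b_form_zero:
  assumes q: "FE (k - 1) q" and q0: "FE (k - 1) q0" and X: "X q = 0"
  shows "b_form \<Omega> (vf q0 m) q = 0"
  unfolding b_form_cells[OF q q0]
proof (rule sum.neutral, rule ballI)
  fix K assume K: "K \<in> T"
  interpret l: line_fields K "F K" "J K" "diameter K" c1 c3 c4 k N w "\<lambda>p. p \<notin> \<Gamma>" by (rule line_fields_cell[OF K])
  have e0: "l.energy (rep q K) = 0" using X_zero[OF X K] by (simp add: en_def)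
  show "- integral Cub (\<lambda>x. det (J K x) * (rep q K x * l.divV (rep q0 K) x)) = 0"
  proof (rule l.cell_energy[OF rep(1)[OF q0 K] rep(1)[OF q K]])
    fix e assume "integral Cub (\<lambda>x. det (J K x) * (rep q K x * l.divV (rep q0 K) x)) = - e"
      and "l.energy (rep q K) = 0 \<Longrightarrow> e = 0"
    then show ?thesis using e0 by simp
  qed
qed

text \<open>The constant of \<open>cell_energy\<close> for the smallest Lobatto weight.\<close>

definition "lo = min 1 (Min (w ` N)) ^ CARD('n) * c1 / c4"

lemma T_ne: "T \<noteq> {}" using ne T(2) closure_subset[of \<Omega>] by auto

lemma c_pos: "c1 > 0" "c3 > 0" "c4 > 0"
  using T_ne cell.cpos[OF cells] by blast+

lemma Min_w: "Min (w ` N) > 0" "u \<in> N \<Longrightarrow> Min (w ` N) \<le> w u"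
proof -
  have "w ` N \<noteq> {}" using N(4) by blast
  then have "Min (w ` N) \<in> w ` N" using N(1) by (intro Min_in) auto
  then show "Min (w ` N) > 0" using w_pos by auto
  show "u \<in> N \<Longrightarrow> Min (w ` N) \<le> w u" using N(1) by simp
qed

lemma lo_pos: "lo > 0"
  unfolding lo_def using Min_w(1) c_pos by simp

lemma b_form_lower:
  assumes q: "FE (k - 1) q"
  shows "b_form \<Omega> (vf q m) q \<ge> lo * X q"
  unfolding b_form_cells[OF q q] X_def sum_distrib_left
proof (rule sum_mono)
  fix K assume K: "K \<in> T"
  interpret l: line_fields K "F K" "J K" "diameter K" c1 c3 c4 k N w "\<lambda>p. p \<notin> \<Gamma>" by (rule line_fields_cell[OF K])
  show "lo * (diameter K ^ CARD('n) / (diameter K)\<^sup>2 * en q K)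
      \<le> - integral Cub (\<lambda>x. det (J K x) * (rep q K x * l.divV (rep q K) x))"
  proof (rule l.cell_energy[OF rep(1)[OF q K] rep(1)[OF q K]])
    fix e assume e: "integral Cub (\<lambda>x. det (J K x) * (rep q K x * l.divV (rep q K) x)) = - e"
      and m: "\<And>m. rep q K = rep q K \<Longrightarrow> (\<And>u. u \<in> N \<Longrightarrow> m \<le> w u) \<Longrightarrow> m > 0 \<Longrightarrow>
        e \<ge> min 1 m ^ CARD('n) * c1 / c4 * (diameter K ^ CARD('n) / (diameter K)\<^sup>2) * l.energy (rep q K)"
    have "e \<ge> lo * (diameter K ^ CARD('n) / (diameter K)\<^sup>2) * l.energy (rep q K)"
      unfolding lo_def by (rule m[OF refl Min_w(2) Min_w(1)])
    then show ?thesis unfolding e en_def by (simp add: mult.assoc)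
  qed
qed

section \<open>Upper bounds for the velocity and for the pressure gradient\<close>

lemma L2_norm_square: "(L2_norm \<Omega> f)\<^sup>2 = (LINT x|lebesgue_on \<Omega>. (norm (f x))\<^sup>2)"
  unfolding L2_norm_def by (rule real_sqrt_pow2) (rule Bochner_Integration.integral_nonneg, simp)

text \<open>The factor h^2 in the pointwise bound and the volume bound (2 h)^d combine to h^(d - 2),
  the weight in \<open>X\<close>. The same computation serves the velocity and the gradient.\<close>

lemma square_integral_le:
  fixes f :: "real ^ 'n \<Rightarrow> real ^ 'n"
  assumes f: "integrable (lebesgue_on \<Omega>) (\<lambda>x. (norm (f x))\<^sup>2)" and C: "C \<ge> 0"
    and bd: "\<And>K p. K \<in> T \<Longrightarrow> p \<in> interior K \<Longrightarrow> c3 * (diameter K)\<^sup>2 * (norm (f p))\<^sup>2 \<le> C * en q K"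
  shows "(LINT x|lebesgue_on \<Omega>. (norm (f x))\<^sup>2) \<le> C / c3 * 2 ^ CARD('n) * X q"
  unfolding integral_cells(3)[OF f] X_def sum_distrib_left
proof (rule sum_mono)
  fix K assume K: "K \<in> T"
  have p: "c3 * (diameter K)\<^sup>2 > 0" using c_pos diam_pos[OF K] by simp
  have "integral K (\<lambda>x. (norm (f x))\<^sup>2) \<le> (C * en q K / (c3 * (diameter K)\<^sup>2)) * (2 * diameter K) ^ CARD('n)"
  proof (rule cell_integral_le[OF K integral_cells(1)[OF f K]])
    show "(norm (f x))\<^sup>2 \<le> C * en q K / (c3 * (diameter K)\<^sup>2)" if "x \<in> interior K" for x
      using bd[OF K that] p by (simp add: pos_le_divide_eq mult.commute)
    show "0 \<le> C * en q K / (c3 * (diameter K)\<^sup>2)" using C en_nonneg[OF K] p by simp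
  qed
  also have "\<dots> = C / c3 * 2 ^ CARD('n) * (diameter K ^ CARD('n) / (diameter K)\<^sup>2 * en q K)"
    by (simp add: power_mult_distrib)
  finally show "integral K (\<lambda>x. (norm (f x))\<^sup>2) \<le> \<dots>" .
qed

lemma vf_L2:
  assumes q: "FE (k - 1) q"
  shows "vf q m \<in> borel_measurable (lebesgue_on \<Omega>)" "integrable (lebesgue_on \<Omega>) (vf q m)"
    "integrable (lebesgue_on \<Omega>) (\<lambda>x. (norm (vf q m x))\<^sup>2)"
proof -
  note f = FE_facts[OF vf_FE[OF q, of m]]
  have "(\<lambda>x. vf q m x \<bullet> b) \<in> borel_measurable (lebesgue_on \<Omega>)" if "b \<in> Basis" for b
  proof -
    obtain i where "b = axis i 1" using \<open>b \<in> Basis\<close> by (auto simp: Basis_vec_def)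
    then show ?thesis using f(1)[of i] by (simp add: inner_axis L2_def)
  qed
  then show m: "vf q m \<in> borel_measurable (lebesgue_on \<Omega>)"
    by (subst borel_measurable_euclidean_space) blast
  have "\<forall>i. \<exists>B. \<forall>x\<in>\<Omega>. \<bar>vf q m x $ i\<bar> \<le> B" using f(7) by blast
  from choice[OF this] obtain B where B: "\<forall>i. \<forall>x\<in>\<Omega>. \<bar>vf q m x $ i\<bar> \<le> B i" by blast
  define b where "b = (\<Sum>i\<in>UNIV. B i)"
  have b: "norm (vf q m x) \<le> b" if "x \<in> \<Omega>" for x
    unfolding b_def using B that by (intro order.trans[OF norm_le_l1_cart] sum_mono) auto
  show "integrable (lebesgue_on \<Omega>) (vf q m)"
  proof (rule Bochner_Integration.integrable_bound[OF integrable_const_lebesgue_on[OF \<Omega>, of b] m])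
    show "AE x in lebesgue_on \<Omega>. norm (vf q m x) \<le> norm b"
      by (rule AE_I2) (use b in \<open>force intro: order.trans[OF _ abs_ge_self]\<close>)
  qed
  show "integrable (lebesgue_on \<Omega>) (\<lambda>x. (norm (vf q m x))\<^sup>2)"
  proof (rule Bochner_Integration.integrable_bound[OF integrable_const_lebesgue_on[OF \<Omega>, of "b\<^sup>2"]])
    show "(\<lambda>x. (norm (vf q m x))\<^sup>2) \<in> borel_measurable (lebesgue_on \<Omega>)" using m by measurable
    show "AE x in lebesgue_on \<Omega>. norm ((norm (vf q m x))\<^sup>2) \<le> norm (b\<^sup>2)"
    proof (rule AE_I2)
      fix x assume "x \<in> space (lebesgue_on \<Omega>)"
      then have "norm (vf q m x) \<le> b" using b by simp
      then have "(norm (vf q m x))\<^sup>2 \<le> b\<^sup>2" by (intro power_mono) auto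
      then show "norm ((norm (vf q m x))\<^sup>2) \<le> norm (b\<^sup>2)" by simp
    qed
  qed
qed

lemma vf_norm:
  assumes q: "FE (k - 1) q"
  shows "(L2_norm \<Omega> (vf q 0))\<^sup>2 \<le> C1 / c3 * 2 ^ CARD('n) * X q"
  unfolding L2_norm_square
proof (rule square_integral_le[OF vf_L2(3)[OF q]])
  fix K p assume K: "K \<in> T" and p: "p \<in> interior K"
  have "p \<in> K" using p interior_subset by blast
  then obtain y where y: "y \<in> Cub" "p = F K y" using cell.K_obtain[OF cells[OF K]] by blast
  show "c3 * (diameter K)\<^sup>2 * (norm (vf q 0 p))\<^sup>2 \<le> C1 * en q K"
    unfolding y(2) vf_cell[OF q K y(1)] W_def en_def diff_zero
    using C1(2)[rule_format, OF line_fields_cell[OF K] rep(1)[OF q K] y(1)] .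
qed (use C1 in simp)

text \<open>The lines supplied by \<open>derivative_sup_bound\<close> for a vertex off \<Gamma>
  avoid the opposite faces and are therefore all retained, so their weighted norms are part of the
  energy of the cell.\<close>

lemma grad_pointwise:
  assumes q: "FE (k - 1) q" and K: "K \<in> T" and p: "p \<in> interior K"
  shows "c3 * (diameter K)\<^sup>2 * (norm (grad q p))\<^sup>2 \<le> real CARD('n) * C2 * en q K"
proof -
  interpret l: line_fields K "F K" "J K" "diameter K" c1 c3 c4 k N w "\<lambda>p. p \<notin> \<Gamma>" by (rule line_fields_cell[OF K])
  obtain x where x: "x \<in> box 0 1" "p = F K x" using cell_point[OF K p] by blast
  have xC: "x \<in> Cub" using x(1) box_subset_cbox by blast
  obtain d where d: "\<forall>i. Qfun (k - 1) (d i)" "\<forall>x. (rep q K has_derivative (\<lambda>h. \<Sum>i\<in>UNIV. d i x * h $ i)) (at x)"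
    using Qfun_derivative[OF rep(1)[OF q K]] by (elim exE conjE) (rule that)
  define D where "D x = (\<chi> i. d i x)" for x
  have D: "\<forall>x. (rep q K has_derivative (\<lambda>h. D x \<bullet> h)) (at x)"
    using d(2) by (simp add: inner_vec_def D_def)
  obtain v where v: "v \<in> Cub" "\<forall>i. v $ i \<in> {0, 1}" "F K v \<notin> \<Gamma>" using vertex[OF K] by blast
  have comp: "(D x $ j)\<^sup>2 \<le> C2 * en q K" for j
  proof -
    have "\<exists>z. (j, z) \<in> lines \<and> opposite_free v (j, z) \<and> (D x $ j)\<^sup>2 \<le> C2 * ip ([:0, 1, - 1:] * (pderiv (lp (rep q K) z j)) ^ 2)"
      using C2(2)[rule_format, OF rep(1)[OF q K], of D x v j] D xC v(2) by blast
    then obtain z where z: "(j, z) \<in> lines" "opposite_free v (j, z)"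
      "(D x $ j)\<^sup>2 \<le> C2 * ip ([:0, 1, - 1:] * (pderiv (lp (rep q K) z j)) ^ 2)" by blast
    have zi: "z $ i \<noteq> 1 - v $ i" for i
    proof (cases "i = j")
      case True
      then have "z $ i = 1 / 2" using z(1) by (simp add: lines_def)
      then show ?thesis using v(2)[rule_format, of i] by auto
    next
      case False
      then show ?thesis using z(2) by (simp add: opposite_free_def)
    qed
    \<comment> \<open>\<Gamma> may touch \<open>K\<close> only in a face of lower dimension, so the
      face in \<Gamma> that contains the midpoint can belong to a different cell.\<close>
    have "F K z \<notin> \<Gamma>"
    proof
      assume "F K z \<in> \<Gamma>"
      then obtain K' f where K': "K' \<in> T" and f: "f face_of K'" "F K z \<in> f" "f \<subseteq> \<Gamma>" using \<Gamma> by blast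
      have a: "(K \<inter> K') face_of K" "(K \<inter> K') face_of K'"
      proof -
        show "(K \<inter> K') face_of K"
          by (cases "K = K'") (use faces[OF K K'] face_of_refl[OF l.K(1)] in auto)
        show "(K \<inter> K') face_of K'"
          by (cases "K = K'") (use faces[OF K' K] face_of_refl[OF l.K(1)] in \<open>auto simp: Int_commute\<close>)
      qed
      have "F K v \<notin> f" using v(3) f(3) by blast
      from l.opposite_free_retained[OF f(1) a v(1) spec[OF v(2)] this lines_cube[OF z(1)] zi]
      show False using f(2) by blast
    qed
    then have "wsq (pderiv (lp (rep q K) z j)) \<le> en q K"
      unfolding en_def by (rule l.energy_line[OF z(1)])
    then have "C2 * ip ([:0, 1, - 1:] * (pderiv (lp (rep q K) z j)) ^ 2) \<le> C2 * en q K"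
      using C2(1) by (simp add: wsq_def)
    then show ?thesis using z(3) by linarith
  qed
  have gp: "grad q (F K x) = D x v* matrix_inv (J K x)"
    by (rule grad_at(1)[OF K rep(2)[OF q K] x(1) spec[OF D]])
  have "c3 * (diameter K)\<^sup>2 * (norm (grad q p))\<^sup>2 \<le> (norm (D x))\<^sup>2"
    unfolding x(2) gp by (rule l.pullback_gradient_bound[OF xC])
  also have "\<dots> = (\<Sum>j\<in>UNIV. (D x $ j)\<^sup>2)"
    by (simp add: norm_vec_def L2_set_def sum_nonneg)
  also have "\<dots> \<le> (\<Sum>j\<in>(UNIV :: 'n set). C2 * en q K)" by (rule sum_mono[OF comp])
  finally show ?thesis by (simp add: mult.assoc)
qed

lemma grad_norm:
  assumes q: "FE (k - 1) q"
  shows "(L2_norm \<Omega> (weak_grad \<Omega> q))\<^sup>2 \<le> real CARD('n) * C2 / c3 * 2 ^ CARD('n) * X q"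
proof -
  note f = FE_facts[OF q]
  have wg: "weak_grad \<Omega> q \<in> L2 \<Omega>" by (rule weak_grad_works(1)[OF f(2,3)])
  have i: "integrable (lebesgue_on \<Omega>) (\<lambda>x. (norm (weak_grad \<Omega> q x))\<^sup>2)" "integrable (lebesgue_on \<Omega>) (\<lambda>x. (norm (grad q x))\<^sup>2)"
    using wg f(2) by (simp_all add: L2_def)
  have "AE x in lebesgue_on \<Omega>. (norm (weak_grad \<Omega> q x))\<^sup>2 = (norm (grad q x))\<^sup>2"
    by (rule AE_mp[OF f(5)]) simp
  from integral_cong_AE[OF borel_measurable_integrable[OF i(1)] borel_measurable_integrable[OF i(2)] this]
  have "(L2_norm \<Omega> (weak_grad \<Omega> q))\<^sup>2 = (LINT x|lebesgue_on \<Omega>. (norm (grad q x))\<^sup>2)"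
    unfolding L2_norm_square .
  also have "\<dots> \<le> real CARD('n) * C2 / c3 * 2 ^ CARD('n) * X q"
    by (rule square_integral_le[OF i(2) _ grad_pointwise[OF q]]) (use C2 in auto)
  finally show ?thesis .
qed

text \<open>A coordinate function has a nonzero gradient and, by \<open>k \<ge> 2\<close>, an
  admissible degree. It only has to generate a nonzero velocity, so a mean value condition is
  irrelevant to it.\<close>

lemma coordinate_positive: "\<exists>q. FE (k - 1) q \<and> X q > 0"
proof -
  fix i :: 'n
  define u where "u x = x $ i" for x :: "real ^ 'n"
  have FE1: "FE (k - 1) u" unfolding FE_def
  proof
    fix K assume K: "K \<in> T"
    obtain g where g: "Qfun 1 g" "\<forall>x\<in>Cub. F K x $ i = g x" using cell.Q1[OF cells[OF K]] by blast
    have "Qfun (k - 1) g"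
    proof (rule Qspan_subset[OF g(1)], rule subsetI)
      fix \<beta> :: "'n \<Rightarrow> nat" assume "\<beta> \<in> {\<beta>. \<forall>i. \<beta> i \<le> 1}"
      then have b: "\<beta> i \<le> 1" for i by blast
      have "\<beta> i \<le> k - 1" for i using b[of i] k by linarith
      then show "\<beta> \<in> {\<beta>. \<forall>i. \<beta> i \<le> k - 1}" by blast
    qed
    then show "\<exists>g. Qfun (k - 1) g \<and> (\<forall>y\<in>Cub. u (F K y) = g y)" using g(2) by (auto simp: u_def)
  qed
  moreover have "X u \<noteq> 0"
  proof
    assume X: "X u = 0"
    obtain K where K: "K \<in> T" using T_ne by blast
    obtain p where p: "p \<in> interior K" using cell.int[OF cells[OF K]] by blast
    have "(u has_derivative (\<lambda>x. x $ i)) (at p)"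
      unfolding u_def by (rule bounded_linear_imp_has_derivative[OF bounded_linear_vec_nth])
    then have fd: "frechet_derivative u (at p) = (\<lambda>x. x $ i)" by (rule frechet_derivative_at[symmetric])
    have "p \<in> U" using p K by (auto simp: U_def)
    then have "grad u p $ i = 1" by (simp add: grad_def fd axis_def)
    then have n: "grad u p \<noteq> 0" by auto
    have "c3 * (diameter K)\<^sup>2 * (norm (grad u p))\<^sup>2 \<le> 0"
      using grad_pointwise[OF FE1 K p] X_zero[OF X K] by simp
    moreover have "c3 * (diameter K)\<^sup>2 * (norm (grad u p))\<^sup>2 > 0" using n c_pos diam_pos[OF K] by simp
    ultimately show False by linarith
  qed
  ultimately show ?thesis using X_nonneg[of u] by (intro exI[of _ u]) auto
qed

text \<open>A velocity that is zero almost everywhere has zero weak gradients, so a nonzero value of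
  the form certifies membership in the index set of the supremum.\<close>

lemma b_form_nonzero:
  assumes "b_form \<Omega> v q \<noteq> 0"
  shows "\<not> (AE x in lebesgue_on \<Omega>. v x = 0)"
proof
  assume v: "AE x in lebesgue_on \<Omega>. v x = 0"
  have "AE x in lebesgue_on \<Omega>. weak_grad \<Omega> (\<lambda>y. v y $ i) x = 0" for i
  proof (rule weak_grad_eq[OF \<Omega>])
    show "(\<lambda>x. 0 :: real ^ 'n) \<in> L2 \<Omega>" by (simp add: L2_def)
    show "is_weak_grad \<Omega> (\<lambda>y. v y $ i) (\<lambda>x. 0)" unfolding is_weak_grad_def
    proof (intro ballI allI)
      fix \<phi> j
      have "(LINT x|lebesgue_on \<Omega>. v x $ i * partial j \<phi> x) = 0"
        by (rule integral_eq_zero_AE, rule AE_mp[OF v]) simp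
      then show "(LINT x|lebesgue_on \<Omega>. v x $ i * partial j \<phi> x) = - (LINT x|lebesgue_on \<Omega>. (0 :: real ^ 'n) $ j * \<phi> x)" by simp
    qed
  qed
  then have "AE x in lebesgue_on \<Omega>. \<forall>i\<in>UNIV. weak_grad \<Omega> (\<lambda>y. v y $ i) x = 0"
    by (intro AE_finite_allI) auto
  then have "AE x in lebesgue_on \<Omega>. q x * weak_div \<Omega> v x = 0"
    by (rule AE_mp) (auto simp: weak_div_def)
  then have "b_form \<Omega> v q = 0" unfolding b_form_def by (simp add: integral_eq_zero_AE)
  then show False using assms by simp
qed

text \<open>The form is at least lo X, while velocity and gradient norms are at most sqrt(B X) and
  sqrt(D X); X cancels from the quotient. The hypothesis \<open>V\<close> is all that distinguishes
  the three kinds of boundary conditions.\<close>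

lemma inf_sup:
  assumes q: "FE (k - 1) q"
    and V: "\<And>q. FE (k - 1) q \<Longrightarrow> \<exists>m. vf q m \<in> Vh \<and> L2_norm \<Omega> (vf q m) \<le> L2_norm \<Omega> (vf q 0)"
  shows "(SUP v \<in> {v \<in> Vh. \<not> (AE x in lebesgue_on \<Omega>. v x = 0)}. ereal (b_form \<Omega> v q / L2_norm \<Omega> v))
    \<ge> ereal (lo / sqrt ((C1 / c3 * 2 ^ CARD('n)) * (real CARD('n) * C2 / c3 * 2 ^ CARD('n))) * L2_norm \<Omega> (weak_grad \<Omega> q))"
proof -
  define B where "B = C1 / c3 * 2 ^ CARD('n)"
  define D where "D = real CARD('n) * C2 / c3 * 2 ^ CARD('n)"
  have BD: "B > 0" "D > 0" using C1 C2 c_pos by (simp_all add: B_def D_def)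
  have L2n: "L2_norm \<Omega> f \<ge> 0" for f :: "real ^ 'n \<Rightarrow> real ^ 'n"
    unfolding L2_norm_def by (intro real_sqrt_ge_zero Bochner_Integration.integral_nonneg) simp
  have g: "L2_norm \<Omega> (weak_grad \<Omega> q) \<le> sqrt (D * X q)"
    using grad_norm[OF q] by (intro real_le_rsqrt) (simp add: D_def)
  show ?thesis
  proof (cases "X q = 0")
    case True
    \<comment> \<open>The right-hand side is 0, but some nonzero velocity with value at least 0 is
      still required. The one generated by a coordinate function is nonzero, and it pairs to 0 with
      q by \<open>b_form_zero\<close>.\<close>
    obtain q0 where q0: "FE (k - 1) q0" "X q0 > 0" using coordinate_positive by blast
    obtain m where m: "vf q0 m \<in> Vh" using V[OF q0(1)] by blast
    have "lo * X q0 > 0" using lo_pos q0(2) by simp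
    then have "b_form \<Omega> (vf q0 m) q0 \<noteq> 0" using b_form_lower[OF q0(1), of m] by linarith
    then have "\<not> (AE x in lebesgue_on \<Omega>. vf q0 m x = 0)" by (rule b_form_nonzero)
    then have mem: "vf q0 m \<in> {v \<in> Vh. \<not> (AE x in lebesgue_on \<Omega>. v x = 0)}" using m by blast
    have g0: "L2_norm \<Omega> (weak_grad \<Omega> q) = 0" using g True L2n[of "weak_grad \<Omega> q"] by simp
    show ?thesis
      by (rule SUP_upper2[OF mem]) (simp add: g0 b_form_zero[OF q q0(1) True])
  next
    case False
    then have X: "X q > 0" using X_nonneg[of q] by linarith
    obtain m where m: "vf q m \<in> Vh" "L2_norm \<Omega> (vf q m) \<le> L2_norm \<Omega> (vf q 0)" using V[OF q] by blast
    have bl: "lo * X q \<le> b_form \<Omega> (vf q m) q" by (rule b_form_lower[OF q])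
    have "lo * X q > 0" using lo_pos X by simp
    then have "b_form \<Omega> (vf q m) q \<noteq> 0" using bl by linarith
    then have nz: "\<not> (AE x in lebesgue_on \<Omega>. vf q m x = 0)" by (rule b_form_nonzero)
    then have mem: "vf q m \<in> {v \<in> Vh. \<not> (AE x in lebesgue_on \<Omega>. v x = 0)}" using m by blast
    have "L2_norm \<Omega> (vf q m) \<noteq> 0"
    proof
      assume "L2_norm \<Omega> (vf q m) = 0"
      then have "(LINT x|lebesgue_on \<Omega>. (norm (vf q m x))\<^sup>2) = 0" using L2_norm_square[of "vf q m"] by simp
      then have "AE x in lebesgue_on \<Omega>. (norm (vf q m x))\<^sup>2 = 0"
        by (subst (asm) integral_nonneg_eq_0_iff_AE[OF vf_L2(3)[OF q]]) auto
      then have "AE x in lebesgue_on \<Omega>. vf q m x = 0" by (rule AE_mp) simp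
      then show False using nz by blast
    qed
    then have vp: "L2_norm \<Omega> (vf q m) > 0" using L2n[of "vf q m"] by linarith
    have v: "L2_norm \<Omega> (vf q m) \<le> sqrt (B * X q)"
      using m(2) real_le_rsqrt[OF vf_norm[OF q]] by (simp add: B_def)
    have s: "sqrt (B * D) > 0" unfolding real_sqrt_gt_0_iff using BD by (rule mult_pos_pos)
    have "L2_norm \<Omega> (weak_grad \<Omega> q) * L2_norm \<Omega> (vf q m) \<le> sqrt (D * X q) * sqrt (B * X q)"
      by (rule mult_mono[OF g v]) (use L2n BD X in auto)
    also have "\<dots> = sqrt (B * D) * X q"
      using X by (simp add: real_sqrt_mult)
    finally have "lo / sqrt (B * D) * (L2_norm \<Omega> (weak_grad \<Omega> q) * L2_norm \<Omega> (vf q m)) \<le> lo / sqrt (B * D) * (sqrt (B * D) * X q)"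
      using lo_pos s by (intro mult_left_mono) auto
    also have "\<dots> = lo * X q" 
    proof -
      have gen: "a / b * (b * c) = a * c" if "b \<noteq> 0" for a b c :: real using that by simp
      have "sqrt (B * D) \<noteq> 0"
      proof
        assume "sqrt (B * D) = 0"
        then show False using s by (simp only: less_irrefl)
      qed
      then show ?thesis by (rule gen)
    qed
    finally have "lo / sqrt (B * D) * L2_norm \<Omega> (weak_grad \<Omega> q) * L2_norm \<Omega> (vf q m) \<le> b_form \<Omega> (vf q m) q"
      using bl by (simp only: mult.assoc)
    then have "lo / sqrt (B * D) * L2_norm \<Omega> (weak_grad \<Omega> q) \<le> b_form \<Omega> (vf q m) q / L2_norm \<Omega> (vf q m)"
      by (subst pos_le_divide_eq[OF vp])
    then show ?thesis
      by (intro SUP_upper2[OF mem]) (simp only: ereal_less_eq(3) B_def D_def)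
  qed
qed

section \<open>Boundary values, polynomial shape and mean value of the velocity\<close>

lemma has_trace_FE:
  assumes "FE m u"
  shows "has_trace \<Omega> u u"
proof -
  note f = FE_facts[OF assms]
  \<comment> \<open>The measurable sets are the Borel sets whatever the values of the outer measure,
    so only Borel measurability is at issue.\<close>
  have s1: "sets (surface_measure :: (real ^ 'n) measure) = sets borel"
    unfolding surface_measure_def using sets.sigma_sets_eq[of "borel :: (real ^ 'n) measure"] by (simp add: sets_measure_of)
  have "u \<in> borel_measurable (restrict_space borel (frontier \<Omega>))"
    by (rule borel_measurable_continuous_on_restrict[OF continuous_on_subset[OF f(6)]]) (simp add: frontier_def)
  moreover have "sets (boundary_measure \<Omega>) = sets (restrict_space borel (frontier \<Omega>))"
    by (rule sets_restrict_space_cong[OF s1])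
  ultimately have meas: "u \<in> borel_measurable (boundary_measure \<Omega>)"
    by (simp cong: measurable_cong_sets)
  have z: "AE x in lebesgue_on \<Omega>. weak_grad \<Omega> (\<lambda>x. 0) x = 0"
    by (rule weak_grad_eq[OF \<Omega>]) (simp_all add: L2_def is_weak_grad_def)
  have "(LINT x|lebesgue_on \<Omega>. (norm (weak_grad \<Omega> (\<lambda>x. 0) x))\<^sup>2) = 0"
    by (rule integral_eq_zero_AE, rule AE_mp[OF z]) simp
  then have "H1_norm \<Omega> (\<lambda>x. 0) = 0" by (simp add: H1_norm_def L2_norm_def)
  \<comment> \<open>As u is continuous on the closure, the constant sequence approximates it and u
    is its own trace.\<close>
  then show ?thesis unfolding has_trace_def using f(4,6) meas by (intro conjI exI[of _ "\<lambda>n. u"]) auto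
qed

lemma vf_H1_zero_on:
  assumes "FE (k - 1) q"
  shows "vf q 0 \<in> componentwise (H1_zero_on \<Omega> \<Gamma>)"
  unfolding componentwise_def H1_zero_on_def
proof (rule CollectI, rule allI, rule CollectI, rule conjI)
  fix i
  show "(\<lambda>x. vf q 0 x $ i) \<in> H1 \<Omega>" by (rule FE_facts(4)[OF vf_FE[OF assms]])
  have "AE x in boundary_measure \<Omega>. x \<in> \<Gamma> \<longrightarrow> vf q 0 x $ i = 0"
    by (rule AE_I2) (simp add: vf_zero[OF assms])
  then show "\<exists>g. has_trace \<Omega> (\<lambda>x. vf q 0 x $ i) g \<and> (AE x in boundary_measure \<Omega>. x \<in> \<Gamma> \<longrightarrow> g x = 0)"
    using has_trace_FE[OF vf_FE[OF assms, of 0 i]] by blast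
qed

lemma vf_polynomial:
  assumes q: "FE (k - 1) q" and K: "K \<in> T"
  shows "\<exists>p\<in>componentwise (Q_poly k ref_cell). AE x in lebesgue_on ref_cell. vf q m (F K x) = p x"
proof (rule bexI)
  show "AE x in lebesgue_on ref_cell. vf q m (F K x) = W q K x - m"
    by (rule AE_I2) (simp add: vf_cell[OF q K])
  show "(\<lambda>x. W q K x - m) \<in> componentwise (Q_poly k ref_cell)"
    unfolding componentwise_def using Qfun_Q_poly[OF W_facts[OF q K]] by blast
qed

text \<open>Taking m as the mean lowers the squared norm by |\<Omega>| |m|^2, since the mixed term
  is twice that amount.\<close>

lemma vf_mean_free:
  assumes q: "FE (k - 1) q"
  shows "\<exists>m. (LINT x|lebesgue_on \<Omega>. vf q m x) = 0 \<and> L2_norm \<Omega> (vf q m) \<le> L2_norm \<Omega> (vf q 0)"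
proof -
  define vol where "vol = measure (lebesgue_on \<Omega>) (space (lebesgue_on \<Omega>))"
  define I where "I = (LINT x|lebesgue_on \<Omega>. vf q 0 x)"
  define m where "m = (1 / vol) *\<^sub>R I"
  have lm: "\<Omega> \<in> lmeasurable" using \<Omega> by (simp add: bounded_set_imp_lmeasurable)
  have "measure lebesgue \<Omega> \<noteq> 0"
    using open_not_negligible[OF \<Omega>(1) ne] negligible_iff_measure[of \<Omega>] lm by blast
  then have vol: "vol > 0"
    using fmeasurableD[OF lm] measure_nonneg[of lebesgue \<Omega>] by (simp add: vol_def measure_restrict_space less_le)
  have shift: "vf q m x = vf q 0 x - m" for x by (simp add: vf_def)
  have ci: "integrable (lebesgue_on \<Omega>) (\<lambda>x. c :: 'b::{banach, second_countable_topology})" for c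
    by (rule integrable_const_lebesgue_on[OF \<Omega>])
  have "(LINT x|lebesgue_on \<Omega>. vf q m x) = I - vol *\<^sub>R m"
    unfolding shift I_def vol_def by (subst Bochner_Integration.integral_diff[OF vf_L2(2)[OF q] integrable_const_lebesgue_on[OF \<Omega>]]) simp
  then have z: "(LINT x|lebesgue_on \<Omega>. vf q m x) = 0" using vol by (simp add: m_def)
  have i2: "integrable (lebesgue_on \<Omega>) (\<lambda>x. vf q 0 x \<bullet> m)" using vf_L2(2)[OF q] by simp
  have "(LINT x|lebesgue_on \<Omega>. (norm (vf q m x))\<^sup>2)
     = (LINT x|lebesgue_on \<Omega>. (norm (vf q 0 x))\<^sup>2 - 2 * (vf q 0 x \<bullet> m) + m \<bullet> m)"
    unfolding shift by (simp add: power2_norm_eq_inner inner_diff_left inner_diff_right inner_commute algebra_simps)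
  also have "\<dots> = (LINT x|lebesgue_on \<Omega>. (norm (vf q 0 x))\<^sup>2) - 2 * (I \<bullet> m) + vol * (m \<bullet> m)"
    using vf_L2(2,3)[OF q, of 0] i2 integrable_const_lebesgue_on[OF \<Omega>, of "m \<bullet> m"]
    by (simp add: I_def vol_def)
  also have "I = vol *\<^sub>R m" using vol by (simp add: m_def)
  finally have "(LINT x|lebesgue_on \<Omega>. (norm (vf q m x))\<^sup>2) = (LINT x|lebesgue_on \<Omega>. (norm (vf q 0 x))\<^sup>2) - vol * (m \<bullet> m)"
    by simp
  then have "(LINT x|lebesgue_on \<Omega>. (norm (vf q m x))\<^sup>2) \<le> (LINT x|lebesgue_on \<Omega>. (norm (vf q 0 x))\<^sup>2)"
    using vol by simp
  then have "L2_norm \<Omega> (vf q m) \<le> L2_norm \<Omega> (vf q 0)" unfolding L2_norm_def by (rule real_sqrt_le_mono)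
  then show ?thesis using z by blast
qed

end

text \<open>Above the graph there are no points of \<open>\<Omega>\<close>, so a boundary point in the interior of a cell
  would yield points of the cell away from the closure of \<open>\<Omega>\<close>.\<close>

lemma lipschitz_interior:
  fixes \<Omega> :: "(real ^ 'n::finite) set"
  assumes \<Omega>: "open \<Omega>" "lipschitz_boundary \<Omega>" and K: "K \<subseteq> closure \<Omega>"
  shows "interior K \<subseteq> \<Omega>"
proof
  fix x assume x: "x \<in> interior K"
  show "x \<in> \<Omega>"
  proof (rule ccontr)
    assume nx: "x \<notin> \<Omega>"
    have "x \<in> closure \<Omega>" using x K interior_subset by blast
    then have "x \<in> frontier \<Omega>" using nx \<Omega>(1) by (simp add: frontier_def interior_open)
    then obtain \<nu> r L \<gamma> where \<nu>: "norm \<nu> = 1" and r: "r > 0" and L: "L-lipschitz_on {z. z \<bullet> \<nu> = 0} \<gamma>"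
      and graph: "\<Omega> \<inter> ball x r = {y \<in> ball x r. y \<bullet> \<nu> < \<gamma> (y - (y \<bullet> \<nu>) *\<^sub>R \<nu>)}"
      using \<Omega>(2) unfolding lipschitz_boundary_def by blast
    define P where "P y = y - (y \<bullet> \<nu>) *\<^sub>R \<nu>" for y
    have \<nu>\<nu>: "\<nu> \<bullet> \<nu> = 1" using \<nu> by (simp add: dot_square_norm)
    have P0: "P y \<bullet> \<nu> = 0" for y by (simp add: P_def inner_diff_left \<nu>\<nu>)
    have xP: "\<gamma> (P x) \<le> x \<bullet> \<nu>"
    proof (rule ccontr)
      assume "\<not> \<gamma> (P x) \<le> x \<bullet> \<nu>"
      then have "x \<in> {y \<in> ball x r. y \<bullet> \<nu> < \<gamma> (y - (y \<bullet> \<nu>) *\<^sub>R \<nu>)}" using r by (simp add: P_def)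
      then have "x \<in> \<Omega> \<inter> ball x r" by (simp only: graph)
      then show False using nx by blast
    qed
    obtain e where e: "e > 0" "ball x e \<subseteq> interior K" using open_contains_ball[of "interior K"] x by auto
    define \<epsilon> where "\<epsilon> = min e r / 2"
    have \<epsilon>: "\<epsilon> > 0" "\<epsilon> < e" "2 * \<epsilon> \<le> r" using e(1) r by (auto simp: \<epsilon>_def)
    define p where "p = x + \<epsilon> *\<^sub>R \<nu>"
    have "dist x p = \<epsilon>" using \<epsilon>(1) \<nu> by (simp add: p_def dist_norm)
    then have "p \<in> ball x e" using \<epsilon>(2) by simp
    then have pc: "p \<in> closure \<Omega>" using e(2) K interior_subset by blast
    have L0: "L \<ge> 0" by (rule lipschitz_on_nonneg[OF L])
    \<comment> \<open>Chosen so that \<delta> + 2 L \<delta> = \<epsilon>: a point within \<delta>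
      of p loses less than \<delta> in height, and its projection moves by at most 2 \<delta>, which
      changes the graph by at most 2 L \<delta>.\<close>
    define \<delta> where "\<delta> = \<epsilon> / (1 + 2 * L)"
    have \<delta>: "\<delta> > 0" "\<delta> \<le> \<epsilon>" "\<delta> * (1 + 2 * L) = \<epsilon>" using \<epsilon>(1) L0 by (auto simp: \<delta>_def field_simps)
    obtain y where y: "y \<in> \<Omega>" "dist y p < \<delta>" using pc \<delta>(1) unfolding closure_approachable by blast
    have "dist x y \<le> dist x p + dist y p" by (rule dist_triangle2)
    then have "y \<in> ball x r" using y(2) \<open>dist x p = \<epsilon>\<close> \<delta>(2) \<epsilon>(3) by simp
    then have "y \<in> \<Omega> \<inter> ball x r" using y(1) by blast
    then have yg: "y \<bullet> \<nu> < \<gamma> (P y)" by (simp add: graph P_def)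
    have Ppx: "P p = P x" by (simp add: p_def P_def inner_add_left \<nu>\<nu> algebra_simps)
    have c: "\<bar>(y - p) \<bullet> \<nu>\<bar> \<le> norm (y - p)" using Cauchy_Schwarz_ineq2[of "y - p" \<nu>] \<nu> by simp
    have "P y - P p = (y - p) - ((y - p) \<bullet> \<nu>) *\<^sub>R \<nu>" by (simp add: P_def inner_diff_left scaleR_left_diff_distrib)
    then have "norm (P y - P p) \<le> norm (y - p) + norm (((y - p) \<bullet> \<nu>) *\<^sub>R \<nu>)" by (simp only: norm_triangle_ineq4)
    then have Pd: "dist (P y) (P x) \<le> 2 * \<delta>" using c y(2) \<nu> by (simp add: Ppx dist_norm)
    have "dist (\<gamma> (P y)) (\<gamma> (P x)) \<le> L * dist (P y) (P x)" by (rule lipschitz_onD[OF L]) (simp_all add: P0)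
    also have "\<dots> \<le> L * (2 * \<delta>)" by (rule mult_left_mono[OF Pd L0])
    finally have "\<gamma> (P y) \<le> x \<bullet> \<nu> + L * (2 * \<delta>)" using xP by (simp add: dist_real_def)
    moreover have "p \<bullet> \<nu> = x \<bullet> \<nu> + \<epsilon>" by (simp add: p_def inner_add_left \<nu>\<nu>)
    moreover have "p \<bullet> \<nu> - \<delta> < y \<bullet> \<nu>" using c y(2) by (simp add: dist_norm inner_diff_left)
    ultimately have "\<epsilon> < \<delta> + L * (2 * \<delta>)" using yg by linarith
    also have "\<dots> = \<delta> * (1 + 2 * L)" by (simp add: algebra_simps)
    finally show False using \<delta>(3) by simp
  qed
qed

theorem theorem4:
  fixes \<Omega> \<Gamma>\<^sub>D \<Gamma>\<^sub>N :: "(real ^ 'n::finite) set"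
    and c1 c2 c3 c4 :: real
    and k :: nat
  assumes "CARD('n) = 2 \<or> CARD('n) = 3"
    and "polyhedral_domain \<Omega>"
    and "boundary_partition \<Omega> \<Gamma>\<^sub>D \<Gamma>\<^sub>N"
    and "c1 > 0" "c2 > 0" "c3 > 0" "c4 > 0"
    and "k \<ge> 2"
  shows "\<exists>c>0. \<forall>(\<T> :: (real ^ 'n) set set) (F :: (real ^ 'n) set \<Rightarrow> real ^ 'n \<Rightarrow> real ^ 'n).
    regular_mesh \<Omega> \<Gamma>\<^sub>D \<Gamma>\<^sub>N c1 c2 c3 c4 \<T> F \<and>
    (\<forall>K\<in>\<T>. F K \<in> componentwise (if CARD('n) = 2 then Q_poly 1 ref_cell else P_poly 1 ref_cell))
    \<longrightarrow> (\<forall>q \<in> Q_h \<Omega> \<Gamma>\<^sub>N \<T> F k.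
          (SUP v \<in> {v \<in> V_h \<Omega> \<Gamma>\<^sub>D \<Gamma>\<^sub>N \<T> F k. \<not> (AE x in lebesgue_on \<Omega>. v x = 0)}.
             ereal (b_form \<Omega> v q / L2_norm \<Omega> v))
          \<ge> ereal (c * L2_norm \<Omega> (weak_grad \<Omega> q)))"
proof -
  note card = assms(1) and dom = assms(2)[unfolded polyhedral_domain_def] and part = assms(3)[unfolded boundary_partition_def]
  note d1 = conjunct1[OF dom] and d2 = conjunct1[OF conjunct2[OF dom]]
    and d4 = conjunct1[OF conjunct2[OF conjunct2[OF conjunct2[OF dom]]]]
    and d6 = conjunct2[OF conjunct2[OF conjunct2[OF conjunct2[OF conjunct2[OF dom]]]]]
  have "k \<ge> 1" using assms(8) by simp
  then obtain N w where Nw: "finite N" "card N = Suc k" "N \<subseteq> {0..1}" "0 \<in> N" "1 \<in> N"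
    "\<And>u. u \<in> N \<Longrightarrow> 1 - u \<in> N" "\<And>u. u \<in> N \<Longrightarrow> w u > 0"
    "\<And>p. degree p \<le> 2 * k - 1 \<Longrightarrow> ip p = (\<Sum>u\<in>N. w u * poly p u)"
    using lobatto_rule by blast
  interpret lob: lobatto k N w by (unfold_locales; (rule assms(8) Nw)?)
  obtain C1 where C1: "C1 > 0" "\<forall>K F J h c1 c3 c4 chi. line_fields K F J h c1 c3 c4 k N w \<longrightarrow>
     (\<forall>(g :: real ^ 'n \<Rightarrow> real) x. Qfun (k - 1) g \<longrightarrow> x \<in> cbox 0 1 \<longrightarrow>
       c3 * h\<^sup>2 * (norm (line_fields.V F J N chi g x))\<^sup>2 \<le> C1 * line_fields.energy F N chi g)"
    using lob.line_field_bound by (elim exE conjE) (rule that)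
  obtain C2 where C2: "C2 > 0" "\<forall>(g :: real ^ 'n \<Rightarrow> real) g'. Qfun (k - 1) g \<longrightarrow>
     (\<forall>x. (g has_derivative (\<lambda>h. g' x \<bullet> h)) (at x)) \<longrightarrow>
     (\<forall>v j. \<forall>x\<in>cbox 0 1. (\<forall>i. v $ i \<in> {0, 1}) \<longrightarrow>
       (\<exists>z. (j, z) \<in> lob.lines \<and> lob.opposite_free v (j, z) \<and>
          (g' x $ j)\<^sup>2 \<le> C2 * ip ([:0, 1, - 1:] * (pderiv (lob.lp g z j)) ^ 2)))"
    using lob.derivative_sup_bound by (elim exE conjE) (rule that)
  \<comment> \<open>The nodes and weights depend on k only and \<open>C1\<close>, \<open>C2\<close>
    on k and d, so the constant is fixed before the mesh is introduced.\<close>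
  define c where "c = (min 1 (Min (w ` N)) ^ CARD('n) * c1 / c4)
    / sqrt ((C1 / c3 * 2 ^ CARD('n)) * (real CARD('n) * C2 / c3 * 2 ^ CARD('n)))"
  have "Min (w ` N) \<in> w ` N" using Nw(1,4) by (intro Min_in) auto
  then have "Min (w ` N) > 0" using Nw(7) by auto
  then have cpos: "c > 0" unfolding c_def using assms(4,6,7) C1(1) C2(1) by simp
  have main: "(SUP v \<in> {v \<in> V_h \<Omega> \<Gamma>\<^sub>D \<Gamma>\<^sub>N T F k. \<not> (AE x in lebesgue_on \<Omega>. v x = 0)}.
             ereal (b_form \<Omega> v q / L2_norm \<Omega> v)) \<ge> ereal (c * L2_norm \<Omega> (weak_grad \<Omega> q))"
    if rm0: "regular_mesh \<Omega> \<Gamma>\<^sub>D \<Gamma>\<^sub>N c1 c2 c3 c4 T F"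
      and FP: "\<forall>K\<in>T. F K \<in> componentwise (if CARD('n) = 2 then Q_poly 1 ref_cell else P_poly 1 ref_cell)"
      and q: "q \<in> Q_h \<Omega> \<Gamma>\<^sub>N T F k" for T :: "(real ^ 'n) set set" and F q
  proof -
    note rm = rm0[unfolded regular_mesh_def]
    note s2 = conjunct2[OF rm]
    note s3 = conjunct2[OF s2]
    note s4 = conjunct2[OF s3]
    note s6 = conjunct2[OF conjunct2[OF s4]]
    note r1 = conjunct1[OF rm] and r2 = conjunct1[OF s2] and r3 = conjunct1[OF s3] and r4 = conjunct1[OF s4]
      and r6 = conjunct1[OF s6] and r7 = conjunct2[OF s6]
    have "\<exists>J. cell K (F K) J (diameter K) c1 c3 c4" if K: "K \<in> T" for K
    proof -
      have a: "mesh_cell K" "regular_map c1 c2 c3 c4 K (F K)" using bspec[OF r3 K] by simp_all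
      show ?thesis by (rule cell_intro[OF card assms(4,6,7) a bspec[OF FP K]]) blast
    qed
    then have "\<forall>K\<in>T. \<exists>J. cell K (F K) J (diameter K) c1 c3 c4" by blast
    from bchoice[OF this] obtain J where J: "\<forall>K\<in>T. cell K (F K) (J K) (diameter K) c1 c3 c4" by blast
    have m: "mesh \<Omega> T F J c1 c3 c4"
    proof (rule mesh.intro)
      show "open \<Omega>" "bounded \<Omega>" by (rule d2 d4)+
      show "CARD('n) = 2 \<or> CARD('n) = 3" by (rule card)
      show T: "finite T" "\<Union>T = closure \<Omega>" by (rule r1 r2)+
      show "cell K (F K) (J K) (diameter K) c1 c3 c4" if "K \<in> T" for K by (rule bspec[OF J that])
      show "interior K \<subseteq> \<Omega>" if "K \<in> T" for K
      proof (rule lipschitz_interior[OF d2 d6])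
        show "K \<subseteq> closure \<Omega>" using that T(2) by blast
      qed
      show "(K \<inter> K') face_of K" if "K \<in> T" "K' \<in> T" "K \<noteq> K'" for K K'
        using bspec[OF bspec[OF r4 that(1)] that(2)] that(3) by simp
    qed
    have f: "fem \<Omega> T F J c1 c3 c4 k N w \<Gamma>\<^sub>D C1 C2"
    proof (intro fem.intro m lob.lobatto_axioms fem_axioms.intro C1 C2)
      show "\<Omega> \<noteq> {}" by (rule d1)
      show "\<exists>K\<in>T. \<exists>f. f face_of K \<and> p \<in> f \<and> f \<subseteq> \<Gamma>\<^sub>D" if p: "p \<in> \<Gamma>\<^sub>D" for p
      proof -
        have "p \<in> \<Union>{f. f \<subseteq> \<Gamma>\<^sub>D \<and> (\<exists>K\<in>T. f facet_of K)}" using p by (subst (asm) r6)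
        then obtain f K where "p \<in> f" "f \<subseteq> \<Gamma>\<^sub>D" "K \<in> T" "f facet_of K" by blast
        then show ?thesis using facet_of_imp_face_of by blast
      qed
      show "\<exists>v\<in>cbox 0 1. (\<forall>i. v $ i \<in> {0, 1}) \<and> F K v \<notin> \<Gamma>\<^sub>D" if K: "K \<in> T" for K
      proof -
        interpret cl: cell K "F K" "J K" "diameter K" c1 c3 c4 by (rule bspec[OF J K])
        obtain x where x: "x extreme_point_of K" "x \<notin> \<Gamma>\<^sub>D" using bspec[OF r7 K] by blast
        then have "x \<in> K" by (simp add: extreme_point_of_def)
        then obtain y where y: "y \<in> cbox 0 1" "x = F K y" using cl.K_obtain by blast
        have "{F K y} face_of K" using x(1) y(2) by (simp add: face_of_singleton)
        then show ?thesis using cl.extreme_corner[OF y(1)] x(2) y by blast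
      qed
    qed
    interpret fem \<Omega> T F J c1 c3 c4 k N w \<Gamma>\<^sub>D C1 C2 by (rule f)
    have qFE: "FE (k - 1) q" unfolding FE_def
    proof
      fix K assume K: "K \<in> T"
      then have "q \<circ> F K \<in> Q_poly (k - 1) ref_cell" using q unfolding Q_h_def by blast
      then obtain g where "Qfun (k - 1) g" "\<And>x. x \<in> ref_cell \<Longrightarrow> (q \<circ> F K) x = g x" using Q_poly_obtain by blast
      then show "\<exists>g. Qfun (k - 1) g \<and> (\<forall>y\<in>cbox 0 1. q (F K y) = g y)" by (intro exI[of _ g]) auto
    qed
    have V: "\<exists>m. vf q m \<in> V_h \<Omega> \<Gamma>\<^sub>D \<Gamma>\<^sub>N T F k \<and> L2_norm \<Omega> (vf q m) \<le> L2_norm \<Omega> (vf q 0)" if q: "FE (k - 1) q" for q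
    proof -
      have "\<exists>m. vf q m \<in> V_space \<Omega> \<Gamma>\<^sub>D \<Gamma>\<^sub>N \<and> L2_norm \<Omega> (vf q m) \<le> L2_norm \<Omega> (vf q 0)"
      \<comment> \<open>Only the pure Neumann case constrains the mean. Otherwise
        \<open>m = 0\<close>, and the velocity vanishes on \<open>\<Gamma>\<^sub>D\<close>, which is
        the whole frontier when \<open>\<Gamma>\<^sub>N\<close> is empty.\<close>
      proof (cases "\<Gamma>\<^sub>N \<noteq> {} \<and> \<Gamma>\<^sub>D = {}")
        case True
        obtain m where m: "(LINT x|lebesgue_on \<Omega>. vf q m x) = 0" "L2_norm \<Omega> (vf q m) \<le> L2_norm \<Omega> (vf q 0)"
          using vf_mean_free[OF q] by blast
        have "vf q m \<in> componentwise (H1 \<Omega>)" unfolding componentwise_def using FE_facts(4)[OF vf_FE[OF q]] by blast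
        then show ?thesis using m True by (intro exI[of _ m]) (simp add: V_space_def)
      next
        case False
        have "vf q 0 \<in> V_space \<Omega> \<Gamma>\<^sub>D \<Gamma>\<^sub>N"
        proof (cases "\<Gamma>\<^sub>N = {}")
          case True
          then have "frontier \<Omega> = \<Gamma>\<^sub>D" using conjunct1[OF part] by simp
          then show ?thesis using vf_H1_zero_on[OF q] True by (simp add: V_space_def)
        next
          case N0: False
          then show ?thesis using vf_H1_zero_on[OF q] False by (simp add: V_space_def)
        qed
        then show ?thesis by blast
      qed
      then obtain m where m: "vf q m \<in> V_space \<Omega> \<Gamma>\<^sub>D \<Gamma>\<^sub>N" "L2_norm \<Omega> (vf q m) \<le> L2_norm \<Omega> (vf q 0)" by blast
      have "vf q m \<in> V_h \<Omega> \<Gamma>\<^sub>D \<Gamma>\<^sub>N T F k"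
        unfolding V_h_def by (intro CollectI conjI ballI vf_polynomial[OF q] m(1))
      then show ?thesis using m(2) by blast
    qed
    have cc: "c = lo / sqrt ((C1 / c3 * 2 ^ CARD('n)) * (real CARD('n) * C2 / c3 * 2 ^ CARD('n)))"
      unfolding c_def lo_def ..
    show ?thesis unfolding cc by (rule inf_sup[OF qFE V])
  qed
  show ?thesis
  proof (rule exI[of _ c], intro conjI allI impI ballI)
    show "c > 0" by (rule cpos)
    fix T :: "(real ^ 'n) set set" and F q
    assume a: "regular_mesh \<Omega> \<Gamma>\<^sub>D \<Gamma>\<^sub>N c1 c2 c3 c4 T F \<and>
        (\<forall>K\<in>T. F K \<in> componentwise (if CARD('n) = 2 then Q_poly 1 ref_cell else P_poly 1 ref_cell))"
      and q: "q \<in> Q_h \<Omega> \<Gamma>\<^sub>N T F k"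
    show "(SUP v \<in> {v \<in> V_h \<Omega> \<Gamma>\<^sub>D \<Gamma>\<^sub>N T F k. \<not> (AE x in lebesgue_on \<Omega>. v x = 0)}.
             ereal (b_form \<Omega> v q / L2_norm \<Omega> v)) \<ge> ereal (c * L2_norm \<Omega> (weak_grad \<Omega> q))"
      by (rule main[OF conjunct1[OF a] conjunct2[OF a] q])
  qed
qed

end
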